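(* Let $\Omega\subseteq\mathbb{R}^2$ be an open, bounded, connected polygonal Lipschitz domain and $f\in L^2(\Omega)$. Let $\Psi=(\psi_1,\psi_2)\in H^2_0(\Omega;\mathbb{R}^2)$ be a nonsingular solution of the von Kármán equations in weak form, $$A(\Psi,\Phi)+B(\Psi,\Psi,\Phi)=F(\Phi)\qquad\text{for all }\Phi\in H^2_0(\Omega;\mathbb{R}^2),$$ and, for a regular triangulation $\mathcal{T}$ of $\Omega$ from a shape-regular family (with sufficiently small maximal mesh size, so that the discrete solution exists), let $\Psi_h=(\psi_{h,1},\psi_{h,2})\in\mathcal{M}_0(\mathcal{T};\mathbb{R}^2)$ be the discrete solution near $\Psi$ (see context) of $$A_{\mathrm{pw}}(\Psi_h,\Phi_h)+B_{\mathrm{pw}}(\Psi_h,I_h\Psi_h,I_h\Phi_h)=F(\Phi_h)\qquad\text{for all }\Phi_h\in\mathcal{M}_0(\mathcal{T};\mathbb{R}^2).$$ Then, with constants hidden in $\lesssim$ that are independent of the mesh size, the estimator contributions defined in the context satisfy, for every $T\in\mathcal{T}$ and $j=1,2$, $$\mu_{\mathrm{NC}}(T)\lesssim\min_{\Phi\in H^2_0(\Omega;\mathbb{R}^2)}\|D^2_{\mathrm{pw}}(\Psi_h-\Phi)\|_{L^2(\Omega_T)}\le\|D^2_{\mathrm{pw}}(\Psi-\Psi_h)\|_{L^2(\Omega_T)},$$ $$\sum_{K\in\mathcal{T}}\mu_{I_h}^2(K)\lesssim\|D^2_{\mathrm{pw}}(\Psi-\Psi_h)\|_{L^2(\Omega)}^2+\|\nabla(\Psi-I_h\Psi_h)\|_{L^2(\Omega)}^2,$$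 $$\eta_f(T)\lesssim\|D^2_{\mathrm{pw}}(\Psi-\Psi_h)\|_{L^2(T)}+\|\nabla(\Psi-I_h\Psi_h)\|_{L^2(T)}+\operatorname{osc}(f,\{T\}),$$ $$\eta_j(T)\lesssim\|D^2_{\mathrm{pw}}(\Psi-\Psi_h)\|_{L^2(\omega_T)}+\|\nabla(\Psi-I_h\Psi_h)\|_{L^2(\omega_T)}+\operatorname{osc}(f,\mathcal{T}(\omega_T)).$$
   Context: Mesh notation: $\mathcal{N}$, $\mathcal{F}$ are the vertices and faces (edges) of $\mathcal{T}$; $\mathcal{F}(\Omega)$ the interior faces; $\mathcal{F}(T)$ the faces of $T\in\mathcal{T}$; $h_T=\operatorname{diam}(T)$, $h_{\mathcal{T}}|_T=h_T$. For an interior face $F=T_+\cap T_-$ (fixed choice of $T_\pm$), $\nu_F$ is the unit normal on $F$ pointing out of $T_+$, $[v]_F:=v|_{T_+}-v|_{T_-}$ and $\omega_F:=T_+\cup T_-$; for a boundary face $F\subseteq T_+$, $[v]_F:=v|_{T_+}$ and $\omega_F:=T_+$. Patches: $\omega_T:=\bigcup_{F\in\mathcal{F}(T)}\omega_F$, $\mathcal{T}(\omega_T)$ is the set of triangles covering $\omega_T$, and $\Omega_T:=\bigcup\{K\in\mathcal{T}: K\cap T\ne\emptyset\}$. $D^2_{\mathrm{pw}},\nabla_{\mathrm{pw}}$ are the piecewise Hessian and gradient; they act componentwise on vector-valued functions. $\Pi_0$ is the $L^2$ projection onto piecewise constants. Morley space: $\mathcal{M}(\mathcal{T})$ is the set of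 piecewise quadratic $v_h$ (polynomials of degree $\le2$ on each $T$) that are continuous at all vertices and satisfy $[\nabla v_h(\operatorname{mid}(F))]_F=0$ for all interior faces $F$ ($\operatorname{mid}(F)$ is the midpoint). $\mathcal{M}_0(\mathcal{T})$ is the subset with $v_h(z)=0$ at boundary vertices $z$ and $\nabla v_h(\operatorname{mid}(F))=0$ for boundary faces $F$; $\mathcal{M}_0(\mathcal{T};\mathbb{R}^2)=\mathcal{M}_0(\mathcal{T})^2$. $I_h$ is the nodal interpolation onto continuous piecewise affine functions, $(I_hv)(z)=v(z)$ for all $z\in\mathcal{N}$, acting componentwise. Forms: $\operatorname{cof}(M)=\begin{pmatrix}M_{22}&-M_{12}\\-M_{21}&M_{11}\end{pmatrix}$. With $a(\psi,\varphi)=\int_\Omega D^2\psi:D^2\varphi\,dx$ and $b(\theta,\psi,\varphi)=\frac12\int_\Omega(\operatorname{cof}(D^2\theta)\nabla\psi)\cdot\nabla\varphi\,dx$, for $\Psi=(\psi_1,\psi_2)$, $\Phi=(\varphi_1,\varphi_2)$, $\Theta=(\theta_1,\theta_2)$, $$A(\Psi,\Phi)=a(\psi_1,\varphi_1)+a(\psi_2,\varphi_2),\quad B(\Theta,\Psi,\Phi)=b(\theta_1,\psi_2,\varphi_1)+b(\theta_2,\psi_1,\varphi_1)-b(\theta_1,\psi_1,\varphi_2),\quad F(\Phi)=\int_\Omega f\varphi_1\,dx.$$ $A_{\mathrm{pw}}$, $B_{\mathrm{pw}}$ are obtained by replacing $D^2,\nabla$ by $D^2_{\mathrm{pw}},\nabla_{\mathrm{pw}}$.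 Nonsingular: the solution $\Psi$ is such that the Fréchet derivative of the nonlinear problem at $\Psi$ is nonsingular, i.e. with $DN(\Psi;\Xi,\Theta):=A(\Xi,\Theta)+2B(\Psi,\Xi,\Theta)$ the map $\Xi\mapsto DN(\Psi;\Xi,\cdot)$ from $H^2_0(\Omega;\mathbb{R}^2)$ to its dual is an isomorphism. Regularity: $\alpha\in(1/2,1]$ denotes the elliptic regularity index of the biharmonic operator on $\Omega$ with clamped boundary conditions; $\Psi\in H^{2+\alpha}(\Omega;\mathbb{R}^2)$ with $\|\Psi\|_{H^{2+\alpha}(\Omega)}\lesssim\|f\|_{L^2(\Omega)}$. Discrete solution: for sufficiently small maximal mesh size $h$ there is a locally unique discrete solution $\Psi_h$ near $\Psi$, and it satisfies $\|D^2_{\mathrm{pw}}(\Psi-\Psi_h)\|_{L^2(\Omega)}\lesssim h^\alpha$; $\Psi_h$ denotes this solution. Estimator: let $$A_1:=\operatorname{cof}(D^2_{\mathrm{pw}}\psi_{h,1})\nabla I_h\psi_{h,2}+\operatorname{cof}(D^2_{\mathrm{pw}}\psi_{h,2})\nabla I_h\psi_{h,1},\qquad A_2:=\operatorname{cof}(D^2_{\mathrm{pw}}\psi_{h,1})\nabla I_h\psi_{h,1},$$ $$\mu_{\mathrm{NC}}^2(T):=\sum_{F\in\mathcal{F}(T)}h_T^{-1}\|[\nabla_{\mathrm{pw}}\Psi_h]_F\|_{L^2(F)}^2,\quad\mu_{I_h}(T):=\|\nabla_{\mathrm{pw}}(\Psi_h-I_h\Psi_h)\|_{L^2(T)},\quad\eta_f(T):=\|h_T^2f\|_{L^2(T)},$$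 $$\eta_j^2(T):=\sum_{F\in\mathcal{F}(T)\cap\mathcal{F}(\Omega)}h_T^3\|[A_j]_F\cdot\nu_F\|_{L^2(F)}^2\quad(j=1,2).$$ Oscillations: $\operatorname{osc}(f,\mathcal{T}(\omega)):=\|h_{\mathcal{T}}^2(f-\Pi_0f)\|_{L^2(\omega)}$ for $\omega=\omega_T$, and likewise $\operatorname{osc}(f,\{T\}):=\|h_T^2(f-\Pi_0f)\|_{L^2(T)}$. Constants hidden in $\lesssim$ may depend on $\Omega$, the shape-regularity, $f$ and $\Psi$, but not on the mesh size. *)

theory Defs
  imports "HOL-Analysis.Analysis"
begin

type_synonym point = "real^2"
type_synonym mesh = "point set set"

text \<open>A piecewise function assigns to every triangle its own (globally defined) branch, so that
  the one-sided traces entering jumps are available on the edges.\<close>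
type_synonym 'a pwfun = "point set \<Rightarrow> point \<Rightarrow> 'a"

definition cmp :: "2 \<Rightarrow> ('b \<Rightarrow> real^2) \<Rightarrow> 'b \<Rightarrow> real"
  where "cmp j \<Psi> = (\<lambda>x. \<Psi> x $ j)"

definition pw_cmp :: "2 \<Rightarrow> (real^2) pwfun \<Rightarrow> real pwfun"
  where "pw_cmp j v = (\<lambda>K. cmp j (v K))"


section \<open>The domain\<close>

definition polygonal :: "point set \<Rightarrow> bool"
  where "polygonal \<Omega> \<longleftrightarrow>
    (\<exists>S. finite S \<and> frontier \<Omega> = (\<Union>(a, b)\<in>S. closed_segment a b))"

text \<open>Near each boundary point, \<open>\<Omega>\<close> is the strict epigraph of a Lipschitz function in some
  orthonormal coordinate system \<open>(e, n)\<close>.\<close>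
definition Lipschitz_domain :: "point set \<Rightarrow> bool"
  where "Lipschitz_domain \<Omega> \<longleftrightarrow>
    open \<Omega> \<and>
    (\<forall>z\<in>frontier \<Omega>. \<exists>e n. \<exists>L \<gamma>. \<exists>r>0.
       norm e = 1 \<and> norm n = 1 \<and> e \<bullet> n = 0 \<and> L-lipschitz_on UNIV \<gamma> \<and>
       (\<forall>x\<in>ball z r. x \<in> \<Omega> \<longleftrightarrow> \<gamma> (e \<bullet> x) < n \<bullet> x))"

definition polygonal_Lipschitz_domain :: "point set \<Rightarrow> bool"
  where "polygonal_Lipschitz_domain \<Omega> \<longleftrightarrow>
    \<Omega> \<noteq> {} \<and> open \<Omega> \<and> bounded \<Omega> \<and> connected \<Omega> \<and> polygonal \<Omega> \<and> Lipschitz_domain \<Omega>"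


section \<open>Lebesgue and Sobolev spaces\<close>

text \<open>Elements of these spaces are represented by functions, not by almost-everywhere classes.\<close>

definition L2 :: "point set \<Rightarrow> (point \<Rightarrow> 'a::euclidean_space) set"
  where "L2 S = {v. v \<in> borel_measurable (lebesgue_on S) \<and>
                    integrable (lebesgue_on S) (\<lambda>x. (norm (v x))\<^sup>2)}"

text \<open>On \<^typ>\<open>real^2^2\<close> the library norm and inner product are the Frobenius ones.\<close>
definition L2norm :: "point set \<Rightarrow> (point \<Rightarrow> 'a::real_normed_vector) \<Rightarrow> real"
  where "L2norm S v = sqrt (LINT x|lebesgue_on S. (norm (v x))\<^sup>2)"

definition pderiv2 :: "2 \<Rightarrow> (point \<Rightarrow> real) \<Rightarrow> point \<Rightarrow> real"
  where "pderiv2 i \<phi> x = frechet_derivative \<phi> (at x) (axis i 1)"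

definition smooth :: "(point \<Rightarrow> real) \<Rightarrow> bool"
  where "smooth \<phi> \<longleftrightarrow> (\<forall>is x. fold pderiv2 is \<phi> differentiable (at x))"

definition test_functions :: "point set \<Rightarrow> (point \<Rightarrow> real) set"
  where "test_functions \<Omega> = {\<phi>. smooth \<phi> \<and> compact (closure {x. \<phi> x \<noteq> 0}) \<and>
                                closure {x. \<phi> x \<noteq> 0} \<subseteq> \<Omega>}"

definition weak_pderiv :: "point set \<Rightarrow> 2 \<Rightarrow> (point \<Rightarrow> real) \<Rightarrow> (point \<Rightarrow> real) \<Rightarrow> bool"
  where "weak_pderiv \<Omega> i v g \<longleftrightarrow>
    (\<forall>\<phi>\<in>test_functions \<Omega>.
       (LINT x|lebesgue_on \<Omega>. v x * pderiv2 i \<phi> x) = - (LINT x|lebesgue_on \<Omega>. g x * \<phi> x))"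

text \<open>\<open>sobolev \<Omega> k\<close> is \<open>H\<^sup>k(\<Omega>)\<close>.\<close>
fun sobolev :: "point set \<Rightarrow> nat \<Rightarrow> (point \<Rightarrow> real) set"
  where
    "sobolev \<Omega> 0 = L2 \<Omega>"
  | "sobolev \<Omega> (Suc k) = {v \<in> L2 \<Omega>. \<forall>i. \<exists>g\<in>sobolev \<Omega> k. weak_pderiv \<Omega> i v g}"

text \<open>A representative of the weak partial derivative, which is unique almost everywhere.\<close>
definition wpderiv :: "point set \<Rightarrow> 2 \<Rightarrow> (point \<Rightarrow> real) \<Rightarrow> point \<Rightarrow> real"
  where "wpderiv \<Omega> i v = (SOME g. g \<in> L2 \<Omega> \<and> weak_pderiv \<Omega> i v g)"

definition wgrad :: "point set \<Rightarrow> (point \<Rightarrow> real) \<Rightarrow> point \<Rightarrow> real^2"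
  where "wgrad \<Omega> v x = (\<chi> i. wpderiv \<Omega> i v x)"

definition whess :: "point set \<Rightarrow> (point \<Rightarrow> real) \<Rightarrow> point \<Rightarrow> real^2^2"
  where "whess \<Omega> v x = (\<chi> i k. wpderiv \<Omega> k (wpderiv \<Omega> i v) x)"

definition D3 :: "point set \<Rightarrow> (point \<Rightarrow> real) \<Rightarrow> point \<Rightarrow> real^2^2^2"
  where "D3 \<Omega> v x = (\<chi> i k l. wpderiv \<Omega> l (wpderiv \<Omega> k (wpderiv \<Omega> i v)) x)"

text \<open>Componentwise derivatives of vector-valued functions; the first index is the component.\<close>
definition Wgrad :: "point set \<Rightarrow> (point \<Rightarrow> real^2) \<Rightarrow> point \<Rightarrow> real^2^2"
  where "Wgrad \<Omega> \<Psi> x = (\<chi> j. wgrad \<Omega> (cmp j \<Psi>) x)"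

definition Whess :: "point set \<Rightarrow> (point \<Rightarrow> real^2) \<Rightarrow> point \<Rightarrow> real^2^2^2"
  where "Whess \<Omega> \<Psi> x = (\<chi> j. whess \<Omega> (cmp j \<Psi>) x)"

definition H2norm :: "point set \<Rightarrow> (point \<Rightarrow> real) \<Rightarrow> real"
  where "H2norm \<Omega> v =
    sqrt ((L2norm \<Omega> v)\<^sup>2 + (L2norm \<Omega> (wgrad \<Omega> v))\<^sup>2 + (L2norm \<Omega> (whess \<Omega> v))\<^sup>2)"

definition H20 :: "point set \<Rightarrow> (point \<Rightarrow> real) set"
  where "H20 \<Omega> = {v \<in> sobolev \<Omega> 2. \<exists>\<phi>::nat \<Rightarrow> point \<Rightarrow> real.
    (\<forall>n. \<phi> n \<in> test_functions \<Omega>) \<and> (\<lambda>n. H2norm \<Omega> (\<lambda>x. v x - \<phi> n x)) \<longlonglongrightarrow> 0}"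

definition H20v :: "point set \<Rightarrow> (point \<Rightarrow> real^2) set"
  where "H20v \<Omega> = {\<Psi>. \<forall>j. cmp j \<Psi> \<in> H20 \<Omega>}"

definition H2vnorm :: "point set \<Rightarrow> (point \<Rightarrow> real^2) \<Rightarrow> real"
  where "H2vnorm \<Omega> \<Psi> = sqrt (\<Sum>j\<in>UNIV. (H2norm \<Omega> (cmp j \<Psi>))\<^sup>2)"

text \<open>The Sobolev--Slobodeckij spaces \<open>H\<^sup>2\<^sup>+\<^sup>s(\<Omega>)\<close> for \<open>0 < s < 1\<close>, and \<open>H\<^sup>3(\<Omega>)\<close> for \<open>s = 1\<close>.\<close>

definition slobodeckij :: "point set \<Rightarrow> real \<Rightarrow> (point \<Rightarrow> real) \<Rightarrow> ennreal"
  where "slobodeckij \<Omega> s v =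
    (\<integral>\<^sup>+x. (\<integral>\<^sup>+y. ennreal ((norm (whess \<Omega> v x - whess \<Omega> v y))\<^sup>2 / (dist x y) powr (2 + 2 * s))
       \<partial>lebesgue_on \<Omega>) \<partial>lebesgue_on \<Omega>)"

definition H2plus :: "point set \<Rightarrow> real \<Rightarrow> (point \<Rightarrow> real) set"
  where "H2plus \<Omega> s =
    (if s = 1 then sobolev \<Omega> 3 else {v \<in> sobolev \<Omega> 2. slobodeckij \<Omega> s v < \<infinity>})"

definition H2plus_norm :: "point set \<Rightarrow> real \<Rightarrow> (point \<Rightarrow> real) \<Rightarrow> real"
  where "H2plus_norm \<Omega> s v = sqrt ((H2norm \<Omega> v)\<^sup>2 +
    (if s = 1 then (L2norm \<Omega> (D3 \<Omega> v))\<^sup>2 else enn2real (slobodeckij \<Omega> s v)))"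


section \<open>The von Karman equations\<close>

definition cof :: "real^2^2 \<Rightarrow> real^2^2"
  where "cof M = vector [vector [M $ 2 $ 2, - (M $ 1 $ 2)], vector [- (M $ 2 $ 1), M $ 1 $ 1]]"

text \<open>The forms are written as functions of the Hessian and gradient fields of their arguments, so
  that the continuous and the piecewise forms are literally instances of the same expression.\<close>

definition a_form :: "point set \<Rightarrow> (point \<Rightarrow> real^2^2) \<Rightarrow> (point \<Rightarrow> real^2^2) \<Rightarrow> real"
  where "a_form \<Omega> D2\<psi> D2\<phi> = (LINT x|lebesgue_on \<Omega>. D2\<psi> x \<bullet> D2\<phi> x)"

definition b_form ::
    "point set \<Rightarrow> (point \<Rightarrow> real^2^2) \<Rightarrow> (point \<Rightarrow> real^2) \<Rightarrow> (point \<Rightarrow> real^2) \<Rightarrow> real"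
  where "b_form \<Omega> D2\<theta> D\<psi> D\<phi> = 1/2 * (LINT x|lebesgue_on \<Omega>. (cof (D2\<theta> x) *v D\<psi> x) \<bullet> D\<phi> x)"

definition A_form :: "point set \<Rightarrow> (point \<Rightarrow> real^2^2^2) \<Rightarrow> (point \<Rightarrow> real^2^2^2) \<Rightarrow> real"
  where "A_form \<Omega> D2\<Psi> D2\<Phi> =
    a_form \<Omega> (\<lambda>x. D2\<Psi> x $ 1) (\<lambda>x. D2\<Phi> x $ 1) + a_form \<Omega> (\<lambda>x. D2\<Psi> x $ 2) (\<lambda>x. D2\<Phi> x $ 2)"

definition B_form ::
    "point set \<Rightarrow> (point \<Rightarrow> real^2^2^2) \<Rightarrow> (point \<Rightarrow> real^2^2) \<Rightarrow> (point \<Rightarrow> real^2^2) \<Rightarrow> real"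
  where "B_form \<Omega> D2\<Theta> D\<Psi> D\<Phi> =
    b_form \<Omega> (\<lambda>x. D2\<Theta> x $ 1) (\<lambda>x. D\<Psi> x $ 2) (\<lambda>x. D\<Phi> x $ 1) +
    b_form \<Omega> (\<lambda>x. D2\<Theta> x $ 2) (\<lambda>x. D\<Psi> x $ 1) (\<lambda>x. D\<Phi> x $ 1) -
    b_form \<Omega> (\<lambda>x. D2\<Theta> x $ 1) (\<lambda>x. D\<Psi> x $ 1) (\<lambda>x. D\<Phi> x $ 2)"

definition vK_A :: "point set \<Rightarrow> (point \<Rightarrow> real^2) \<Rightarrow> (point \<Rightarrow> real^2) \<Rightarrow> real"
  where "vK_A \<Omega> \<Psi> \<Phi> = A_form \<Omega> (Whess \<Omega> \<Psi>) (Whess \<Omega> \<Phi>)"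

definition vK_B :: "point set \<Rightarrow> (point \<Rightarrow> real^2) \<Rightarrow> (point \<Rightarrow> real^2) \<Rightarrow> (point \<Rightarrow> real^2) \<Rightarrow> real"
  where "vK_B \<Omega> \<Theta> \<Psi> \<Phi> = B_form \<Omega> (Whess \<Omega> \<Theta>) (Wgrad \<Omega> \<Psi>) (Wgrad \<Omega> \<Phi>)"

definition load :: "point set \<Rightarrow> (point \<Rightarrow> real) \<Rightarrow> (point \<Rightarrow> real^2) \<Rightarrow> real"
  where "load \<Omega> f \<Phi> = (LINT x|lebesgue_on \<Omega>. f x * \<Phi> x $ 1)"

definition vK_solution :: "point set \<Rightarrow> (point \<Rightarrow> real) \<Rightarrow> (point \<Rightarrow> real^2) \<Rightarrow> bool"
  where "vK_solution \<Omega> f \<Psi> \<longleftrightarrow>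
    \<Psi> \<in> H20v \<Omega> \<and> (\<forall>\<Phi>\<in>H20v \<Omega>. vK_A \<Omega> \<Psi> \<Phi> + vK_B \<Omega> \<Psi> \<Psi> \<Phi> = load \<Omega> f \<Phi>)"

definition DN :: "point set \<Rightarrow> (point \<Rightarrow> real^2) \<Rightarrow> (point \<Rightarrow> real^2) \<Rightarrow> (point \<Rightarrow> real^2) \<Rightarrow> real"
  where "DN \<Omega> \<Psi> \<Xi> \<Theta> = vK_A \<Omega> \<Xi> \<Theta> + 2 * vK_B \<Omega> \<Psi> \<Xi> \<Theta>"

text \<open>The dual of \<open>H\<^sup>2\<^sub>0(\<Omega>;\<real>\<^sup>2)\<close>. Boundedness forces a functional to respect equality almost
  everywhere.\<close>
definition H20v_dual :: "point set \<Rightarrow> ((point \<Rightarrow> real^2) \<Rightarrow> real) set"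
  where "H20v_dual \<Omega> = {G.
    (\<forall>\<Theta>\<in>H20v \<Omega>. \<forall>\<Theta>'\<in>H20v \<Omega>. \<forall>s t. G (\<lambda>x. s *\<^sub>R \<Theta> x + t *\<^sub>R \<Theta>' x) = s * G \<Theta> + t * G \<Theta>') \<and>
    (\<exists>c. \<forall>\<Theta>\<in>H20v \<Omega>. \<bar>G \<Theta>\<bar> \<le> c * H2vnorm \<Omega> \<Theta>)}"

definition dual_norm :: "point set \<Rightarrow> ((point \<Rightarrow> real^2) \<Rightarrow> real) \<Rightarrow> real"
  where "dual_norm \<Omega> G = (SUP \<Theta>\<in>{\<Theta> \<in> H20v \<Omega>. H2vnorm \<Omega> \<Theta> \<le> 1}. \<bar>G \<Theta>\<bar>)"

text \<open>\<open>\<Xi> \<mapsto> DN(\<Psi>;\<Xi>,\<cdot>)\<close> is an isomorphism onto the dual: well defined, onto, bounded and bounded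
  below. The lower bound contains both injectivity (up to equality almost everywhere) and
  boundedness of the inverse; linearity holds by the form of \<open>DN\<close>.\<close>
definition nonsingular :: "point set \<Rightarrow> (point \<Rightarrow> real^2) \<Rightarrow> bool"
  where "nonsingular \<Omega> \<Psi> \<longleftrightarrow>
    (\<forall>\<Xi>\<in>H20v \<Omega>. DN \<Omega> \<Psi> \<Xi> \<in> H20v_dual \<Omega>) \<and>
    (\<forall>G\<in>H20v_dual \<Omega>. \<exists>\<Xi>\<in>H20v \<Omega>. \<forall>\<Theta>\<in>H20v \<Omega>. DN \<Omega> \<Psi> \<Xi> \<Theta> = G \<Theta>) \<and>
    (\<exists>c>0. \<exists>M. \<forall>\<Xi>\<in>H20v \<Omega>.
       c * H2vnorm \<Omega> \<Xi> \<le> dual_norm \<Omega> (DN \<Omega> \<Psi> \<Xi>) \<and> dual_norm \<Omega> (DN \<Omega> \<Psi> \<Xi>) \<le> M * H2vnorm \<Omega> \<Xi>)"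

text \<open>Elliptic regularity of the clamped biharmonic operator with index \<open>\<alpha>\<close>, for \<open>L\<^sup>2\<close> data.\<close>
definition biharmonic_regularity :: "point set \<Rightarrow> real \<Rightarrow> bool"
  where "biharmonic_regularity \<Omega> \<alpha> \<longleftrightarrow>
    (\<exists>c. \<forall>g\<in>L2 \<Omega>. \<forall>u\<in>H20 \<Omega>.
       (\<forall>\<phi>\<in>H20 \<Omega>. a_form \<Omega> (whess \<Omega> u) (whess \<Omega> \<phi>) = (LINT x|lebesgue_on \<Omega>. g x * \<phi> x)) \<longrightarrow>
       u \<in> H2plus \<Omega> \<alpha> \<and> H2plus_norm \<Omega> \<alpha> u \<le> c * L2norm \<Omega> g)"

text \<open>\<open>\<Psi> \<in> H\<^sup>2\<^sup>+\<^sup>\<alpha>(\<Omega>;\<real>\<^sup>2)\<close> with norm at most \<open>c\<close> times the norm of \<open>f\<close>.\<close>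
definition regular_solution ::
    "point set \<Rightarrow> (point \<Rightarrow> real) \<Rightarrow> real \<Rightarrow> real \<Rightarrow> (point \<Rightarrow> real^2) \<Rightarrow> bool"
  where "regular_solution \<Omega> f \<alpha> c \<Psi> \<longleftrightarrow>
    (\<forall>j. cmp j \<Psi> \<in> H2plus \<Omega> \<alpha>) \<and>
    sqrt (\<Sum>j\<in>UNIV. (H2plus_norm \<Omega> \<alpha> (cmp j \<Psi>))\<^sup>2) \<le> c * L2norm \<Omega> f"


section \<open>Triangulations\<close>

definition regular_triangulation :: "point set \<Rightarrow> mesh \<Rightarrow> bool"
  where "regular_triangulation \<Omega> \<T> \<longleftrightarrow>
    triangulation \<T> \<and> (\<forall>T\<in>\<T>. 2 simplex T) \<and> \<Union>\<T> = closure \<Omega>"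

definition shape_regular :: "real \<Rightarrow> mesh \<Rightarrow> bool"
  where "shape_regular \<rho> \<T> \<longleftrightarrow>
    (\<forall>T\<in>\<T>. \<exists>z. \<exists>r>0. cball z r \<subseteq> T \<and> diameter T \<le> \<rho> * r)"

definition mesh_size :: "mesh \<Rightarrow> real"
  where "mesh_size \<T> = Max (diameter ` \<T>)"

definition vertices :: "point set \<Rightarrow> point set"
  where "vertices T = {z. z extreme_point_of T}"

definition edges :: "point set \<Rightarrow> point set set"
  where "edges T = {F. F edge_of T}"

definition faces :: "mesh \<Rightarrow> point set set"
  where "faces \<T> = (\<Union>T\<in>\<T>. edges T)"

definition interior_faces :: "mesh \<Rightarrow> point set set"
  where "interior_faces \<T> = {F \<in> faces \<T>. \<exists>K\<in>\<T>. \<exists>K'\<in>\<T>. K \<noteq> K' \<and> F = K \<inter> K'}"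

definition boundary_faces :: "mesh \<Rightarrow> point set set"
  where "boundary_faces \<T> = faces \<T> - interior_faces \<T>"

text \<open>The fixed choice of \<open>T\<^sub>+\<close> and \<open>T\<^sub>-\<close> for a face; \<open>Tminus\<close> is meaningful for interior faces.\<close>
definition Tplus :: "mesh \<Rightarrow> point set \<Rightarrow> point set"
  where "Tplus \<T> F = (SOME K. K \<in> \<T> \<and> F \<in> edges K)"

definition Tminus :: "mesh \<Rightarrow> point set \<Rightarrow> point set"
  where "Tminus \<T> F = (SOME K. K \<in> \<T> \<and> F = Tplus \<T> F \<inter> K)"

definition jump :: "mesh \<Rightarrow> point set \<Rightarrow> 'a::ab_group_add pwfun \<Rightarrow> point \<Rightarrow> 'a"
  where "jump \<T> F v x =
    (if F \<in> interior_faces \<T> then v (Tplus \<T> F) x - v (Tminus \<T> F) x else v (Tplus \<T> F) x)"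

definition face_normal :: "mesh \<Rightarrow> point set \<Rightarrow> point"
  where "face_normal \<T> F = (THE \<nu>. norm \<nu> = 1 \<and> (\<forall>x\<in>F. \<forall>y\<in>F. \<nu> \<bullet> (y - x) = 0) \<and>
                                    (\<forall>x\<in>F. \<forall>y\<in>Tplus \<T> F. \<nu> \<bullet> (y - x) \<le> 0))"

definition face_midpoint :: "point set \<Rightarrow> point"
  where "face_midpoint F = (THE m. \<exists>a b. F = closed_segment a b \<and> m = midpoint a b)"

text \<open>Integration over a segment with respect to arc length; interchanging the end points does not
  change the value.\<close>
definition face_integral :: "point set \<Rightarrow> (point \<Rightarrow> real) \<Rightarrow> real"
  where "face_integral F g = (THE I. \<exists>a b. F = closed_segment a b \<and>
    I = dist a b * (LINT t|lebesgue_on {0..1}. g (linepath a b t)))"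

definition face_L2norm :: "point set \<Rightarrow> (point \<Rightarrow> 'a::real_normed_vector) \<Rightarrow> real"
  where "face_L2norm F g = sqrt (face_integral F (\<lambda>x. (norm (g x))\<^sup>2))"

definition face_patch :: "mesh \<Rightarrow> point set \<Rightarrow> point set"
  where "face_patch \<T> F =
    (if F \<in> interior_faces \<T> then Tplus \<T> F \<union> Tminus \<T> F else Tplus \<T> F)"

definition edge_patch :: "mesh \<Rightarrow> point set \<Rightarrow> point set"
  where "edge_patch \<T> T = (\<Union>F\<in>edges T. face_patch \<T> F)"

definition vertex_patch :: "mesh \<Rightarrow> point set \<Rightarrow> point set"
  where "vertex_patch \<T> T = \<Union>{K\<in>\<T>. K \<inter> T \<noteq> {}}"

text \<open>The function on \<open>\<Union>\<T>\<close> given by a piecewise function; on the edges, a null set, the branch is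
  arbitrary.\<close>
definition glue :: "mesh \<Rightarrow> 'a pwfun \<Rightarrow> point \<Rightarrow> 'a"
  where "glue \<T> v x = v (SOME K. K \<in> \<T> \<and> x \<in> K) x"

definition mesh_function :: "mesh \<Rightarrow> point \<Rightarrow> real"
  where "mesh_function \<T> = glue \<T> (\<lambda>K x. diameter K)"

text \<open>The \<open>L\<^sup>2\<close> projection of \<open>f\<close> onto the piecewise constants, by its orthogonality relation.\<close>
definition Pi0 :: "mesh \<Rightarrow> (point \<Rightarrow> real) \<Rightarrow> point \<Rightarrow> real"
  where "Pi0 \<T> f = glue \<T> (\<lambda>K x. (SOME q. \<forall>r::point set \<Rightarrow> real.
    (LINT y|lebesgue_on (\<Union>\<T>). (f y - glue \<T> (\<lambda>K y. q K) y) * glue \<T> (\<lambda>K y. r K) y) = 0) K)"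

definition osc :: "mesh \<Rightarrow> (point \<Rightarrow> real) \<Rightarrow> point set \<Rightarrow> real"
  where "osc \<T> f \<omega> = L2norm \<omega> (\<lambda>x. (mesh_function \<T> x)\<^sup>2 * (f x - Pi0 \<T> f x))"


section \<open>Morley functions\<close>

definition affine_poly :: "(point \<Rightarrow> real) \<Rightarrow> bool"
  where "affine_poly p \<longleftrightarrow> (\<exists>c b. \<forall>x. p x = c + b \<bullet> x)"

definition quadratic_poly :: "(point \<Rightarrow> real) \<Rightarrow> bool"
  where "quadratic_poly p \<longleftrightarrow> (\<exists>c b. \<exists>M::real^2^2. \<forall>x. p x = c + b \<bullet> x + x \<bullet> (M *v x))"

definition pw_grad :: "real pwfun \<Rightarrow> (real^2) pwfun"
  where "pw_grad v K x = (\<chi> i. pderiv2 i (v K) x)"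

definition pw_hess :: "real pwfun \<Rightarrow> (real^2^2) pwfun"
  where "pw_hess v K x = (\<chi> i k. pderiv2 k (pderiv2 i (v K)) x)"

definition pw_Grad :: "(real^2) pwfun \<Rightarrow> (real^2^2) pwfun"
  where "pw_Grad v K x = (\<chi> j. pw_grad (pw_cmp j v) K x)"

definition pw_Hess :: "(real^2) pwfun \<Rightarrow> (real^2^2^2) pwfun"
  where "pw_Hess v K x = (\<chi> j. pw_hess (pw_cmp j v) K x)"

definition morley :: "mesh \<Rightarrow> real pwfun set"
  where "morley \<T> = {v.
    (\<forall>K\<in>\<T>. quadratic_poly (v K)) \<and>
    (\<forall>K\<in>\<T>. \<forall>K'\<in>\<T>. \<forall>z\<in>vertices K \<inter> vertices K'. v K z = v K' z) \<and>
    (\<forall>F\<in>interior_faces \<T>. jump \<T> F (pw_grad v) (face_midpoint F) = 0)}"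

definition morley0 :: "point set \<Rightarrow> mesh \<Rightarrow> real pwfun set"
  where "morley0 \<Omega> \<T> = {v \<in> morley \<T>.
    (\<forall>K\<in>\<T>. \<forall>z\<in>vertices K \<inter> frontier \<Omega>. v K z = 0) \<and>
    (\<forall>F\<in>boundary_faces \<T>. pw_grad v (Tplus \<T> F) (face_midpoint F) = 0)}"

definition morley0v :: "point set \<Rightarrow> mesh \<Rightarrow> (real^2) pwfun set"
  where "morley0v \<Omega> \<T> = {v. \<forall>j. pw_cmp j v \<in> morley0 \<Omega> \<T>}"

definition interp :: "real pwfun \<Rightarrow> real pwfun"
  where "interp v K = (THE p. affine_poly p \<and> (\<forall>z\<in>vertices K. p z = v K z))"

definition interpv :: "(real^2) pwfun \<Rightarrow> (real^2) pwfun"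
  where "interpv v K x = (\<chi> j. interp (pw_cmp j v) K x)"

definition A_pw :: "point set \<Rightarrow> mesh \<Rightarrow> (real^2) pwfun \<Rightarrow> (real^2) pwfun \<Rightarrow> real"
  where "A_pw \<Omega> \<T> \<Psi> \<Phi> = A_form \<Omega> (glue \<T> (pw_Hess \<Psi>)) (glue \<T> (pw_Hess \<Phi>))"

definition B_pw ::
    "point set \<Rightarrow> mesh \<Rightarrow> (real^2) pwfun \<Rightarrow> (real^2) pwfun \<Rightarrow> (real^2) pwfun \<Rightarrow> real"
  where "B_pw \<Omega> \<T> \<Theta> \<Psi> \<Phi> =
    B_form \<Omega> (glue \<T> (pw_Hess \<Theta>)) (glue \<T> (pw_Grad \<Psi>)) (glue \<T> (pw_Grad \<Phi>))"

definition discrete_solution :: "point set \<Rightarrow> (point \<Rightarrow> real) \<Rightarrow> mesh \<Rightarrow> (real^2) pwfun \<Rightarrow> bool"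
  where "discrete_solution \<Omega> f \<T> \<Psi>h \<longleftrightarrow>
    \<Psi>h \<in> morley0v \<Omega> \<T> \<and>
    (\<forall>\<Phi>h\<in>morley0v \<Omega> \<T>.
       A_pw \<Omega> \<T> \<Psi>h \<Phi>h + B_pw \<Omega> \<T> \<Psi>h (interpv \<Psi>h) (interpv \<Phi>h) = load \<Omega> f (glue \<T> \<Phi>h))"

text \<open>The \<open>L\<^sup>2(\<omega>)\<close> norms of \<open>D\<^sup>2\<^sub>p\<^sub>w(\<Psi> - \<Psi>\<^sub>h)\<close> and \<open>\<nabla>(\<Psi> - I\<^sub>h\<Psi>\<^sub>h)\<close>.\<close>

definition hess_err ::
    "point set \<Rightarrow> mesh \<Rightarrow> (point \<Rightarrow> real^2) \<Rightarrow> (real^2) pwfun \<Rightarrow> point set \<Rightarrow> real"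
  where "hess_err \<Omega> \<T> \<Psi> \<Psi>h \<omega> = L2norm \<omega> (\<lambda>x. Whess \<Omega> \<Psi> x - glue \<T> (pw_Hess \<Psi>h) x)"

definition interp_err ::
    "point set \<Rightarrow> mesh \<Rightarrow> (point \<Rightarrow> real^2) \<Rightarrow> (real^2) pwfun \<Rightarrow> point set \<Rightarrow> real"
  where "interp_err \<Omega> \<T> \<Psi> \<Psi>h \<omega> =
    L2norm \<omega> (\<lambda>x. Wgrad \<Omega> \<Psi> x - glue \<T> (pw_Grad (interpv \<Psi>h)) x)"

text \<open>The discrete solution near \<open>\<Psi>\<close>: the only discrete solution at distance at most \<open>\<delta>\<close> from
  \<open>\<Psi>\<close>, with error at most \<open>c * h powr \<alpha>\<close>.\<close>
definition near_discrete_solution :: "point set \<Rightarrow> (point \<Rightarrow> real) \<Rightarrow> (point \<Rightarrow> real^2) \<Rightarrow>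
    real \<Rightarrow> real \<Rightarrow> real \<Rightarrow> mesh \<Rightarrow> (real^2) pwfun \<Rightarrow> bool"
  where "near_discrete_solution \<Omega> f \<Psi> \<alpha> \<delta> c \<T> \<Psi>h \<longleftrightarrow>
    discrete_solution \<Omega> f \<T> \<Psi>h \<and>
    hess_err \<Omega> \<T> \<Psi> \<Psi>h \<Omega> \<le> \<delta> \<and>
    (\<forall>\<Psi>h'. discrete_solution \<Omega> f \<T> \<Psi>h' \<and> hess_err \<Omega> \<T> \<Psi> \<Psi>h' \<Omega> \<le> \<delta> \<longrightarrow>
            (\<forall>K\<in>\<T>. \<Psi>h' K = \<Psi>h K)) \<and>
    hess_err \<Omega> \<T> \<Psi> \<Psi>h \<Omega> \<le> c * mesh_size \<T> powr \<alpha>"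


section \<open>Error estimator\<close>

definition A_field :: "2 \<Rightarrow> (real^2) pwfun \<Rightarrow> (real^2) pwfun"
  where "A_field j \<Psi>h K x =
    (let H = (\<lambda>i. pw_hess (pw_cmp i \<Psi>h) K x); G = (\<lambda>i. pw_grad (interp (pw_cmp i \<Psi>h)) K x)
     in if j = 1 then cof (H 1) *v G 2 + cof (H 2) *v G 1 else cof (H 1) *v G 1)"

definition \<mu>_NC :: "mesh \<Rightarrow> (real^2) pwfun \<Rightarrow> point set \<Rightarrow> real"
  where "\<mu>_NC \<T> \<Psi>h T =
    sqrt (\<Sum>F\<in>edges T. inverse (diameter T) * (face_L2norm F (jump \<T> F (pw_Grad \<Psi>h)))\<^sup>2)"

definition \<mu>_I :: "mesh \<Rightarrow> (real^2) pwfun \<Rightarrow> point set \<Rightarrow> real"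
  where "\<mu>_I \<T> \<Psi>h T = L2norm T (glue \<T> (pw_Grad (\<lambda>K x. \<Psi>h K x - interpv \<Psi>h K x)))"

definition \<eta>_f :: "(point \<Rightarrow> real) \<Rightarrow> point set \<Rightarrow> real"
  where "\<eta>_f f T = L2norm T (\<lambda>x. (diameter T)\<^sup>2 * f x)"

definition \<eta> :: "2 \<Rightarrow> mesh \<Rightarrow> (real^2) pwfun \<Rightarrow> point set \<Rightarrow> real"
  where "\<eta> j \<T> \<Psi>h T =
    sqrt (\<Sum>F\<in>edges T \<inter> interior_faces \<T>.
      diameter T ^ 3 * (face_L2norm F (\<lambda>x. jump \<T> F (A_field j \<Psi>h) x \<bullet> face_normal \<T> F))\<^sup>2)"

end

(*
  Each upper bound tests an equation solved by Psi, or an orthogonality relation of Morley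
  functions, against a function supported near the term to be bounded.

  mu_NC: the jump of the gradient of Psi_h has mean zero on every face, so it is controlled by the
  mean-free part of the gradient of Psi_h - phi on the adjacent triangles for every test function
  phi. A trace inequality for such Crouzeix-Raviart type defects bounds it by the piecewise Hessian,
  and density of test functions gives every Phi in H^2_0.

  mu_I: the triangle inequality leaves the gradient of Psi - Psi_h, which a discrete Friedrichs
  inequality for functions with mean-free jumps bounds by the Hessian error.

  eta_f and eta_j: a smooth bump phi inserted in the weak equation leaves, up to the errors, the
  integral of D^2 Psi_h : D^2 phi, the integral of A_j . grad phi, and the load. On an interior disc
  the first two vanish because Psi_h has constant Hessians and A_j is constant, which bounds the
  mean of f. A bump centred at the midpoint of a face is even, so its Hessian integrates to zero
  over each of the two triangles, while the gradient term gives the jump of A_j.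
*)
theory Submission
  imports Defs
begin

section \<open>Integration over triangles\<close>

text \<open>Membership in \<open>H20\<close> is a limit of test functions, and
  \<open>wpderiv\<close> is an arbitrarily chosen representative. Estimates are therefore proved for
  smooth \<phi> by calculus on triangles and carried over by an L^2 limit; uniqueness of weak
  derivatives (\<open>du_Bois_Reymond\<close>) ties the chosen representatives to classical
  derivatives. Calculus on a triangle rests on one tool, integration along lines parallel to a side
  (\<open>triangle_slice\<close>). The obstacle in the residual bounds is that the product of a
  Hessian and a gradient is only integrable, so it has to be paired with a bounded function. A bump
  of radius r has a gradient of size 1/r in the supremum norm and a Hessian of size 1/r in L^2, so
  both parts of the residual scale alike. Linearising the product needs a bound \<open>M\<close> on
  two L^2 factors that does not depend on the mesh; the radius \<delta> around \<Psi> provides it.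
  The jump estimate builds on the volume estimate, because the load on a face patch is bounded by
  \<open>\<eta>_f\<close> on its two triangles.\<close>

definition area2 :: "point \<Rightarrow> point \<Rightarrow> point \<Rightarrow> real"
  where "area2 a b c = (b - a)$1 * (c - a)$2 - (b - a)$2 * (c - a)$1"

lemma continuous_on_vec2 [continuous_intros]:
  fixes f g :: "'a::topological_space \<Rightarrow> real"
  assumes "continuous_on S f" "continuous_on S g"
  shows "continuous_on S (\<lambda>x. vector [f x, g x] :: real^2)"
proof -
  have "(\<lambda>x. vector [f x, g x] :: real^2) = (\<lambda>x. \<chi> i. if i = 1 then f x else g x)"
    by (auto simp: vec_eq_iff forall_2)
  moreover have "continuous_on S (\<lambda>x. \<chi> i. if i = (1::2) then f x else g x)"
  proof (rule continuous_on_vec_lambda)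
    show "continuous_on S (\<lambda>x. if i = 1 then f x else g x)" for i :: 2
      using assms by (cases "i = 1") auto
  qed
  ultimately show ?thesis by (simp only:)
qed

text \<open>Boxes determine Lebesgue measure; this transports Fubini from pairs to
  \<open>real^2\<close>.\<close>

lemma lborel_vec2: "distr (lborel \<Otimes>\<^sub>M lborel) borel (\<lambda>p. vector [fst p, snd p] :: real^2) = lborel"
proof (rule lborel_eqI[symmetric])
  have c: "continuous_on UNIV (\<lambda>p. vector [fst p, snd p] :: real^2)"
    by (intro continuous_intros)
  have m: "(\<lambda>p. vector [fst p, snd p] :: real^2) \<in> borel_measurable (lborel \<Otimes>\<^sub>M lborel)"
    using borel_measurable_continuous_onI[OF c] by (simp add: borel_prod lborel_prod)
  fix l u :: "real^2" assume le: "\<And>b. b \<in> Basis \<Longrightarrow> l \<bullet> b \<le> u \<bullet> b"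
  have l12: "l$1 \<le> u$1" "l$2 \<le> u$2"
    using le[of "axis 1 1"] le[of "axis 2 1"] by (auto simp: inner_axis axis_in_Basis_iff)
  have v: "(\<lambda>p. vector [fst p, snd p] :: real^2) -` box l u \<inter> space (lborel \<Otimes>\<^sub>M lborel)
    = {l$1<..<u$1} \<times> {l$2<..<u$2}"
    by (auto simp: mem_box_cart forall_2 space_pair_measure)
  have "emeasure (distr (lborel \<Otimes>\<^sub>M lborel) borel (\<lambda>p. vector [fst p, snd p] :: real^2)) (box l u)
     = emeasure (lborel \<Otimes>\<^sub>M lborel) ({l$1<..<u$1} \<times> {l$2<..<u$2})"
    using m by (subst emeasure_distr) (auto simp: v)
  also have "\<dots> = ennreal ((u$1 - l$1) * (u$2 - l$2))"
    using l12 by (subst lborel.emeasure_pair_measure_Times) (auto simp: ennreal_mult)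
  also have "(u$1 - l$1) * (u$2 - l$2) = (\<Prod>b\<in>Basis. (u - l) \<bullet> b)"
    by (simp add: Basis_vec_def  UNION_singleton_eq_range prod.reindex inj_on_def axis_eq_axis inner_axis UNIV_2)
  finally show "emeasure (distr (lborel \<Otimes>\<^sub>M lborel) borel (\<lambda>p. vector [fst p, snd p] :: real^2)) (box l u)
     = ennreal (\<Prod>b\<in>Basis. (u - l) \<bullet> b)" .
qed simp

lemma integral_vec2:
  fixes h :: "real^2 \<Rightarrow> real"
  assumes h: "integrable lborel h"
  shows "integrable lborel (\<lambda>t. LINT s|lborel. h (vector [t, s]))"
    and "(LINT t|lborel. LINT s|lborel. h (vector [t, s])) = (LINT x|lborel. h x)"
proof -
  have c: "continuous_on UNIV (\<lambda>p. vector [fst p, snd p] :: real^2)"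
    by (intro continuous_intros)
  have m: "(\<lambda>p. vector [fst p, snd p] :: real^2) \<in> (lborel \<Otimes>\<^sub>M lborel) \<rightarrow>\<^sub>M borel"
    using borel_measurable_continuous_onI[OF c] by (simp add: borel_prod lborel_prod)
  have hm: "h \<in> borel_measurable borel" using h by auto
  have i: "integrable (lborel \<Otimes>\<^sub>M lborel) (\<lambda>p. h (vector [fst p, snd p]))"
    by (subst integrable_distr_eq[OF m hm, symmetric]) (simp add: lborel_vec2 h)
  have e: "(LINT x|lborel. h x) = (LINT p|(lborel \<Otimes>\<^sub>M lborel). h (vector [fst p, snd p]))"
    by (subst lborel_vec2[symmetric], subst integral_distr[OF m hm]) simp
  show "integrable lborel (\<lambda>t. LINT s|lborel. h (vector [t, s]))"
    using lborel_pair.integrable_fst'[OF i] by simp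
  show "(LINT t|lborel. LINT s|lborel. h (vector [t, s])) = (LINT x|lborel. h x)"
    using lborel_pair.integral_fst'[OF i] e by simp
qed

lemma convex_hull_3_param:
  fixes a b c :: "'a::real_vector"
  shows "convex hull {a, b, c} = {a + t *\<^sub>R (b - a) + s *\<^sub>R (c - a) | t s. 0 \<le> t \<and> 0 \<le> s \<and> t + s \<le> 1}"
proof -
  have "convex hull {a, b, c} = {a + t *\<^sub>R (b - a) + s *\<^sub>R (c - a) | t s. 0 \<le> t \<and> 0 \<le> s \<and> t + s \<le> 1}"
    using convex_hull_3_alt[of a b c] by (auto simp: algebra_simps)
  then show ?thesis .
qed

lemma compact_triangle: "compact (convex hull {a, b, c :: 'a::euclidean_space})"
  by (intro compact_convex_hull finite_imp_compact) auto

text \<open>Bridge between the three integrals in use: Lebesgue on \<open>K\<close>, the Borel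
  integral with an indicator for Fubini, and the gauge integral for the change of variables.\<close>

lemma continuous_compact_integrable:
  fixes g :: "'a::euclidean_space \<Rightarrow> real"
  assumes "compact K" "continuous_on K g"
  shows "integrable (lebesgue_on K) g" "integrable lborel (\<lambda>x. indicator K x * g x)"
    "(LINT x|lebesgue_on K. g x) = (LINT x|lborel. indicator K x * g x)"
    "g absolutely_integrable_on K"
    "(LINT x|lebesgue_on K. g x) = integral K g"
proof -
  have K: "K \<in> sets lebesgue" using assms(1) by (simp add: lmeasurable_compact fmeasurableD)
  show 1: "integrable lborel (\<lambda>x. indicator K x * g x)"
    using borel_integrable_compact[OF assms] by simp
  then have m: "(\<lambda>x. indicator K x * g x) \<in> borel_measurable lborel" by auto
  have 2: "integrable lebesgue (\<lambda>x. indicator K x * g x)"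
    using 1 integrable_completion[OF m] by simp
  then show "g absolutely_integrable_on K" by (simp add: set_integrable_def)
  show 3: "integrable (lebesgue_on K) g"
    using 2 K by (subst integrable_restrict_space) auto
  show "(LINT x|lebesgue_on K. g x) = (LINT x|lborel. indicator K x * g x)"
    using K integral_completion[OF m] by (subst integral_restrict_space) auto
  show "(LINT x|lebesgue_on K. g x) = integral K g"
    by (rule lebesgue_integral_eq_integral[OF 3 K])
qed

text \<open>Affine change of variables to the reference triangle \<open>S\<close>, then Fubini. The
  outer parameter runs along the side from \<open>a\<close> to \<open>b\<close>, the inner one along
  lines parallel to \<open>c - a\<close>, where the fundamental theorem of calculus can evaluate
  derivatives.\<close>

lemma triangle_slice:
  fixes g :: "real^2 \<Rightarrow> real"
  assumes cont: "continuous_on UNIV g" and D: "area2 a b c \<noteq> 0"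
  shows "((\<lambda>t. integral {0..1-t} (\<lambda>s. g (a + t *\<^sub>R (b-a) + s *\<^sub>R (c-a))))
    has_integral (LINT x|lebesgue_on (convex hull {a,b,c}). g x) / \<bar>area2 a b c\<bar>) {0..1}"
proof -
  define l :: "real^2 \<Rightarrow> real^2" where "l = (\<lambda>y. y$1 *\<^sub>R (b-a) + y$2 *\<^sub>R (c-a))"
  define S :: "(real^2) set" where "S = {y. 0 \<le> y$1 \<and> 0 \<le> y$2 \<and> y$1 + y$2 \<le> 1}"
  define h where "h = (\<lambda>y. g (a + l y))"
  have lin: "linear l" unfolding l_def by (rule linearI) (auto simp: algebra_simps)
  have det: "det (matrix l) = area2 a b c"
    by (simp add: det_2 matrix_def l_def area2_def axis_def)
  have img: "(\<lambda>y. a + l y) ` S = convex hull {a,b,c}"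
    unfolding convex_hull_3_param
  proof safe
    fix y assume "y \<in> S"
    then show "\<exists>t s. a + l y = a + t *\<^sub>R (b - a) + s *\<^sub>R (c - a) \<and> 0 \<le> t \<and> 0 \<le> s \<and> t + s \<le> 1"
      by (intro exI[of _ "y$1"] exI[of _ "y$2"]) (auto simp: l_def S_def)
  next
    fix t s :: real assume "0 \<le> t" "0 \<le> s" "t + s \<le> 1"
    then show "a + t *\<^sub>R (b - a) + s *\<^sub>R (c - a) \<in> (\<lambda>y. a + l y) ` S"
      by (intro image_eqI[of _ _ "vector [t,s]"]) (auto simp: l_def S_def)
  qed
  have Seq: "S = convex hull {0, axis 1 1, axis 2 1}"
    unfolding convex_hull_3_param
  proof safe
    fix y assume "y \<in> S"
    then show "\<exists>t s. y = 0 + t *\<^sub>R (axis 1 1 - 0) + s *\<^sub>R (axis 2 1 - 0) \<and> 0 \<le> t \<and> 0 \<le> s \<and> t + s \<le> 1"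
      by (intro exI[of _ "y$1"] exI[of _ "y$2"]) (auto simp: S_def vec_eq_iff forall_2 axis_def)
  qed (auto simp: S_def axis_def)
  have Sc: "compact S" unfolding Seq by (rule compact_triangle)
  have contl: "continuous_on UNIV l" using lin by (simp add: linear_continuous_on linear_conv_bounded_linear)
  have conth: "continuous_on UNIV h" unfolding h_def
    by (intro continuous_on_compose2[OF cont] continuous_intros contl) auto
  have Sl: "S \<in> sets lebesgue" using Sc by (simp add: lmeasurable_compact fmeasurableD)
  have inj: "inj l" using det_nz_iff_inj[OF lin] det D by simp
  have inja: "inj_on (\<lambda>y. a + l y) S" using inj by (auto simp: inj_on_def)
  \<comment> \<open>The change of variables theorem speaks of values in \<open>real^n\<close>, so
    the real integrand is wrapped as a vector with one component.\<close>
  let ?f = "\<lambda>x. vec (g x) :: real^1"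
  have ch: "(\<lambda>x. \<bar>det (matrix l)\<bar> *\<^sub>R ?f (a + l x)) absolutely_integrable_on S \<and>
           integral S (\<lambda>x. \<bar>det (matrix l)\<bar> *\<^sub>R ?f (a + l x)) = B
     \<longleftrightarrow> ?f absolutely_integrable_on ((\<lambda>y. a + l y) ` S) \<and> integral ((\<lambda>y. a + l y) ` S) ?f = B" for B
  proof (rule has_absolute_integral_change_of_variables[OF Sl _ inja])
    fix x assume "x \<in> S"
    show "((\<lambda>y. a + l y) has_derivative l) (at x within S)"
      using has_derivative_add[OF has_derivative_const linear_imp_has_derivative[OF lin]] by simp
  qed
  have K: "compact (convex hull {a,b,c})" by (rule compact_triangle)
  note gK = continuous_compact_integrable[OF K continuous_on_subset[OF cont]]
  note hS = continuous_compact_integrable[OF Sc continuous_on_subset[OF conth]]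
  have fabs: "?f absolutely_integrable_on (convex hull {a,b,c})"
    using absolutely_integrable_componentwise_iff[where f = ?f] gK(4) by (simp add: Basis_vec_def inner_axis vec_def)
  from ch[of "integral (convex hull {a,b,c}) ?f"] fabs
  have habs: "(\<lambda>x. \<bar>det (matrix l)\<bar> *\<^sub>R ?f (a + l x)) absolutely_integrable_on S"
    and heq: "integral S (\<lambda>x. \<bar>det (matrix l)\<bar> *\<^sub>R ?f (a + l x)) = integral (convex hull {a,b,c}) ?f"
    unfolding img by auto
  have "integral S (\<lambda>x. \<bar>det (matrix l)\<bar> *\<^sub>R ?f (a + l x)) $ 1 = integral S (\<lambda>x. (\<bar>det (matrix l)\<bar> *\<^sub>R ?f (a + l x)) $ 1)"
    using integral_component_eq_cart[where f = "\<lambda>x. \<bar>det (matrix l)\<bar> *\<^sub>R ?f (a + l x)" and s = S and k = 1] habs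
    unfolding absolutely_integrable_on_def by (metis (mono_tags))
  moreover have "integral (convex hull {a,b,c}) ?f $ 1 = integral (convex hull {a,b,c}) (\<lambda>x. ?f x $ 1)"
    using integral_component_eq_cart[where f = ?f and s = "convex hull {a,b,c}" and k = 1] fabs
    by (simp add: absolutely_integrable_on_def)
  ultimately have "integral (convex hull {a,b,c}) g = \<bar>area2 a b c\<bar> * integral S h"
    using arg_cong[OF heq, of "\<lambda>v. v $ 1"] by (auto simp: det h_def)
  then have main: "(LINT x|lebesgue_on (convex hull {a,b,c}). g x) / \<bar>area2 a b c\<bar> = (LINT x|lborel. indicator S x * h x)"
    using gK(5) hS(5) hS(3) D by simp
  have hint: "integrable lborel (\<lambda>x. indicator S x * h x)" using hS(2) by simp
  note F = integral_vec2[OF this]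
  have inner: "(LINT s|lborel. indicator S (vector [t,s]) * h (vector [t,s])) =
      indicator {0..1} t * integral {0..1-t} (\<lambda>s. g (a + t *\<^sub>R (b-a) + s *\<^sub>R (c-a)))" for t
  proof (cases "t \<in> {0..1}")
    case True
    have "indicator S (vector [t,s]) * h (vector [t,s]) = indicator {0..1-t} s * g (a + t *\<^sub>R (b-a) + s *\<^sub>R (c-a))" for s
      using True by (auto simp: S_def h_def l_def indicator_def add.assoc)
    moreover have "continuous_on {0..1-t} (\<lambda>s. g (a + t *\<^sub>R (b-a) + s *\<^sub>R (c-a)))"
      by (intro continuous_on_compose2[OF cont] continuous_intros) auto
    from continuous_compact_integrable(3,5)[OF _ this]
    have "(LINT s|lborel. indicator {0..1-t} s * g (a + t *\<^sub>R (b-a) + s *\<^sub>R (c-a)))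
      = integral {0..1-t} (\<lambda>s. g (a + t *\<^sub>R (b-a) + s *\<^sub>R (c-a)))" by simp
    ultimately show ?thesis using True by simp
  next
    case False
    then have "indicator S (vector [t,s]) * h (vector [t,s]) = 0" for s
      by (auto simp: S_def)
    then have "(\<lambda>s. indicator S (vector [t,s]) * h (vector [t,s])) = (\<lambda>s. 0)" by blast
    then show ?thesis using False by simp
  qed
  have "((\<lambda>t. indicator {0..1} t * integral {0..1-t} (\<lambda>s. g (a + t *\<^sub>R (b-a) + s *\<^sub>R (c-a))))
     has_integral (LINT x|lborel. indicator S x * h x)) UNIV"
    using has_integral_integral_lborel[OF F(1)] F(2) by (simp add: inner)
  moreover have "(\<lambda>t. indicator {0..1} t * integral {0..1-t} (\<lambda>s. g (a + t *\<^sub>R (b-a) + s *\<^sub>R (c-a))))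
    = (\<lambda>t. if t \<in> {0..1} then integral {0..1-t} (\<lambda>s. g (a + t *\<^sub>R (b-a) + s *\<^sub>R (c-a))) else 0)"
    by (auto simp: indicator_def)
  ultimately show ?thesis unfolding main by (simp only: has_integral_restrict_UNIV)
qed


section \<open>Gauss and trace identities for continuously differentiable functions on a
  triangle\<close>

definition C1 :: "(point \<Rightarrow> real) \<Rightarrow> (point \<Rightarrow> point) \<Rightarrow> bool"
  where "C1 v G \<longleftrightarrow> (\<forall>x. (v has_derivative (\<lambda>h. G x \<bullet> h)) (at x)) \<and> continuous_on UNIV G"

text \<open>The parameter is normalised, so this is a mean and not an arc length integral; edge
  lengths are brought in by \<open>face_integral_segment\<close> and
  \<open>edge_weight\<close>.\<close>

definition segmean :: "(point \<Rightarrow> real) \<Rightarrow> point \<Rightarrow> point \<Rightarrow> real"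
  where "segmean v a b = integral {0..1} (\<lambda>t. v (linepath a b t))"

lemma C1_cont: "C1 v G \<Longrightarrow> continuous_on UNIV v"
  unfolding C1_def by (meson differentiable_imp_continuous_on differentiable_on_def differentiable_def differentiable_at_imp_differentiable_on)

lemma C1_cont_grad: "C1 v G \<Longrightarrow> continuous_on UNIV G"
  unfolding C1_def by blast

lemma C1_diff: "C1 u G \<Longrightarrow> C1 v H \<Longrightarrow> C1 (\<lambda>x. u x - v x) (\<lambda>x. G x - H x)"
  unfolding C1_def by (auto intro!: continuous_intros derivative_eq_intros simp: inner_diff_left)

lemma C1_mult: "C1 u G \<Longrightarrow> C1 v H \<Longrightarrow> C1 (\<lambda>x. u x * v x) (\<lambda>x. u x *\<^sub>R H x + v x *\<^sub>R G x)"
  using C1_cont[of u G] C1_cont[of v H] unfolding C1_def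
  by (auto intro!: continuous_intros derivative_eq_intros simp: inner_add_left algebra_simps)

lemma C1_affine: "C1 (\<lambda>x. d + g \<bullet> x) (\<lambda>x. g)"
  unfolding C1_def by (auto intro!: continuous_intros derivative_eq_intros)

lemma C1_along:
  assumes "C1 v G"
  shows "((\<lambda>s. v (p + s *\<^sub>R d)) has_vector_derivative (G (p + s *\<^sub>R d) \<bullet> d)) (at s within S)"
proof -
  have "(v has_derivative (\<lambda>h. G (p + s *\<^sub>R d) \<bullet> h)) (at (p + s *\<^sub>R d) within ((\<lambda>s. p + s *\<^sub>R d) ` S))"
    using assms has_derivative_at_withinI unfolding C1_def by blast
  moreover have "((\<lambda>s. p + s *\<^sub>R d) has_vector_derivative d) (at s within S)"
    by (auto intro!: derivative_eq_intros)
  ultimately show ?thesis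
    using vector_derivative_diff_chain_within by (force simp: o_def)
qed

lemma C1_line_integral:
  assumes "C1 v G" "0 \<le> r"
  shows "((\<lambda>s. G (p + s *\<^sub>R d) \<bullet> d) has_integral (v (p + r *\<^sub>R d) - v p)) {0..r}"
  using fundamental_theorem_of_calculus[OF assms(2), of "\<lambda>s. v (p + s *\<^sub>R d)" "\<lambda>s. G (p + s *\<^sub>R d) \<bullet> d"] C1_along[OF assms(1)]
  by simp

lemma continuous_linepath_comp:
  assumes "continuous_on UNIV (v :: 'a::real_normed_vector \<Rightarrow> 'b::topological_space)"
  shows "continuous_on S (\<lambda>t. v (linepath a b t))"
  by (rule continuous_on_compose2[OF assms]) (auto simp: linepath_def intro!: continuous_intros)

lemma segmean_integrable:
  "continuous_on UNIV v \<Longrightarrow> (\<lambda>t. v (linepath a b t)) integrable_on {0..1::real}" for v :: "point \<Rightarrow> real"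
  using continuous_linepath_comp[of v "{0..1}" a b] by (rule integrable_continuous_interval)

lemma segmean_has_integral:
  "continuous_on UNIV v \<Longrightarrow> ((\<lambda>t. v (linepath a b t)) has_integral segmean v a b) {0..1::real}"
  unfolding segmean_def by (rule integrable_integral[OF segmean_integrable])

lemma has_integral_reflect01:
  fixes f :: "real \<Rightarrow> real"
  assumes "(f has_integral I) {0..1}"
  shows "((\<lambda>t. f (1 - t)) has_integral I) {0..1}"
proof -
  have "((\<lambda>x. f ((-1) *\<^sub>R x + 1)) has_integral (1 / (\<bar>-1\<bar> ^ DIM(real))) *\<^sub>R I) ((\<lambda>x. (1 / (-1)) *\<^sub>R x + - ((1 / (-1)) *\<^sub>R 1)) ` cbox 0 1)"
    using assms by (intro has_integral_affinity) auto
  moreover have "(\<lambda>x. (1 / (-1)) *\<^sub>R x + - ((1 / (-1)) *\<^sub>R 1)) ` cbox 0 1 = {0..1::real}"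
    by (auto simp: image_iff intro!: bexI[of _ "1 - _"])
  ultimately show ?thesis by simp
qed

lemma segmean_swap:
  assumes "continuous_on UNIV v"
  shows "segmean v a b = segmean v b a"
proof -
  have "((\<lambda>t. v (linepath a b (1 - t))) has_integral segmean v a b) {0..1}"
    by (rule has_integral_reflect01[OF segmean_has_integral[OF assms]])
  moreover have "linepath a b (1 - t) = linepath b a t" for t
    by (simp add: linepath_def algebra_simps)
  ultimately show ?thesis by (simp add: segmean_def integral_unique)
qed

lemma abs_area2_perm:
  "\<bar>area2 a c b\<bar> = \<bar>area2 a b c\<bar>" "\<bar>area2 b a c\<bar> = \<bar>area2 a b c\<bar>" "\<bar>area2 b c a\<bar> = \<bar>area2 a b c\<bar>"
  "\<bar>area2 c a b\<bar> = \<bar>area2 a b c\<bar>" "\<bar>area2 c b a\<bar> = \<bar>area2 a b c\<bar>"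
proof -
  have "area2 a c b = - area2 a b c" "area2 b a c = - area2 a b c" "area2 b c a = area2 a b c"
    "area2 c a b = area2 a b c" "area2 c b a = - area2 a b c"
    by (auto simp: area2_def algebra_simps)
  then show "\<bar>area2 a c b\<bar> = \<bar>area2 a b c\<bar>" "\<bar>area2 b a c\<bar> = \<bar>area2 a b c\<bar>" "\<bar>area2 b c a\<bar> = \<bar>area2 a b c\<bar>"
  "\<bar>area2 c a b\<bar> = \<bar>area2 a b c\<bar>" "\<bar>area2 c b a\<bar> = \<bar>area2 a b c\<bar>" by auto
qed

text \<open>Gauss theorem for a constant direction parallel to one side: the fundamental theorem
  evaluates the inner integral of \<open>triangle_slice\<close>, and the end points of the lines
  trace out the other two sides.\<close>

lemma triangle_gauss:
  assumes "C1 v G" "area2 a b c \<noteq> 0"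
  shows "(LINT x|lebesgue_on (convex hull {a,b,c}). G x \<bullet> (c - a))
    = \<bar>area2 a b c\<bar> * (segmean v b c - segmean v a b)"
proof -
  have contG: "continuous_on UNIV (\<lambda>x. G x \<bullet> (c - a))"
    by (intro continuous_intros C1_cont_grad[OF assms(1)])
  have cv: "continuous_on UNIV v" by (rule C1_cont[OF assms(1)])
  have inner: "integral {0..1-t} (\<lambda>s. G (a + t *\<^sub>R (b-a) + s *\<^sub>R (c-a)) \<bullet> (c - a)) = v (linepath c b t) - v (linepath a b t)"
    if "t \<in> {0..1}" for t
  proof -
    have "integral {0..1-t} (\<lambda>s. G (a + t *\<^sub>R (b-a) + s *\<^sub>R (c-a)) \<bullet> (c - a))
      = v (a + t *\<^sub>R (b-a) + (1-t) *\<^sub>R (c-a)) - v (a + t *\<^sub>R (b-a))"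
      using C1_line_integral[OF assms(1), of "1-t" "a + t *\<^sub>R (b-a)" "c-a"] that by (auto intro: integral_unique)
    moreover have "a + t *\<^sub>R (b-a) + (1-t) *\<^sub>R (c-a) = linepath c b t" "a + t *\<^sub>R (b-a) = linepath a b t"
      by (simp_all add: linepath_def algebra_simps)
    ultimately show ?thesis by metis
  qed
  have "((\<lambda>t. v (linepath c b t) - v (linepath a b t)) has_integral
     (LINT x|lebesgue_on (convex hull {a,b,c}). G x \<bullet> (c - a)) / \<bar>area2 a b c\<bar>) {0..1}"
    using triangle_slice[OF contG assms(2)] inner by (subst has_integral_cong[symmetric]) auto
  moreover have "((\<lambda>t. v (linepath c b t) - v (linepath a b t)) has_integral (segmean v c b - segmean v a b)) {0..1}"
    by (intro has_integral_diff segmean_has_integral cv)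
  ultimately have "(LINT x|lebesgue_on (convex hull {a,b,c}). G x \<bullet> (c - a)) / \<bar>area2 a b c\<bar> = segmean v c b - segmean v a b"
    by (rule has_integral_unique)
  then show ?thesis using assms(2) segmean_swap[OF cv, of c b] by (simp add: field_simps)
qed

text \<open>Divergence theorem for the field \<open>v x *\<^sub>R (x - a)\<close>, whose normal
  component vanishes on both sides through \<open>a\<close>. The field is split along the two edge
  vectors with the barycentric coordinates \<open>lb\<close> and \<open>lc\<close> as weights, and
  each part falls under \<open>triangle_gauss\<close>.\<close>

lemma triangle_trace_identity:
  assumes "C1 v G" and D: "area2 a b c \<noteq> 0"
  shows "(LINT x|lebesgue_on (convex hull {a,b,c}). 2 * v x + G x \<bullet> (x - a)) = \<bar>area2 a b c\<bar> * segmean v b c"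
proof -
  let ?K = "convex hull {a,b,c}" and ?D = "area2 a b c"
  \<comment> \<open>Gradients of the barycentric coordinates of \<open>b\<close> and
    \<open>c\<close>: the basis dual to the two edge vectors at \<open>a\<close>.\<close>
  define gb :: point where "gb = (1/?D) *\<^sub>R vector [(c-a)$2, - (c-a)$1]"
  define gc :: point where "gc = (1/?D) *\<^sub>R vector [- (b-a)$2, (b-a)$1]"
  define lb where "lb = (\<lambda>x. - (gb \<bullet> a) + gb \<bullet> x)"
  define lc where "lc = (\<lambda>x. - (gc \<bullet> a) + gc \<bullet> x)"
  have in2: "u \<bullet> w = u$1 * w$1 + u$2 * w$2" for u w :: point by (simp add: inner_vec_def sum_2)
  have Db: "gb \<bullet> (b - a) = 1" "gb \<bullet> (c - a) = 0" "gc \<bullet> (b - a) = 0" "gc \<bullet> (c - a) = 1"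
  proof -
    have "gb \<bullet> w = (w$1 * (c-a)$2 - w$2 * (c-a)$1) / ?D" "gc \<bullet> w = ((b-a)$1 * w$2 - (b-a)$2 * w$1) / ?D" for w
      by (auto simp: gb_def gc_def in2 algebra_simps diff_divide_distrib add_divide_distrib)
    moreover have "((b-a)$1 * (c-a)$2 - (b-a)$2 * (c-a)$1) / ?D = 1"
      using D unfolding area2_def[of a b c, symmetric] by simp
    ultimately show "gb \<bullet> (b - a) = 1" "gb \<bullet> (c - a) = 0" "gc \<bullet> (b - a) = 0" "gc \<bullet> (c - a) = 1"
      by (simp_all add: mult.commute del: vector_minus_component)
  qed
  have vals: "lb a = 0" "lb b = 1" "lb c = 0" "lc a = 0" "lc b = 0" "lc c = 1"
    using Db by (auto simp: lb_def lc_def inner_diff_right)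
  have lin: "lb (linepath p q t) = (1-t) * lb p + t * lb q" "lc (linepath p q t) = (1-t) * lc p + t * lc q" for p q t
    by (auto simp: lb_def lc_def linepath_def inner_add_right algebra_simps)
  have cb: "C1 lb (\<lambda>x. gb)" and cc: "C1 lc (\<lambda>x. gc)" unfolding lb_def lc_def by (rule C1_affine)+
  have dec: "x - a = lb x *\<^sub>R (b - a) + lc x *\<^sub>R (c - a)" for x
  proof -
    have alg: "X1 = (X1 * C2 - X2 * C1) / d * B1 + (B1 * X2 - B2 * X1) / d * C1"
      "X2 = (X1 * C2 - X2 * C1) / d * B2 + (B1 * X2 - B2 * X1) / d * C2"
      if "d \<noteq> 0" "d = B1 * C2 - B2 * C1" for d X1 X2 B1 B2 C1 C2 :: real
      using that by (simp add: divide_simps, simp add: algebra_simps)+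
    have "lb x = ((x-a)$1 * (c-a)$2 - (x-a)$2 * (c-a)$1) / ?D" "lc x = ((b-a)$1 * (x-a)$2 - (b-a)$2 * (x-a)$1) / ?D"
      by (auto simp: lb_def lc_def gb_def gc_def in2 algebra_simps diff_divide_distrib add_divide_distrib)
    then show ?thesis
      using alg(1)[OF D area2_def[of a b c], of "(x-a)$1" "(x-a)$2"]
        alg(2)[OF D area2_def[of a b c], of "(x-a)$2" "(x-a)$1"] by (simp add: vec_eq_iff forall_2)
  qed
  let ?u = "\<lambda>x. v x * lb x" and ?Gu = "\<lambda>x. v x *\<^sub>R gb + lb x *\<^sub>R G x"
  let ?w = "\<lambda>x. v x * lc x" and ?Gw = "\<lambda>x. v x *\<^sub>R gc + lc x *\<^sub>R G x"
  have u: "C1 ?u ?Gu" and w: "C1 ?w ?Gw" using C1_mult[OF assms(1) cb] C1_mult[OF assms(1) cc] by auto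
  have E1: "(LINT x|lebesgue_on ?K. ?Gu x \<bullet> (b - a)) = \<bar>?D\<bar> * (segmean ?u c b - segmean ?u a c)"
    using triangle_gauss[OF u, of a c b] D abs_area2_perm(1)[of a c b] by (auto simp: insert_commute)
  have E2: "(LINT x|lebesgue_on ?K. ?Gw x \<bullet> (c - a)) = \<bar>?D\<bar> * (segmean ?w b c - segmean ?w a b)"
    by (rule triangle_gauss[OF w D])
  have z: "segmean ?u a c = 0" "segmean ?w a b = 0" by (simp_all add: segmean_def lin vals)
  have cu: "continuous_on UNIV ?u" and cw: "continuous_on UNIV ?w" using u w C1_cont by auto
  \<comment> \<open>On the side opposite to \<open>a\<close> the two coordinates add up to one, so
    the weighted means combine to the mean of \<open>v\<close>.\<close>
  have "((\<lambda>t. ?u (linepath b c t) + ?w (linepath b c t)) has_integral (segmean ?u b c + segmean ?w b c)) {0..1}"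
    by (intro has_integral_add segmean_has_integral cu cw)
  moreover have "(\<lambda>t. ?u (linepath b c t) + ?w (linepath b c t)) = (\<lambda>t. v (linepath b c t))"
    by (auto simp: lin vals algebra_simps)
  ultimately have s: "segmean ?u b c + segmean ?w b c = segmean v b c" unfolding segmean_def by (simp add: integral_unique)
  note intg = continuous_compact_integrable(1)[OF compact_triangle continuous_on_subset[OF _ subset_UNIV]]
  have "(LINT x|lebesgue_on ?K. 2 * v x + G x \<bullet> (x - a)) = (LINT x|lebesgue_on ?K. ?Gu x \<bullet> (b - a) + ?Gw x \<bullet> (c - a))"
  proof (intro Bochner_Integration.integral_cong refl)
    fix x
    have "?Gu x \<bullet> (b - a) + ?Gw x \<bullet> (c - a) = 2 * v x + G x \<bullet> (lb x *\<^sub>R (b - a) + lc x *\<^sub>R (c - a))"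
      by (simp add: inner_add_left inner_add_right Db)
    then show "2 * v x + G x \<bullet> (x - a) = ?Gu x \<bullet> (b - a) + ?Gw x \<bullet> (c - a)" using dec[of x] by simp
  qed
  also have "\<dots> = (LINT x|lebesgue_on ?K. ?Gu x \<bullet> (b - a)) + (LINT x|lebesgue_on ?K. ?Gw x \<bullet> (c - a))"
    by (intro Bochner_Integration.integral_add intg continuous_intros C1_cont_grad[OF u] C1_cont_grad[OF w])
  also have "\<dots> = \<bar>?D\<bar> * segmean v b c"
    unfolding E1 E2 z segmean_swap[OF cu, of c b] s[symmetric] by (simp add: algebra_simps)
  finally show ?thesis .
qed

text \<open>Integrate \<open>(f - m)^2\<close> with \<open>m\<close> the integral of
  \<open>f\<close>; on an interval of length at most one no constant is lost.\<close>

lemma integral_CS: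
  fixes f :: "real \<Rightarrow> real"
  assumes "continuous_on {0..r} f" "0 \<le> r" "r \<le> 1"
  shows "(integral {0..r} f)\<^sup>2 \<le> integral {0..r} (\<lambda>x. (f x)\<^sup>2)"
proof -
  define m where "m = integral {0..r} f"
  have f: "(f has_integral m) {0..r}" unfolding m_def
    by (intro integrable_integral integrable_continuous_interval assms)
  have f2: "((\<lambda>x. (f x)\<^sup>2) has_integral integral {0..r} (\<lambda>x. (f x)\<^sup>2)) {0..r}"
    by (intro integrable_integral integrable_continuous_interval continuous_intros assms)
  have "((\<lambda>x. (f x)\<^sup>2 - 2 * m * f x + m\<^sup>2) has_integral (integral {0..r} (\<lambda>x. (f x)\<^sup>2) - 2 * m * m + r * m\<^sup>2)) {0..r}"
    using has_integral_const_real[of "m\<^sup>2" 0 r] assms(2)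
    by (intro has_integral_add has_integral_diff f2 has_integral_mult_right f) auto
  then have "0 \<le> integral {0..r} (\<lambda>x. (f x)\<^sup>2) - 2 * m * m + r * m\<^sup>2"
    by (rule has_integral_nonneg) (metis power2_diff zero_le_power2 mult.commute mult.assoc add.commute diff_add_eq)
  moreover have "r * m\<^sup>2 \<le> m\<^sup>2" using assms by (simp add: mult_left_le_one_le)
  ultimately show ?thesis by (simp add: m_def power2_eq_square)
qed

text \<open>Two points of the edge are joined inside the triangle by a path with one leg parallel to
  \<open>a - b\<close> and one parallel to \<open>a - c\<close>. The fundamental theorem and
  Cauchy-Schwarz bound the difference of values by line integrals, and integrating these over the
  edge gives integrals over the triangle.\<close>

lemma triangle_trace_mean:
  assumes C: "C1 v G" and D: "area2 a b c \<noteq> 0"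
  shows "segmean (\<lambda>x. (v x - segmean v b c)\<^sup>2) b c
    \<le> 4 / \<bar>area2 a b c\<bar> * ((LINT x|lebesgue_on (convex hull {a,b,c}). (G x \<bullet> (a - b))\<^sup>2)
        + (LINT x|lebesgue_on (convex hull {a,b,c}). (G x \<bullet> (a - c))\<^sup>2))"
proof -
  let ?K = "convex hull {a,b,c}"
  define X1 where "X1 = (LINT x|lebesgue_on ?K. (G x \<bullet> (a - b))\<^sup>2)"
  define X2 where "X2 = (LINT x|lebesgue_on ?K. (G x \<bullet> (a - c))\<^sup>2)"
  define p where "p = (\<lambda>t. v (linepath b c t))"
  \<comment> \<open>\<open>I1\<close> follows the leg parallel to \<open>a - b\<close>.
    \<open>I2\<close> follows the leg parallel to \<open>a - c\<close> and runs through the edge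
    backwards, which explains the arguments \<open>1 - t\<close> below.\<close>
  define I1 where "I1 = (\<lambda>t. integral {0..1-t} (\<lambda>s. (G (b + t *\<^sub>R (c-b) + s *\<^sub>R (a-b)) \<bullet> (a-b))\<^sup>2))"
  define I2 where "I2 = (\<lambda>t. integral {0..1-t} (\<lambda>s. (G (c + t *\<^sub>R (b-c) + s *\<^sub>R (a-c)) \<bullet> (a-c))\<^sup>2))"
  have cG: "continuous_on UNIV G" by (rule C1_cont_grad[OF C])
  have cv: "continuous_on UNIV v" by (rule C1_cont[OF C])
  have D1: "area2 b c a \<noteq> 0" "area2 c b a \<noteq> 0" using D abs_area2_perm[of a b c] by auto
  have H1: "(I1 has_integral X1 / \<bar>area2 a b c\<bar>) {0..1}"
    using triangle_slice[of "\<lambda>x. (G x \<bullet> (a - b))\<^sup>2" b c a] D1 cG abs_area2_perm(3)[of b c a]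
    by (simp add: I1_def X1_def insert_commute continuous_intros)
  have H2: "(I2 has_integral X2 / \<bar>area2 a b c\<bar>) {0..1}"
    using triangle_slice[of "\<lambda>x. (G x \<bullet> (a - c))\<^sup>2" c b a] D1 cG abs_area2_perm(5)[of c b a]
    by (simp add: I2_def X2_def insert_commute continuous_intros)
  have contl: "continuous_on S (\<lambda>s. G (q + s *\<^sub>R d) \<bullet> d)" for q d S
    by (intro continuous_intros continuous_on_compose2[OF cG]) auto
  have bound: "(v (q + r *\<^sub>R d) - v q)\<^sup>2 \<le> integral {0..R} (\<lambda>s. (G (q + s *\<^sub>R d) \<bullet> d)\<^sup>2)"
    if "0 \<le> r" "r \<le> R" "R \<le> 1" for q d r R
  proof -
    have "(v (q + r *\<^sub>R d) - v q)\<^sup>2 = (integral {0..r} (\<lambda>s. G (q + s *\<^sub>R d) \<bullet> d))\<^sup>2"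
      using C1_line_integral[OF C that(1), of q d] by (simp add: integral_unique)
    also have "\<dots> \<le> integral {0..r} (\<lambda>s. (G (q + s *\<^sub>R d) \<bullet> d)\<^sup>2)"
      using that by (intro integral_CS contl) auto
    also have "\<dots> \<le> integral {0..R} (\<lambda>s. (G (q + s *\<^sub>R d) \<bullet> d)\<^sup>2)"
      using that by (intro integral_subset_le integrable_continuous_interval continuous_intros contl) auto
    finally show ?thesis .
  qed
  have nn: "0 \<le> I1 t" "0 \<le> I2 t" if "t \<in> {0..1}" for t
    unfolding I1_def I2_def
    by (intro integral_nonneg integrable_continuous_interval continuous_intros contl; simp)+
  have key0: "(p t' - p t)\<^sup>2 \<le> 2 * I1 t + 2 * I2 (1 - t')" if "0 \<le> t" "t \<le> t'" "t' \<le> 1" for t t'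
  proof -
    \<comment> \<open>The corner of the path, written from both of its ends; the ordering of
      \<open>t\<close> and \<open>t'\<close> keeps it inside the triangle.\<close>
    define q where "q = b + t *\<^sub>R (c-b) + (t'-t) *\<^sub>R (a-b)"
    have q2: "q = c + (1-t') *\<^sub>R (b-c) + (t'-t) *\<^sub>R (a-c)"
      by (simp add: q_def algebra_simps)
    have pt: "p t = v (b + t *\<^sub>R (c-b))" "p t' = v (c + (1-t') *\<^sub>R (b-c))"
      by (simp_all add: p_def linepath_def algebra_simps)
    have "(v q - p t)\<^sup>2 \<le> I1 t"
      unfolding I1_def pt q_def using that by (intro bound) auto
    moreover have "(v q - p t')\<^sup>2 \<le> I2 (1 - t')"
      unfolding I2_def pt q2 using that by (intro bound) auto
    moreover have "(p t' - p t)\<^sup>2 \<le> 2 * (v q - p t)\<^sup>2 + 2 * (v q - p t')\<^sup>2"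
      using zero_le_power2[of "(v q - p t) + (v q - p t')"] by (simp add: power2_eq_square algebra_simps)
    ultimately show ?thesis by linarith
  qed
  define H where "H = (\<lambda>t. I1 t + I2 (1 - t))"
  define J where "J = X1 / \<bar>area2 a b c\<bar> + X2 / \<bar>area2 a b c\<bar>"
  have HH: "(H has_integral J) {0..1}"
    unfolding H_def J_def by (intro has_integral_add H1 has_integral_reflect01 H2)
  have key: "(p t - p t')\<^sup>2 \<le> 2 * H t + 2 * H t'" if "t \<in> {0..1}" "t' \<in> {0..1}" for t t'
  proof (cases "t \<le> t'")
    case True
    then show ?thesis using key0[of t t'] nn[of t] nn[of "t'"] nn[of "1-t"] nn[of "1-t'"] that
      by (auto simp: H_def power2_commute)
  next
    case False
    then show ?thesis using key0[of t' t] nn[of t] nn[of "t'"] nn[of "1-t"] nn[of "1-t'"] that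
      by (auto simp: H_def)
  qed
  define m where "m = segmean v b c"
  have cp: "continuous_on S p" for S unfolding p_def by (rule continuous_linepath_comp[OF cv])
  have pm: "(p has_integral m) {0..1}" unfolding p_def m_def by (rule segmean_has_integral[OF cv])
  \<comment> \<open>Averaging over the second edge point replaces its value by the mean; a second
    average over the first point follows.\<close>
  have jen: "(p t - m)\<^sup>2 \<le> 2 * H t + 2 * J" if t: "t \<in> {0..1}" for t
  proof -
    have i: "((\<lambda>t'. p t - p t') has_integral (p t - m)) {0..1}"
      using has_integral_diff[OF has_integral_const_real[of "p t" 0 1] pm] by simp
    have "(p t - m)\<^sup>2 = (integral {0..1} (\<lambda>t'. p t - p t'))\<^sup>2" using i by (simp add: integral_unique)
    also have "\<dots> \<le> integral {0..1} (\<lambda>t'. (p t - p t')\<^sup>2)"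
      by (intro integral_CS continuous_intros cp) auto
    also have "\<dots> \<le> 2 * H t + 2 * J"
    proof (rule has_integral_le)
      show "((\<lambda>t'. (p t - p t')\<^sup>2) has_integral integral {0..1} (\<lambda>t'. (p t - p t')\<^sup>2)) {0..1}"
        by (intro integrable_integral integrable_continuous_interval continuous_intros cp)
      show "((\<lambda>t'. 2 * H t + 2 * H t') has_integral 2 * H t + 2 * J) {0..1}"
        using has_integral_add[OF has_integral_const_real[of "2 * H t" 0 1] has_integral_mult_right[OF HH, of 2]] by simp
    qed (use key t in auto)
    finally show ?thesis .
  qed
  have "integral {0..1} (\<lambda>t. (p t - m)\<^sup>2) \<le> 2 * J + 2 * J"
  proof (rule has_integral_le)
    show "((\<lambda>t. (p t - m)\<^sup>2) has_integral integral {0..1} (\<lambda>t. (p t - m)\<^sup>2)) {0..1}"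
      by (intro integrable_integral integrable_continuous_interval continuous_intros cp)
    show "((\<lambda>t. 2 * H t + 2 * J) has_integral 2 * J + 2 * J) {0..1}"
      using has_integral_add[OF has_integral_mult_right[OF HH, of 2] has_integral_const_real[of "2 * J" 0 1]] by simp
  qed (use jen in auto)
  then show ?thesis unfolding segmean_def p_def m_def J_def X1_def X2_def
    by (simp add: distrib_left add_divide_distrib)
qed

section \<open>Square-integrable functions\<close>

lemma restrict_integral:
  fixes f :: "'a::euclidean_space \<Rightarrow> real"
  assumes "S \<in> sets lebesgue"
  shows "integrable (lebesgue_on S) f \<longleftrightarrow> integrable lebesgue (\<lambda>x. indicator S x * f x)"
    and "(LINT x|lebesgue_on S. f x) = (LINT x|lebesgue. indicator S x * f x)"
  using assms by (simp_all add: integrable_restrict_space integral_restrict_space)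

lemma integrable_on_subset:
  fixes f :: "'a::euclidean_space \<Rightarrow> real"
  assumes "integrable (lebesgue_on S) f" "S \<in> sets lebesgue" "T \<in> sets lebesgue" "T \<subseteq> S"
  shows "integrable (lebesgue_on T) f"
proof -
  have "set_integrable lebesgue S f" using assms by (simp add: restrict_integral set_integrable_def)
  then have "set_integrable lebesgue T f" by (rule set_integrable_subset) (use assms in auto)
  then show ?thesis using assms by (simp add: restrict_integral set_integrable_def)
qed

lemma integral_on_subset_le:
  fixes f :: "'a::euclidean_space \<Rightarrow> real"
  assumes "integrable (lebesgue_on S) f" "S \<in> sets lebesgue" "T \<in> sets lebesgue" "T \<subseteq> S" "\<And>x. 0 \<le> f x"
  shows "(LINT x|lebesgue_on T. f x) \<le> (LINT x|lebesgue_on S. f x)"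
  unfolding restrict_integral(2)[OF assms(2)] restrict_integral(2)[OF assms(3)]
  using assms integrable_on_subset[OF assms(1-4)]
  by (intro integral_mono) (auto simp: restrict_integral indicator_def)

lemma L2_measurable: "f \<in> L2 S \<Longrightarrow> f \<in> borel_measurable (lebesgue_on S)"
  and L2_sq_integrable: "f \<in> L2 S \<Longrightarrow> integrable (lebesgue_on S) (\<lambda>x. (norm (f x))\<^sup>2)"
  by (auto simp: L2_def)

lemma L2norm_sq: "(L2norm S f)\<^sup>2 = (LINT x|lebesgue_on S. (norm (f x))\<^sup>2)"
  by (simp add: L2norm_def)

lemma L2norm_nonneg [simp]: "0 \<le> L2norm S f"
  by (simp add: L2norm_def)

lemma norm_add_sq: "(norm (a + b))\<^sup>2 \<le> 2 * (norm a)\<^sup>2 + 2 * (norm b)\<^sup>2" for a b :: "'a::real_normed_vector"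
proof -
  have "(norm (a + b))\<^sup>2 \<le> (norm a + norm b)\<^sup>2" by (intro power_mono norm_triangle_ineq) auto
  also have "\<dots> \<le> 2 * (norm a)\<^sup>2 + 2 * (norm b)\<^sup>2"
    using zero_le_power2[of "norm a - norm b"] by (simp add: power2_eq_square algebra_simps)
  finally show ?thesis .
qed

lemma norm_diff_sq: "(norm (a - b))\<^sup>2 \<le> 2 * (norm a)\<^sup>2 + 2 * (norm b)\<^sup>2" for a b :: "'a::real_normed_vector"
  using norm_add_sq[of a "-b"] by simp

lemma L2_dominated:
  assumes "f \<in> borel_measurable (lebesgue_on S)" "integrable (lebesgue_on S) h" "\<And>x. x \<in> S \<Longrightarrow> (norm (f x))\<^sup>2 \<le> h x"
  shows "f \<in> L2 S"
proof -
  have "integrable (lebesgue_on S) (\<lambda>x. (norm (f x))\<^sup>2)"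
  proof (rule Bochner_Integration.integrable_bound[OF assms(2)])
    show "AE x in lebesgue_on S. norm ((norm (f x))\<^sup>2) \<le> norm (h x)"
      using assms(3) by (intro AE_I2) (simp add: order_trans[OF _ abs_ge_self])
    show "(\<lambda>x. (norm (f x))\<^sup>2) \<in> borel_measurable (lebesgue_on S)"
      by (rule measurable_compose[OF assms(1)]) (intro borel_measurable_continuous_onI continuous_intros)
  qed
  then show ?thesis using assms(1) by (simp add: L2_def)
qed

lemma L2_add:
  assumes "f \<in> L2 S" "g \<in> L2 S"
  shows "(\<lambda>x. f x + g x) \<in> L2 S"
proof (rule L2_dominated)
  show "(\<lambda>x. f x + g x) \<in> borel_measurable (lebesgue_on S)"
    by (rule borel_measurable_add[OF L2_measurable[OF assms(1)] L2_measurable[OF assms(2)]])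
  show "integrable (lebesgue_on S) (\<lambda>x. 2 * (norm (f x))\<^sup>2 + 2 * (norm (g x))\<^sup>2)"
    using L2_sq_integrable[OF assms(1)] L2_sq_integrable[OF assms(2)] by simp
qed (rule norm_add_sq)

lemma L2_diff:
  assumes "f \<in> L2 S" "g \<in> L2 S"
  shows "(\<lambda>x. f x - g x) \<in> L2 S"
proof (rule L2_dominated)
  show "(\<lambda>x. f x - g x) \<in> borel_measurable (lebesgue_on S)"
    by (rule borel_measurable_diff[OF L2_measurable[OF assms(1)] L2_measurable[OF assms(2)]])
  show "integrable (lebesgue_on S) (\<lambda>x. 2 * (norm (f x))\<^sup>2 + 2 * (norm (g x))\<^sup>2)"
    using L2_sq_integrable[OF assms(1)] L2_sq_integrable[OF assms(2)] by simp
qed (rule norm_diff_sq)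

lemma L2_norm: "f \<in> L2 S \<Longrightarrow> (\<lambda>x. norm (f x)) \<in> L2 S"
  by (auto simp: L2_def)

lemma L2_subset:
  assumes "f \<in> L2 S" "S \<in> sets lebesgue" "T \<in> sets lebesgue" "T \<subseteq> S"
  shows "f \<in> L2 T"
  using assms integrable_on_subset[OF L2_sq_integrable[OF assms(1)] assms(2-4)]
    measurable_restrict_mono[OF L2_measurable[OF assms(1)] assms(4)]
  by (simp add: L2_def)

lemma L2norm_subset:
  assumes "f \<in> L2 S" "S \<in> sets lebesgue" "T \<in> sets lebesgue" "T \<subseteq> S"
  shows "L2norm T f \<le> L2norm S f"
  unfolding L2norm_def using integral_on_subset_le[OF L2_sq_integrable[OF assms(1)] assms(2-4)] by simp

lemma L2_mult_integrable:
  fixes f g :: "point \<Rightarrow> real"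
  assumes "f \<in> L2 S" "g \<in> L2 S"
  shows "integrable (lebesgue_on S) (\<lambda>x. f x * g x)"
proof (rule Bochner_Integration.integrable_bound)
  show "integrable (lebesgue_on S) (\<lambda>x. (norm (f x))\<^sup>2 + (norm (g x))\<^sup>2)"
    using assms by (intro Bochner_Integration.integrable_add L2_sq_integrable)
  show "(\<lambda>x. f x * g x) \<in> borel_measurable (lebesgue_on S)"
    using assms L2_measurable by (intro borel_measurable_times) auto
  have "\<bar>a * b\<bar> \<le> a\<^sup>2 + b\<^sup>2" for a b :: real
    using zero_le_power2[of "a - b"] zero_le_power2[of "a + b"] zero_le_power2[of a] zero_le_power2[of b]
    unfolding power2_sum power2_diff by linarith
  then show "AE x in lebesgue_on S. norm (f x * g x) \<le> norm ((norm (f x))\<^sup>2 + (norm (g x))\<^sup>2)"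
    by (intro AE_I2) simp
qed

lemma L2norm_abs_norm: "L2norm S (\<lambda>x. norm (f x)) = L2norm S f"
  by (simp add: L2norm_def)

text \<open>Young's inequality with a free weight \<open>s\<close>, optimised at
  \<open>s = Q / P\<close>. If one of the norms is zero the optimum does not exist, and a suitable
  extreme weight forces the product to vanish.\<close>

lemma L2_CS:
  fixes f g :: "point \<Rightarrow> real"
  assumes f: "f \<in> L2 S" and g: "g \<in> L2 S"
  shows "(LINT x|lebesgue_on S. \<bar>f x * g x\<bar>) \<le> L2norm S f * L2norm S g"
proof -
  define X where "X = (LINT x|lebesgue_on S. \<bar>f x * g x\<bar>)"
  define P where "P = L2norm S f" define Q where "Q = L2norm S g"
  have ineq: "2 * X \<le> s * P\<^sup>2 + Q\<^sup>2 / s" if s: "s > 0" for s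
  proof -
    have "(LINT x|lebesgue_on S. 2 * \<bar>f x * g x\<bar>) \<le> (LINT x|lebesgue_on S. s * (norm (f x))\<^sup>2 + (1/s) * (norm (g x))\<^sup>2)"
    proof (rule integral_mono)
      show "integrable (lebesgue_on S) (\<lambda>x. 2 * \<bar>f x * g x\<bar>)" using L2_mult_integrable[OF f g] by auto
      show "integrable (lebesgue_on S) (\<lambda>x. s * (norm (f x))\<^sup>2 + (1/s) * (norm (g x))\<^sup>2)"
        using f g by (intro Bochner_Integration.integrable_add integrable_mult_right L2_sq_integrable)
      fix x
      have "0 \<le> (s * \<bar>f x\<bar> - \<bar>g x\<bar>)\<^sup>2" by simp
      then have "2 * \<bar>f x\<bar> * \<bar>g x\<bar> * s \<le> (s * (f x)\<^sup>2 + (1/s) * (g x)\<^sup>2) * s"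
        using s by (simp add: power2_eq_square algebra_simps)
      then show "2 * \<bar>f x * g x\<bar> \<le> s * (norm (f x))\<^sup>2 + (1/s) * (norm (g x))\<^sup>2"
        using s by (simp add: abs_mult)
    qed
    also have "\<dots> = s * P\<^sup>2 + Q\<^sup>2 / s"
      using f g by (subst Bochner_Integration.integral_add) (auto simp: P_def Q_def L2norm_sq L2_sq_integrable simp del: real_norm_def)
    finally show ?thesis by (simp add: X_def)
  qed
  have nn: "0 \<le> P" "0 \<le> Q" by (simp_all add: P_def Q_def)
  show ?thesis
  proof (cases "P = 0")
    case True
    have "X \<le> 0"
    proof (rule ccontr)
      assume "\<not> X \<le> 0"
      then have "X > 0" by simp
      \<comment> \<open>With \<open>P = 0\<close> the weight can be chosen freely; this choice makes
        the right-hand side at most \<open>X\<close>.\<close>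
      then have "2 * X \<le> Q\<^sup>2 / ((Q\<^sup>2 + 1) / X)" using ineq[of "(Q\<^sup>2 + 1) / X"] True by (auto simp: add_nonneg_pos)
      also have "\<dots> = X * (Q\<^sup>2 / (Q\<^sup>2 + 1))" by simp
      also have "\<dots> \<le> X * 1" using \<open>X > 0\<close> by (intro mult_left_mono) (auto simp: divide_simps add_nonneg_pos)
      finally show False using \<open>X > 0\<close> by simp
    qed
    then show ?thesis using True by (simp add: X_def P_def)
  next
    case False
    show ?thesis
    proof (cases "Q = 0")
      case True
      have "X \<le> 0"
      proof (rule ccontr)
        assume "\<not> X \<le> 0"
        then have "X > 0" by simp
        have Pp: "P\<^sup>2 > 0" using False by simp
        then have "2 * X \<le> X" using ineq[of "X / P\<^sup>2"] True False \<open>X > 0\<close> by auto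
        then show False using \<open>X > 0\<close> by simp
      qed
      then show ?thesis using True by (simp add: X_def Q_def)
    next
      case Q: False
      then have "2 * X \<le> Q/P * P\<^sup>2 + Q\<^sup>2 / (Q/P)" using ineq[of "Q/P"] False nn by auto
      also have "\<dots> = 2 * (P * Q)" using False Q by (simp add: power2_eq_square)
      finally show ?thesis by (simp add: X_def P_def Q_def)
    qed
  qed
qed

lemma L2_inner_integrable:
  fixes f g :: "point \<Rightarrow> 'a::euclidean_space"
  assumes "f \<in> L2 S" "g \<in> L2 S"
  shows "integrable (lebesgue_on S) (\<lambda>x. f x \<bullet> g x)"
proof (rule Bochner_Integration.integrable_bound)
  show "integrable (lebesgue_on S) (\<lambda>x. norm (f x) * norm (g x))"
    by (intro L2_mult_integrable L2_norm assms)
  show "(\<lambda>x. f x \<bullet> g x) \<in> borel_measurable (lebesgue_on S)"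
    using assms L2_measurable by (intro borel_measurable_inner) auto
qed (auto simp: Cauchy_Schwarz_ineq2 abs_mult)

lemma L2norm_add_sq:
  assumes "f \<in> L2 S" "g \<in> L2 S"
  shows "(L2norm S (\<lambda>x. f x + g x))\<^sup>2 \<le> 2 * (L2norm S f)\<^sup>2 + 2 * (L2norm S g)\<^sup>2"
proof -
  have "(L2norm S (\<lambda>x. f x + g x))\<^sup>2 \<le> (LINT x|lebesgue_on S. 2 * (norm (f x))\<^sup>2 + 2 * (norm (g x))\<^sup>2)"
    unfolding L2norm_sq by (intro integral_mono L2_sq_integrable L2_add Bochner_Integration.integrable_add integrable_mult_right assms norm_add_sq)
  also have "\<dots> = 2 * (L2norm S f)\<^sup>2 + 2 * (L2norm S g)\<^sup>2"
    using assms by (subst Bochner_Integration.integral_add) (auto simp: L2norm_sq L2_sq_integrable)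
  finally show ?thesis .
qed

lemma L2norm_cong_AE:
  assumes "AE x in lebesgue_on S. f x = g x" "f \<in> borel_measurable (lebesgue_on S)" "g \<in> borel_measurable (lebesgue_on S)"
  shows "L2norm S f = L2norm S g"
proof -
  have "(LINT x|lebesgue_on S. (norm (f x))\<^sup>2) = (LINT x|lebesgue_on S. (norm (g x))\<^sup>2)"
    by (rule integral_cong_AE) (use assms in auto)
  then show ?thesis by (simp add: L2norm_def)
qed

lemma L2_cong_AE:
  assumes "AE x in lebesgue_on S. f x = g x" "f \<in> L2 S" "g \<in> borel_measurable (lebesgue_on S)"
  shows "g \<in> L2 S"
proof -
  have "integrable (lebesgue_on S) (\<lambda>x. (norm (g x))\<^sup>2) \<longleftrightarrow> integrable (lebesgue_on S) (\<lambda>x. (norm (f x))\<^sup>2)"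
    by (rule integrable_cong_AE) (use assms in \<open>auto dest: L2_measurable\<close>)
  then show ?thesis using assms by (auto simp: L2_def)
qed

lemma vec_borel_measurable:
  fixes f :: "'b \<Rightarrow> 'a::euclidean_space ^ 'n"
  shows "f \<in> borel_measurable M \<longleftrightarrow> (\<forall>i. (\<lambda>x. f x $ i) \<in> borel_measurable M)"
proof
  assume "f \<in> borel_measurable M"
  then show "\<forall>i. (\<lambda>x. f x $ i) \<in> borel_measurable M"
    by (auto intro: borel_measurable_continuous_on[OF continuous_on_component[OF continuous_on_id]])
next
  assume *: "\<forall>i. (\<lambda>x. f x $ i) \<in> borel_measurable M"
  show "f \<in> borel_measurable M"
  proof (subst borel_measurable_euclidean_space, intro ballI)
    fix b :: "'a^'n" assume "b \<in> Basis"
    then obtain i u where "b = axis i u" "u \<in> Basis" by (auto simp: Basis_vec_def)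
    then have "(\<lambda>x. f x \<bullet> b) = (\<lambda>x. f x $ i \<bullet> u)" by (auto simp: inner_axis)
    moreover have "(\<lambda>x. f x $ i \<bullet> u) \<in> borel_measurable M"
      using * by (intro borel_measurable_inner) auto
    ultimately show "(\<lambda>x. f x \<bullet> b) \<in> borel_measurable M" by simp
  qed
qed

lemma norm_vec_sq: "(norm x)\<^sup>2 = (\<Sum>i\<in>UNIV. (norm (x $ i))\<^sup>2)" for x :: "'a::real_normed_vector ^ 'n"
  by (simp add: norm_vec_def L2_set_def sum_nonneg)

lemma L2_vec:
  fixes f :: "point \<Rightarrow> 'a::euclidean_space ^ 'n"
  shows "f \<in> L2 S \<longleftrightarrow> (\<forall>i. (\<lambda>x. f x $ i) \<in> L2 S)"
proof
  assume f: "f \<in> L2 S"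
  show "\<forall>i. (\<lambda>x. f x $ i) \<in> L2 S"
  proof
    fix i show "(\<lambda>x. f x $ i) \<in> L2 S"
    by (rule L2_dominated[OF _ L2_sq_integrable[OF f]])
       (use f L2_measurable[OF f] in \<open>auto simp: vec_borel_measurable intro!: power_mono Finite_Cartesian_Product.norm_nth_le\<close>)
  qed
next
  assume *: "\<forall>i. (\<lambda>x. f x $ i) \<in> L2 S"
  show "f \<in> L2 S"
    by (rule L2_dominated[where h = "\<lambda>x. \<Sum>i\<in>UNIV. (norm (f x $ i))\<^sup>2"])
       (use * in \<open>auto simp: norm_vec_sq vec_borel_measurable L2_measurable L2_sq_integrable\<close>)
qed

lemma L2norm_vec_sq:
  fixes f :: "point \<Rightarrow> 'a::euclidean_space ^ 'n"
  assumes "f \<in> L2 S"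
  shows "(L2norm S f)\<^sup>2 = (\<Sum>i\<in>UNIV. (L2norm S (\<lambda>x. f x $ i))\<^sup>2)"
  using assms by (simp add: L2norm_sq norm_vec_sq L2_vec L2_sq_integrable)

lemma continuous_bounded_integrable:
  fixes h :: "point \<Rightarrow> real"
  assumes "continuous_on UNIV h" "bounded S" "S \<in> sets lebesgue"
  shows "integrable (lebesgue_on S) h"
proof -
  obtain a where a: "S \<subseteq> cbox (-a) a" using bounded_subset_cbox_symmetric[OF assms(2)] by blast
  have i: "integrable (lebesgue_on (cbox (-a) a)) h"
    by (rule continuous_compact_integrable(1)[OF compact_cbox continuous_on_subset[OF assms(1) subset_UNIV]])
  have "cbox (-a) a \<in> sets lebesgue" by (intro lmeasurable_cbox fmeasurableD)
  from integrable_on_subset[OF i this assms(3) a] show ?thesis .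
qed

lemma continuous_bounded_L2:
  fixes h :: "point \<Rightarrow> 'a::euclidean_space"
  assumes "continuous_on UNIV h" "bounded S" "S \<in> sets lebesgue"
  shows "h \<in> L2 S"
proof -
  have "h \<in> borel_measurable (lebesgue_on S)"
    by (rule continuous_imp_measurable_on_sets_lebesgue[OF continuous_on_subset[OF assms(1)] assms(3)]) auto
  moreover have "integrable (lebesgue_on S) (\<lambda>x. (norm (h x))\<^sup>2)"
    by (intro continuous_bounded_integrable assms continuous_intros)
  ultimately show ?thesis by (simp add: L2_def)
qed

section \<open>Smooth functions\<close>

text \<open>For \<open>n = 0\<close> the classical function exp(-1/u) extended by zero. The powers
  of 1/u are what differentiation produces, so the family is closed under derivatives up to linear
  combinations.\<close>

definition flat :: "nat \<Rightarrow> real \<Rightarrow> real"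
  where "flat n u = (if u > 0 then exp (- inverse u) * inverse u ^ n else 0)"

lemma flat_tendsto_0: "(flat n \<longlongrightarrow> 0) (at 0)"
proof -
  have "((\<lambda>u. inverse u ^ n / exp (inverse u)) \<longlongrightarrow> (0::real)) (at_right 0)"
    by (rule filterlim_compose[OF tendsto_power_div_exp_0 filterlim_inverse_at_top_right])
  moreover have "\<forall>\<^sub>F u in at_right 0. inverse u ^ n / exp (inverse u) = flat n u"
    by (auto simp: eventually_at_filter flat_def exp_minus field_simps)
  ultimately have "(flat n \<longlongrightarrow> 0) (at_right 0)" by (rule Lim_transform_eventually)
  moreover have "(flat n \<longlongrightarrow> 0) (at_left 0)"
    by (rule Lim_transform_eventually[OF tendsto_const]) (auto simp: eventually_at_filter flat_def)
  ultimately show ?thesis by (simp add: filterlim_split_at)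
qed

text \<open>The critical point is the origin, where the difference quotient of \<open>flat n\<close>
  is \<open>flat (n+1)\<close> and tends to zero.\<close>

lemma flat_deriv: "(flat n has_real_derivative (flat (n+2) u - real n * flat (n+1) u)) (at u)"
proof -
  consider "u > 0" | "u < 0" | "u = 0" by linarith
  then show ?thesis
  proof cases
    case 1
    have "((\<lambda>u. exp (- inverse u) * inverse u ^ n) has_real_derivative (flat (n+2) u - real n * flat (n+1) u)) (at u)"
    proof (cases n)
      case 0
      then show ?thesis using 1
        by (auto intro!: derivative_eq_intros simp: flat_def power2_eq_square)
    next
      case (Suc m)
      have "((\<lambda>u. exp (- inverse u) * inverse u ^ n) has_real_derivative
        (exp (- inverse u) * (inverse u * inverse u)) * inverse u ^ n
          + (real n * inverse u ^ (n - 1) * (- (inverse u * inverse u))) * exp (- inverse u)) (at u)"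
        using 1 by (auto intro!: derivative_eq_intros simp: power2_eq_square)
      then show ?thesis using 1 Suc
        by (simp add: flat_def algebra_simps)
    qed
    moreover have ev: "\<forall>\<^sub>F v in nhds u. flat n v = exp (- inverse v) * inverse v ^ n"
      using eventually_nhds_in_open[of "{0<..}" u] 1 by (auto elim!: eventually_mono simp: flat_def)
    ultimately show ?thesis by (simp only: DERIV_cong_ev[OF refl ev refl])
  next
    case 2
    have ev: "\<forall>\<^sub>F v in nhds u. flat n v = 0"
      using eventually_nhds_in_open[of "{..<0}" u] 2 by (auto elim!: eventually_mono simp: flat_def)
    moreover have "((\<lambda>u. 0) has_real_derivative (flat (n+2) u - real n * flat (n+1) u)) (at u)"
      using 2 by (auto simp: flat_def)
    ultimately show ?thesis by (simp only: DERIV_cong_ev[OF refl ev refl])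
  next
    case 3
    have "((\<lambda>h. (flat n (0 + h) - flat n 0) / h) \<longlongrightarrow> 0) (at 0)"
    proof (rule Lim_transform_eventually[OF flat_tendsto_0[of "n+1"]])
      show "\<forall>\<^sub>F x in at 0. flat (n + 1) x = (flat n (0 + x) - flat n 0) / x"
        by (auto simp: eventually_at_filter flat_def field_simps)
    qed
    then have "(flat n has_real_derivative 0) (at 0)" by (simp add: DERIV_def)
    then show ?thesis using 3 by (simp add: flat_def)
  qed
qed

lemma flat_0_bounds: "0 \<le> flat 0 u" "flat 0 u \<le> 1"
  by (auto simp: flat_def)

text \<open>A class closed under partial derivatives, so that membership alone yields smoothness of
  every order. It covers polynomials as well as all cutoffs built from \<open>flat\<close>.\<close>

inductive elementary :: "(point \<Rightarrow> real) \<Rightarrow> bool" where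
  const: "elementary (\<lambda>x. c)"
| coord: "elementary (\<lambda>x. x $ i)"
| add: "elementary f \<Longrightarrow> elementary g \<Longrightarrow> elementary (\<lambda>x. f x + g x)"
| mult: "elementary f \<Longrightarrow> elementary g \<Longrightarrow> elementary (\<lambda>x. f x * g x)"
| flat: "elementary q \<Longrightarrow> elementary (\<lambda>x. flat n (q x))"

lemma pderiv2_eq:
  assumes "\<And>x. (f has_derivative D x) (at x)"
  shows "pderiv2 i f = (\<lambda>x. D x (axis i 1))"
  using frechet_derivative_at[OF assms] unfolding pderiv2_def fun_eq_iff by metis

lemma has_derivative_pderiv2:
  assumes "f differentiable (at x)"
  shows "(f has_derivative (\<lambda>h. (\<chi> i. pderiv2 i f x) \<bullet> h)) (at x)"
proof -
  let ?D = "frechet_derivative f (at x)"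
  have d: "(f has_derivative ?D) (at x)" using assms by (simp add: frechet_derivative_works)
  then have lin: "linear ?D" by (simp add: has_derivative_linear)
  have "?D h = (\<chi> i. pderiv2 i f x) \<bullet> h" for h
  proof -
    have "h = (\<Sum>i\<in>UNIV. h $ i *\<^sub>R axis i 1)" using basis_expansion[of h] by (simp add: scalar_mult_eq_scaleR)
    then have "?D h = ?D (\<Sum>i\<in>UNIV. h $ i *\<^sub>R axis i 1)" by (rule arg_cong)
    also have "\<dots> = (\<Sum>i\<in>UNIV. h $ i * ?D (axis i 1))" by (simp add: linear_sum[OF lin] linear_cmul[OF lin])
    finally show ?thesis by (simp add: inner_vec_def pderiv2_def mult.commute)
  qed
  then have "?D = (\<lambda>h. (\<chi> i. pderiv2 i f x) \<bullet> h)" by (rule ext)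
  then show ?thesis using d by simp
qed

lemma elementary_pderiv:
  assumes "elementary f"
  shows "(\<forall>x. f differentiable (at x)) \<and> (\<forall>i. elementary (pderiv2 i f))"
  using assms
proof induction
  case (const c)
  have "((\<lambda>x. c) has_derivative (\<lambda>h. 0)) (at x)" for x :: point by simp
  from pderiv2_eq[OF this] this show ?case by (auto intro: elementary.const)
next
  case (coord j)
  have d: "((\<lambda>x. x $ j) has_derivative (\<lambda>h. h $ j)) (at x)" for x :: point
    by (rule bounded_linear_imp_has_derivative) (rule bounded_linear_vec_nth)
  from pderiv2_eq[OF d] d show ?case by (auto simp: differentiable_def intro: elementary.const)
next
  case (add f g)
  then have "(f has_derivative (\<lambda>h. (\<chi> i. pderiv2 i f x) \<bullet> h)) (at x)" "(g has_derivative (\<lambda>h. (\<chi> i. pderiv2 i g x) \<bullet> h)) (at x)" for x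
    using has_derivative_pderiv2 by auto
  then have d: "((\<lambda>x. f x + g x) has_derivative (\<lambda>h. (\<chi> i. pderiv2 i f x) \<bullet> h + (\<chi> i. pderiv2 i g x) \<bullet> h)) (at x)" for x
    by (intro has_derivative_add)
  show ?case using pderiv2_eq[OF d] d add by (auto simp: differentiable_def inner_axis intro: elementary.add)
next
  case (mult f g)
  then have "(f has_derivative (\<lambda>h. (\<chi> i. pderiv2 i f x) \<bullet> h)) (at x)" "(g has_derivative (\<lambda>h. (\<chi> i. pderiv2 i g x) \<bullet> h)) (at x)" for x
    using has_derivative_pderiv2 by auto
  then have d: "((\<lambda>x. f x * g x) has_derivative (\<lambda>h. f x * ((\<chi> i. pderiv2 i g x) \<bullet> h) + ((\<chi> i. pderiv2 i f x) \<bullet> h) * g x)) (at x)" for x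
    by (intro has_derivative_mult)
  show ?case using pderiv2_eq[OF d] d mult by (auto simp: differentiable_def inner_axis intro!: elementary.add elementary.mult)
next
  case (flat q n)
  then have q: "(q has_derivative (\<lambda>h. (\<chi> i. pderiv2 i q x) \<bullet> h)) (at x)" for x
    using has_derivative_pderiv2 by auto
  have d: "((\<lambda>x. flat n (q x)) has_derivative (\<lambda>h. (flat (n+2) (q x) + (- real n) * flat (n+1) (q x)) * ((\<chi> i. pderiv2 i q x) \<bullet> h))) (at x)" for x
    using has_derivative_compose[OF q, of "flat n" "(*) (flat (n+2) (q x) - real n * flat (n+1) (q x))" x] flat_deriv[of n "q x"]
    by (simp add: has_field_derivative_def)
  have "elementary (\<lambda>x. (flat (n+2) (q x) + (- real n) * flat (n+1) (q x)) * pderiv2 i q x)" for i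
    using flat by (intro elementary.intros) auto
  then show ?case using pderiv2_eq[OF d] d by (simp add: differentiable_def inner_axis) blast
qed

lemma elementary_smooth: "elementary f \<Longrightarrow> smooth f"
proof -
  have "\<forall>f. elementary f \<longrightarrow> (\<forall>x. fold pderiv2 is f differentiable (at x))" for "is"
    by (induction "is") (auto simp: elementary_pderiv)
  then show "elementary f \<Longrightarrow> smooth f" unfolding smooth_def by blast
qed

lemma smooth_pderiv: "smooth f \<Longrightarrow> smooth (pderiv2 i f)"
  unfolding smooth_def
proof (intro allI)
  fix "is" x assume *: "\<forall>is x. fold pderiv2 is f differentiable (at x)"
  show "fold pderiv2 is (pderiv2 i f) differentiable at x" using *[rule_format, of "i # is" x] by simp
qed

lemma smooth_C1:
  assumes "smooth f" shows "C1 f (\<lambda>x. \<chi> i. pderiv2 i f x)"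
proof -
  have "f differentiable (at x)" for x using assms unfolding smooth_def by (metis fold_simps(1))
  moreover have "pderiv2 i f differentiable (at x)" for i x
    using smooth_pderiv[OF assms, of i] unfolding smooth_def by (metis fold_simps(1))
  then have "continuous_on UNIV (pderiv2 i f)" for i
    by (meson differentiable_imp_continuous_on differentiable_on_def differentiable_at_imp_differentiable_on)
  moreover have "continuous_on UNIV (\<lambda>x. \<chi> i. pderiv2 i f x)"
    using calculation(2) by (rule continuous_on_vec_lambda)
  ultimately show ?thesis unfolding C1_def using has_derivative_pderiv2 by blast
qed

lemma smooth_continuous: "smooth f \<Longrightarrow> continuous_on UNIV f"
  using smooth_C1 C1_cont by blast

section \<open>Test functions and weak derivatives\<close>

lemma test_functionsD:
  assumes "\<phi> \<in> test_functions \<Omega>"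
  shows "smooth \<phi>" "compact (closure {x. \<phi> x \<noteq> 0})" "closure {x. \<phi> x \<noteq> 0} \<subseteq> \<Omega>"
  using assms by (auto simp: test_functions_def)

lemma test_functions_outside:
  assumes "\<phi> \<in> test_functions \<Omega>" "x \<notin> \<Omega>"
  shows "\<phi> x = 0"
  using test_functionsD(3)[OF assms(1)] assms(2) closure_subset[of "{x. \<phi> x \<noteq> 0}"] by blast

lemma C1_zero_outside:
  assumes "C1 v G" "open U" "\<And>x. x \<in> U \<Longrightarrow> v x = 0" "x \<in> U"
  shows "G x = 0"
proof -
  have "(v has_derivative (\<lambda>h. G x \<bullet> h)) (at x)" using assms(1) by (simp add: C1_def)
  moreover have "(v has_derivative (\<lambda>h. 0)) (at x)"
    by (rule has_derivative_transform_within_open[OF has_derivative_const assms(2,4)]) (simp add: assms(3))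
  ultimately have "(\<lambda>h. G x \<bullet> h) = (\<lambda>h. 0)" by (rule has_derivative_unique)
  then have "G x \<bullet> G x = 0" by (rule fun_cong)
  then show ?thesis by simp
qed

lemma test_functions_pderiv:
  assumes "\<phi> \<in> test_functions \<Omega>"
  shows "pderiv2 i \<phi> \<in> test_functions \<Omega>"
proof -
  note D = test_functionsD[OF assms]
  have z: "pderiv2 i \<phi> x = 0" if "x \<notin> closure {x. \<phi> x \<noteq> 0}" for x
  proof -
    have "(\<chi> i. pderiv2 i \<phi> x) = 0"
    proof (rule C1_zero_outside[OF smooth_C1[OF D(1)]])
      show "open (- closure {x. \<phi> x \<noteq> 0})" by auto
      show "\<phi> y = 0" if "y \<in> - closure {x. \<phi> x \<noteq> 0}" for y
        using that closure_subset[of "{x. \<phi> x \<noteq> 0}"] by auto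
    qed (use that in auto)
    then show ?thesis by (metis vec_lambda_beta zero_index)
  qed
  then have sub: "closure {x. pderiv2 i \<phi> x \<noteq> 0} \<subseteq> closure {x. \<phi> x \<noteq> 0}"
    by (intro closure_minimal) auto
  then have "compact (closure {x. pderiv2 i \<phi> x \<noteq> 0})"
    using D(2) by (meson closed_closure compact_imp_bounded bounded_subset compact_eq_bounded_closed)
  then show ?thesis using sub D smooth_pderiv[OF D(1)] by (auto simp: test_functions_def)
qed

lemma test_functionsI:
  assumes "smooth \<phi>" "closed K" "bounded K" "K \<subseteq> \<Omega>" "\<And>x. \<phi> x \<noteq> 0 \<Longrightarrow> x \<in> K"
  shows "\<phi> \<in> test_functions \<Omega>"
proof -
  have "closure {x. \<phi> x \<noteq> 0} \<subseteq> K" using assms by (intro closure_minimal) auto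
  then show ?thesis using assms
    by (auto simp: test_functions_def compact_eq_bounded_closed intro: bounded_subset)
qed

text \<open>Place the support inside a large triangle: \<open>v\<close> vanishes on all three sides,
  and \<open>triangle_gauss\<close> gives zero in two independent directions.\<close>

lemma compact_support_integral_gradient:
  assumes C: "C1 v G" and R: "\<And>x. v x \<noteq> 0 \<Longrightarrow> norm x < R"
  shows "(LINT x|lborel. G x $ i) = 0"
proof -
  define r where "r = \<bar>R\<bar> + 1"
  have r: "r > 0" "\<And>x. v x \<noteq> 0 \<Longrightarrow> norm x < r" using R by (force simp: r_def)+
  \<comment> \<open>A right triangle with legs of length \<open>4 * r\<close>. It contains the
    square of half-width \<open>r\<close>, and every point of its sides has a coordinate of modulus
    at least \<open>r\<close>.\<close>
  define a :: point where "a = vector [-r, -r]"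
  define b where "b = a + vector [4*r, 0]"
  define c where "c = a + vector [0, 4*r]"
  let ?K = "convex hull {a,b,c}"
  have D: "area2 a b c \<noteq> 0" using r by (simp add: area2_def b_def c_def)
  have cG: "continuous_on UNIV G" by (rule C1_cont_grad[OF C])
  have far: "v x = 0" if "r \<le> \<bar>x $ j\<bar>" for x j
    using r(2)[of x] component_le_norm_cart[of x j] that by fastforce
  have Gz: "G x = 0" if "x \<notin> ?K" for x
  proof -
    have "\<exists>j. r < \<bar>x $ j\<bar>"
    proof (rule ccontr)
      assume "\<nexists>j. r < \<bar>x $ j\<bar>"
      then have le: "\<bar>x $ 1\<bar> \<le> r" "\<bar>x $ 2\<bar> \<le> r" by (auto simp: not_less)
      have "x \<in> ?K" unfolding convex_hull_3_param
      proof (intro CollectI exI conjI)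
        show "x = a + ((x$1 + r) / (4*r)) *\<^sub>R (b - a) + ((x$2 + r) / (4*r)) *\<^sub>R (c - a)"
          using r by (simp add: vec_eq_iff forall_2 a_def b_def c_def)
        show "0 \<le> (x$1 + r) / (4*r)" "0 \<le> (x$2 + r) / (4*r)" using le r by auto
        have "(x$1 + r) / (4*r) + (x$2 + r) / (4*r) = (x$1 + x$2 + 2*r) / (4*r)" by (simp add: add_divide_distrib)
        also have "\<dots> \<le> 1" using le r by (simp add: divide_simps)
        finally show "(x$1 + r) / (4*r) + (x$2 + r) / (4*r) \<le> 1" .
      qed
      then show False using that by simp
    qed
    then obtain j where j: "r < \<bar>x $ j\<bar>" by blast
    show ?thesis
    proof (rule C1_zero_outside[OF C])
      show "open {x :: point. r < \<bar>x $ j\<bar>}" by (intro open_Collect_less continuous_intros)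
      show "v y = 0" if "y \<in> {x. r < \<bar>x $ j\<bar>}" for y
        using that far[of y j] by simp
      show "x \<in> {x. r < \<bar>x $ j\<bar>}" using j by simp
    qed
  qed
  have s1: "segmean v a b = 0" unfolding segmean_def
  proof (subst integral_cong[where g = "\<lambda>_. 0"])
    show "v (linepath a b t) = 0" for t
      using r by (intro far[of _ 2]) (simp add: linepath_def a_def b_def algebra_simps)
  qed simp
  have s2: "segmean v a c = 0" unfolding segmean_def
  proof (subst integral_cong[where g = "\<lambda>_. 0"])
    show "v (linepath a c t) = 0" for t
      using r by (intro far[of _ 1]) (simp add: linepath_def a_def c_def algebra_simps)
  qed simp
  have s3: "segmean v b c = 0" unfolding segmean_def
  proof (subst integral_cong[where g = "\<lambda>_. 0"])
    fix t :: real assume "t \<in> {0..1}"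
    have e: "linepath b c t $ 1 = r * (3 - 4 * t)" "linepath b c t $ 2 = r * (4 * t - 1)"
      by (auto simp: linepath_def a_def b_def c_def algebra_simps)
    have "3 - 4 * t \<ge> 1 \<or> 4 * t - 1 \<ge> 1" by linarith
    then have "r \<le> \<bar>linepath b c t $ 1\<bar> \<or> r \<le> \<bar>linepath b c t $ 2\<bar>"
      unfolding e abs_mult using r mult_left_mono[of 1 "\<bar>3 - 4 * t\<bar>" r] mult_left_mono[of 1 "\<bar>4 * t - 1\<bar>" r]
      by auto
    then show "v (linepath b c t) = 0" using far by blast
  qed simp
  have tot: "(LINT x|lborel. G x \<bullet> d) = (LINT x|lebesgue_on ?K. G x \<bullet> d)" for d
  proof -
    have "continuous_on ?K (\<lambda>x. G x \<bullet> d)"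
      by (intro continuous_intros continuous_on_subset[OF cG]) auto
    from continuous_compact_integrable(3)[OF compact_triangle this]
    show ?thesis using Gz by (auto simp: indicator_def intro!: Bochner_Integration.integral_cong)
  qed
  have g1: "(LINT x|lborel. G x \<bullet> (c - a)) = 0"
    unfolding tot triangle_gauss[OF C D] s1 s3 by simp
  have D': "area2 a c b \<noteq> 0" using D abs_area2_perm(1)[of a b c] by auto
  have g2: "(LINT x|lborel. G x \<bullet> (b - a)) = 0"
    using tot[of "b - a"] triangle_gauss[OF C D'] s2 s3 segmean_swap[OF C1_cont[OF C], of b c] by (simp add: insert_commute)
  have e1: "G x \<bullet> (b - a) = (4 * r) * (G x $ 1)" "G x \<bullet> (c - a) = (4 * r) * (G x $ 2)" for x
    by (simp_all add: inner_vec_def sum_2 b_def c_def)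
  have "(4 * r) * (LINT x|lborel. G x $ 1) = 0" "(4 * r) * (LINT x|lborel. G x $ 2) = 0"
    using g1 g2 unfolding e1 by simp_all
  then show ?thesis using r exhaust_2[of i] by auto
qed

section \<open>Weak derivatives and the fundamental lemma of the calculus of variations\<close>

lemma integral_zero_outside:
  fixes h :: "'a::euclidean_space \<Rightarrow> real"
  assumes "S \<in> sets lebesgue" "\<And>x. x \<notin> S \<Longrightarrow> h x = 0" "h \<in> borel_measurable borel"
  shows "(LINT x|lebesgue_on S. h x) = (LINT x|lborel. h x)"
proof -
  have "(LINT x|lebesgue_on S. h x) = (LINT x|lebesgue. h x)"
    unfolding restrict_integral(2)[OF assms(1)] by (rule Bochner_Integration.integral_cong) (use assms(2) in \<open>auto simp: indicator_def\<close>)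
  also have "\<dots> = (LINT x|lborel. h x)" by (rule integral_completion) (use assms(3) in simp)
  finally show ?thesis .
qed

text \<open>Integration by parts: the product of \<open>v\<close> and \<phi> inherits the compact
  support, so its gradient integrates to zero.\<close>

lemma C1_weak_pderiv:
  assumes v: "C1 v G" and S: "\<Omega> \<in> sets lebesgue"
  shows "weak_pderiv \<Omega> i v (\<lambda>x. G x $ i)"
  unfolding weak_pderiv_def
proof
  fix \<phi> assume T: "\<phi> \<in> test_functions \<Omega>"
  note D = test_functionsD[OF T]
  note Cp = smooth_C1[OF D(1)]
  obtain R where R: "\<And>x. x \<in> closure {x. \<phi> x \<noteq> 0} \<Longrightarrow> norm x < R"
    using compact_imp_bounded[OF D(2)] by (meson bounded_pos_less)
  have R': "\<phi> x \<noteq> 0 \<Longrightarrow> norm x < R" for x using R[of x] closure_subset[of "{x. \<phi> x \<noteq> 0}"] by auto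
  have "(LINT x|lborel. (v x *\<^sub>R (\<chi> i. pderiv2 i \<phi> x) + \<phi> x *\<^sub>R G x) $ i) = 0"
    by (rule compact_support_integral_gradient[OF C1_mult[OF v Cp], where R = R]) (use R' in auto)
  then have z: "(LINT x|lborel. v x * pderiv2 i \<phi> x + G x $ i * \<phi> x) = 0" by (simp add: mult.commute)
  have cv: "continuous_on UNIV v" "continuous_on UNIV (\<lambda>x. G x $ i)" "continuous_on UNIV \<phi>" "continuous_on UNIV (pderiv2 i \<phi>)"
    using C1_cont[OF v] C1_cont_grad[OF v] smooth_continuous[OF D(1)] smooth_continuous[OF smooth_pderiv[OF D(1)]]
    by (auto intro: continuous_intros)
  define K where "K = closure {x. \<phi> x \<noteq> 0}"
  have DK: "compact K" "K \<subseteq> \<Omega>" "closed K" "{x. \<phi> x \<noteq> 0} \<subseteq> K"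
    using D(2,3) by (simp_all add: K_def closure_subset)
  have zero: "\<phi> x = 0" "pderiv2 i \<phi> x = 0" if "x \<notin> K" for x
  proof -
    show "\<phi> x = 0" using that DK(4) by blast
    have "(\<chi> i. pderiv2 i \<phi> x) = 0"
      by (rule C1_zero_outside[OF Cp, of "- K"]) (use that DK in auto)
    then show "pderiv2 i \<phi> x = 0" by (metis vec_lambda_beta zero_index)
  qed
  have outz: "\<phi> x = 0" "pderiv2 i \<phi> x = 0" if "x \<notin> \<Omega>" for x
    using zero[of x] DK(2) that by blast+
  have i1: "integrable lborel (\<lambda>x. v x * pderiv2 i \<phi> x)" "integrable lborel (\<lambda>x. G x $ i * \<phi> x)"
  proof -
    have "integrable lborel (\<lambda>x. indicator K x * (v x * pderiv2 i \<phi> x))" "integrable lborel (\<lambda>x. indicator K x * (G x $ i * \<phi> x))"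
      by (intro continuous_compact_integrable(2)[OF DK(1)] continuous_intros continuous_on_subset[OF cv(1)]
          continuous_on_subset[OF cv(2)] continuous_on_subset[OF cv(3)] continuous_on_subset[OF cv(4)] subset_UNIV)+
    moreover have "(\<lambda>x. indicator K x * (v x * pderiv2 i \<phi> x)) = (\<lambda>x. v x * pderiv2 i \<phi> x)"
       "(\<lambda>x. indicator K x * (G x $ i * \<phi> x)) = (\<lambda>x. G x $ i * \<phi> x)"
      by (rule ext, rename_tac x, case_tac "x \<in> K", simp, simp add: zero)+
    ultimately show "integrable lborel (\<lambda>x. v x * pderiv2 i \<phi> x)" "integrable lborel (\<lambda>x. G x $ i * \<phi> x)" by simp_all
  qed
  have "(LINT x|lebesgue_on \<Omega>. v x * pderiv2 i \<phi> x) = (LINT x|lborel. v x * pderiv2 i \<phi> x)"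
    by (rule integral_zero_outside[OF S _ borel_measurable_continuous_onI])
       (use outz in simp, intro continuous_intros cv)
  moreover have "(LINT x|lebesgue_on \<Omega>. G x $ i * \<phi> x) = (LINT x|lborel. G x $ i * \<phi> x)"
    by (rule integral_zero_outside[OF S _ borel_measurable_continuous_onI])
       (use outz in simp, intro continuous_intros cv)
  ultimately show "(LINT x|lebesgue_on \<Omega>. v x * pderiv2 i \<phi> x) = - (LINT x|lebesgue_on \<Omega>. G x $ i * \<phi> x)"
    using z i1 by simp
qed

text \<open>A product of one-sided cutoffs in the coordinate directions. The parameter
  \<open>k\<close> is a steepness and not a size: the support stays in the closed box while the
  values tend to the indicator of the open box.\<close>

definition box_bump :: "real \<Rightarrow> point \<Rightarrow> point \<Rightarrow> point \<Rightarrow> real"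
  where "box_bump k l u x = (flat 0 (k * (x$1 + (- l$1))) * flat 0 (k * (u$1 + (-1) * x$1)))
     * (flat 0 (k * (x$2 + (- l$2))) * flat 0 (k * (u$2 + (-1) * x$2)))"

lemma box_bump_elementary: "elementary (box_bump k l u)"
  unfolding box_bump_def by (intro elementary.intros)

lemma box_bump_test:
  assumes "k > 0" "cbox l u \<subseteq> \<Omega>"
  shows "box_bump k l u \<in> test_functions \<Omega>"
proof (rule test_functionsI[OF elementary_smooth[OF box_bump_elementary] closed_cbox bounded_cbox assms(2)])
  fix x assume "box_bump k l u x \<noteq> 0"
  then show "x \<in> cbox l u" using assms(1)
    by (auto simp: box_bump_def flat_def mem_box_cart forall_2 zero_less_mult_iff split: if_splits)
qed

lemma flat_scaled_tendsto: "(\<lambda>n. flat 0 (real (Suc n) * a)) \<longlonglongrightarrow> (if a > 0 then 1 else 0)"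
proof (cases "a > 0")
  case True
  have "(\<lambda>n. exp (- (inverse (real (Suc n)) * inverse a))) \<longlonglongrightarrow> exp (- (0 * inverse a))"
    by (intro tendsto_intros LIMSEQ_inverse_real_of_nat)
  then show ?thesis using True by (simp add: flat_def)
qed (auto simp: flat_def mult_less_0_iff zero_less_mult_iff)

lemma box_bump_tendsto: "(\<lambda>n. box_bump (real (Suc n)) l u x) \<longlonglongrightarrow> indicator (box l u) x"
proof -
  have "(\<lambda>n. box_bump (real (Suc n)) l u x) \<longlonglongrightarrow>
     ((if x$1 + (- l$1) > 0 then 1 else 0) * (if u$1 + (-1) * x$1 > 0 then 1 else 0)) *
     ((if x$2 + (- l$2) > 0 then 1 else 0) * (if u$2 + (-1) * x$2 > 0 then 1 else 0))"
    unfolding box_bump_def by (intro tendsto_mult flat_scaled_tendsto)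
  moreover have "((if x$1 + (- l$1) > 0 then 1 else 0) * (if u$1 + (-1) * x$1 > 0 then 1 else 0)) *
     ((if x$2 + (- l$2) > 0 then 1 else 0) * (if u$2 + (-1) * x$2 > 0 then 1 else 0)) = (indicator (box l u) x :: real)"
    by (auto simp: indicator_def mem_box_cart forall_2)
  ultimately show ?thesis by simp
qed

lemma box_bump_bounds: "\<bar>box_bump k l u x\<bar> \<le> 1"
  using flat_0_bounds by (auto simp: box_bump_def abs_mult intro!: mult_le_one)

text \<open>Open boxes are stable under intersection and generate the Borel sets, so a density with
  zero integral over all of them vanishes. Cutting off to \<open>box l u\<close> makes every box
  admissible, not only those inside \<Omega>.\<close>

lemma AE_zero_box:
  fixes U :: "point \<Rightarrow> real"
  assumes U: "integrable lborel U"
    and z: "\<And>a b. cbox a b \<subseteq> \<Omega> \<Longrightarrow> (LINT x|lborel. indicator (box a b) x * U x) = 0"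
    and Q: "cbox l u \<subseteq> \<Omega>"
  shows "AE x in lborel. x \<in> box l u \<longrightarrow> U x = 0"
proof -
  define f where "f = (\<lambda>x. indicator (box l u) x * U x)"
  have fi: "integrable lborel f"
    unfolding f_def using integrable_mult_indicator[of "box l u" lborel U] U by simp
  have stable: "Int_stable (range (\<lambda>(a, b). box a b :: point set))"
  proof (rule Int_stableI)
    fix A B :: "point set" assume "A \<in> range (\<lambda>(a, b). box a b)" "B \<in> range (\<lambda>(a, b). box a b)"
    then obtain a b c d where "A = box a b" "B = box c d" by auto
    then obtain e g where "A \<inter> B = box e g" by (simp add: box_Int_box)
    then have "A \<inter> B = (\<lambda>(a, b). box a b) (e, g)" by simp
    then show "A \<inter> B \<in> range (\<lambda>(a, b). box a b)" by (rule range_eqI)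
  qed
  have pow: "range (\<lambda>(a, b). box a b :: point set) \<subseteq> Pow UNIV" by simp
  have zero: "set_lebesgue_integral lborel A f = 0" if "A \<in> sigma_sets UNIV (range (\<lambda>(a, b). box a b))" for A
    using stable pow that
  proof (induction rule: sigma_sets_induct_disjoint)
    case (basic A)
    then obtain a b where A: "A = box a b" by auto
    obtain c d where cd: "box a b \<inter> box l u = box c d" by (simp add: box_Int_box)
    have "set_lebesgue_integral lborel A f = (LINT x|lborel. indicator (box c d) x * U x)"
      unfolding set_lebesgue_integral_def f_def A cd[symmetric] by (simp add: indicator_inter_arith mult.assoc)
    also have "\<dots> = 0"
    proof (cases "box c d = {}")
      case True then show ?thesis by simp
    next
      case False
      \<comment> \<open>The hypothesis asks for closed boxes in \<Omega>; for nonempty open boxes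
        these are the closures.\<close>
      have "closure (box c d) \<subseteq> closure (box l u)" using cd by (intro closure_mono) auto
      moreover have "box l u \<noteq> {}" using False cd by auto
      ultimately have "cbox c d \<subseteq> \<Omega>" using False Q by (simp add: closure_box)
      then show ?thesis by (rule z)
    qed
    finally show ?case .
  next
    case empty then show ?case by (simp add: set_lebesgue_integral_def)
  next
    case (compl A)
    have A: "A \<in> sets lborel" using compl(1) by (simp add: borel_eq_box sets_measure_of)
    have "set_lebesgue_integral lborel (UNIV - A) f = (LINT x|lborel. f x) - set_lebesgue_integral lborel A f"
    proof -
      have "set_lebesgue_integral lborel (UNIV - A) f = (LINT x|lborel. f x - indicator A x *\<^sub>R f x)"
        unfolding set_lebesgue_integral_def by (rule Bochner_Integration.integral_cong) (auto simp: indicator_def)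
      also have "\<dots> = (LINT x|lborel. f x) - set_lebesgue_integral lborel A f"
        unfolding set_lebesgue_integral_def by (intro Bochner_Integration.integral_diff fi integrable_mult_indicator A)
      finally show ?thesis .
    qed
    then show ?case using compl(2) z[OF Q] by (simp add: f_def)
  next
    case (union A)
    have A: "A i \<in> sets lborel" for i using union(2) by (auto simp: borel_eq_box sets_measure_of)
    have "set_lebesgue_integral lborel (\<Union>i. A i) f = (\<Sum>i. set_lebesgue_integral lborel (A i) f)"
    proof (rule lebesgue_integral_countable_add[OF A])
      show "A i \<inter> A j = {}" if "i \<noteq> j" for i j using union(1) that by (auto simp: disjoint_family_on_def)
      show "set_integrable lborel (\<Union>i. A i) f"
        unfolding set_integrable_def by (intro integrable_mult_indicator fi sets.countable_UN) (use A in auto)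
    qed
    then show ?case using union(3) by simp
  qed
  have "AE x in lborel. f x = 0"
    by (rule sigma_finite_measure.density_zero[OF sigma_finite_lborel fi]) (simp add: zero borel_eq_box sets_measure_of)
  then show ?thesis by eventually_elim (auto simp: f_def indicator_def split: if_splits)
qed

text \<open>Box bumps converge boundedly to indicators of boxes, hence all box integrals of
  \<open>u\<close> vanish; countably many closed boxes exhaust \<Omega>.\<close>

lemma du_Bois_Reymond:
  assumes op: "open \<Omega>" and u: "integrable (lebesgue_on \<Omega>) u"
    and z: "\<And>\<phi>. \<phi> \<in> test_functions \<Omega> \<Longrightarrow> (LINT x|lebesgue_on \<Omega>. u x * \<phi> x) = 0"
  shows "AE x in lebesgue_on \<Omega>. u x = 0"
proof -
  have S: "\<Omega> \<in> sets lebesgue" using op by (simp add: lborelD)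
  define U where "U = (\<lambda>x. indicator \<Omega> x * u x)"
  have Ui: "integrable lebesgue U" using u S by (simp add: restrict_integral U_def)
  \<comment> \<open>A Borel representative, since the generator argument of
    \<open>AE_zero_box\<close> works with Borel sets only.\<close>
  obtain U' where U': "U' \<in> borel_measurable lborel" and ae: "AE x in lborel. U x = U' x"
    using completion_ex_borel_measurable_real[OF borel_measurable_integrable[OF Ui]] by blast
  have ae': "AE x in lebesgue. U x = U' x" by (rule AE_completion[OF ae])
  have m': "U' \<in> borel_measurable lebesgue" using U' by (simp add: measurable_completion)
  have "integrable lebesgue U'"
    using integrable_cong_AE_imp[OF Ui m'] ae' by (auto elim: AE_mp)
  then have U'i: "integrable lborel U'" using U' by (simp add: integrable_completion)
  have box0: "(LINT x|lborel. indicator (box a b) x * U' x) = 0" if ab: "cbox a b \<subseteq> \<Omega>" for a b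
  proof -
    have meas: "box_bump k a b \<in> borel_measurable borel" for k
      by (intro borel_measurable_continuous_onI smooth_continuous elementary_smooth box_bump_elementary)
    have "(\<lambda>n. LINT x|lborel. box_bump (real (Suc n)) a b x * U' x) \<longlonglongrightarrow> (LINT x|lborel. indicator (box a b) x * U' x)"
    proof (rule integral_dominated_convergence[where w = "\<lambda>x. \<bar>U' x\<bar>"])
      show "AE x in lborel. (\<lambda>n. box_bump (real (Suc n)) a b x * U' x) \<longlonglongrightarrow> indicator (box a b) x * U' x"
        by (intro AE_I2 tendsto_mult box_bump_tendsto tendsto_const)
      show "AE x in lborel. norm (box_bump (real (Suc n)) a b x * U' x) \<le> \<bar>U' x\<bar>" for n
        using box_bump_bounds by (intro AE_I2) (auto simp: abs_mult intro: mult_left_le_one_le)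
      show "integrable lborel (\<lambda>x. \<bar>U' x\<bar>)" using U'i by simp
    qed (use U' meas in auto)
    moreover have "(LINT x|lborel. box_bump (real (Suc n)) a b x * U' x) = 0" for n
    proof -
      have bm: "box_bump (real (Suc n)) a b \<in> borel_measurable lebesgue"
        using meas by (simp add: measurable_completion)
      have "(LINT x|lborel. box_bump (real (Suc n)) a b x * U' x) = (LINT x|lebesgue. box_bump (real (Suc n)) a b x * U' x)"
        by (rule integral_completion[symmetric]) (use U' meas in auto)
      also have "\<dots> = (LINT x|lebesgue. box_bump (real (Suc n)) a b x * U x)"
        by (rule integral_cong_AE) (use bm m' Ui ae' in auto)
      also have "\<dots> = (LINT x|lebesgue_on \<Omega>. u x * box_bump (real (Suc n)) a b x)"
        unfolding restrict_integral(2)[OF S] U_def by (rule Bochner_Integration.integral_cong) auto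
      also have "\<dots> = 0" by (rule z[OF box_bump_test[OF _ ab]]) simp
      finally show ?thesis .
    qed
    ultimately show ?thesis by (simp only: LIMSEQ_const_iff)
  qed
  obtain \<D> where \<D>: "countable \<D>" "\<D> \<subseteq> Pow \<Omega>" "\<And>X. X \<in> \<D> \<Longrightarrow> \<exists>a b. X = cbox a b" "\<Union>\<D> = \<Omega>"
    using open_countable_Union_open_cbox[OF op] by metis
  have "AE x in lebesgue. \<forall>X\<in>\<D>. x \<in> X \<longrightarrow> U' x = 0"
  proof (subst AE_ball_countable[OF \<D>(1)], intro ballI)
    fix X assume X: "X \<in> \<D>"
    then obtain a b where ab: "X = cbox a b" "cbox a b \<subseteq> \<Omega>" using \<D> by blast
    have "AE x in lebesgue. x \<in> box a b \<longrightarrow> U' x = 0"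
      by (rule AE_completion[OF AE_zero_box[OF U'i box0 ab(2)]])
    moreover have "AE x in lebesgue. x \<notin> cbox a b - box a b"
      using negligible_frontier_interval[of a b] by (intro AE_not_in) (simp add: negligible_iff_null_sets)
    ultimately show "AE x in lebesgue. x \<in> X \<longrightarrow> U' x = 0"
      by eventually_elim (auto simp: ab)
  qed
  with ae' have "AE x in lebesgue. x \<in> \<Omega> \<longrightarrow> u x = 0"
  proof eventually_elim
    case (elim x)
    show ?case
    proof
      assume x: "x \<in> \<Omega>"
      then obtain X where "X \<in> \<D>" "x \<in> X" using \<D>(4) by blast
      then have "U' x = 0" using elim by blast
      then show "u x = 0" using elim x by (simp add: U_def)
    qed
  qed
  then show ?thesis using S by (simp add: AE_restrict_space_iff)
qed

section \<open>The space of clamped functions\<close>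

text \<open>Classical counterparts of \<open>wgrad\<close> and \<open>whess\<close>, for test
  functions and for single branches of piecewise functions.\<close>

definition grad :: "(point \<Rightarrow> real) \<Rightarrow> point \<Rightarrow> real^2"
  where "grad v x = (\<chi> i. pderiv2 i v x)"

definition hess :: "(point \<Rightarrow> real) \<Rightarrow> point \<Rightarrow> real^2^2"
  where "hess v x = (\<chi> i k. pderiv2 k (pderiv2 i v) x)"

lemma test_functions_zero: "(\<lambda>x. 0) \<in> test_functions \<Omega>"
  using elementary_smooth[OF elementary.const[of 0]] by (simp add: test_functions_def)

lemma pderiv2_zero: "pderiv2 i (\<lambda>x. 0) = (\<lambda>x. 0)"
  using pderiv2_eq[of "\<lambda>x. 0" "\<lambda>x h. 0" i] by simp

locale bounded_open =
  fixes \<Omega> :: "point set"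
  assumes op: "open \<Omega>" and bd: "bounded \<Omega>"
begin

lemma Omega_lebesgue [simp]: "\<Omega> \<in> sets lebesgue"
  using op by (simp add: lborelD)

lemma test_continuous: "\<phi> \<in> test_functions \<Omega> \<Longrightarrow> continuous_on UNIV \<phi>"
  using test_functionsD(1) smooth_continuous by blast

lemma test_L2: "\<phi> \<in> test_functions \<Omega> \<Longrightarrow> \<phi> \<in> L2 \<Omega>"
  by (intro continuous_bounded_L2 test_continuous bd) auto

lemma L2_integrable:
  fixes f :: "point \<Rightarrow> real"
  assumes "f \<in> L2 \<Omega>"
  shows "integrable (lebesgue_on \<Omega>) f"
proof -
  have "(\<lambda>x. 1::real) \<in> L2 \<Omega>" by (intro continuous_bounded_L2 bd continuous_intros) auto
  from L2_mult_integrable[OF assms this] show ?thesis by simp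
qed

text \<open>On a bounded set the difference of two candidates is integrable, so
  \<open>du_Bois_Reymond\<close> applies to it.\<close>

lemma weak_pderiv_unique:
  assumes "g \<in> L2 \<Omega>" "h \<in> L2 \<Omega>" "weak_pderiv \<Omega> i v g" "weak_pderiv \<Omega> i v h"
  shows "AE x in lebesgue_on \<Omega>. g x = h x"
proof -
  have "AE x in lebesgue_on \<Omega>. g x - h x = 0"
  proof (rule du_Bois_Reymond[OF op L2_integrable[OF L2_diff[OF assms(1,2)]]])
    fix \<phi> assume T: "\<phi> \<in> test_functions \<Omega>"
    have "(LINT x|lebesgue_on \<Omega>. (g x - h x) * \<phi> x) = (LINT x|lebesgue_on \<Omega>. g x * \<phi> x) - (LINT x|lebesgue_on \<Omega>. h x * \<phi> x)"
      unfolding left_diff_distrib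
      by (intro Bochner_Integration.integral_diff L2_mult_integrable assms test_L2 T)
    also have "\<dots> = 0" using assms(3,4) T by (simp add: weak_pderiv_def)
    finally show "(LINT x|lebesgue_on \<Omega>. (g x - h x) * \<phi> x) = 0" .
  qed
  then show ?thesis by simp
qed

lemma weak_pderiv_cong_AE:
  assumes "AE x in lebesgue_on \<Omega>. v x = w x" "v \<in> L2 \<Omega>" "w \<in> L2 \<Omega>" "weak_pderiv \<Omega> i v g"
  shows "weak_pderiv \<Omega> i w g"
  unfolding weak_pderiv_def
proof
  fix \<phi> assume T: "\<phi> \<in> test_functions \<Omega>"
  have m: "pderiv2 i \<phi> \<in> borel_measurable (lebesgue_on \<Omega>)"
    using L2_measurable[OF test_L2[OF test_functions_pderiv[OF T]]] .
  have "(LINT x|lebesgue_on \<Omega>. w x * pderiv2 i \<phi> x) = (LINT x|lebesgue_on \<Omega>. v x * pderiv2 i \<phi> x)"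
  proof (rule integral_cong_AE)
    show "AE x in lebesgue_on \<Omega>. w x * pderiv2 i \<phi> x = v x * pderiv2 i \<phi> x"
      using assms(1) by eventually_elim simp
  qed (intro borel_measurable_times L2_measurable assms m)+
  then show "(LINT x|lebesgue_on \<Omega>. w x * pderiv2 i \<phi> x) = - (LINT x|lebesgue_on \<Omega>. g x * \<phi> x)"
    using assms(4) T by (simp add: weak_pderiv_def)
qed

lemma weak_pderiv_diff:
  assumes "v \<in> L2 \<Omega>" "w \<in> L2 \<Omega>" "g \<in> L2 \<Omega>" "h \<in> L2 \<Omega>" "weak_pderiv \<Omega> i v g" "weak_pderiv \<Omega> i w h"
  shows "weak_pderiv \<Omega> i (\<lambda>x. v x - w x) (\<lambda>x. g x - h x)"
  unfolding weak_pderiv_def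
proof
  fix \<phi> assume T: "\<phi> \<in> test_functions \<Omega>"
  note T' = test_functions_pderiv[OF T, of i]
  have "(LINT x|lebesgue_on \<Omega>. (v x - w x) * pderiv2 i \<phi> x)
     = (LINT x|lebesgue_on \<Omega>. v x * pderiv2 i \<phi> x) - (LINT x|lebesgue_on \<Omega>. w x * pderiv2 i \<phi> x)"
    unfolding left_diff_distrib by (intro Bochner_Integration.integral_diff L2_mult_integrable assms test_L2 T')
  moreover have "(LINT x|lebesgue_on \<Omega>. (g x - h x) * \<phi> x)
     = (LINT x|lebesgue_on \<Omega>. g x * \<phi> x) - (LINT x|lebesgue_on \<Omega>. h x * \<phi> x)"
    unfolding left_diff_distrib by (intro Bochner_Integration.integral_diff L2_mult_integrable assms test_L2 T)
  ultimately show "(LINT x|lebesgue_on \<Omega>. (v x - w x) * pderiv2 i \<phi> x) = - (LINT x|lebesgue_on \<Omega>. (g x - h x) * \<phi> x)"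
    using assms(5,6) T by (simp add: weak_pderiv_def)
qed

lemma wpderiv_weak:
  assumes "g \<in> L2 \<Omega>" "weak_pderiv \<Omega> i v g"
  shows "wpderiv \<Omega> i v \<in> L2 \<Omega>" "weak_pderiv \<Omega> i v (wpderiv \<Omega> i v)"
    "AE x in lebesgue_on \<Omega>. wpderiv \<Omega> i v x = g x"
proof -
  have "wpderiv \<Omega> i v \<in> L2 \<Omega> \<and> weak_pderiv \<Omega> i v (wpderiv \<Omega> i v)"
    unfolding wpderiv_def by (rule someI[of _ g]) (use assms in simp)
  then show "wpderiv \<Omega> i v \<in> L2 \<Omega>" "weak_pderiv \<Omega> i v (wpderiv \<Omega> i v)" by auto
  then show "AE x in lebesgue_on \<Omega>. wpderiv \<Omega> i v x = g x"
    using assms weak_pderiv_unique by blast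
qed

text \<open>An iterated \<open>wpderiv\<close> differentiates a chosen representative and not
  \<open>g\<close> itself. The two agree almost everywhere, and weak derivatives cannot see the
  difference.\<close>

lemma second_wpderiv:
  assumes "g \<in> L2 \<Omega>" "weak_pderiv \<Omega> i v g" "h \<in> L2 \<Omega>" "weak_pderiv \<Omega> k g h"
  shows "wpderiv \<Omega> k (wpderiv \<Omega> i v) \<in> L2 \<Omega>" "weak_pderiv \<Omega> k (wpderiv \<Omega> i v) (wpderiv \<Omega> k (wpderiv \<Omega> i v))"
    "AE x in lebesgue_on \<Omega>. wpderiv \<Omega> k (wpderiv \<Omega> i v) x = h x"
proof -
  note W = wpderiv_weak[OF assms(1,2)]
  have "AE x in lebesgue_on \<Omega>. g x = wpderiv \<Omega> i v x" using W(3) by eventually_elim simp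
  then have "weak_pderiv \<Omega> k (wpderiv \<Omega> i v) h"
    using weak_pderiv_cong_AE[OF _ assms(1) W(1) assms(4)] by blast
  from wpderiv_weak[OF assms(3) this]
  show "wpderiv \<Omega> k (wpderiv \<Omega> i v) \<in> L2 \<Omega>" "weak_pderiv \<Omega> k (wpderiv \<Omega> i v) (wpderiv \<Omega> k (wpderiv \<Omega> i v))"
    "AE x in lebesgue_on \<Omega>. wpderiv \<Omega> k (wpderiv \<Omega> i v) x = h x" by auto
qed

lemma sobolev2: "v \<in> sobolev \<Omega> 2 \<longleftrightarrow> v \<in> L2 \<Omega> \<and>
    (\<forall>i. \<exists>g\<in>L2 \<Omega>. weak_pderiv \<Omega> i v g \<and> (\<forall>k. \<exists>h\<in>L2 \<Omega>. weak_pderiv \<Omega> k g h))"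
  unfolding numeral_2_eq_2 by auto

lemma sobolev2D:
  assumes "v \<in> sobolev \<Omega> 2"
  shows "v \<in> L2 \<Omega>" "wpderiv \<Omega> i v \<in> L2 \<Omega>" "weak_pderiv \<Omega> i v (wpderiv \<Omega> i v)"
    "wpderiv \<Omega> k (wpderiv \<Omega> i v) \<in> L2 \<Omega>" "weak_pderiv \<Omega> k (wpderiv \<Omega> i v) (wpderiv \<Omega> k (wpderiv \<Omega> i v))"
proof -
  show "v \<in> L2 \<Omega>" using assms by (simp add: sobolev2)
  obtain g where g: "g \<in> L2 \<Omega>" "weak_pderiv \<Omega> i v g" "\<forall>k. \<exists>h\<in>L2 \<Omega>. weak_pderiv \<Omega> k g h"
    using assms unfolding sobolev2 by blast
  then obtain h where h: "h \<in> L2 \<Omega>" "weak_pderiv \<Omega> k g h" by blast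
  show "wpderiv \<Omega> i v \<in> L2 \<Omega>" "weak_pderiv \<Omega> i v (wpderiv \<Omega> i v)" using wpderiv_weak[OF g(1,2)] by auto
  show "wpderiv \<Omega> k (wpderiv \<Omega> i v) \<in> L2 \<Omega>" "weak_pderiv \<Omega> k (wpderiv \<Omega> i v) (wpderiv \<Omega> k (wpderiv \<Omega> i v))"
    using second_wpderiv[OF g(1,2) h] by auto
qed

lemma wgrad_L2: "v \<in> sobolev \<Omega> 2 \<Longrightarrow> wgrad \<Omega> v \<in> L2 \<Omega>"
  using sobolev2D(2)[of v] by (simp add: L2_vec wgrad_def)

lemma whess_L2: "v \<in> sobolev \<Omega> 2 \<Longrightarrow> whess \<Omega> v \<in> L2 \<Omega>"
  using sobolev2D(4)[of v] by (simp add: L2_vec whess_def)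

lemma test_weak_pderiv:
  assumes "\<phi> \<in> test_functions \<Omega>"
  shows "weak_pderiv \<Omega> i \<phi> (pderiv2 i \<phi>)"
  using C1_weak_pderiv[OF smooth_C1[OF test_functionsD(1)[OF assms]], of \<Omega> i] by simp

lemma sobolev2I:
  assumes "v \<in> L2 \<Omega>" "\<And>i. g i \<in> L2 \<Omega>" "\<And>i. weak_pderiv \<Omega> i v (g i)"
    "\<And>i k. h i k \<in> L2 \<Omega>" "\<And>i k. weak_pderiv \<Omega> k (g i) (h i k)"
  shows "v \<in> sobolev \<Omega> 2"
  unfolding sobolev2
proof (intro conjI allI assms(1))
  fix i
  have "\<exists>h\<in>L2 \<Omega>. weak_pderiv \<Omega> k (g i) h" for k
    by (rule bexI[of _ "h i k"]) (rule assms)+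
  then show "\<exists>g\<in>L2 \<Omega>. weak_pderiv \<Omega> i v g \<and> (\<forall>k. \<exists>h\<in>L2 \<Omega>. weak_pderiv \<Omega> k g h)"
    by (intro bexI[of _ "g i"] conjI assms(2,3)) auto
qed

lemma test_sobolev2: "\<phi> \<in> test_functions \<Omega> \<Longrightarrow> \<phi> \<in> sobolev \<Omega> 2"
  by (rule sobolev2I[where g = "\<lambda>i. pderiv2 i \<phi>" and h = "\<lambda>i k. pderiv2 k (pderiv2 i \<phi>)"])
     (simp_all add: test_L2 test_functions_pderiv test_weak_pderiv)

lemma AE_vec_eq:
  assumes "\<And>i. AE x in M. f i x = g i x"
  shows "AE x in M. (\<chi> i. f i x) = (\<chi> i. g i x :: 'a ^ 'n)"
proof -
  have "AE x in M. \<forall>i\<in>UNIV. f i x = g i x"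
    by (subst AE_ball_countable) (use assms in auto)
  then show ?thesis by eventually_elim auto
qed

text \<open>\<open>H2norm\<close> in the definition of \<open>H20\<close> evaluates derivatives
  chosen for the difference; here they become differences of derivatives, almost everywhere.\<close>

lemma diff_test_derivs:
  assumes v: "v \<in> sobolev \<Omega> 2" and T: "\<phi> \<in> test_functions \<Omega>"
  shows "(\<lambda>x. v x - \<phi> x) \<in> sobolev \<Omega> 2"
    "AE x in lebesgue_on \<Omega>. wgrad \<Omega> (\<lambda>x. v x - \<phi> x) x = wgrad \<Omega> v x - grad \<phi> x"
    "AE x in lebesgue_on \<Omega>. whess \<Omega> (\<lambda>x. v x - \<phi> x) x = whess \<Omega> v x - hess \<phi> x"
proof -
  note T1 = test_functions_pderiv[OF T] and T2 = test_functions_pderiv[OF test_functions_pderiv[OF T]]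
  note D = sobolev2D[OF v]
  have w1: "weak_pderiv \<Omega> i (\<lambda>x. v x - \<phi> x) (\<lambda>x. wpderiv \<Omega> i v x - pderiv2 i \<phi> x)" for i
    by (intro weak_pderiv_diff D test_L2 T T1 test_weak_pderiv)
  have w2: "weak_pderiv \<Omega> k (\<lambda>x. wpderiv \<Omega> i v x - pderiv2 i \<phi> x)
     (\<lambda>x. wpderiv \<Omega> k (wpderiv \<Omega> i v) x - pderiv2 k (pderiv2 i \<phi>) x)" for i k
    by (intro weak_pderiv_diff D test_L2 T1 T2 test_weak_pderiv)
  have l1: "(\<lambda>x. wpderiv \<Omega> i v x - pderiv2 i \<phi> x) \<in> L2 \<Omega>" for i by (intro L2_diff D test_L2 T1)
  have l2: "(\<lambda>x. wpderiv \<Omega> k (wpderiv \<Omega> i v) x - pderiv2 k (pderiv2 i \<phi>) x) \<in> L2 \<Omega>" for i k by (intro L2_diff D test_L2 T2)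
  show "(\<lambda>x. v x - \<phi> x) \<in> sobolev \<Omega> 2"
    by (rule sobolev2I[OF L2_diff[OF D(1) test_L2[OF T]] l1 w1 l2 w2])
  have "AE x in lebesgue_on \<Omega>. wgrad \<Omega> (\<lambda>x. v x - \<phi> x) x = (\<chi> i. wpderiv \<Omega> i v x - pderiv2 i \<phi> x)"
    unfolding wgrad_def by (intro AE_vec_eq wpderiv_weak(3)[OF l1 w1])
  then show "AE x in lebesgue_on \<Omega>. wgrad \<Omega> (\<lambda>x. v x - \<phi> x) x = wgrad \<Omega> v x - grad \<phi> x"
    by eventually_elim (simp add: vec_eq_iff wgrad_def grad_def)
  have "AE x in lebesgue_on \<Omega>. whess \<Omega> (\<lambda>x. v x - \<phi> x) x
     = (\<chi> i k. wpderiv \<Omega> k (wpderiv \<Omega> i v) x - pderiv2 k (pderiv2 i \<phi>) x)"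
    unfolding whess_def by (intro AE_vec_eq second_wpderiv(3)[OF l1 w1 l2 w2])
  then show "AE x in lebesgue_on \<Omega>. whess \<Omega> (\<lambda>x. v x - \<phi> x) x = whess \<Omega> v x - hess \<phi> x"
    by eventually_elim (simp add: vec_eq_iff whess_def hess_def)
qed

lemma test_derivs:
  assumes T: "\<phi> \<in> test_functions \<Omega>"
  shows "AE x in lebesgue_on \<Omega>. wgrad \<Omega> \<phi> x = grad \<phi> x"
    "AE x in lebesgue_on \<Omega>. whess \<Omega> \<phi> x = hess \<phi> x"
proof -
  note T1 = test_functions_pderiv[OF T]
  show "AE x in lebesgue_on \<Omega>. wgrad \<Omega> \<phi> x = grad \<phi> x"
    unfolding wgrad_def grad_def by (intro AE_vec_eq wpderiv_weak(3) test_L2 T1 test_weak_pderiv T)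
  show "AE x in lebesgue_on \<Omega>. whess \<Omega> \<phi> x = hess \<phi> x"
    unfolding whess_def hess_def
    by (intro AE_vec_eq second_wpderiv(3)[OF test_L2[OF T1] test_weak_pderiv[OF T]
          test_L2[OF test_functions_pderiv[OF T1]] test_weak_pderiv[OF T1]])
qed

lemma grad_test_L2: "\<phi> \<in> test_functions \<Omega> \<Longrightarrow> grad \<phi> \<in> L2 \<Omega>"
  by (simp add: L2_vec grad_def test_L2 test_functions_pderiv)

lemma hess_test_L2: "\<phi> \<in> test_functions \<Omega> \<Longrightarrow> hess \<phi> \<in> L2 \<Omega>"
  by (simp add: L2_vec hess_def test_L2 test_functions_pderiv)

text \<open>Even for the zero function \<open>wpderiv\<close> is a choice, so uniqueness of weak
  derivatives is what makes the norm vanish.\<close>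

lemma H2norm_zero: "H2norm \<Omega> (\<lambda>x. 0) = 0"
proof -
  note T = test_functions_zero[of \<Omega>]
  have g: "L2norm \<Omega> (wgrad \<Omega> (\<lambda>x. 0)) = L2norm \<Omega> (grad (\<lambda>x. 0))"
    by (intro L2norm_cong_AE test_derivs(1) T L2_measurable wgrad_L2 grad_test_L2 test_sobolev2)
  have h: "L2norm \<Omega> (whess \<Omega> (\<lambda>x. 0)) = L2norm \<Omega> (hess (\<lambda>x. 0))"
    by (intro L2norm_cong_AE test_derivs(2) T L2_measurable whess_L2 hess_test_L2 test_sobolev2)
  have "grad (\<lambda>x. 0) = (\<lambda>x. 0)" "hess (\<lambda>x. 0) = (\<lambda>x. 0)"
    by (simp_all add: fun_eq_iff grad_def hess_def pderiv2_zero vec_eq_iff)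
  then show ?thesis unfolding H2norm_def g h by (simp add: L2norm_def)
qed

lemma test_H20: "\<phi> \<in> test_functions \<Omega> \<Longrightarrow> \<phi> \<in> H20 \<Omega>"
  unfolding H20_def using test_sobolev2 H2norm_zero
  by (auto intro!: exI[of _ "\<lambda>n. \<phi>"])

lemma H20_sobolev2: "v \<in> H20 \<Omega> \<Longrightarrow> v \<in> sobolev \<Omega> 2"
  by (simp add: H20_def)

text \<open>The form in which clamped functions enter all later estimates: L^2 convergence of
  classical gradients and Hessians.\<close>

lemma H20_approx:
  assumes "v \<in> H20 \<Omega>"
  obtains \<phi> :: "nat \<Rightarrow> point \<Rightarrow> real" where "\<And>n. \<phi> n \<in> test_functions \<Omega>"
    "(\<lambda>n. L2norm \<Omega> (\<lambda>x. wgrad \<Omega> v x - grad (\<phi> n) x)) \<longlonglongrightarrow> 0"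
    "(\<lambda>n. L2norm \<Omega> (\<lambda>x. whess \<Omega> v x - hess (\<phi> n) x)) \<longlonglongrightarrow> 0"
proof -
  from assms obtain \<phi> where v: "v \<in> sobolev \<Omega> 2" and T: "\<And>n. \<phi> n \<in> test_functions \<Omega>"
    and lim: "(\<lambda>n. H2norm \<Omega> (\<lambda>x. v x - \<phi> n x)) \<longlonglongrightarrow> 0" by (auto simp: H20_def)
  note D = diff_test_derivs[OF v T]
  have "L2norm \<Omega> (\<lambda>x. wgrad \<Omega> v x - grad (\<phi> n) x) = L2norm \<Omega> (wgrad \<Omega> (\<lambda>x. v x - \<phi> n x))" for n
    by (rule L2norm_cong_AE[symmetric, OF D(2)])
       (intro L2_measurable wgrad_L2 D L2_diff grad_test_L2 T v)+
  moreover have "L2norm \<Omega> (\<lambda>x. whess \<Omega> v x - hess (\<phi> n) x) = L2norm \<Omega> (whess \<Omega> (\<lambda>x. v x - \<phi> n x))" for n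
    by (rule L2norm_cong_AE[symmetric, OF D(3)])
       (intro L2_measurable whess_L2 D L2_diff hess_test_L2 T v)+
  moreover have le: "L2norm \<Omega> (wgrad \<Omega> w) \<le> H2norm \<Omega> w" "L2norm \<Omega> (whess \<Omega> w) \<le> H2norm \<Omega> w" for w
    unfolding H2norm_def by (intro real_le_rsqrt; simp)+
  ultimately have b: "norm (L2norm \<Omega> (\<lambda>x. wgrad \<Omega> v x - grad (\<phi> n) x)) \<le> H2norm \<Omega> (\<lambda>x. v x - \<phi> n x)"
      "norm (L2norm \<Omega> (\<lambda>x. whess \<Omega> v x - hess (\<phi> n) x)) \<le> H2norm \<Omega> (\<lambda>x. v x - \<phi> n x)" for n
    by simp_all
  have "(\<lambda>n. L2norm \<Omega> (\<lambda>x. wgrad \<Omega> v x - grad (\<phi> n) x)) \<longlonglongrightarrow> 0"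
    "(\<lambda>n. L2norm \<Omega> (\<lambda>x. whess \<Omega> v x - hess (\<phi> n) x)) \<longlonglongrightarrow> 0"
    by (rule Lim_null_comparison[OF _ lim], intro always_eventually allI b)+
  with T that show ?thesis by blast
qed

end

section \<open>Triangles\<close>

lemma inner_2: "u \<bullet> w = u$1 * w$1 + u$2 * w$2" for u w :: point
  by (simp add: inner_vec_def sum_2)

text \<open>\<open>area2\<close> is twice the signed area. Replacing one vertex by \<open>x\<close>
  and dividing by \<open>area2 a b c\<close> gives a barycentric coordinate of \<open>x\<close>, and
  these sum to one.\<close>

lemma area2_sum: "area2 x b c + area2 a x c + area2 a b x = area2 a b c"
  by (simp add: area2_def algebra_simps)

lemma area2_param:
  "area2 (a + t *\<^sub>R (b - a) + s *\<^sub>R (c - a)) b c = (1 - t - s) * area2 a b c"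
  "area2 a (a + t *\<^sub>R (b - a) + s *\<^sub>R (c - a)) c = t * area2 a b c"
  "area2 a b (a + t *\<^sub>R (b - a) + s *\<^sub>R (c - a)) = s * area2 a b c"
  by (simp_all add: area2_def algebra_simps)

text \<open>Cramer's rule for the two edge vectors at \<open>a\<close>.\<close>

lemma bary_point:
  assumes "area2 a b c \<noteq> 0"
  shows "x = a + (area2 a x c / area2 a b c) *\<^sub>R (b - a) + (area2 a b x / area2 a b c) *\<^sub>R (c - a)"
proof -
  have alg: "X1 = (X1 * C2 - X2 * C1) / d * B1 + (B1 * X2 - B2 * X1) / d * C1"
    "X2 = (X1 * C2 - X2 * C1) / d * B2 + (B1 * X2 - B2 * X1) / d * C2"
    if "d \<noteq> 0" "d = B1 * C2 - B2 * C1" for d X1 X2 B1 B2 C1 C2 :: real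
    using that by (simp add: divide_simps, simp add: algebra_simps)+
  have "x - a = (area2 a x c / area2 a b c) *\<^sub>R (b - a) + (area2 a b x / area2 a b c) *\<^sub>R (c - a)"
    using alg(1)[OF assms area2_def[of a b c], of "(x-a)$1" "(x-a)$2"]
      alg(2)[OF assms area2_def[of a b c], of "(x-a)$2" "(x-a)$1"]
    by (simp add: vec_eq_iff forall_2 area2_def[of a x c] area2_def[of a b x])
  then show ?thesis by (simp add: algebra_simps)
qed

text \<open>The quotients are the barycentric coordinates; dividing by the signed area makes the
  test independent of the orientation of the vertices.\<close>

lemma mem_triangle:
  assumes D: "area2 a b c \<noteq> 0"
  shows "x \<in> convex hull {a,b,c} \<longleftrightarrow>
    0 \<le> area2 x b c / area2 a b c \<and> 0 \<le> area2 a x c / area2 a b c \<and> 0 \<le> area2 a b x / area2 a b c"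
proof
  assume "x \<in> convex hull {a,b,c}"
  then obtain t s where x: "x = a + t *\<^sub>R (b - a) + s *\<^sub>R (c - a)" and ts: "0 \<le> t" "0 \<le> s" "t + s \<le> 1"
    by (auto simp: convex_hull_3_param)
  show "0 \<le> area2 x b c / area2 a b c \<and> 0 \<le> area2 a x c / area2 a b c \<and> 0 \<le> area2 a b x / area2 a b c"
    unfolding x area2_param using D ts by simp
next
  assume *: "0 \<le> area2 x b c / area2 a b c \<and> 0 \<le> area2 a x c / area2 a b c \<and> 0 \<le> area2 a b x / area2 a b c"
  have "area2 x b c / area2 a b c + area2 a x c / area2 a b c + area2 a b x / area2 a b c = 1"
    using D unfolding add_divide_distrib[symmetric] area2_sum by simp
  with * have "area2 a x c / area2 a b c + area2 a b x / area2 a b c \<le> 1" by linarith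
  with * bary_point[OF D, of x] show "x \<in> convex hull {a,b,c}"
    unfolding convex_hull_3_param by blast
qed

lemma collinear_area2: "collinear {a, b, c} \<longleftrightarrow> area2 a b c = 0"
proof
  assume "collinear {a, b, c}"
  then have "collinear {0, a - b, c - b}" by (subst (asm) collinear_3) auto
  then consider "a = b" | "c = b" | k where "c - b = k *\<^sub>R (a - b)"
    by (auto simp: collinear_lemma)
  then show "area2 a b c = 0"
  proof cases
    case 3
    then have c: "c = b + k *\<^sub>R (a - b)" by (simp add: algebra_simps)
    show ?thesis unfolding c by (simp add: area2_def algebra_simps)
  qed (auto simp: area2_def)
next
  assume z: "area2 a b c = 0"
  define d where "d = a - b" define e where "e = c - b"
  have cr: "e$1 * d$2 = e$2 * d$1" using z by (simp add: area2_def d_def e_def algebra_simps)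
  have "d = 0 \<or> (\<exists>k. e = k *\<^sub>R d)"
  proof (cases "d = 0")
    case False
    then have dd: "d \<bullet> d \<noteq> 0" by simp
    have "(d \<bullet> d) *\<^sub>R e = (e \<bullet> d) *\<^sub>R d"
      using cr unfolding vec_eq_iff forall_2 inner_2 by (simp add: algebra_simps)
    then have "e = ((e \<bullet> d) / (d \<bullet> d)) *\<^sub>R d"
      using dd by (metis divideR_right divide_inverse_commute scaleR_scaleR)
    then show ?thesis by blast
  qed simp
  then have "collinear {0, a - b, c - b}" by (auto simp: collinear_lemma d_def e_def)
  then show "collinear {a, b, c}" by (subst collinear_3) auto
qed

lemma triangle_independent:
  assumes "area2 a b c \<noteq> 0"
  shows "\<not> affine_dependent {a, b, c}" "a \<noteq> b" "b \<noteq> c" "a \<noteq> c"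
  using assms collinear_area2[of a b c] collinear_3_eq_affine_dependent[of a b c] by auto

lemma simplex2E:
  assumes "2 simplex T"
  obtains a b c where "area2 a b c \<noteq> 0" "T = convex hull {a,b,c}"
proof -
  obtain C where C: "\<not> affine_dependent C" "int (card C) = 2 + 1" "T = convex hull C"
    using assms unfolding simplex_def by blast
  then have "card C = 3" by simp
  then obtain a b c where abc: "C = {a,b,c}" "a \<noteq> b" "b \<noteq> c" "a \<noteq> c" by (auto simp: card_3_iff)
  then have "area2 a b c \<noteq> 0" using C(1) collinear_area2[of a b c] collinear_3_eq_affine_dependent[of a b c] by auto
  then show ?thesis using that C(3) abc(1) by blast
qed

lemma vertices_triangle:
  assumes "area2 a b c \<noteq> 0"
  shows "vertices (convex hull {a,b,c}) = {a,b,c}"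
  using extreme_point_of_convex_hull_affine_independent[OF triangle_independent(1)[OF assms]]
  by (auto simp: vertices_def)

lemma edges_triangle:
  assumes "area2 a b c \<noteq> 0"
  shows "edges (convex hull {a,b,c}) = {closed_segment b c, closed_segment c a, closed_segment a b}"
proof -
  note I = triangle_independent[OF assms]
  have d3: "aff_dim {a,b,c} = 2"
    using aff_dim_affine_independent[OF I(1)] I by simp
  have "edges (convex hull {a,b,c}) = {F. \<exists>c'\<in>Pow {a,b,c}. F = convex hull c' \<and> aff_dim c' = 1}"
    unfolding edges_def edge_of_def face_of_convex_hull_affine_independent[OF I(1)]
    by (auto simp: aff_dim_convex_hull)
  also have "\<dots> = {convex hull {b,c}, convex hull {c,a}, convex hull {a,b}}"
    using I d3 by (auto simp: Pow_insert aff_dim_2 insert_commute)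
  finally show ?thesis by (simp add: segment_convex_hull)
qed

text \<open>Cyclic relabelling: every edge may be taken as the side opposite to the first
  vertex.\<close>

lemma edgeE:
  assumes "2 simplex T" "F \<in> edges T"
  obtains a b c where "area2 a b c \<noteq> 0" "T = convex hull {a,b,c}" "F = closed_segment b c"
proof -
  obtain a b c where D: "area2 a b c \<noteq> 0" and T: "T = convex hull {a,b,c}"
    using simplex2E[OF assms(1)] .
  have perm: "area2 b c a \<noteq> 0" "area2 c a b \<noteq> 0" using D abs_area2_perm[of a b c] by auto
  have perm': "T = convex hull {b,c,a}" "T = convex hull {c,a,b}" by (simp_all add: T insert_commute)
  from assms(2) T edges_triangle[OF D] have "F = closed_segment b c \<or> F = closed_segment c a \<or> F = closed_segment a b" by auto
  then show ?thesis using that D T perm perm' by metis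
qed

lemma edges_finite: "2 simplex T \<Longrightarrow> finite (edges T)" and card_edges: "2 simplex T \<Longrightarrow> card (edges T) \<le> 3"
proof -
  assume "2 simplex T"
  then obtain a b c where D: "area2 a b c \<noteq> 0" and T: "T = convex hull {a,b,c}" using simplex2E by blast
  show "finite (edges T)" unfolding T edges_triangle[OF D] by simp
  show "card (edges T) \<le> 3" unfolding T edges_triangle[OF D] by (auto simp: card_insert_if)
qed

text \<open>Proper faces drop the dimension, and no integer lies strictly between one and
  two.\<close>

lemma edge_maximal:
  assumes K: "2 simplex K" and F: "F \<in> edges K" and G: "G face_of K" and sub: "F \<subseteq> G"
  shows "G = F \<or> G = K"
proof (rule ccontr)
  assume n: "\<not> (G = F \<or> G = K)"
  have FK: "F face_of K" "aff_dim F = 1" using F by (auto simp: edges_def edge_of_def)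
  have cK: "convex K" using K by (rule convex_simplex)
  have cG: "convex G" using G by (rule face_of_imp_convex)
  have "F face_of G" using FK(1) sub G by (meson face_of_imp_subset face_of_subset)
  then have "aff_dim F < aff_dim G" using n cG by (intro face_of_aff_dim_lt) auto
  moreover have "aff_dim G < aff_dim K" using G n cK by (intro face_of_aff_dim_lt) auto
  ultimately show False using FK aff_dim_simplex[OF K] by simp
qed

section \<open>Metric geometry of triangles: inballs, heights, discs around edge midpoints\<close>

lemma dist_le_diameter:
  assumes "p \<in> {a,b,c}" "q \<in> {a,b,c}"
  shows "dist p q \<le> diameter (convex hull {a,b,c :: point})"
  using assms hull_subset[of "{a,b,c}" convex]
  by (intro diameter_bounded_bound compact_imp_bounded compact_triangle) auto

lemma area2_shift: "area2 (x + h) b c - area2 x b c = h$1 * (b$2 - c$2) + h$2 * (c$1 - b$1)"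
  by (simp add: area2_def algebra_simps)

text \<open>The increment is the inner product of \<open>x - y\<close> with the side
  \<open>b\<close>, \<open>c\<close> turned by a right angle.\<close>

lemma area2_lipschitz: "\<bar>area2 x b c - area2 y b c\<bar> \<le> dist x y * dist b c"
proof -
  define h where "h = x - y"
  have "area2 x b c - area2 y b c = h \<bullet> vector [b$2 - c$2, c$1 - b$1]"
    using area2_shift[of y h b c] by (simp add: h_def inner_2)
  also have "\<bar>\<dots>\<bar> \<le> norm h * norm (vector [b$2 - c$2, c$1 - b$1] :: point)" by (rule Cauchy_Schwarz_ineq2)
  also have "norm (vector [b$2 - c$2, c$1 - b$1] :: point) = norm (b - c)"
    by (simp add: norm_eq_sqrt_inner inner_2 algebra_simps)
  finally show ?thesis by (simp add: h_def dist_norm)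
qed

lemma area2_cyclic: "area2 a b c = area2 b c a" "area2 a b c = area2 c a b"
  by (simp_all add: area2_def algebra_simps)

text \<open>Moving from \<open>z\<close> by \<open>r\<close> in both directions normal to the side
  changes the barycentric coordinate of \<open>a\<close> by
  \<open>2 * r * dist b c / \<bar>area2 a b c\<bar>\<close> in total, and inside the triangle this
  coordinate stays between zero and one.\<close>

lemma inball_height:
  assumes D: "area2 a b c \<noteq> 0" and ball: "cball z r \<subseteq> convex hull {a,b,c}" and r: "r > 0"
  shows "2 * r * dist b c \<le> \<bar>area2 a b c\<bar>"
proof -
  have bc: "b \<noteq> c" using triangle_independent[OF D] by auto
  define n :: point where "n = vector [b$2 - c$2, c$1 - b$1]"
  have nn: "norm n = dist b c"
    by (simp add: n_def norm_eq_sqrt_inner inner_2 dist_norm algebra_simps)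
  define h where "h = (r / dist b c) *\<^sub>R n"
  have hn: "norm h = r" using r bc by (simp add: h_def nn)
  have in1: "z + h \<in> convex hull {a,b,c}" "z - h \<in> convex hull {a,b,c}"
    using ball hn by (auto simp: subset_iff dist_norm)
  have le1: "area2 x b c / area2 a b c \<le> 1" if "x \<in> convex hull {a,b,c}" for x
  proof -
    have "area2 x b c / area2 a b c + area2 a x c / area2 a b c + area2 a b x / area2 a b c = 1"
      using D unfolding add_divide_distrib[symmetric] area2_sum by simp
    then show ?thesis using that unfolding mem_triangle[OF D] by linarith
  qed
  have ge0: "0 \<le> area2 x b c / area2 a b c" if "x \<in> convex hull {a,b,c}" for x
    using that unfolding mem_triangle[OF D] by blast
  have "area2 (z + h) b c - area2 z b c = h \<bullet> n" "area2 (z + (-h)) b c - area2 z b c = - (h \<bullet> n)"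
    unfolding area2_shift by (simp_all add: inner_2 n_def)
  moreover have "h \<bullet> n = r * dist b c"
    using bc by (simp add: h_def power2_norm_eq_inner[symmetric] nn power2_eq_square)
  ultimately have "area2 (z + h) b c - area2 (z - h) b c = 2 * r * dist b c" by simp
  then have "\<bar>2 * r * dist b c / area2 a b c\<bar> = \<bar>area2 (z + h) b c / area2 a b c - area2 (z - h) b c / area2 a b c\<bar>"
    by (simp add: diff_divide_distrib[symmetric])
  also have "\<dots> \<le> 1" using in1 le1 ge0 by (smt (verit))
  finally have "\<bar>2 * r * dist b c\<bar> \<le> \<bar>area2 a b c\<bar>" using D by (simp add: abs_divide divide_simps)
  then show ?thesis using r by simp
qed

text \<open>The height over the side \<open>c\<close>, \<open>a\<close> is at least the inball
  diameter and at most the length of the edge \<open>b\<close>, \<open>c\<close> that reaches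
  it.\<close>

lemma inball_edge:
  assumes D: "area2 a b c \<noteq> 0" and ball: "cball z r \<subseteq> convex hull {a,b,c}" and r: "r > 0"
  shows "2 * r \<le> dist b c"
proof -
  have D': "area2 b c a \<noteq> 0" and hull: "convex hull {a,b,c} = convex hull {b,c,a}"
    using D by (simp_all add: area2_cyclic insert_commute)
  have h: "2 * r * dist c a \<le> \<bar>area2 b c a\<bar>" using inball_height[OF D' _ r] ball hull by metis
  have "\<bar>area2 b c a - area2 c c a\<bar> \<le> dist b c * dist c a" by (rule area2_lipschitz)
  moreover have "area2 c c a = 0" by (simp add: area2_def)
  ultimately have "2 * r * dist c a \<le> dist b c * dist c a" using h by simp
  then show ?thesis using triangle_independent(4)[OF D] by simp
qed

text \<open>At the midpoint of \<open>b\<close>, \<open>c\<close> the coordinates of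
  \<open>b\<close> and \<open>c\<close> are 1/2, and they vary with slope at most the diameter over
  \<open>\<bar>area2 a b c\<bar>\<close>. Within the given radius they remain nonnegative, and only
  the side of the edge decides.\<close>

lemma midpoint_disc:
  assumes D: "area2 a b c \<noteq> 0" and x: "dist x (midpoint b c) * diameter (convex hull {a,b,c}) \<le> \<bar>area2 a b c\<bar> / 2"
    and side: "0 \<le> area2 x b c / area2 a b c"
  shows "x \<in> convex hull {a,b,c}"
proof -
  let ?m = "midpoint b c" and ?h = "diameter (convex hull {a,b,c})"
  have mb: "area2 a ?m c = area2 a b c / 2" "area2 a b ?m = area2 a b c / 2"
  proof -
    have m: "?m = a + (1/2) *\<^sub>R (b - a) + (1/2) *\<^sub>R (c - a)"
      by (simp add: midpoint_def vec_eq_iff forall_2 field_simps)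
    show "area2 a ?m c = area2 a b c / 2" "area2 a b ?m = area2 a b c / 2" unfolding m area2_param by simp_all
  qed
  have nn: "0 \<le> area2 a y c / area2 a b c" if "\<bar>area2 a y c - area2 a b c / 2\<bar> \<le> \<bar>area2 a b c\<bar> / 2" for y
    using that D by (cases "area2 a b c > 0") (auto simp: abs_if divide_simps split: if_splits)
  have nn2: "0 \<le> area2 a b y / area2 a b c" if "\<bar>area2 a b y - area2 a b c / 2\<bar> \<le> \<bar>area2 a b c\<bar> / 2" for y
    using that D by (cases "area2 a b c > 0") (auto simp: abs_if divide_simps split: if_splits)
  have "\<bar>area2 a x c - area2 a ?m c\<bar> = \<bar>area2 x c a - area2 ?m c a\<bar>" by (simp add: area2_cyclic(1)[of a])
  also have "\<dots> \<le> dist x ?m * dist c a" by (rule area2_lipschitz)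
  also have "\<dots> \<le> dist x ?m * ?h" by (intro mult_left_mono dist_le_diameter) auto
  finally have 1: "0 \<le> area2 a x c / area2 a b c" using x by (intro nn) (simp add: mb)
  have "\<bar>area2 a b x - area2 a b ?m\<bar> = \<bar>area2 x a b - area2 ?m a b\<bar>" by (simp add: area2_cyclic(2)[of a])
  also have "\<dots> \<le> dist x ?m * dist a b" by (rule area2_lipschitz)
  also have "\<dots> \<le> dist x ?m * ?h" by (intro mult_left_mono dist_le_diameter) auto
  finally have 2: "0 \<le> area2 a b x / area2 a b c" using x by (intro nn2) (simp add: mb)
  show ?thesis unfolding mem_triangle[OF D] using 1 2 side by blast
qed

text \<open>With both apexes on the same side, a point slightly off the midpoint of the edge towards
  \<open>a\<close> would lie in both triangles but not on the common edge.\<close>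

lemma opposite_sides:
  assumes D: "area2 a b c \<noteq> 0" and D': "area2 a' b c \<noteq> 0"
    and int: "convex hull {a,b,c} \<inter> convex hull {a',b,c} = closed_segment b c"
  shows "area2 a b c * area2 a' b c < 0"
proof (rule ccontr)
  assume "\<not> ?thesis"
  then have pos: "area2 a b c * area2 a' b c > 0" using D D' by (simp add: not_less order_less_le)
  let ?m = "midpoint b c"
  define h where "h = diameter (convex hull {a',b,c})"
  have hp: "h > 0" using dist_le_diameter[of b a' b c c] triangle_independent(3)[OF D] unfolding h_def
    by (smt (verit) insertCI zero_less_dist_iff)
  have am: "dist a ?m > 0"
  proof -
    have "area2 ?m b c = 0" by (simp add: area2_def midpoint_def algebra_simps)
    then show ?thesis using D by (metis zero_less_dist_iff)
  qed
  \<comment> \<open>The second bound puts the point \<open>x\<close> below into the range of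
    \<open>midpoint_disc\<close> for the other triangle.\<close>
  define \<epsilon> where "\<epsilon> = min 1 (\<bar>area2 a' b c\<bar> / (2 * h * dist a ?m))"
  have e: "0 < \<epsilon>" "\<epsilon> \<le> 1" using hp am D' by (auto simp: \<epsilon>_def)
  define x where "x = ?m + \<epsilon> *\<^sub>R (a - ?m)"
  have xb: "area2 x b c = \<epsilon> * area2 a b c" by (simp add: x_def area2_def midpoint_def algebra_simps)
  have "x = (1 - \<epsilon>) *\<^sub>R ?m + \<epsilon> *\<^sub>R a" by (simp add: x_def algebra_simps)
  moreover have "?m \<in> convex hull {a,b,c}"
    by (rule subsetD[OF hull_mono[of "{b,c}"]]) (auto simp: segment_convex_hull[symmetric])
  moreover have "a \<in> convex hull {a,b,c}" by (simp add: hull_inc)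
  ultimately have x1: "x \<in> convex hull {a,b,c}"
    using e convexD_alt[OF convex_convex_hull] by (metis less_imp_le)
  have "dist x ?m = \<epsilon> * dist a ?m" using e by (simp add: x_def dist_norm)
  also have "\<dots> \<le> (\<bar>area2 a' b c\<bar> / (2 * h * dist a ?m)) * dist a ?m"
    by (intro mult_right_mono) (auto simp: \<epsilon>_def)
  also have "\<dots> = \<bar>area2 a' b c\<bar> / (2 * h)" using am by simp
  finally have "dist x ?m * h \<le> \<bar>area2 a' b c\<bar> / 2" using hp by (simp add: field_simps)
  moreover have "0 \<le> area2 x b c / area2 a' b c"
    using pos e unfolding xb by (auto simp: zero_le_divide_iff zero_le_mult_iff zero_less_mult_iff mult_le_0_iff)
  ultimately have x2: "x \<in> convex hull {a',b,c}" by (intro midpoint_disc[OF D']) (auto simp: h_def)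
  have "x \<in> closed_segment b c" using x1 x2 int by blast
  then obtain u where u: "x = (1 - u) *\<^sub>R b + u *\<^sub>R c" by (auto simp: closed_segment_def)
  have "area2 x b c = 0" unfolding u by (simp add: area2_def algebra_simps)
  then show False using xb e D by simp
qed

text \<open>Excludes slits and punctures. Below a boundary point the Lipschitz graph leaves a whole
  ball outside \<Omega>, so the point cannot be interior to the closure. A triangulation covers the
  closure, and this leads back to \<Omega>.\<close>

lemma Lipschitz_domain_interior_closure:
  assumes "Lipschitz_domain \<Omega>"
  shows "interior (closure \<Omega>) \<subseteq> \<Omega>"
proof
  fix x assume x: "x \<in> interior (closure \<Omega>)"
  have op: "open \<Omega>" using assms by (simp add: Lipschitz_domain_def)
  show "x \<in> \<Omega>"
  proof (rule ccontr)
    assume nx: "x \<notin> \<Omega>"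
    then have "x \<in> frontier \<Omega>" using x op interior_subset by (auto simp: frontier_def interior_open)
    then obtain e n L \<gamma> r where r: "r > 0" and en: "norm e = 1" "norm n = 1" "e \<bullet> n = 0"
      and lip: "L-lipschitz_on UNIV \<gamma>" and epi: "\<And>y. y \<in> ball x r \<Longrightarrow> y \<in> \<Omega> \<longleftrightarrow> \<gamma> (e \<bullet> y) < n \<bullet> y"
      using assms unfolding Lipschitz_domain_def by blast
    have L: "0 \<le> L" using lip by (rule lipschitz_on_nonneg)
    obtain \<epsilon> where \<epsilon>: "\<epsilon> > 0" "ball x \<epsilon> \<subseteq> interior (closure \<Omega>)"
      using x open_interior open_contains_ball by blast
    define s where "s = min \<epsilon> r / 2"
    have s: "0 < s" "s < \<epsilon>" "s \<le> r / 2" using r \<epsilon> by (auto simp: s_def)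
    define y where "y = x - s *\<^sub>R n"
    have "dist x y = s" using s en by (simp add: y_def dist_norm)
    then have "y \<in> closure \<Omega>" using \<epsilon> s interior_subset by (metis mem_ball subsetD)
    have L1: "1 + L > 0" using L by linarith
    \<comment> \<open>Moving by \<delta> costs at most \<delta> in direction \<open>n\<close> and
      \<open>L * \<delta>\<close> along the graph; the sum is half of the drop
      \<open>s\<close>.\<close>
    define \<delta> where "\<delta> = inverse (1 + L) * (s / 2)"
    have \<delta>: "0 < \<delta>" "(1 + L) * \<delta> = s / 2"
      using s L1 by (auto simp: \<delta>_def mult.assoc[symmetric] simp del: distrib_right distrib_left)
    obtain w where w: "w \<in> \<Omega>" "dist w y < \<delta>" using \<open>y \<in> closure \<Omega>\<close> \<delta>(1) closure_approachable by blast
    have "1 * \<delta> \<le> (1 + L) * \<delta>" using L \<delta>(1) by (intro mult_right_mono) auto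
    then have "\<delta> \<le> s / 2" using \<delta> by simp
    have "dist x w < r"
      using dist_triangle[of x w y] \<open>dist x y = s\<close> w(2) \<open>\<delta> \<le> s / 2\<close> s by (simp add: dist_commute)
    then have 1: "\<gamma> (e \<bullet> w) < n \<bullet> w" using epi[of w] w(1) by simp
    have 2: "\<not> \<gamma> (e \<bullet> x) < n \<bullet> x" using epi[of x] nx r by simp
    have in1: "\<bar>v \<bullet> w - v \<bullet> y\<bar> \<le> dist w y" if "norm v = 1" for v
      using Cauchy_Schwarz_ineq2[of v "w - y"] that by (simp add: dist_norm inner_diff_right)
    have ey: "e \<bullet> y = e \<bullet> x" "n \<bullet> y = n \<bullet> x - s"
      using en by (simp_all add: y_def inner_diff_right power2_norm_eq_inner[symmetric])
    have "dist (\<gamma> (e \<bullet> w)) (\<gamma> (e \<bullet> x)) \<le> L * dist (e \<bullet> w) (e \<bullet> x)"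
      using lip by (rule lipschitz_onD) auto
    also have "\<dots> \<le> L * \<delta>"
      using in1[OF en(1)] w(2) ey L by (intro mult_left_mono) (auto simp: dist_real_def)
    finally have "\<gamma> (e \<bullet> x) - L * \<delta> \<le> \<gamma> (e \<bullet> w)" by (simp add: dist_real_def abs_if split: if_splits)
    moreover have "n \<bullet> w \<le> n \<bullet> x - s + \<delta>" using in1[OF en(2)] w(2) ey by (auto simp: abs_if split: if_splits)
    ultimately have "s < (1 + L) * \<delta>" using 1 2 by (simp add: algebra_simps)
    then show False using \<delta>(2) s(1) by simp
  qed
qed

section \<open>Triangulations\<close>

text \<open>Completeness of Lebesgue measure, so measurability of \<open>g\<close> comes for free.
  This serves functions made by \<open>glue\<close>, whose values on edges depend on an arbitrary
  choice.\<close>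

lemma measurable_cong_AE_on:
  fixes f g :: "'a::euclidean_space \<Rightarrow> 'b::euclidean_space"
  assumes S: "S \<in> sets lebesgue" and f: "f \<in> borel_measurable (lebesgue_on S)" and ae: "AE x in lebesgue_on S. f x = g x"
  shows "g \<in> borel_measurable (lebesgue_on S)"
proof -
  have 1: "(\<lambda>x. if x \<in> S then f x else 0) \<in> borel_measurable lebesgue"
    using f S by (simp add: borel_measurable_if)
  have ae': "AE x in lebesgue. x \<in> S \<longrightarrow> f x = g x" using ae S by (simp add: AE_restrict_space_iff)
  have "AE x in lebesgue. (if x \<in> S then f x else 0) = (if x \<in> S then g x else 0)"
    using ae' by eventually_elim auto
  from borel_measurable_AE[OF 1 this] show ?thesis using S by (simp add: borel_measurable_if)
qed

lemma L2_cong_AE_on: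
  fixes f g :: "point \<Rightarrow> 'b::euclidean_space"
  assumes S: "S \<in> sets lebesgue" and f: "f \<in> L2 S" and ae: "AE x in lebesgue_on S. f x = g x"
  shows "g \<in> L2 S"
  by (rule L2_cong_AE[OF ae f measurable_cong_AE_on[OF S L2_measurable[OF f] ae]])

text \<open>Allows passing between a triangle and its interior, and between \<Omega> and its
  closure, which differ by null sets.\<close>

lemma null_extension:
  fixes f :: "'a::euclidean_space \<Rightarrow> 'b::euclidean_space"
  assumes S: "S \<in> sets lebesgue" "S \<subseteq> S'" "negligible (S' - S)"
  shows null_extension_sets: "S' \<in> sets lebesgue"
    and null_extension_AE: "(AE x in lebesgue_on S'. P x) \<longleftrightarrow> (AE x in lebesgue_on S. P x)"
    and null_extension_measurable: "f \<in> borel_measurable (lebesgue_on S') \<longleftrightarrow> f \<in> borel_measurable (lebesgue_on S)"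
proof -
  have n: "S' - S \<in> null_sets lebesgue" using S(3) by (simp add: negligible_iff_null_sets)
  then have "S \<union> (S' - S) \<in> sets lebesgue" using S(1) null_setsD2 by (intro sets.Un) auto
  also have "S \<union> (S' - S) = S'" using S(2) by auto
  finally show S': "S' \<in> sets lebesgue" .
  have ae: "AE x in lebesgue. x \<notin> S' - S" by (rule AE_not_in[OF n])
  show "(AE x in lebesgue_on S'. P x) \<longleftrightarrow> (AE x in lebesgue_on S. P x)"
  proof -
    have "(AE x in lebesgue. x \<in> S' \<longrightarrow> P x) \<longleftrightarrow> (AE x in lebesgue. x \<in> S \<longrightarrow> P x)"
    proof
      assume "AE x in lebesgue. x \<in> S' \<longrightarrow> P x"
      then show "AE x in lebesgue. x \<in> S \<longrightarrow> P x" by eventually_elim (use S(2) in auto)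
    next
      assume "AE x in lebesgue. x \<in> S \<longrightarrow> P x"
      with ae show "AE x in lebesgue. x \<in> S' \<longrightarrow> P x" by eventually_elim auto
    qed
    then show ?thesis using S(1) S' by (simp add: AE_restrict_space_iff)
  qed
  have e: "AE x in lebesgue. (if x \<in> S then f x else 0) = (if x \<in> S' then f x else 0)"
    using ae by eventually_elim (use S(2) in auto)
  have e': "AE x in lebesgue. (if x \<in> S' then f x else 0) = (if x \<in> S then f x else 0)"
    using e by eventually_elim simp
  show "f \<in> borel_measurable (lebesgue_on S') \<longleftrightarrow> f \<in> borel_measurable (lebesgue_on S)"
    using borel_measurable_AE[OF _ e] borel_measurable_AE[OF _ e']
      borel_measurable_if[OF S(1), of f] borel_measurable_if[OF S', of f] by blast
qed

lemma null_extension_integral: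
  fixes f :: "'a::euclidean_space \<Rightarrow> real"
  assumes S: "S \<in> sets lebesgue" "S \<subseteq> S'" "negligible (S' - S)"
  shows "integrable (lebesgue_on S') f \<longleftrightarrow> integrable (lebesgue_on S) f"
    and "(LINT x|lebesgue_on S'. f x) = (LINT x|lebesgue_on S. f x)"
proof -
  note S' = null_extension_sets[OF S]
  have n: "S' - S \<in> null_sets lebesgue" using S(3) by (simp add: negligible_iff_null_sets)
  have ae: "AE x in lebesgue. indicator S' x * f x = indicator S x * f x"
    using AE_not_in[OF n] by eventually_elim (use S(2) in \<open>auto simp: indicator_def\<close>)
  have ae': "AE x in lebesgue. indicator S x * f x = indicator S' x * f x"
    using ae by eventually_elim (rule sym)
  show "integrable (lebesgue_on S') f \<longleftrightarrow> integrable (lebesgue_on S) f"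
    unfolding restrict_integral(1)[OF S'] restrict_integral(1)[OF S(1)]
  proof
    assume *: "integrable lebesgue (\<lambda>x. indicator S' x * f x)"
    show "integrable lebesgue (\<lambda>x. indicator S x * f x)"
      by (rule integrable_cong_AE_imp[OF * borel_measurable_AE[OF borel_measurable_integrable[OF *] ae] ae])
  next
    assume *: "integrable lebesgue (\<lambda>x. indicator S x * f x)"
    show "integrable lebesgue (\<lambda>x. indicator S' x * f x)"
      by (rule integrable_cong_AE_imp[OF * borel_measurable_AE[OF borel_measurable_integrable[OF *] ae'] ae'])
  qed
  show "(LINT x|lebesgue_on S'. f x) = (LINT x|lebesgue_on S. f x)"
  proof (cases "f \<in> borel_measurable (lebesgue_on S)")
    case True
    then have "f \<in> borel_measurable (lebesgue_on S')" using null_extension_measurable[OF S, of f] by simp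
    then have m: "(\<lambda>x. indicator S' x * f x) \<in> borel_measurable lebesgue" "(\<lambda>x. indicator S x * f x) \<in> borel_measurable lebesgue"
      using True S(1) S' by (simp_all add: borel_measurable_restrict_space_iff)
    show ?thesis unfolding restrict_integral(2)[OF S'] restrict_integral(2)[OF S(1)]
      by (rule integral_cong_AE[OF m ae])
  next
    case False
    then have "f \<notin> borel_measurable (lebesgue_on S')" using null_extension_measurable[OF S, of f] by simp
    then show ?thesis using False by (metis borel_measurable_integrable not_integrable_integral_eq)
  qed
qed

lemma null_extension_L2:
  fixes f :: "point \<Rightarrow> 'b::euclidean_space"
  assumes S: "S \<in> sets lebesgue" "S \<subseteq> S'" "negligible (S' - S)"
  shows "f \<in> L2 S' \<longleftrightarrow> f \<in> L2 S" "L2norm S' f = L2norm S f"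
  by (simp_all add: L2_def L2norm_def null_extension_measurable[OF S] null_extension_integral[OF S])

text \<open>The Lipschitz boundary enters the mesh arguments through \<open>int_closure\<close>: it
  places the interiors of triangles in \<Omega>.\<close>

locale mesh = bounded_open \<Omega> for \<Omega> +
  fixes \<T> :: mesh
  assumes reg: "regular_triangulation \<Omega> \<T>" and int_closure: "interior (closure \<Omega>) \<subseteq> \<Omega>"
begin

lemma fin: "finite \<T>" and simp2: "T \<in> \<T> \<Longrightarrow> 2 simplex T" and Un: "\<Union>\<T> = closure \<Omega>"
  and inter: "T \<in> \<T> \<Longrightarrow> T' \<in> \<T> \<Longrightarrow> T \<inter> T' face_of T"
  using reg by (auto simp: regular_triangulation_def triangulation_def)

lemma mesh_maximal: "T \<in> \<T> \<Longrightarrow> T' \<in> \<T> \<Longrightarrow> T \<subseteq> T' \<Longrightarrow> T = T'"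
proof (rule ccontr)
  assume a: "T \<in> \<T>" "T' \<in> \<T>" "T \<subseteq> T'" "T \<noteq> T'"
  then have "T face_of T'" using inter[OF a(2,1)] by (simp add: Int_absorb1)
  then have "aff_dim T < aff_dim T'" using a convex_simplex[OF simp2[OF a(2)]] by (intro face_of_aff_dim_lt) auto
  then show False using aff_dim_simplex[OF simp2[OF a(1)]] aff_dim_simplex[OF simp2[OF a(2)]] by simp
qed

text \<open>The intersection is a face of \<open>K\<close> containing the edge, hence the edge or
  all of \<open>K\<close>; the latter contradicts \<open>mesh_maximal\<close>.\<close>

lemma shared_edge:
  assumes "K \<in> \<T>" "K' \<in> \<T>" "K \<noteq> K'" "F \<in> edges K" "F \<subseteq> K'"
  shows "K \<inter> K' = F" "F \<in> edges K'"
proof -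
  have F: "F face_of K" "aff_dim F = 1" using assms(4) by (auto simp: edges_def edge_of_def)
  have "F \<subseteq> K \<inter> K'" using assms face_of_imp_subset[OF F(1)] by auto
  from edge_maximal[OF simp2[OF assms(1)] assms(4) inter[OF assms(1,2)] this]
  show "K \<inter> K' = F" using mesh_maximal[OF assms(1,2)] assms(3) by blast
  then have "F face_of K'" using inter[OF assms(2,1)] by (simp add: Int_commute)
  then show "F \<in> edges K'" using F by (simp add: edges_def edge_of_def)
qed

lemma Tplus:
  assumes "F \<in> faces \<T>"
  shows "Tplus \<T> F \<in> \<T>" "F \<in> edges (Tplus \<T> F)"
proof -
  have "\<exists>K. K \<in> \<T> \<and> F \<in> edges K" using assms by (auto simp: faces_def)
  from someI_ex[OF this] show "Tplus \<T> F \<in> \<T>" "F \<in> edges (Tplus \<T> F)" by (auto simp: Tplus_def)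
qed

lemma edge_ne: "F \<in> edges K \<Longrightarrow> 2 simplex K \<Longrightarrow> F \<noteq> K"
  using aff_dim_simplex[of 2 K] by (auto simp: edges_def edge_of_def)

lemma edge_subset: "F \<in> edges K \<Longrightarrow> F \<subseteq> K"
  by (auto simp: edges_def edge_of_def dest: face_of_imp_subset)

lemma Tminus:
  assumes F: "F \<in> interior_faces \<T>"
  shows "Tminus \<T> F \<in> \<T>" "F \<in> edges (Tminus \<T> F)" "Tplus \<T> F \<noteq> Tminus \<T> F" "F = Tplus \<T> F \<inter> Tminus \<T> F"
proof -
  have Ff: "F \<in> faces \<T>" using F by (simp add: interior_faces_def)
  note P = Tplus[OF Ff]
  obtain K K' where K: "K \<in> \<T>" "K' \<in> \<T>" "K \<noteq> K'" "F = K \<inter> K'" using F by (auto simp: interior_faces_def)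
  \<comment> \<open>\<open>Tplus\<close> may differ from both triangles that witness the interior
    face; in that case it meets the first of them exactly in \<open>F\<close>.\<close>
  have "\<exists>L. L \<in> \<T> \<and> F = Tplus \<T> F \<inter> L"
  proof (cases "Tplus \<T> F = K")
    case True then show ?thesis using K by blast
  next
    case False
    then show ?thesis using shared_edge(1)[OF P(1) K(1) False P(2)] K by blast
  qed
  from someI_ex[OF this] have M: "Tminus \<T> F \<in> \<T>" "F = Tplus \<T> F \<inter> Tminus \<T> F" by (auto simp: Tminus_def)
  then show "Tminus \<T> F \<in> \<T>" "F = Tplus \<T> F \<inter> Tminus \<T> F" by auto
  show ne: "Tplus \<T> F \<noteq> Tminus \<T> F" using M(2) edge_ne[OF P(2) simp2[OF P(1)]] by auto
  show "F \<in> edges (Tminus \<T> F)" using shared_edge(2)[OF P(1) M(1) ne P(2)] M(2) by blast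
qed

lemma shared_edge_interior:
  assumes "K \<in> \<T>" "K' \<in> \<T>" "K \<noteq> K'" "F \<in> edges K" "F \<in> edges K'"
  shows "F \<in> interior_faces \<T>" "K \<inter> K' = F"
proof -
  show e: "K \<inter> K' = F" using shared_edge(1)[OF assms(1-4)] edge_subset[OF assms(5)] by blast
  show "F \<in> interior_faces \<T>" using assms e by (auto simp: interior_faces_def faces_def)
qed

lemma opposite_apexes:
  assumes "K \<in> \<T>" "K' \<in> \<T>" "K \<noteq> K'" "K = convex hull {a,b,c}" "K' = convex hull {a',b,c}"
    "area2 a b c \<noteq> 0" "area2 a' b c \<noteq> 0"
  shows "area2 a b c * area2 a' b c < 0"
proof -
  have "closed_segment b c \<in> edges K" "closed_segment b c \<in> edges K'"
    unfolding assms(4,5) edges_triangle[OF assms(6)] edges_triangle[OF assms(7)] by auto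
  from shared_edge_interior(2)[OF assms(1-3) this] show ?thesis
    using opposite_sides[OF assms(6,7)] assms(4,5) by simp
qed

text \<open>Brings a triangle into the form opposite to prescribed end points, so that both
  triangles at a face can be written with the same \<open>b\<close> and \<open>c\<close>.\<close>

lemma edge_apex:
  assumes "K \<in> \<T>" "closed_segment b c \<in> edges K"
  obtains a where "area2 a b c \<noteq> 0" "K = convex hull {a,b,c}"
proof -
  obtain a' b' c' where *: "area2 a' b' c' \<noteq> 0" "K = convex hull {a',b',c'}" "closed_segment b c = closed_segment b' c'"
    using edgeE[OF simp2[OF assms(1)] assms(2)] by metis
  then have "{b,c} = {b',c'}" by (simp add: closed_segment_eq)
  then have "(b = b' \<and> c = c') \<or> (b = c' \<and> c = b')" by (auto simp: doubleton_eq_iff)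
  then show ?thesis
  proof
    assume "b = b' \<and> c = c'" then show ?thesis using that[of a'] * by simp
  next
    assume "b = c' \<and> c = b'" then show ?thesis
      using that[of a'] * abs_area2_perm(1)[of a' b' c'] by (auto simp: insert_commute)
  qed
qed

text \<open>A third triangle is impossible: three apexes would lie pairwise on opposite sides of one
  line.\<close>

lemma interior_face_triangles:
  assumes F: "F \<in> interior_faces \<T>"
  shows "{K \<in> \<T>. F \<in> edges K} = {Tplus \<T> F, Tminus \<T> F}"
proof -
  have Ff: "F \<in> faces \<T>" using F by (simp add: interior_faces_def)
  note P = Tplus[OF Ff] and M = Tminus[OF F]
  have "K = Tplus \<T> F \<or> K = Tminus \<T> F" if K: "K \<in> \<T>" "F \<in> edges K" for K
  proof (rule ccontr)
    assume n: "\<not> ?thesis"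
    obtain a b c where 1: "area2 a b c \<noteq> 0" "Tplus \<T> F = convex hull {a,b,c}" "F = closed_segment b c"
      using edgeE[OF simp2[OF P(1)] P(2)] by metis
    obtain a' where 2: "area2 a' b c \<noteq> 0" "Tminus \<T> F = convex hull {a',b,c}"
      using edge_apex[OF M(1)] M(2) 1(3) by metis
    obtain a'' where 3: "area2 a'' b c \<noteq> 0" "K = convex hull {a'',b,c}"
      using edge_apex[OF K(1)] K(2) 1(3) by metis
    have "area2 a b c * area2 a' b c < 0" by (rule opposite_apexes[OF P(1) M(1) M(3) 1(2) 2(2) 1(1) 2(1)])
    moreover have "area2 a b c * area2 a'' b c < 0" using opposite_apexes[OF P(1) K(1) _ 1(2) 3(2) 1(1) 3(1)] n by auto
    moreover have "area2 a' b c * area2 a'' b c < 0" using opposite_apexes[OF M(1) K(1) _ 2(2) 3(2) 2(1) 3(1)] n by auto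
    ultimately show False by (auto simp: mult_less_0_iff)
  qed
  then show ?thesis using P M by auto
qed

lemma boundary_face_triangles:
  assumes F: "F \<in> boundary_faces \<T>" and K: "K \<in> \<T>" "F \<in> edges K"
  shows "K = Tplus \<T> F"
proof (rule ccontr)
  assume n: "K \<noteq> Tplus \<T> F"
  have Ff: "F \<in> faces \<T>" "F \<notin> interior_faces \<T>" using F by (auto simp: boundary_faces_def)
  from shared_edge_interior(1)[OF K(1) Tplus(1)[OF Ff(1)] n K(2) Tplus(2)[OF Ff(1)]] Ff(2) show False by simp
qed

lemma triangle_closed: "K \<in> \<T> \<Longrightarrow> closed K" and triangle_bounded: "K \<in> \<T> \<Longrightarrow> bounded K"
  and triangle_lebesgue [simp]: "K \<in> \<T> \<Longrightarrow> K \<in> sets lebesgue"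
  and triangle_convex: "K \<in> \<T> \<Longrightarrow> convex K" and triangle_subset: "K \<in> \<T> \<Longrightarrow> K \<subseteq> closure \<Omega>"
proof -
  assume K: "K \<in> \<T>"
  obtain a b c where "K = convex hull {a,b,c}" using simplex2E[OF simp2[OF K]] by metis
  then have "compact K" using compact_triangle by simp
  then show "closed K" "bounded K" "K \<in> sets lebesgue"
    by (auto simp: compact_imp_closed compact_imp_bounded lmeasurable_compact fmeasurableD)
  show "convex K" by (rule convex_simplex[OF simp2[OF K]])
  show "K \<subseteq> closure \<Omega>" using K Un by auto
qed

text \<open>A point of \<Omega> in the relative interior of \<open>F\<close> is a limit of points of
  \<Omega> outside \<open>K\<close>. One of the finitely many triangles contains infinitely many of
  them, hence the limit by closedness, hence all of \<open>F\<close> since triangles meet in faces;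
  then \<open>F\<close> would be interior. Openness of \<Omega> settles the end points.\<close>

lemma boundary_face_disjoint:
  assumes F: "F \<in> boundary_faces \<T>"
  shows "F \<inter> \<Omega> = {}"
proof -
  have Ff: "F \<in> faces \<T>" "F \<notin> interior_faces \<T>" using F by (auto simp: boundary_faces_def)
  define K where "K = Tplus \<T> F"
  have K: "K \<in> \<T>" "F \<in> edges K" using Tplus[OF Ff(1)] by (auto simp: K_def)
  obtain a b c where D: "area2 a b c \<noteq> 0" and Kh: "K = convex hull {a,b,c}" and Fs: "F = closed_segment b c"
    using edgeE[OF simp2[OF K(1)] K(2)] by metis
  have "rel_interior F \<inter> \<Omega> = {}"
  proof (rule ccontr)
    assume "rel_interior F \<inter> \<Omega> \<noteq> {}"
    then obtain x where x: "x \<in> rel_interior F" "x \<in> \<Omega>" by blast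
    have xF: "x \<in> F" using x rel_interior_subset by blast
    \<comment> \<open>Points beyond the edge as seen from the apex \<open>a\<close>: their
      coordinate at \<open>a\<close> is negative.\<close>
    define y where "y = (\<lambda>n. x + (1 / real (Suc n)) *\<^sub>R (x - a))"
    have xb: "area2 x b c = 0"
    proof -
      obtain u where u: "x = (1 - u) *\<^sub>R b + u *\<^sub>R c" using xF Fs by (auto simp: closed_segment_def)
      show ?thesis unfolding u by (simp add: area2_def algebra_simps)
    qed
    have yb: "area2 (y n) b c / area2 a b c < 0" for n
    proof -
      have "area2 (y n) b c = area2 x b c + (1 / real (Suc n)) * (area2 x b c - area2 a b c)"
        unfolding y_def by (simp add: area2_def algebra_simps add_divide_distrib diff_divide_distrib)
      then have "area2 (y n) b c / area2 a b c = - (1 / real (Suc n))" using D by (simp add: xb)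
      then show ?thesis by simp
    qed
    have yK: "y n \<notin> K" for n using yb[of n] unfolding Kh mem_triangle[OF D] by linarith
    have lim: "y \<longlonglongrightarrow> x"
    proof -
      have "(\<lambda>n. x + (1 / real (Suc n)) *\<^sub>R (x - a)) \<longlonglongrightarrow> x + 0 *\<^sub>R (x - a)"
        by (intro tendsto_intros LIMSEQ_Suc[OF lim_1_over_n])
      then show ?thesis by (simp add: y_def)
    qed
    have "\<forall>\<^sub>F n in sequentially. y n \<in> \<Omega>" using lim op x(2) by (rule topological_tendstoD)
    then have ev: "\<forall>\<^sub>F n in sequentially. \<exists>K'\<in>\<T>. y n \<in> K'"
      by eventually_elim (use Un closure_subset in blast)
    have "\<exists>K'\<in>\<T>. \<exists>\<^sub>F n in sequentially. y n \<in> K'"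
    proof (rule ccontr)
      assume "\<not> ?thesis"
      then have "\<forall>K'\<in>\<T>. \<forall>\<^sub>F n in sequentially. y n \<notin> K'" by (simp add: not_frequently)
      then have "\<forall>\<^sub>F n in sequentially. \<forall>K'\<in>\<T>. y n \<notin> K'" by (simp add: eventually_ball_finite[OF fin])
      with ev have "\<forall>\<^sub>F n in sequentially. False" by eventually_elim blast
      then show False by simp
    qed
    then obtain K' where K': "K' \<in> \<T>" and fr: "\<exists>\<^sub>F n in sequentially. y n \<in> K'" by blast
    have "x \<in> K'"
    proof (rule ccontr)
      assume "x \<notin> K'"
      then have "\<forall>\<^sub>F n in sequentially. y n \<in> - K'"
        using triangle_closed[OF K'] by (intro topological_tendstoD[OF lim]) auto
      then show False using fr by (simp add: frequently_def)
    qed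
    have ne: "K \<noteq> K'" using fr yK by (auto simp: frequently_def)
    have "F \<subseteq> K \<inter> K'"
      by (rule subset_of_face_of[OF inter[OF K(1) K']]) (use x(1) xF \<open>x \<in> K'\<close> edge_subset[OF K(2)] in auto)
    then have "F \<in> edges K'" using shared_edge(2)[OF K(1) K' ne K(2)] by blast
    then show False using shared_edge_interior(1)[OF K(1) K' ne K(2)] Ff(2) by blast
  qed
  then have "\<Omega> \<inter> closure (rel_interior F) = {}" using op by (simp add: open_Int_closure_eq_empty Int_commute)
  moreover have "closure (rel_interior F) = F"
    unfolding Fs using convex_closure_rel_interior[of "closed_segment b c"] by simp
  ultimately show ?thesis by blast
qed

section \<open>Gluing piecewise functions and integrating over the mesh\<close>

lemma interior_triangle_subset: "K \<in> \<T> \<Longrightarrow> interior K \<subseteq> \<Omega>"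
  using triangle_subset[of K] int_closure interior_mono[of K "closure \<Omega>"] by blast

lemma negligible_triangle_boundary: "K \<in> \<T> \<Longrightarrow> negligible (K - interior K)"
  using negligible_convex_frontier[OF triangle_convex, of K] triangle_closed[of K] by (simp add: frontier_def)

lemma other_triangle_disjoint: "K \<in> \<T> \<Longrightarrow> K' \<in> \<T> \<Longrightarrow> K \<noteq> K' \<Longrightarrow> K' \<inter> interior K = {}"
proof -
  assume a: "K \<in> \<T>" "K' \<in> \<T>" "K \<noteq> K'"
  have "K \<inter> K' \<noteq> K" using mesh_maximal[OF a(1,2)] a(3) by blast
  from face_of_disjoint_interior[OF inter[OF a(1,2)] this] show ?thesis using interior_subset by blast
qed

lemma glue_interior: "K \<in> \<T> \<Longrightarrow> x \<in> interior K \<Longrightarrow> glue \<T> v x = v K x"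
proof -
  assume K: "K \<in> \<T>" "x \<in> interior K"
  have "(SOME K. K \<in> \<T> \<and> x \<in> K) = K"
  proof (rule some_equality)
    show "K \<in> \<T> \<and> x \<in> K" using K interior_subset by blast
    show "L = K" if "L \<in> \<T> \<and> x \<in> L" for L using that other_triangle_disjoint[of K L] K by blast
  qed
  then show ?thesis by (simp add: glue_def)
qed

lemma AE_interior: "K \<in> \<T> \<Longrightarrow> AE x in lebesgue_on K. x \<in> interior K"
  using null_extension_AE[of "interior K" K "\<lambda>x. x \<in> interior K"] negligible_triangle_boundary[of K] interior_subset[of K]
  by (simp add: AE_restrict_space_iff)

lemma AE_glue: "K \<in> \<T> \<Longrightarrow> AE x in lebesgue_on K. glue \<T> v x = v K x"
  using AE_interior[of K] by (rule AE_mp) (auto intro: glue_interior)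

lemma negligible_frontier_Omega: "negligible (closure \<Omega> - \<Omega>)"
proof (rule negligible_subset)
  show "negligible (\<Union>K\<in>\<T>. K - interior K)"
    using fin negligible_triangle_boundary by (intro negligible_Union) auto
  show "closure \<Omega> - \<Omega> \<subseteq> (\<Union>K\<in>\<T>. K - interior K)"
    using Un interior_triangle_subset by blast
qed

lemmas closure_integral = null_extension_integral[OF Omega_lebesgue closure_subset negligible_frontier_Omega]
lemmas closure_L2 = null_extension_L2[OF Omega_lebesgue closure_subset negligible_frontier_Omega]

lemma closure_lebesgue [simp]: "closure \<Omega> \<in> sets lebesgue"
  by (simp add: lborelD)

lemma union_lebesgue: "S \<subseteq> \<T> \<Longrightarrow> \<Union>S \<in> sets lebesgue" and union_subset: "S \<subseteq> \<T> \<Longrightarrow> \<Union>S \<subseteq> closure \<Omega>"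
proof -
  assume S: "S \<subseteq> \<T>"
  show "\<Union>S \<in> sets lebesgue" by (rule sets.finite_Union) (use S fin finite_subset in auto)
  show "\<Union>S \<subseteq> closure \<Omega>" using S Un by auto
qed

lemma union_integral:
  fixes h :: "point \<Rightarrow> real"
  assumes S: "S \<subseteq> \<T>" and h: "integrable (lebesgue_on (closure \<Omega>)) h"
  shows "(LINT x|lebesgue_on (\<Union>S). h x) = (\<Sum>K\<in>S. LINT x|lebesgue_on K. h x)"
proof -
  have fS: "finite S" using S fin finite_subset by blast
  have hK: "integrable lebesgue (\<lambda>x. indicator K x * h x)" if "K \<in> S" for K
  proof -
    have K: "K \<in> \<T>" using that S by auto
    show ?thesis using integrable_on_subset[OF h closure_lebesgue triangle_lebesgue[OF K] triangle_subset[OF K]]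
      by (simp add: restrict_integral K)
  qed
  have hS: "integrable lebesgue (\<lambda>x. indicator (\<Union>S) x * h x)"
    using integrable_on_subset[OF h closure_lebesgue union_lebesgue[OF S] union_subset[OF S]] union_lebesgue[OF S]
    by (simp add: restrict_integral)
  have "AE x in lebesgue. x \<notin> (\<Union>K\<in>\<T>. K - interior K)"
  proof (rule AE_not_in)
    have "negligible (\<Union>K\<in>\<T>. K - interior K)"
      using fin negligible_triangle_boundary by (intro negligible_Union) auto
    then show "(\<Union>K\<in>\<T>. K - interior K) \<in> null_sets lebesgue" by (simp add: negligible_iff_null_sets)
  qed
  then have ae: "AE x in lebesgue. indicator (\<Union>S) x * h x = (\<Sum>K\<in>S. indicator K x * h x)"
  proof eventually_elim
    case (elim x)
    show ?case
    proof (cases "x \<in> \<Union>S")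
      case False
      then show ?thesis by (auto intro!: sum.neutral[symmetric] simp: indicator_def)
    next
      case True
      then obtain K where K: "K \<in> S" "x \<in> K" by blast
      then have xi: "x \<in> interior K" using elim S by blast
      have "(\<Sum>L\<in>S. indicator L x * h x) = (\<Sum>L\<in>{K}. indicator L x * h x)"
      proof (rule sum.mono_neutral_right[OF fS])
        show "\<forall>L\<in>S - {K}. indicator L x * h x = 0"
          using other_triangle_disjoint[of K] xi K S by (auto simp: indicator_def)
      qed (use K in auto)
      then show ?thesis using True K by simp
    qed
  qed
  have "(LINT x|lebesgue_on (\<Union>S). h x) = (LINT x|lebesgue. indicator (\<Union>S) x * h x)"
    by (rule restrict_integral(2)[OF union_lebesgue[OF S]])
  also have "\<dots> = (LINT x|lebesgue. (\<Sum>K\<in>S. indicator K x * h x))"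
    by (rule integral_cong_AE[OF _ _ ae]) (use hS hK in auto)
  also have "\<dots> = (\<Sum>K\<in>S. LINT x|lebesgue. indicator K x * h x)"
    by (rule Bochner_Integration.integral_sum) (rule hK)
  also have "\<dots> = (\<Sum>K\<in>S. LINT x|lebesgue_on K. h x)"
  proof (rule sum.cong[OF refl])
    fix K assume "K \<in> S"
    then have "K \<in> sets lebesgue" using S by auto
    then show "(LINT x|lebesgue. indicator K x * h x) = (LINT x|lebesgue_on K. h x)"
      by (rule restrict_integral(2)[symmetric])
  qed
  finally show ?thesis .
qed

lemma Omega_integral:
  fixes h :: "point \<Rightarrow> real"
  assumes h: "integrable (lebesgue_on \<Omega>) h"
  shows "(LINT x|lebesgue_on \<Omega>. h x) = (\<Sum>K\<in>\<T>. LINT x|lebesgue_on K. h x)"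
  using union_integral[of \<T> h] h closure_integral[of h] Un by simp

lemma L2norm_Omega_sq:
  fixes f :: "point \<Rightarrow> 'b::euclidean_space"
  assumes f: "f \<in> L2 \<Omega>"
  shows "(L2norm \<Omega> f)\<^sup>2 = (\<Sum>K\<in>\<T>. (L2norm K f)\<^sup>2)"
  unfolding L2norm_sq by (rule Omega_integral[OF L2_sq_integrable[OF f]])

lemma L2_glue:
  fixes v :: "'b::euclidean_space pwfun"
  assumes v: "\<And>K. K \<in> \<T> \<Longrightarrow> continuous_on UNIV (v K)"
  shows "glue \<T> v \<in> L2 (closure \<Omega>)"
proof -
  \<comment> \<open>A Borel function that agrees with the glued one off the triangle boundaries,
    whatever branch \<open>glue\<close> picks there.\<close>
  define g where "g = (\<lambda>x. \<Sum>K\<in>\<T>. indicator (interior K) x *\<^sub>R v K x)"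
  have "v K \<in> borel_measurable borel" if "K \<in> \<T>" for K
    by (rule borel_measurable_continuous_onI[OF v[OF that]])
  then have m1: "g \<in> borel_measurable borel" unfolding g_def
    by (intro borel_measurable_sum borel_measurable_scaleR borel_measurable_indicator) auto
  then have m: "g \<in> borel_measurable (lebesgue_on (closure \<Omega>))"
    by (simp add: measurable_completion measurable_restrict_space1)
  have n: "negligible (\<Union>K\<in>\<T>. K - interior K)"
    using fin negligible_triangle_boundary by (intro negligible_Union) auto
  then have "AE x in lebesgue. x \<notin> (\<Union>K\<in>\<T>. K - interior K)" by (intro AE_not_in) (simp add: negligible_iff_null_sets)
  then have "AE x in lebesgue. x \<in> closure \<Omega> \<longrightarrow> g x = glue \<T> v x"
  proof eventually_elim
    case (elim x)
    show ?case
    proof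
      assume "x \<in> closure \<Omega>"
      then obtain K where K: "K \<in> \<T>" "x \<in> interior K" using elim Un by blast
      have "g x = (\<Sum>L\<in>{K}. indicator (interior L) x *\<^sub>R v L x)"
        unfolding g_def
      proof (rule sum.mono_neutral_right[OF fin])
        show "\<forall>L\<in>\<T> - {K}. indicator (interior L) x *\<^sub>R v L x = 0"
          using other_triangle_disjoint[OF K(1)] K(2) interior_subset by (fastforce simp: indicator_def)
      qed (use K in auto)
      then show "g x = glue \<T> v x" using K by (simp add: glue_interior[OF K, of v])
    qed
  qed
  then have ae: "AE x in lebesgue_on (closure \<Omega>). g x = glue \<T> v x" by (simp add: AE_restrict_space_iff)
  have gL: "g \<in> L2 (closure \<Omega>)"
  proof -
    have cmp: "compact (closure \<Omega>)" using bd by simp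
    have "\<exists>B. \<forall>x\<in>closure \<Omega>. norm (v K x) \<le> B" if "K \<in> \<T>" for K
    proof -
      have "compact (v K ` closure \<Omega>)"
        by (rule compact_continuous_image[OF continuous_on_subset[OF v[OF that]] cmp]) auto
      from compact_imp_bounded[OF this] obtain B where "\<forall>y\<in>v K ` closure \<Omega>. norm y \<le> B"
        unfolding bounded_iff by (rule exE)
      then show ?thesis by blast
    qed
    then obtain B where B: "\<And>K x. K \<in> \<T> \<Longrightarrow> x \<in> closure \<Omega> \<Longrightarrow> norm (v K x) \<le> B K" by metis
    have bound: "norm (g x) \<le> (\<Sum>K\<in>\<T>. \<bar>B K\<bar>)" for x
    proof -
      have "norm (g x) \<le> (\<Sum>K\<in>\<T>. norm (indicator (interior K) x *\<^sub>R v K x))" unfolding g_def by (rule norm_sum)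
      also have "\<dots> \<le> (\<Sum>K\<in>\<T>. \<bar>B K\<bar>)"
      proof (rule sum_mono)
        fix K assume K: "K \<in> \<T>"
        show "norm (indicator (interior K) x *\<^sub>R v K x) \<le> \<bar>B K\<bar>"
        proof (cases "x \<in> interior K")
          case True
          then have "x \<in> closure \<Omega>" using triangle_subset[OF K] interior_subset by blast
          then show ?thesis using B[OF K] True by (force simp: abs_if)
        qed simp
      qed
      finally show ?thesis .
    qed
    have b2: "(norm (g x))\<^sup>2 \<le> (\<Sum>K\<in>\<T>. \<bar>B K\<bar>)\<^sup>2" for x
      using bound by (intro power_mono) auto
    have bc: "bounded (closure \<Omega>)" by (rule bounded_closure[OF bd])
    have "integrable (lebesgue_on (closure \<Omega>)) (\<lambda>x. (\<Sum>K\<in>\<T>. \<bar>B K\<bar>)\<^sup>2)"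
      by (rule continuous_bounded_integrable[OF continuous_on_const bc closure_lebesgue])
    from L2_dominated[OF m this b2] show ?thesis .
  qed
  show ?thesis by (rule L2_cong_AE_on[OF closure_lebesgue gL ae])
qed

end

section \<open>Trace and Friedrichs inequalities\<close>

lemma segmean_add:
  "continuous_on UNIV u \<Longrightarrow> continuous_on UNIV v \<Longrightarrow> segmean (\<lambda>x. u x + v x) a b = segmean u a b + segmean v a b"
  unfolding segmean_def by (intro integral_add segmean_integrable)

lemma segmean_diff:
  "continuous_on UNIV u \<Longrightarrow> continuous_on UNIV v \<Longrightarrow> segmean (\<lambda>x. u x - v x) a b = segmean u a b - segmean v a b"
  unfolding segmean_def by (intro integral_diff segmean_integrable)

lemma segmean_const [simp]: "segmean (\<lambda>x. d) a b = d"
  by (simp add: segmean_def)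

lemma segmean_cmult: "segmean (\<lambda>x. d * v x) a b = d * segmean v a b"
  by (simp add: segmean_def)

lemma segmean_cong:
  assumes "\<And>x. x \<in> closed_segment a b \<Longrightarrow> u x = v x"
  shows "segmean u a b = segmean v a b"
  unfolding segmean_def by (rule integral_cong, rule assms, rule linepath_in_path)

lemma segmean_mono:
  assumes "continuous_on UNIV u" "continuous_on UNIV v" "\<And>x. x \<in> closed_segment a b \<Longrightarrow> u x \<le> v x"
  shows "segmean u a b \<le> segmean v a b"
  unfolding segmean_def
  by (intro integral_le segmean_integrable assms linepath_in_path)

lemma segmean_affine: "segmean (\<lambda>x. d + g \<bullet> x) b c = d + g \<bullet> midpoint b c"
proof -
  have "((\<lambda>t. (d + g \<bullet> b) + t * (g \<bullet> (c - b))) has_integral ((d + g \<bullet> b) + 1/2 * (g \<bullet> (c - b)))) {0..1::real}"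
  proof -
    have "((\<lambda>t::real. t) has_integral (1\<^sup>2 / 2 - 0\<^sup>2 / 2)) {0..1}"
      by (rule fundamental_theorem_of_calculus) (auto intro!: derivative_eq_intros simp: has_real_derivative_iff_has_vector_derivative[symmetric])
    from has_integral_mult_left[OF this, of "g \<bullet> (c - b)"]
    have "((\<lambda>t. t * (g \<bullet> (c - b))) has_integral (1/2 * (g \<bullet> (c - b)))) {0..1::real}" by simp
    from has_integral_add[OF has_integral_const_real[of "d + g \<bullet> b" 0 1] this] show ?thesis by simp
  qed
  moreover have "(\<lambda>t. (d + g \<bullet> b) + t * (g \<bullet> (c - b))) = (\<lambda>t. d + g \<bullet> linepath b c t)"
    by (auto simp: linepath_def algebra_simps inner_diff_right inner_add_right)
  ultimately have "segmean (\<lambda>x. d + g \<bullet> x) b c = (d + g \<bullet> b) + 1/2 * (g \<bullet> (c - b))"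
    unfolding segmean_def by (simp add: integral_unique)
  also have "\<dots> = d + g \<bullet> midpoint b c"
  proof -
    have m: "g \<bullet> midpoint b c = (g \<bullet> b + g \<bullet> c) / 2" by (simp add: midpoint_def inner_add_right)
    have "d + B + 1/2 * (C - B) = d + (B + C) / 2" for B C :: real by (simp add: field_simps)
    then show ?thesis unfolding m inner_diff_right .
  qed
  finally show ?thesis .
qed

text \<open>Decomposition into squared mean and variance. In the Friedrichs inequality the former
  cancels between neighbours and the latter is bounded by the trace inequality.\<close>

lemma segmean_sq:
  assumes v: "continuous_on UNIV v"
  shows "segmean (\<lambda>x. (v x)\<^sup>2) a b = (segmean v a b)\<^sup>2 + segmean (\<lambda>x. (v x - segmean v a b)\<^sup>2) a b"
proof -
  define m where "m = segmean v a b"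
  have "segmean (\<lambda>x. (v x - m)\<^sup>2) a b = segmean (\<lambda>x. ((v x)\<^sup>2 - (2 * m) * v x) + m\<^sup>2) a b"
    by (rule segmean_cong) (simp add: power2_diff)
  also have "\<dots> = segmean (\<lambda>x. (v x)\<^sup>2) a b - (2 * m) * m + m\<^sup>2"
    by (subst segmean_add segmean_diff; (intro continuous_intros v)?)+ (simp add: segmean_cmult m_def)
  finally show ?thesis by (simp add: m_def power2_eq_square)
qed

text \<open>A function of the set \<open>F\<close>, so that both triangles at a face refer to the
  same quantity; \<open>segmean_swap\<close> makes the order of the end points irrelevant for
  continuous functions.\<close>

definition fmean :: "point set \<Rightarrow> (point \<Rightarrow> real) \<Rightarrow> real"
  where "fmean F v = (SOME I. \<exists>a b. F = closed_segment a b \<and> I = segmean v a b)"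

lemma fmean_eq:
  assumes "continuous_on UNIV v"
  shows "fmean (closed_segment a b) v = segmean v a b"
  unfolding fmean_def
proof (rule some_equality)
  show "\<exists>c d. closed_segment a b = closed_segment c d \<and> segmean v a b = segmean v c d" by blast
next
  fix I assume "\<exists>c d. closed_segment a b = closed_segment c d \<and> I = segmean v c d"
  then show "I = segmean v a b"
    using segmean_swap[OF assms, of a b] by (auto simp: closed_segment_eq doubleton_eq_iff)
qed

lemma face_midpoint_segment: "face_midpoint (closed_segment a b) = midpoint a b"
  unfolding face_midpoint_def
  by (rule the_equality) (auto simp: closed_segment_eq doubleton_eq_iff midpoint_sym)

lemma face_integral_segment:
  assumes g: "continuous_on UNIV g"
  shows "face_integral (closed_segment a b) g = dist a b * segmean g a b"
proof -
  have e: "(LINT t|lebesgue_on {0..1}. g (linepath c d t)) = segmean g c d" for c d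
    unfolding segmean_def
    by (rule continuous_compact_integrable(5)[OF compact_Icc continuous_linepath_comp[OF g]])
  show ?thesis unfolding face_integral_def e
  proof (rule the_equality)
    show "\<exists>c d. closed_segment a b = closed_segment c d \<and> dist a b * segmean g a b = dist c d * segmean g c d" by blast
  qed (auto simp: closed_segment_eq doubleton_eq_iff dist_commute segmean_swap[OF g, of a b])
qed

text \<open>The length of \<open>F\<close> times the constant value of x \<bullet> \<nu> on
  \<open>F\<close>, with \<nu> the outer unit normal of \<open>K\<close>: the boundary factor in the
  divergence theorem for the field u x.\<close>

definition edge_weight :: "point set \<Rightarrow> point set \<Rightarrow> real"
  where "edge_weight K F = (SOME s. \<exists>a b c. area2 a b c \<noteq> 0 \<and> K = convex hull {a,b,c} \<and>
    F = closed_segment b c \<and> s = sgn (area2 a b c) * area2 0 b c)"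

text \<open>Exchanging \<open>b\<close> and \<open>c\<close> flips the sign of both factors, so the
  labelling picked by the definition does not matter.\<close>

lemma edge_weight_eq:
  assumes D: "area2 a b c \<noteq> 0"
  shows "edge_weight (convex hull {a,b,c}) (closed_segment b c) = sgn (area2 a b c) * area2 0 b c"
  unfolding edge_weight_def
proof (rule some_equality)
  show "\<exists>a' b' c'. area2 a' b' c' \<noteq> 0 \<and> convex hull {a,b,c} = convex hull {a',b',c'} \<and>
    closed_segment b c = closed_segment b' c' \<and> sgn (area2 a b c) * area2 0 b c = sgn (area2 a' b' c') * area2 0 b' c'"
    using D by blast
next
  fix s assume "\<exists>a' b' c'. area2 a' b' c' \<noteq> 0 \<and> convex hull {a,b,c} = convex hull {a',b',c'} \<and>
    closed_segment b c = closed_segment b' c' \<and> s = sgn (area2 a' b' c') * area2 0 b' c'"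
  then obtain a' b' c' where *: "area2 a' b' c' \<noteq> 0" "convex hull {a,b,c} = convex hull {a',b',c'}"
    "closed_segment b c = closed_segment b' c'" "s = sgn (area2 a' b' c') * area2 0 b' c'" by blast
  have v: "{a,b,c} = {a',b',c'}" using vertices_triangle[OF D] vertices_triangle[OF *(1)] *(2) by metis
  have bc: "{b,c} = {b',c'}" using *(3) by (simp add: closed_segment_eq)
  have "a \<notin> {b,c}" "a' \<notin> {b',c'}" using triangle_independent[OF D] triangle_independent[OF *(1)] by auto
  then have "a = a'" using v bc by auto
  moreover have "(b = b' \<and> c = c') \<or> (b = c' \<and> c = b')" using bc by (auto simp: doubleton_eq_iff)
  moreover have "area2 a c b = - area2 a b c" "area2 0 c b = - area2 0 b c"
    by (simp_all add: area2_def algebra_simps)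
  ultimately show "s = sgn (area2 a b c) * area2 0 b c" using *(4) by (auto simp: sgn_minus)
qed

text \<open>Writing \<open>x\<close> as the barycentric combination of \<open>x - a\<close>, \<open>x - b\<close> and \<open>x - c\<close> with the coordinates
  of the origin, the divergence theorem for \<open>u x\<close> follows from the trace identity at each vertex.\<close>
lemma triangle_divergence:
  assumes u: "C1 u U" and D: "area2 a b c \<noteq> 0"
  shows "(LINT x|lebesgue_on (convex hull {a,b,c}). 2 * u x + U x \<bullet> x)
    = (\<Sum>F\<in>edges (convex hull {a,b,c}). edge_weight (convex hull {a,b,c}) F * fmean F u)"
proof -
  let ?K = "convex hull {a,b,c}" and ?D = "area2 a b c"
  have cu: "continuous_on UNIV u" by (rule C1_cont[OF u])
  have cU: "continuous_on UNIV U" by (rule C1_cont_grad[OF u])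
  have D': "area2 b c a \<noteq> 0" "area2 c a b \<noteq> 0" and cyc: "area2 b c a = ?D" "area2 c a b = ?D"
    using D by (simp_all add: area2_cyclic)
  have K': "convex hull {b,c,a} = ?K" "convex hull {c,a,b} = ?K" by (simp_all add: insert_commute)
  define \<alpha> \<beta> \<gamma> where "\<alpha> = area2 0 b c / ?D" and "\<beta> = area2 0 c a / ?D" and "\<gamma> = area2 0 a b / ?D"
  have sum1: "\<alpha> + \<beta> + \<gamma> = 1"
  proof -
    have "area2 0 b c + area2 0 c a + area2 0 a b = ?D" by (simp add: area2_def algebra_simps)
    then show ?thesis using D by (simp add: \<alpha>_def \<beta>_def \<gamma>_def add_divide_distrib[symmetric])
  qed
  have comb0: "\<alpha> *\<^sub>R a + \<beta> *\<^sub>R b + \<gamma> *\<^sub>R c = 0"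
  proof -
    have "area2 a 0 c / ?D = \<beta>" "area2 a b 0 / ?D = \<gamma>" by (simp_all add: \<beta>_def \<gamma>_def area2_def algebra_simps)
    then have "0 = a + \<beta> *\<^sub>R (b - a) + \<gamma> *\<^sub>R (c - a)" using bary_point[OF D, of 0] by simp
    also have "\<dots> = (1 - \<beta> - \<gamma>) *\<^sub>R a + \<beta> *\<^sub>R b + \<gamma> *\<^sub>R c" by (simp add: algebra_simps)
    also have "1 - \<beta> - \<gamma> = \<alpha>" using sum1 by simp
    finally show ?thesis by simp
  qed
  let ?I = "\<lambda>p. LINT x|lebesgue_on ?K. 2 * u x + U x \<bullet> (x - p)"
  have Ia: "?I a = \<bar>?D\<bar> * segmean u b c" by (rule triangle_trace_identity[OF u D])
  have Ib: "?I b = \<bar>?D\<bar> * segmean u c a" using triangle_trace_identity[OF u D'(1)] cyc K' by simp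
  have Ic: "?I c = \<bar>?D\<bar> * segmean u a b" using triangle_trace_identity[OF u D'(2)] cyc K' by simp
  have int: "integrable (lebesgue_on ?K) (\<lambda>x. s * (2 * u x + U x \<bullet> (x - p)))" for s p
    by (rule continuous_compact_integrable(1)[OF compact_triangle continuous_on_subset[OF _ subset_UNIV]])
       (intro continuous_intros cu cU)
  have "(LINT x|lebesgue_on ?K. 2 * u x + U x \<bullet> x) =
    (LINT x|lebesgue_on ?K. \<alpha> * (2 * u x + U x \<bullet> (x - a)) + \<beta> * (2 * u x + U x \<bullet> (x - b)) + \<gamma> * (2 * u x + U x \<bullet> (x - c)))"
  proof (rule Bochner_Integration.integral_cong[OF refl])
    fix x
    have "\<alpha> * (2 * u x + U x \<bullet> (x - a)) + \<beta> * (2 * u x + U x \<bullet> (x - b)) + \<gamma> * (2 * u x + U x \<bullet> (x - c))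
      = (\<alpha> + \<beta> + \<gamma>) * (2 * u x + U x \<bullet> x) - U x \<bullet> (\<alpha> *\<^sub>R a + \<beta> *\<^sub>R b + \<gamma> *\<^sub>R c)"
      by (simp add: inner_diff_right inner_add_right algebra_simps)
    then show "2 * u x + U x \<bullet> x =
      \<alpha> * (2 * u x + U x \<bullet> (x - a)) + \<beta> * (2 * u x + U x \<bullet> (x - b)) + \<gamma> * (2 * u x + U x \<bullet> (x - c))"
      unfolding sum1 comb0 by simp
  qed
  also have "\<dots> = \<alpha> * ?I a + \<beta> * ?I b + \<gamma> * ?I c"
    using int[of \<alpha> a] int[of \<beta> b] int[of \<gamma> c]
    by (simp only: Bochner_Integration.integral_add Bochner_Integration.integrable_add Bochner_Integration.integral_mult_right_zero)
  also have "\<dots> = sgn ?D * area2 0 b c * segmean u b c + sgn ?D * area2 0 c a * segmean u c a + sgn ?D * area2 0 a b * segmean u a b"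
    unfolding Ia Ib Ic \<alpha>_def \<beta>_def \<gamma>_def using D by (simp add: abs_sgn[of ?D] field_simps)
  also have "\<dots> = (\<Sum>F\<in>edges ?K. edge_weight ?K F * fmean F u)"
  proof -
    have d: "closed_segment b c \<noteq> closed_segment c a" "closed_segment b c \<noteq> closed_segment a b" "closed_segment c a \<noteq> closed_segment a b"
      using triangle_independent[OF D] by (auto simp: closed_segment_eq doubleton_eq_iff)
    have "edge_weight ?K (closed_segment b c) = sgn ?D * area2 0 b c" by (rule edge_weight_eq[OF D])
    moreover have "edge_weight ?K (closed_segment c a) = sgn ?D * area2 0 c a" using edge_weight_eq[OF D'(1)] by (simp add: K' cyc)
    moreover have "edge_weight ?K (closed_segment a b) = sgn ?D * area2 0 a b" using edge_weight_eq[OF D'(2)] by (simp add: K' cyc)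
    ultimately show ?thesis unfolding edges_triangle[OF D] using d by (simp add: fmean_eq[OF cu])
  qed
  finally show ?thesis .
qed

section \<open>Shape-regular meshes: scaled trace inequality and discrete Friedrichs
  inequality\<close>

locale shape_mesh = mesh +
  fixes \<rho> h0 R :: real
  assumes shape: "shape_regular \<rho> \<T>" and h0: "\<And>K. K \<in> \<T> \<Longrightarrow> diameter K \<le> h0"
    and R: "\<And>x. x \<in> \<Omega> \<Longrightarrow> norm x \<le> R" and ne: "\<Omega> \<noteq> {}"
begin

lemma R_closure: "x \<in> closure \<Omega> \<Longrightarrow> norm x \<le> R"
  using R closure_minimal[of \<Omega> "cball 0 R"] by (auto simp: subset_iff)

lemma R_nonneg: "0 \<le> R"
  using R ne norm_ge_zero order_trans by blast

text \<open>Translates the inball into edge length and area of a labelled triangle, through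
  \<open>inball_edge\<close> and \<open>inball_height\<close>.\<close>

lemma shape_triangle:
  assumes K: "K \<in> \<T>" and Kh: "K = convex hull {a,b,c}" and D: "area2 a b c \<noteq> 0"
  shows "0 < diameter K" "0 < \<rho>" "2 * diameter K \<le> \<rho> * dist b c" "4 * (diameter K)\<^sup>2 \<le> \<rho>\<^sup>2 * \<bar>area2 a b c\<bar>"
proof -
  obtain z r where zr: "r > 0" "cball z r \<subseteq> K" "diameter K \<le> \<rho> * r"
    using shape K by (auto simp: shape_regular_def)
  let ?h = "diameter K"
  have "dist b c \<le> ?h" unfolding Kh by (rule dist_le_diameter) auto
  moreover have "0 < dist b c" using triangle_independent(3)[OF D] by simp
  ultimately show hp: "0 < ?h" by linarith
  then have "0 < \<rho> * r" using zr by linarith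
  then show rho: "0 < \<rho>" using zr(1) by (simp add: zero_less_mult_iff)
  have e: "2 * r \<le> dist b c" using inball_edge[OF D _ zr(1)] zr(2) Kh by simp
  have g: "2 * r * dist b c \<le> \<bar>area2 a b c\<bar>" using inball_height[OF D _ zr(1)] zr(2) Kh by simp
  have "2 * ?h \<le> \<rho> * (2 * r)" using zr(3) by simp
  also have "\<dots> \<le> \<rho> * dist b c" using e rho by (intro mult_left_mono) auto
  finally show "2 * ?h \<le> \<rho> * dist b c" .
  have "4 * ?h\<^sup>2 \<le> 4 * (\<rho> * r)\<^sup>2" using zr(3) hp by (intro mult_left_mono power_mono) auto
  also have "\<dots> = \<rho>\<^sup>2 * (2 * r * (2 * r))" by (simp add: power2_eq_square)
  also have "\<dots> \<le> \<rho>\<^sup>2 * (2 * r * dist b c)" using e zr(1) by (intro mult_left_mono) auto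
  also have "\<dots> \<le> \<rho>\<^sup>2 * \<bar>area2 a b c\<bar>" using g by (intro mult_left_mono) auto
  finally show "4 * ?h\<^sup>2 \<le> \<rho>\<^sup>2 * \<bar>area2 a b c\<bar>" .
qed

text \<open>Bounding the two directional derivatives by the diameter leaves the factor
  \<open>4 * (diameter K)\<^sup>2 / \<bar>area2 a b c\<bar>\<close> twice, and shape regularity
  bounds it by the square of \<rho>. No power of the mesh size remains.\<close>

lemma trace_mean:
  assumes K: "K \<in> \<T>" and F: "F \<in> edges K" and C: "C1 v G"
  shows "fmean F (\<lambda>x. (v x - fmean F v)\<^sup>2) \<le> 2 * \<rho>\<^sup>2 * (LINT x|lebesgue_on K. (norm (G x))\<^sup>2)"
proof -
  obtain a b c where D: "area2 a b c \<noteq> 0" and Kh: "K = convex hull {a,b,c}" and Fs: "F = closed_segment b c"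
    using edgeE[OF simp2[OF K] F] by metis
  let ?h = "diameter K" and ?N = "LINT x|lebesgue_on K. (norm (G x))\<^sup>2"
  have cv: "continuous_on UNIV v" and cG: "continuous_on UNIV G" using C1_cont[OF C] C1_cont_grad[OF C] by auto
  have Kc: "compact K" unfolding Kh by (rule compact_triangle)
  have Nn: "0 \<le> ?N" by (rule Bochner_Integration.integral_nonneg) simp
  have b: "(LINT x|lebesgue_on K. (G x \<bullet> d)\<^sup>2) \<le> ?h\<^sup>2 * ?N" if "norm d \<le> ?h" for d
  proof -
    have "(LINT x|lebesgue_on K. (G x \<bullet> d)\<^sup>2) \<le> (LINT x|lebesgue_on K. ?h\<^sup>2 * (norm (G x))\<^sup>2)"
    proof (rule integral_mono)
      show "integrable (lebesgue_on K) (\<lambda>x. (G x \<bullet> d)\<^sup>2)" "integrable (lebesgue_on K) (\<lambda>x. ?h\<^sup>2 * (norm (G x))\<^sup>2)"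
        by (rule continuous_compact_integrable(1)[OF Kc continuous_on_subset[OF _ subset_UNIV]], intro continuous_intros cG)+
      fix x
      have "\<bar>G x \<bullet> d\<bar> \<le> norm (G x) * norm d" by (rule Cauchy_Schwarz_ineq2)
      also have "\<dots> \<le> norm (G x) * ?h" using that by (intro mult_left_mono) auto
      finally have "\<bar>G x \<bullet> d\<bar>\<^sup>2 \<le> (norm (G x) * ?h)\<^sup>2" by (intro power_mono) auto
      then show "(G x \<bullet> d)\<^sup>2 \<le> ?h\<^sup>2 * (norm (G x))\<^sup>2" by (simp add: power_mult_distrib mult.commute)
    qed
    then show ?thesis by simp
  qed
  have d1: "norm (a - b) \<le> ?h" and d2: "norm (a - c) \<le> ?h"
    unfolding Kh dist_norm[symmetric] by (intro dist_le_diameter; simp)+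
  have "fmean F (\<lambda>x. (v x - fmean F v)\<^sup>2) = segmean (\<lambda>x. (v x - segmean v b c)\<^sup>2) b c"
    unfolding Fs fmean_eq[OF cv] by (rule fmean_eq) (intro continuous_intros cv)
  also have "\<dots> \<le> 4 / \<bar>area2 a b c\<bar> * ((LINT x|lebesgue_on K. (G x \<bullet> (a - b))\<^sup>2) + (LINT x|lebesgue_on K. (G x \<bullet> (a - c))\<^sup>2))"
    unfolding Kh by (rule triangle_trace_mean[OF C D])
  also have "\<dots> \<le> 4 / \<bar>area2 a b c\<bar> * (?h\<^sup>2 * ?N + ?h\<^sup>2 * ?N)"
    by (intro mult_left_mono add_mono b d1 d2) auto
  also have "\<dots> = 2 * (4 * ?h\<^sup>2 / \<bar>area2 a b c\<bar>) * ?N" by simp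
  also have "\<dots> \<le> 2 * \<rho>\<^sup>2 * ?N"
    using shape_triangle(4)[OF K Kh D] D by (intro mult_right_mono mult_left_mono Nn) (auto simp: divide_le_eq)
  finally show ?thesis .
qed

text \<open>The Crouzeix-Raviart condition, freed from piecewise polynomials so that it also covers
  the difference of a discrete gradient and the gradient of a test function.\<close>

definition CR :: "(point set \<Rightarrow> point \<Rightarrow> real) \<Rightarrow> (point set \<Rightarrow> point \<Rightarrow> point) \<Rightarrow> bool"
  where "CR w G \<longleftrightarrow> (\<forall>K\<in>\<T>. C1 (w K) (G K)) \<and>
    (\<forall>F\<in>interior_faces \<T>. fmean F (w (Tplus \<T> F)) = fmean F (w (Tminus \<T> F))) \<and>
    (\<forall>F\<in>boundary_faces \<T>. fmean F (w (Tplus \<T> F)) = 0)"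

lemma edge_weight_bound:
  assumes K: "K \<in> \<T>" and F: "F \<in> edges K"
  shows "\<bar>edge_weight K F\<bar> \<le> R * h0"
proof -
  obtain a b c where D: "area2 a b c \<noteq> 0" and Kh: "K = convex hull {a,b,c}" and Fs: "F = closed_segment b c"
    using edgeE[OF simp2[OF K] F] by metis
  have "\<bar>edge_weight K F\<bar> = \<bar>area2 0 b c - area2 b b c\<bar>"
    unfolding Kh Fs edge_weight_eq[OF D] using D by (simp add: abs_mult area2_def[of b b c] abs_sgn_eq)
  also have "\<dots> \<le> dist 0 b * dist b c" by (rule area2_lipschitz)
  also have "\<dots> \<le> R * h0"
  proof (intro mult_mono R_nonneg)
    have "b \<in> K" unfolding Kh by (simp add: hull_inc)
    then show "dist 0 b \<le> R" using R_closure triangle_subset[OF K] by auto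
    have "dist b c \<le> diameter K" unfolding Kh by (rule dist_le_diameter) auto
    then show "dist b c \<le> h0" using h0[OF K] by simp
  qed auto
  finally show ?thesis .
qed

text \<open>The apexes lie on opposite sides of the face, so the two outer normals are
  opposite.\<close>

lemma edge_weight_opposite:
  assumes F: "F \<in> interior_faces \<T>"
  shows "edge_weight (Tplus \<T> F) F + edge_weight (Tminus \<T> F) F = 0"
proof -
  have Ff: "F \<in> faces \<T>" using F by (simp add: interior_faces_def)
  note P = Tplus[OF Ff] and M = Tminus[OF F]
  obtain a b c where 1: "area2 a b c \<noteq> 0" "Tplus \<T> F = convex hull {a,b,c}" "F = closed_segment b c"
    using edgeE[OF simp2[OF P(1)] P(2)] by metis
  obtain a' where 2: "area2 a' b c \<noteq> 0" "Tminus \<T> F = convex hull {a',b,c}"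
    using edge_apex[OF M(1)] M(2) 1(3) by metis
  have "area2 a b c * area2 a' b c < 0" by (rule opposite_apexes[OF P(1) M(1) M(3) 1(2) 2(2) 1(1) 2(1)])
  then have "sgn (area2 a b c) + sgn (area2 a' b c) = 0" by (auto simp: mult_less_0_iff)
  moreover have "edge_weight (Tplus \<T> F) F = sgn (area2 a b c) * area2 0 b c"
    using edge_weight_eq[OF 1(1)] unfolding 1(2)[symmetric] 1(3)[symmetric] .
  moreover have "edge_weight (Tminus \<T> F) F = sgn (area2 a' b c) * area2 0 b c"
    using edge_weight_eq[OF 2(1)] unfolding 2(2)[symmetric] 1(3)[symmetric] .
  ultimately show ?thesis by (metis distrib_right mult_zero_left)
qed

text \<open>Regroup the sum by faces: at an interior face equal means meet opposite weights, and at
  a boundary face the mean is zero.\<close>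

lemma CR_cancel:
  assumes "CR w G"
  shows "(\<Sum>K\<in>\<T>. \<Sum>F\<in>edges K. edge_weight K F * (fmean F (w K))\<^sup>2) = 0"
proof -
  have ff: "finite (faces \<T>)" unfolding faces_def using fin edges_finite simp2 by auto
  have "(\<Sum>K\<in>\<T>. \<Sum>F\<in>edges K. edge_weight K F * (fmean F (w K))\<^sup>2)
    = (\<Sum>K\<in>\<T>. \<Sum>F\<in>{F\<in>faces \<T>. F \<in> edges K}. edge_weight K F * (fmean F (w K))\<^sup>2)"
    by (intro sum.cong refl) (auto simp: faces_def)
  also have "\<dots> = (\<Sum>F\<in>faces \<T>. \<Sum>K\<in>{K\<in>\<T>. F \<in> edges K}. edge_weight K F * (fmean F (w K))\<^sup>2)"
    by (rule sum.swap_restrict[OF fin ff])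
  also have "\<dots> = (\<Sum>F\<in>faces \<T>. 0)"
  proof (rule sum.cong[OF refl])
    fix F assume F: "F \<in> faces \<T>"
    show "(\<Sum>K\<in>{K\<in>\<T>. F \<in> edges K}. edge_weight K F * (fmean F (w K))\<^sup>2) = 0"
    proof (cases "F \<in> interior_faces \<T>")
      case True
      have e: "fmean F (w (Tplus \<T> F)) = fmean F (w (Tminus \<T> F))" using assms True by (simp add: CR_def)
      have "(\<Sum>K\<in>{K\<in>\<T>. F \<in> edges K}. edge_weight K F * (fmean F (w K))\<^sup>2)
        = (edge_weight (Tplus \<T> F) F + edge_weight (Tminus \<T> F) F) * (fmean F (w (Tminus \<T> F)))\<^sup>2"
        unfolding interior_face_triangles[OF True] using Tminus(3)[OF True] by (simp add: e distrib_right)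
      then show ?thesis unfolding edge_weight_opposite[OF True] by simp
    next
      case False
      then have Fb: "F \<in> boundary_faces \<T>" using F by (simp add: boundary_faces_def)
      have "fmean F (w K) = 0" if "K \<in> \<T>" "F \<in> edges K" for K
        using assms Fb boundary_face_triangles[OF Fb that] by (simp add: CR_def)
      then show ?thesis by (intro sum.neutral) simp
    qed
  qed
  finally show ?thesis by simp
qed

text \<open>Since \<open>x\<close> has constant normal component on each face, the face terms in the divergence theorem
  for \<open>w\<^sup>2 x\<close> only see the mean of \<open>w\<^sup>2\<close>; the squared means cancel between neighbours.\<close>
lemma discrete_Friedrichs:
  assumes cr: "CR w G"
  shows "(\<Sum>K\<in>\<T>. LINT x|lebesgue_on K. (w K x)\<^sup>2)
    \<le> (R\<^sup>2 + 6 * R * h0 * \<rho>\<^sup>2) * (\<Sum>K\<in>\<T>. LINT x|lebesgue_on K. (norm (G K x))\<^sup>2)"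
proof -
  let ?N = "\<lambda>K. LINT x|lebesgue_on K. (norm (G K x))\<^sup>2"
  have Nn: "0 \<le> ?N K" for K by (rule Bochner_Integration.integral_nonneg) simp
  have C: "C1 (w K) (G K)" if "K \<in> \<T>" for K using cr that by (simp add: CR_def)
  have one: "(LINT x|lebesgue_on K. (w K x)\<^sup>2) \<le> R\<^sup>2 * ?N K + 6 * R * h0 * \<rho>\<^sup>2 * ?N K
      + (\<Sum>F\<in>edges K. edge_weight K F * (fmean F (w K))\<^sup>2)" if K: "K \<in> \<T>" for K
  proof -
    obtain a b c where D: "area2 a b c \<noteq> 0" and Kh: "K = convex hull {a,b,c}" using simplex2E[OF simp2[OF K]] by metis
    have Kc: "compact K" unfolding Kh by (rule compact_triangle)
    let ?w = "w K" and ?G = "G K"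
    have cw: "continuous_on UNIV ?w" and cG: "continuous_on UNIV ?G" using C1_cont[OF C[OF K]] C1_cont_grad[OF C[OF K]] by auto
    note intg = continuous_compact_integrable(1)[OF Kc continuous_on_subset[OF _ subset_UNIV]]
    have "C1 (\<lambda>x. ?w x * ?w x) (\<lambda>x. ?w x *\<^sub>R ?G x + ?w x *\<^sub>R ?G x)" by (rule C1_mult[OF C[OF K] C[OF K]])
    then have u: "C1 (\<lambda>x. (?w x)\<^sup>2) (\<lambda>x. ?w x *\<^sub>R ?G x + ?w x *\<^sub>R ?G x)" by (simp add: power2_eq_square)
    have div: "(LINT x|lebesgue_on K. 2 * (?w x)\<^sup>2 + (?w x *\<^sub>R ?G x + ?w x *\<^sub>R ?G x) \<bullet> x)
      = (\<Sum>F\<in>edges K. edge_weight K F * fmean F (\<lambda>x. (?w x)\<^sup>2))"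
      unfolding Kh by (rule triangle_divergence[OF u[unfolded Kh] D])
    \<comment> \<open>Completing the square in \<open>2 * w^2 + 2 * w * (G \<bullet> x)\<close>
      keeps one copy of \<open>w^2\<close> and costs the gradient term with
      \<open>R\<close>.\<close>
    have "(LINT x|lebesgue_on K. (?w x)\<^sup>2 - R\<^sup>2 * (norm (?G x))\<^sup>2)
      \<le> (LINT x|lebesgue_on K. 2 * (?w x)\<^sup>2 + (?w x *\<^sub>R ?G x + ?w x *\<^sub>R ?G x) \<bullet> x)"
    proof (rule integral_mono)
      show "integrable (lebesgue_on K) (\<lambda>x. (?w x)\<^sup>2 - R\<^sup>2 * (norm (?G x))\<^sup>2)"
        "integrable (lebesgue_on K) (\<lambda>x. 2 * (?w x)\<^sup>2 + (?w x *\<^sub>R ?G x + ?w x *\<^sub>R ?G x) \<bullet> x)"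
        by (rule intg, intro continuous_intros cw cG)+
      fix x assume "x \<in> space (lebesgue_on K)"
      then have x: "norm x \<le> R" using R_closure triangle_subset[OF K] by auto
      have "\<bar>?G x \<bullet> x\<bar> \<le> norm (?G x) * norm x" by (rule Cauchy_Schwarz_ineq2)
      also have "\<dots> \<le> norm (?G x) * R" using x by (intro mult_left_mono) auto
      finally have "\<bar>?G x \<bullet> x\<bar>\<^sup>2 \<le> (norm (?G x) * R)\<^sup>2" by (intro power_mono) auto
      then have "(?G x \<bullet> x)\<^sup>2 \<le> (norm (?G x) * R)\<^sup>2" by simp
      have "0 \<le> (?w x + ?G x \<bullet> x)\<^sup>2" by simp
      show "(?w x)\<^sup>2 - R\<^sup>2 * (norm (?G x))\<^sup>2 \<le> 2 * (?w x)\<^sup>2 + (?w x *\<^sub>R ?G x + ?w x *\<^sub>R ?G x) \<bullet> x"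
      proof -
        have "(?w x *\<^sub>R ?G x + ?w x *\<^sub>R ?G x) \<bullet> x = 2 * (?w x * (?G x \<bullet> x))"
          by (simp only: inner_add_left inner_scaleR_left)
        moreover have "0 \<le> (?w x)\<^sup>2 + (?G x \<bullet> x)\<^sup>2 + 2 * (?w x * (?G x \<bullet> x))"
          using \<open>0 \<le> (?w x + ?G x \<bullet> x)\<^sup>2\<close> by (simp add: power2_sum)
        moreover have "(norm (?G x) * R)\<^sup>2 = R\<^sup>2 * (norm (?G x))\<^sup>2" by (simp add: power_mult_distrib)
        ultimately show ?thesis using \<open>(?G x \<bullet> x)\<^sup>2 \<le> (norm (?G x) * R)\<^sup>2\<close> by linarith
      qed
    qed
    moreover have "(LINT x|lebesgue_on K. (?w x)\<^sup>2 - R\<^sup>2 * (norm (?G x))\<^sup>2) = (LINT x|lebesgue_on K. (?w x)\<^sup>2) - R\<^sup>2 * ?N K"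
    proof -
      have "(LINT x|lebesgue_on K. (?w x)\<^sup>2 - R\<^sup>2 * (norm (?G x))\<^sup>2) = (LINT x|lebesgue_on K. (?w x)\<^sup>2) - (LINT x|lebesgue_on K. R\<^sup>2 * (norm (?G x))\<^sup>2)"
        by (rule Bochner_Integration.integral_diff; rule intg, intro continuous_intros cw cG)
      then show ?thesis by simp
    qed
    \<comment> \<open>The factor 6 is three edges times the constant 2 of \<open>trace_mean\<close>;
      \<open>R * h0\<close> bounds the weight.\<close>
    moreover have "(\<Sum>F\<in>edges K. edge_weight K F * fmean F (\<lambda>x. (?w x)\<^sup>2))
      \<le> (\<Sum>F\<in>edges K. edge_weight K F * (fmean F ?w)\<^sup>2) + 6 * R * h0 * \<rho>\<^sup>2 * ?N K"
    proof -
      have each: "edge_weight K F * fmean F (\<lambda>x. (?w x)\<^sup>2) \<le> edge_weight K F * (fmean F ?w)\<^sup>2 + R * h0 * (2 * \<rho>\<^sup>2 * ?N K)"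
        if F: "F \<in> edges K" for F
      proof -
        obtain b' c' where Fs: "F = closed_segment b' c'" using edgeE[OF simp2[OF K] F] by metis
        let ?V = "fmean F (\<lambda>x. (?w x - fmean F ?w)\<^sup>2)"
        have cont: "continuous_on UNIV (\<lambda>x. (?w x)\<^sup>2)" "continuous_on UNIV (\<lambda>x. (?w x - segmean ?w b' c')\<^sup>2)"
          by (intro continuous_intros cw)+
        have sq: "fmean F (\<lambda>x. (?w x)\<^sup>2) = (fmean F ?w)\<^sup>2 + ?V"
          unfolding Fs fmean_eq[OF cw] fmean_eq[OF cont(1)] fmean_eq[OF cont(2)] by (rule segmean_sq[OF cw])
        have V0: "0 \<le> ?V"
          unfolding Fs fmean_eq[OF cw] fmean_eq[OF cont(2)]
          using segmean_mono[OF continuous_on_const cont(2), of b' c' 0] by simp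
        have "edge_weight K F * ?V \<le> \<bar>edge_weight K F\<bar> * ?V" using V0 by (intro mult_right_mono) auto
        also have "\<dots> \<le> R * h0 * (2 * \<rho>\<^sup>2 * ?N K)"
        proof (intro mult_mono edge_weight_bound[OF K F] trace_mean[OF K F C[OF K]] V0)
          show "0 \<le> R * h0" using edge_weight_bound[OF K F] by linarith
        qed
        finally show ?thesis unfolding sq by (simp add: distrib_left)
      qed
      have pos: "0 \<le> R * h0 * (2 * \<rho>\<^sup>2 * ?N K)"
      proof -
        have "0 \<le> h0" using h0[OF K] shape_triangle(1)[OF K Kh D] by linarith
        then show ?thesis using R_nonneg Nn by (intro mult_nonneg_nonneg) auto
      qed
      have "(\<Sum>F\<in>edges K. edge_weight K F * fmean F (\<lambda>x. (?w x)\<^sup>2))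
        \<le> (\<Sum>F\<in>edges K. edge_weight K F * (fmean F ?w)\<^sup>2) + real (card (edges K)) * (R * h0 * (2 * \<rho>\<^sup>2 * ?N K))"
        using sum_mono[of "edges K", OF each] by (simp add: sum.distrib)
      also have "real (card (edges K)) * (R * h0 * (2 * \<rho>\<^sup>2 * ?N K)) \<le> 3 * (R * h0 * (2 * \<rho>\<^sup>2 * ?N K))"
        using card_edges[OF simp2[OF K]] pos by (intro mult_right_mono) auto
      finally show ?thesis by simp
    qed
    ultimately show ?thesis using div by linarith
  qed
  have "(\<Sum>K\<in>\<T>. LINT x|lebesgue_on K. (w K x)\<^sup>2) \<le> (\<Sum>K\<in>\<T>. R\<^sup>2 * ?N K + 6 * R * h0 * \<rho>\<^sup>2 * ?N K
      + (\<Sum>F\<in>edges K. edge_weight K F * (fmean F (w K))\<^sup>2))"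
    by (rule sum_mono[OF one])
  also have "\<dots> = (R\<^sup>2 + 6 * R * h0 * \<rho>\<^sup>2) * (\<Sum>K\<in>\<T>. ?N K)"
    using CR_cancel[OF cr] by (simp add: sum.distrib sum_distrib_left distrib_right)
  finally show ?thesis .
qed

end

section \<open>Morley functions\<close>

lemma quadratic_elementary:
  assumes "quadratic_poly p"
  shows "elementary p"
proof -
  obtain c b and M :: "real^2^2" where p: "\<And>x. p x = c + b \<bullet> x + x \<bullet> (M *v x)"
    using assms by (auto simp: quadratic_poly_def)
  have "p = (\<lambda>x. c + (b$1 * x$1 + b$2 * x$2) + (x$1 * (M$1$1 * x$1 + M$1$2 * x$2) + x$2 * (M$2$1 * x$1 + M$2$2 * x$2)))"
    by (auto simp: p inner_2 matrix_vector_mult_def sum_2)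
  moreover have "elementary (\<lambda>x. c + (b$1 * x$1 + b$2 * x$2) + (x$1 * (M$1$1 * x$1 + M$1$2 * x$2) + x$2 * (M$2$1 * x$1 + M$2$2 * x$2)))"
    by (intro elementary.intros)
  ultimately show ?thesis by (simp only:)
qed

lemma affine_pderiv:
  assumes "\<And>x. p x = d + g \<bullet> x"
  shows "pderiv2 k p x = g $ k"
proof -
  have p: "p = (\<lambda>x. d + g \<bullet> x)" using assms by auto
  have "((\<lambda>x. d + g \<bullet> x) has_derivative (\<lambda>h. g \<bullet> h)) (at x)" for x
    by (auto intro!: derivative_eq_intros)
  from pderiv2_eq[OF this, of k] show ?thesis by (simp add: p inner_axis)
qed

lemma quadratic_derivs:
  assumes "quadratic_poly p"
  obtains d :: "2 \<Rightarrow> real" and H :: "real^2^2" where "\<And>i x. pderiv2 i p x = d i + (H $ i) \<bullet> x" "\<And>x. hess p x = H"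
proof -
  obtain c b and M :: "real^2^2" where p: "\<And>x. p x = c + b \<bullet> x + x \<bullet> (M *v x)"
    using assms by (auto simp: quadratic_poly_def)
  define H :: "real^2^2" where "H = (\<chi> i k. M$i$k + M$k$i)"
  have "(p has_derivative (\<lambda>h. b \<bullet> h + (x \<bullet> (M *v h) + h \<bullet> (M *v x)))) (at x)" for x
  proof -
    have "((\<lambda>x. M *v x) has_derivative (\<lambda>h. M *v h)) (at x)"
      by (rule bounded_linear_imp_has_derivative[OF matrix_vector_mul_bounded_linear])
    then have "((\<lambda>x. c + b \<bullet> x + x \<bullet> (M *v x)) has_derivative (\<lambda>h. b \<bullet> h + (x \<bullet> (M *v h) + h \<bullet> (M *v x)))) (at x)"
      by (auto intro!: derivative_eq_intros)
    then show ?thesis using p by presburger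
  qed
  then have 1: "pderiv2 i p = (\<lambda>x. b \<bullet> axis i 1 + (x \<bullet> (M *v axis i 1) + axis i 1 \<bullet> (M *v x)))" for i
    by (rule pderiv2_eq)
  have 2: "pderiv2 i p x = b $ i + (H $ i) \<bullet> x" for i x
    unfolding 1 using exhaust_2[of i]
    by (auto simp: inner_2 matrix_vector_mult_def sum_2 H_def axis_def algebra_simps)
  then have "hess p x = H" for x
    by (simp add: vec_eq_iff hess_def affine_pderiv[of "pderiv2 i p" "b $ i" "H $ i" for i])
  with 2 that show ?thesis by blast
qed

lemma quadratic_smooth: "quadratic_poly p \<Longrightarrow> smooth p"
  by (rule elementary_smooth[OF quadratic_elementary])

lemma smooth_pderiv_C1: "smooth p \<Longrightarrow> C1 (pderiv2 i p) (\<lambda>x. hess p x $ i)"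
  using smooth_C1[OF smooth_pderiv[of p i]] by (simp add: hess_def)

lemma smooth_grad_continuous: "smooth p \<Longrightarrow> continuous_on UNIV (grad p)"
  using C1_cont_grad[OF smooth_C1[of p]] by (simp add: grad_def)

lemma smooth_hess_continuous:
  assumes "smooth p" shows "continuous_on UNIV (hess p)"
proof -
  have "continuous_on UNIV (\<lambda>x. \<chi> i. hess p x $ i)"
    by (rule continuous_on_vec_lambda) (rule C1_cont_grad[OF smooth_pderiv_C1[OF assms]])
  then show ?thesis by simp
qed

lemma pw_grad_eq: "pw_grad v K = grad (v K)" and pw_hess_eq: "pw_hess v K = hess (v K)"
  by (simp_all add: fun_eq_iff pw_grad_def pw_hess_def grad_def hess_def)

lemma fmean_cong:
  assumes "continuous_on UNIV u" "continuous_on UNIV v" "F = closed_segment b c" "\<And>x. x \<in> F \<Longrightarrow> u x = v x"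
  shows "fmean F u = fmean F v"
  using assms(4) unfolding assms(3) fmean_eq[OF assms(1)] fmean_eq[OF assms(2)] by (rule segmean_cong)

lemma fmean_mono:
  assumes "continuous_on UNIV u" "continuous_on UNIV v" "F = closed_segment b c" "\<And>x. x \<in> F \<Longrightarrow> u x \<le> v x"
  shows "fmean F u \<le> fmean F v"
  using segmean_mono[OF assms(1,2)] assms(4) unfolding assms(3) fmean_eq[OF assms(1)] fmean_eq[OF assms(2)] by blast

lemma fmean_add:
  assumes "continuous_on UNIV u" "continuous_on UNIV v" "F = closed_segment b c"
  shows "fmean F (\<lambda>x. u x + v x) = fmean F u + fmean F v"
  unfolding assms(3) fmean_eq[OF assms(1)] fmean_eq[OF assms(2)] fmean_eq[OF continuous_on_add[OF assms(1,2)]]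
  by (rule segmean_add[OF assms(1,2)])

lemma fmean_diff:
  assumes "continuous_on UNIV u" "continuous_on UNIV v" "F = closed_segment b c"
  shows "fmean F (\<lambda>x. u x - v x) = fmean F u - fmean F v"
  unfolding assms(3) fmean_eq[OF assms(1)] fmean_eq[OF assms(2)] fmean_eq[OF continuous_on_diff[OF assms(1,2)]]
  by (rule segmean_diff[OF assms(1,2)])

lemma fmean_cmult:
  assumes "continuous_on UNIV u" "F = closed_segment b c"
  shows "fmean F (\<lambda>x. k * u x) = k * fmean F u"
  unfolding assms(2) fmean_eq[OF assms(1)] fmean_eq[OF continuous_on_mult_left[OF assms(1)]]
  by (rule segmean_cmult)

text \<open>The pattern of the density arguments: inserting a test function costs a factor two and
  an error \<open>a n\<close> that disappears in the limit.\<close>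

lemma square_limit:
  fixes a :: "nat \<Rightarrow> real"
  assumes "a \<longlonglongrightarrow> 0" "\<And>n. X \<le> C * (2 * (a n)\<^sup>2 + 2 * E) + D * (a n)\<^sup>2"
  shows "X \<le> 2 * C * E"
proof -
  have "(\<lambda>n. C * (2 * (a n)\<^sup>2 + 2 * E) + D * (a n)\<^sup>2) \<longlonglongrightarrow> C * (2 * 0\<^sup>2 + 2 * E) + D * 0\<^sup>2"
    by (intro tendsto_intros assms(1))
  then have "X \<le> C * (2 * 0\<^sup>2 + 2 * E) + D * 0\<^sup>2"
    by (rule LIMSEQ_le_const) (use assms(2) in blast)
  then show ?thesis by simp
qed

section \<open>Patches of triangles and square integrability of discrete derivatives\<close>

context mesh
begin

lemma face_edge: "F \<in> faces \<T> \<Longrightarrow> \<exists>b c. F = closed_segment b c"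
proof -
  assume "F \<in> faces \<T>"
  note P = Tplus[OF this]
  show ?thesis using edgeE[OF simp2[OF P(1)] P(2)] by metis
qed

lemma patch_subset: "face_patch \<T> F = \<Union>(if F \<in> interior_faces \<T> then {Tplus \<T> F, Tminus \<T> F} else {Tplus \<T> F})"
  by (simp add: face_patch_def)

lemma face_patch_mesh:
  assumes "F \<in> faces \<T>"
  shows "(if F \<in> interior_faces \<T> then {Tplus \<T> F, Tminus \<T> F} else {Tplus \<T> F}) \<subseteq> \<T>"
  using Tplus[OF assms] Tminus[of F] by auto

lemma face_patch_lebesgue: "F \<in> faces \<T> \<Longrightarrow> face_patch \<T> F \<in> sets lebesgue"
  and face_patch_closure: "F \<in> faces \<T> \<Longrightarrow> face_patch \<T> F \<subseteq> closure \<Omega>"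
  unfolding patch_subset by (rule union_lebesgue union_subset, erule face_patch_mesh)+

lemma edge_patch_lebesgue: "T \<in> \<T> \<Longrightarrow> edge_patch \<T> T \<in> sets lebesgue"
  and edge_patch_closure: "T \<in> \<T> \<Longrightarrow> edge_patch \<T> T \<subseteq> closure \<Omega>"
proof -
  assume T: "T \<in> \<T>"
  have f: "F \<in> faces \<T>" if "F \<in> edges T" for F using that T by (auto simp: faces_def)
  show "edge_patch \<T> T \<in> sets lebesgue" unfolding edge_patch_def
    by (rule sets.finite_UN) (use edges_finite[OF simp2[OF T]] f face_patch_lebesgue in auto)
  show "edge_patch \<T> T \<subseteq> closure \<Omega>" unfolding edge_patch_def using f face_patch_closure by blast
qed

lemma vertex_patch_lebesgue: "vertex_patch \<T> T \<in> sets lebesgue"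
  and vertex_patch_closure: "vertex_patch \<T> T \<subseteq> closure \<Omega>"
  unfolding vertex_patch_def by (rule union_lebesgue union_subset, blast)+

lemma face_patch_vertex_patch:
  assumes T: "T \<in> \<T>" and F: "F \<in> edges T"
  shows "face_patch \<T> F \<subseteq> vertex_patch \<T> T"
proof -
  have Ff: "F \<in> faces \<T>" using T F by (auto simp: faces_def)
  obtain b c where "F = closed_segment b c" using face_edge[OF Ff] by blast
  then have ne: "F \<noteq> {}" by auto
  have "K \<inter> T \<noteq> {}" if "F \<in> edges K" for K
    using edge_subset[OF that] edge_subset[OF F] ne by blast
  moreover note Tplus[OF Ff] Tminus[of F]
  ultimately show ?thesis by (auto simp: face_patch_def vertex_patch_def)
qed

lemma morley_quadratic: "v \<in> morley \<T> \<Longrightarrow> K \<in> \<T> \<Longrightarrow> quadratic_poly (v K)"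
  by (simp add: morley_def)

lemma glue_pw_grad_L2: "v \<in> morley \<T> \<Longrightarrow> glue \<T> (pw_grad v) \<in> L2 (closure \<Omega>)"
  and glue_pw_hess_L2: "v \<in> morley \<T> \<Longrightarrow> glue \<T> (pw_hess v) \<in> L2 (closure \<Omega>)"
  by (rule L2_glue, simp only: pw_grad_eq pw_hess_eq, intro smooth_grad_continuous smooth_hess_continuous quadratic_smooth morley_quadratic, assumption+)+

end

section \<open>The gradient defect as a Crouzeix-Raviart function\<close>

context shape_mesh
begin

text \<open>Taken one partial derivative at a time, since the trace and Friedrichs inequalities are
  for scalar functions.\<close>

definition CR_defect :: "real pwfun \<Rightarrow> (point \<Rightarrow> real) \<Rightarrow> 2 \<Rightarrow> point set \<Rightarrow> point \<Rightarrow> real"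
  where "CR_defect v \<phi> i K x = pderiv2 i (v K) x - pderiv2 i \<phi> x"

definition CR_defect_grad :: "real pwfun \<Rightarrow> (point \<Rightarrow> real) \<Rightarrow> 2 \<Rightarrow> point set \<Rightarrow> point \<Rightarrow> point"
  where "CR_defect_grad v \<phi> i K x = hess (v K) x $ i - hess \<phi> x $ i"

lemma CR_defect_C1:
  assumes "v \<in> morley \<T>" "smooth \<phi>" "K \<in> \<T>"
  shows "C1 (CR_defect v \<phi> i K) (CR_defect_grad v \<phi> i K)"
  using C1_diff[OF smooth_pderiv_C1[OF quadratic_smooth[OF morley_quadratic[OF assms(1,3)]]] smooth_pderiv_C1[OF assms(2)]]
  unfolding CR_defect_def[abs_def] CR_defect_grad_def[abs_def] .

text \<open>The derivative is affine, so the midpoint rule is exact. It turns the midpoint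
  conditions of the Morley space into conditions on edge means.\<close>

lemma fmean_quadratic_pderiv:
  assumes "quadratic_poly p" "F = closed_segment b c"
  shows "fmean F (pderiv2 i p) = pderiv2 i p (face_midpoint F)"
proof -
  obtain d :: "2 \<Rightarrow> real" and H :: "real^2^2" where H: "\<And>i x. pderiv2 i p x = d i + (H $ i) \<bullet> x"
    using quadratic_derivs[OF assms(1)] by metis
  then have e: "pderiv2 i p = (\<lambda>x. d i + (H $ i) \<bullet> x)" by auto
  have c: "continuous_on UNIV (\<lambda>x. d i + (H $ i) \<bullet> x)" by (intro continuous_intros)
  show ?thesis unfolding e assms(2) fmean_eq[OF c] face_midpoint_segment by (rule segmean_affine)
qed

text \<open>The means of \<phi> are the same from both sides of an interior face and vanish on a
  boundary face, where \<phi> is zero because the face is disjoint from \<Omega>.\<close>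

lemma CR_defect_CR:
  assumes v: "v \<in> morley0 \<Omega> \<T>" and T: "\<phi> \<in> test_functions \<Omega>"
  shows "CR (CR_defect v \<phi> i) (CR_defect_grad v \<phi> i)"
  unfolding CR_def
proof (intro conjI ballI)
  have vm: "v \<in> morley \<T>" using v by (simp add: morley0_def)
  have sm: "smooth \<phi>" using T by (rule test_functionsD)
  have c\<phi>: "continuous_on UNIV (pderiv2 i \<phi>)" by (rule smooth_continuous[OF smooth_pderiv[OF sm]])
  have cv: "continuous_on UNIV (pderiv2 i (v K))" if "K \<in> \<T>" for K
    by (rule smooth_continuous[OF smooth_pderiv[OF quadratic_smooth[OF morley_quadratic[OF vm that]]]])
  show "C1 (CR_defect v \<phi> i K) (CR_defect_grad v \<phi> i K)" if "K \<in> \<T>" for K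
    by (rule CR_defect_C1[OF vm sm that])
  have mean: "fmean F (CR_defect v \<phi> i K) = pderiv2 i (v K) (face_midpoint F) - fmean F (pderiv2 i \<phi>)"
    if KF: "K \<in> \<T>" "F \<in> faces \<T>" for K F
  proof -
    obtain b c where Fs: "F = closed_segment b c" using face_edge[OF KF(2)] by blast
    show ?thesis unfolding CR_defect_def[abs_def] fmean_diff[OF cv[OF KF(1)] c\<phi> Fs]
      fmean_quadratic_pderiv[OF morley_quadratic[OF vm KF(1)] Fs] ..
  qed
  show "fmean F (CR_defect v \<phi> i (Tplus \<T> F)) = fmean F (CR_defect v \<phi> i (Tminus \<T> F))" if F: "F \<in> interior_faces \<T>" for F
  proof -
    have Ff: "F \<in> faces \<T>" using F by (simp add: interior_faces_def)
    have "jump \<T> F (pw_grad v) (face_midpoint F) = 0" using vm F by (simp add: morley_def)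
    then have "pderiv2 i (v (Tplus \<T> F)) (face_midpoint F) = pderiv2 i (v (Tminus \<T> F)) (face_midpoint F)"
      using F by (simp add: jump_def pw_grad_def vec_eq_iff)
    then show ?thesis by (simp add: mean[OF Tplus(1)[OF Ff] Ff] mean[OF Tminus(1)[OF F] Ff])
  qed
  show "fmean F (CR_defect v \<phi> i (Tplus \<T> F)) = 0" if F: "F \<in> boundary_faces \<T>" for F
  proof -
    have Ff: "F \<in> faces \<T>" using F by (simp add: boundary_faces_def)
    obtain b c where Fs: "F = closed_segment b c" using face_edge[OF Ff] by blast
    have "pw_grad v (Tplus \<T> F) (face_midpoint F) = 0" using v F by (simp add: morley0_def)
    then have 1: "pderiv2 i (v (Tplus \<T> F)) (face_midpoint F) = 0" by (simp add: pw_grad_def vec_eq_iff)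
    have "fmean F (pderiv2 i \<phi>) = fmean F (\<lambda>x. 0)"
      using boundary_face_disjoint[OF F] test_functions_outside[OF test_functions_pderiv[OF T]]
      by (intro fmean_cong[OF c\<phi> _ Fs]) auto
    also have "\<dots> = 0" by (simp add: Fs fmean_eq)
    finally show ?thesis using 1 by (simp add: mean[OF Tplus(1)[OF Ff] Ff])
  qed
qed

lemma CR_defect_norm:
  "(\<Sum>i\<in>UNIV. (CR_defect v \<phi> i K x)\<^sup>2) = (norm (grad (v K) x - grad \<phi> x))\<^sup>2"
  "(\<Sum>i\<in>UNIV. (norm (CR_defect_grad v \<phi> i K x))\<^sup>2) = (norm (hess (v K) x - hess \<phi> x))\<^sup>2"
  by (simp_all add: norm_vec_sq CR_defect_def CR_defect_grad_def grad_def)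

lemma CR_defect_grad_integral:
  assumes v: "v \<in> morley \<T>" and sm: "smooth \<phi>" and K: "K \<in> \<T>"
  shows "(\<Sum>i\<in>UNIV. LINT x|lebesgue_on K. (norm (CR_defect_grad v \<phi> i K x))\<^sup>2) = (L2norm K (\<lambda>x. hess \<phi> x - glue \<T> (pw_hess v) x))\<^sup>2"
proof -
  have cG: "continuous_on UNIV (CR_defect_grad v \<phi> i K)" for i
    using C1_cont_grad[OF CR_defect_C1[OF v sm K]] .
  have ch: "continuous_on UNIV (hess (v K))" "continuous_on UNIV (hess \<phi>)"
    using smooth_hess_continuous sm quadratic_smooth[OF morley_quadratic[OF v K]] by auto
  have "(\<Sum>i\<in>UNIV. LINT x|lebesgue_on K. (norm (CR_defect_grad v \<phi> i K x))\<^sup>2) = (LINT x|lebesgue_on K. (\<Sum>i\<in>UNIV. (norm (CR_defect_grad v \<phi> i K x))\<^sup>2))"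
    by (rule Bochner_Integration.integral_sum[symmetric], rule continuous_bounded_integrable[OF _ triangle_bounded[OF K] triangle_lebesgue[OF K]])
       (intro continuous_intros cG)
  also have "\<dots> = (L2norm K (\<lambda>x. hess (v K) x - hess \<phi> x))\<^sup>2"
    by (simp add: CR_defect_norm L2norm_sq)
  also have "L2norm K (\<lambda>x. hess (v K) x - hess \<phi> x) = L2norm K (\<lambda>x. hess \<phi> x - hess (v K) x)"
    by (simp add: L2norm_def norm_minus_commute)
  also have "\<dots> = L2norm K (\<lambda>x. hess \<phi> x - glue \<T> (pw_hess v) x)"
  proof (rule L2norm_cong_AE)
    show ae: "AE x in lebesgue_on K. hess \<phi> x - hess (v K) x = hess \<phi> x - glue \<T> (pw_hess v) x"
      using AE_glue[OF K, of "pw_hess v"] by eventually_elim (simp add: pw_hess_eq)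
    show m: "(\<lambda>x. hess \<phi> x - hess (v K) x) \<in> borel_measurable (lebesgue_on K)"
      by (rule L2_measurable, rule continuous_bounded_L2[OF _ triangle_bounded[OF K] triangle_lebesgue[OF K]]) (intro continuous_intros ch)
    show "(\<lambda>x. hess \<phi> x - glue \<T> (pw_hess v) x) \<in> borel_measurable (lebesgue_on K)"
      by (rule measurable_cong_AE_on[OF triangle_lebesgue[OF K] m ae])
  qed
  finally show ?thesis .
qed

lemma CR_defect_integral:
  assumes v: "v \<in> morley \<T>" and sm: "smooth \<phi>" and K: "K \<in> \<T>"
  shows "(\<Sum>i\<in>UNIV. LINT x|lebesgue_on K. (CR_defect v \<phi> i K x)\<^sup>2) = (L2norm K (\<lambda>x. grad \<phi> x - glue \<T> (pw_grad v) x))\<^sup>2"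
proof -
  have cG: "continuous_on UNIV (CR_defect v \<phi> i K)" for i
    using C1_cont[OF CR_defect_C1[OF v sm K]] .
  have ch: "continuous_on UNIV (grad (v K))" "continuous_on UNIV (grad \<phi>)"
    using smooth_grad_continuous sm quadratic_smooth[OF morley_quadratic[OF v K]] by auto
  have "(\<Sum>i\<in>UNIV. LINT x|lebesgue_on K. (CR_defect v \<phi> i K x)\<^sup>2) = (LINT x|lebesgue_on K. (\<Sum>i\<in>UNIV. (CR_defect v \<phi> i K x)\<^sup>2))"
    by (rule Bochner_Integration.integral_sum[symmetric], rule continuous_bounded_integrable[OF _ triangle_bounded[OF K] triangle_lebesgue[OF K]])
       (intro continuous_intros cG)
  also have "\<dots> = (L2norm K (\<lambda>x. grad (v K) x - grad \<phi> x))\<^sup>2"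
    by (simp add: CR_defect_norm L2norm_sq)
  also have "L2norm K (\<lambda>x. grad (v K) x - grad \<phi> x) = L2norm K (\<lambda>x. grad \<phi> x - grad (v K) x)"
    by (simp add: L2norm_def norm_minus_commute)
  also have "\<dots> = L2norm K (\<lambda>x. grad \<phi> x - glue \<T> (pw_grad v) x)"
  proof (rule L2norm_cong_AE)
    show ae: "AE x in lebesgue_on K. grad \<phi> x - grad (v K) x = grad \<phi> x - glue \<T> (pw_grad v) x"
      using AE_glue[OF K, of "pw_grad v"] by eventually_elim (simp add: pw_grad_eq)
    show m: "(\<lambda>x. grad \<phi> x - grad (v K) x) \<in> borel_measurable (lebesgue_on K)"
      by (rule L2_measurable, rule continuous_bounded_L2[OF _ triangle_bounded[OF K] triangle_lebesgue[OF K]]) (intro continuous_intros ch)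
    show "(\<lambda>x. grad \<phi> x - glue \<T> (pw_grad v) x) \<in> borel_measurable (lebesgue_on K)"
      by (rule measurable_cong_AE_on[OF triangle_lebesgue[OF K] m ae])
  qed
  finally show ?thesis .
qed

lemma test_L2_closure:
  assumes "\<phi> \<in> test_functions \<Omega>"
  shows "hess \<phi> \<in> L2 (closure \<Omega>)" "grad \<phi> \<in> L2 (closure \<Omega>)"
  using hess_test_L2[OF assms] grad_test_L2[OF assms] by (simp_all add: closure_L2)

lemma Morley_Friedrichs_test:
  assumes v: "v \<in> morley0 \<Omega> \<T>" and T: "\<phi> \<in> test_functions \<Omega>"
  shows "(L2norm \<Omega> (\<lambda>x. grad \<phi> x - glue \<T> (pw_grad v) x))\<^sup>2
    \<le> (R\<^sup>2 + 6 * R * h0 * \<rho>\<^sup>2) * (L2norm \<Omega> (\<lambda>x. hess \<phi> x - glue \<T> (pw_hess v) x))\<^sup>2"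
proof -
  have vm: "v \<in> morley \<T>" using v by (simp add: morley0_def)
  have sm: "smooth \<phi>" using T by (rule test_functionsD)
  note L = L2_diff[OF test_L2_closure(2)[OF T] glue_pw_grad_L2[OF vm]] L2_diff[OF test_L2_closure(1)[OF T] glue_pw_hess_L2[OF vm]]
  have LO: "(\<lambda>x. grad \<phi> x - glue \<T> (pw_grad v) x) \<in> L2 \<Omega>" "(\<lambda>x. hess \<phi> x - glue \<T> (pw_hess v) x) \<in> L2 \<Omega>"
    using L by (simp_all only: closure_L2)
  have "(L2norm \<Omega> (\<lambda>x. grad \<phi> x - glue \<T> (pw_grad v) x))\<^sup>2
    = (\<Sum>K\<in>\<T>. \<Sum>i\<in>UNIV. LINT x|lebesgue_on K. (CR_defect v \<phi> i K x)\<^sup>2)"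
    unfolding L2norm_Omega_sq[OF LO(1)] by (intro sum.cong refl CR_defect_integral[OF vm sm, symmetric])
  also have "\<dots> = (\<Sum>i\<in>UNIV. \<Sum>K\<in>\<T>. LINT x|lebesgue_on K. (CR_defect v \<phi> i K x)\<^sup>2)" by (rule sum.swap)
  also have "\<dots> \<le> (\<Sum>i\<in>UNIV. (R\<^sup>2 + 6 * R * h0 * \<rho>\<^sup>2) * (\<Sum>K\<in>\<T>. LINT x|lebesgue_on K. (norm (CR_defect_grad v \<phi> i K x))\<^sup>2))"
    by (intro sum_mono discrete_Friedrichs CR_defect_CR v T)
  also have "\<dots> = (R\<^sup>2 + 6 * R * h0 * \<rho>\<^sup>2) * (\<Sum>K\<in>\<T>. \<Sum>i\<in>UNIV. LINT x|lebesgue_on K. (norm (CR_defect_grad v \<phi> i K x))\<^sup>2)"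
    unfolding sum_distrib_left[symmetric] by (subst sum.swap) (rule refl)
  also have "(\<Sum>K\<in>\<T>. \<Sum>i\<in>UNIV. LINT x|lebesgue_on K. (norm (CR_defect_grad v \<phi> i K x))\<^sup>2) = (L2norm \<Omega> (\<lambda>x. hess \<phi> x - glue \<T> (pw_hess v) x))\<^sup>2"
    unfolding L2norm_Omega_sq[OF LO(2)] by (intro sum.cong refl CR_defect_grad_integral[OF vm sm])
  finally show ?thesis .
qed

lemma h0_nonneg: "0 \<le> h0"
proof -
  obtain K where K: "K \<in> \<T>" using Un ne closure_subset by blast
  obtain a b c where "area2 a b c \<noteq> 0" "K = convex hull {a,b,c}" using simplex2E[OF simp2[OF K]] by metis
  from shape_triangle(1)[OF K this(2,1)] h0[OF K] show ?thesis by linarith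
qed

text \<open>Density of test functions; the factor 4 comes from two splittings of a squared norm, one
  for the gradient and one for the Hessian.\<close>

lemma Morley_Friedrichs:
  assumes v: "v \<in> morley0 \<Omega> \<T>" and u: "u \<in> H20 \<Omega>"
  shows "(L2norm \<Omega> (\<lambda>x. wgrad \<Omega> u x - glue \<T> (pw_grad v) x))\<^sup>2
    \<le> 4 * (R\<^sup>2 + 6 * R * h0 * \<rho>\<^sup>2) * (L2norm \<Omega> (\<lambda>x. whess \<Omega> u x - glue \<T> (pw_hess v) x))\<^sup>2"
proof -
  let ?C = "R\<^sup>2 + 6 * R * h0 * \<rho>\<^sup>2"
  have C0: "0 \<le> ?C" using R_nonneg h0_nonneg by simp
  have vm: "v \<in> morley \<T>" using v by (simp add: morley0_def)
  note us = H20_sobolev2[OF u]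
  obtain \<phi> where T: "\<And>n. \<phi> n \<in> test_functions \<Omega>"
    and l1: "(\<lambda>n. L2norm \<Omega> (\<lambda>x. wgrad \<Omega> u x - grad (\<phi> n) x)) \<longlonglongrightarrow> 0"
    and l2: "(\<lambda>n. L2norm \<Omega> (\<lambda>x. whess \<Omega> u x - hess (\<phi> n) x)) \<longlonglongrightarrow> 0"
    using H20_approx[OF u] by blast
  have glueL: "glue \<T> (pw_grad v) \<in> L2 \<Omega>" "glue \<T> (pw_hess v) \<in> L2 \<Omega>"
    using glue_pw_grad_L2[OF vm] glue_pw_hess_L2[OF vm] by (simp_all only: closure_L2)
  define E where "E = (L2norm \<Omega> (\<lambda>x. whess \<Omega> u x - glue \<T> (pw_hess v) x))\<^sup>2"
  \<comment> \<open>One null sequence dominating both errors, as \<open>square_limit\<close> takes a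
    single one.\<close>
  define a where "a n = L2norm \<Omega> (\<lambda>x. wgrad \<Omega> u x - grad (\<phi> n) x) + L2norm \<Omega> (\<lambda>x. whess \<Omega> u x - hess (\<phi> n) x)" for n
  have a0: "a \<longlonglongrightarrow> 0" using tendsto_add[OF l1 l2] by (simp add: a_def[abs_def])
  have le: "(L2norm \<Omega> (\<lambda>x. wgrad \<Omega> u x - grad (\<phi> n) x))\<^sup>2 \<le> (a n)\<^sup>2" "(L2norm \<Omega> (\<lambda>x. whess \<Omega> u x - hess (\<phi> n) x))\<^sup>2 \<le> (a n)\<^sup>2" for n
    by (intro power_mono; simp add: a_def)+
  have "(L2norm \<Omega> (\<lambda>x. wgrad \<Omega> u x - glue \<T> (pw_grad v) x))\<^sup>2 \<le> (2 * ?C) * (2 * (a n)\<^sup>2 + 2 * E) + 2 * (a n)\<^sup>2" for n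
  proof -
    have "(L2norm \<Omega> (\<lambda>x. wgrad \<Omega> u x - glue \<T> (pw_grad v) x))\<^sup>2
      = (L2norm \<Omega> (\<lambda>x. (wgrad \<Omega> u x - grad (\<phi> n) x) + (grad (\<phi> n) x - glue \<T> (pw_grad v) x)))\<^sup>2" by simp
    also have "\<dots> \<le> 2 * (L2norm \<Omega> (\<lambda>x. wgrad \<Omega> u x - grad (\<phi> n) x))\<^sup>2 + 2 * (L2norm \<Omega> (\<lambda>x. grad (\<phi> n) x - glue \<T> (pw_grad v) x))\<^sup>2"
      by (intro L2norm_add_sq L2_diff wgrad_L2[OF us] grad_test_L2[OF T] glueL)
    also have "\<dots> \<le> 2 * (a n)\<^sup>2 + 2 * (?C * (L2norm \<Omega> (\<lambda>x. hess (\<phi> n) x - glue \<T> (pw_hess v) x))\<^sup>2)"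
      by (intro add_mono mult_left_mono le Morley_Friedrichs_test[OF v T]) auto
    also have "(L2norm \<Omega> (\<lambda>x. hess (\<phi> n) x - glue \<T> (pw_hess v) x))\<^sup>2 \<le> 2 * (a n)\<^sup>2 + 2 * E"
    proof -
      have "(L2norm \<Omega> (\<lambda>x. hess (\<phi> n) x - glue \<T> (pw_hess v) x))\<^sup>2
        = (L2norm \<Omega> (\<lambda>x. (hess (\<phi> n) x - whess \<Omega> u x) + (whess \<Omega> u x - glue \<T> (pw_hess v) x)))\<^sup>2" by simp
      also have "\<dots> \<le> 2 * (L2norm \<Omega> (\<lambda>x. hess (\<phi> n) x - whess \<Omega> u x))\<^sup>2 + 2 * E"
        unfolding E_def by (intro L2norm_add_sq L2_diff whess_L2[OF us] hess_test_L2[OF T] glueL)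
      also have "L2norm \<Omega> (\<lambda>x. hess (\<phi> n) x - whess \<Omega> u x) = L2norm \<Omega> (\<lambda>x. whess \<Omega> u x - hess (\<phi> n) x)"
        by (simp add: L2norm_def norm_minus_commute)
      finally show ?thesis using le(2)[of n] by linarith
    qed
    finally have "(L2norm \<Omega> (\<lambda>x. wgrad \<Omega> u x - glue \<T> (pw_grad v) x))\<^sup>2
      \<le> 2 * (a n)\<^sup>2 + 2 * (?C * (2 * (a n)\<^sup>2 + 2 * E))" using C0 by (simp add: mult_left_mono)
    then show ?thesis by (simp only: mult.assoc add.commute)
  qed
  from square_limit[OF a0 this] show ?thesis by (simp add: E_def)
qed

end

section \<open>Jumps and interpolation\<close>

lemma affine_poly_elementary:
  assumes "affine_poly p"
  shows "elementary p"
proof -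
  obtain c b where p: "\<And>x. p x = c + b \<bullet> x" using assms by (auto simp: affine_poly_def)
  have "p = (\<lambda>x. c + (b$1 * x$1 + b$2 * x$2))" by (auto simp: p inner_2)
  moreover have "elementary (\<lambda>x. c + (b$1 * x$1 + b$2 * x$2))" by (intro elementary.intros)
  ultimately show ?thesis by (simp only:)
qed

lemma affine_poly_bary:
  assumes "affine_poly p" "area2 a b c \<noteq> 0"
  shows "p x = p a + (area2 a x c / area2 a b c) * (p b - p a) + (area2 a b x / area2 a b c) * (p c - p a)"
proof -
  obtain d g where p: "\<And>x. p x = d + g \<bullet> x" using assms(1) by (auto simp: affine_poly_def)
  have "p x = p (a + (area2 a x c / area2 a b c) *\<^sub>R (b - a) + (area2 a b x / area2 a b c) *\<^sub>R (c - a))"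
    using bary_point[OF assms(2), of x] by simp
  also have "\<dots> = p a + (area2 a x c / area2 a b c) * (p b - p a) + (area2 a b x / area2 a b c) * (p c - p a)"
    unfolding p by (simp add: inner_add_right inner_diff_right)
  finally show ?thesis .
qed

lemma affine_area2: "affine_poly (\<lambda>x. area2 x b c)"
proof -
  have "area2 x b c = area2 0 b c + vector [b$2 - c$2, c$1 - b$1] \<bullet> x" for x
    using area2_shift[of 0 x b c] by (simp add: inner_2 mult.commute)
  then show ?thesis unfolding affine_poly_def by blast
qed

lemma affine_poly_combination:
  assumes "affine_poly p" "affine_poly q"
  shows "affine_poly (\<lambda>x. k + s * p x + t * q x)"
proof -
  obtain d g d' g' where p: "\<And>x. p x = d + g \<bullet> x" and q: "\<And>x. q x = d' + g' \<bullet> x"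
    using assms by (auto simp: affine_poly_def)
  have "k + s * p x + t * q x = (k + s * d + t * d') + (s *\<^sub>R g + t *\<^sub>R g') \<bullet> x" for x
    by (simp add: p q inner_add_left algebra_simps)
  then show ?thesis unfolding affine_poly_def by blast
qed

text \<open>\<open>interp\<close> is a definite description, so both existence, by the barycentric
  formula, and uniqueness, by \<open>affine_poly_bary\<close>, have to be supplied before it says
  anything.\<close>

lemma interp_affine:
  assumes "2 simplex K"
  shows "affine_poly (interp v K)"
proof -
  obtain a b c where D: "area2 a b c \<noteq> 0" and K: "K = convex hull {a,b,c}" using simplex2E[OF assms] by metis
  have vert: "vertices K = {a,b,c}" unfolding K by (rule vertices_triangle[OF D])
  define p where "p = (\<lambda>x. v K a + ((v K b - v K a) / area2 a b c) * area2 x c a + ((v K c - v K a) / area2 a b c) * area2 x a b)"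
  have "affine_poly p" unfolding p_def by (intro affine_poly_combination affine_area2)
  moreover have "\<forall>z\<in>vertices K. p z = v K z"
    unfolding vert using D by (auto simp: p_def area2_cyclic(1)[of a b c, symmetric] area2_cyclic(2)[of a b c, symmetric])
       (auto simp: area2_def)
  ultimately have ex: "affine_poly p \<and> (\<forall>z\<in>vertices K. p z = v K z)" by blast
  have "affine_poly (interp v K) \<and> (\<forall>z\<in>vertices K. interp v K z = v K z)"
    unfolding interp_def
  proof (rule theI[where a = p])
    show "affine_poly p \<and> (\<forall>z\<in>vertices K. p z = v K z)" by (rule ex)
    fix q assume q: "affine_poly q \<and> (\<forall>z\<in>vertices K. q z = v K z)"
    show "q = p"
    proof
      fix x
      have "q z = p z" if "z \<in> {a,b,c}" for z using q ex that unfolding vert by auto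
      then show "q x = p x"
        using affine_poly_bary[OF _ D, of q x] affine_poly_bary[OF _ D, of p x] q ex by simp
    qed
  qed
  then show ?thesis by blast
qed

lemma grad_diff:
  assumes "smooth p" "smooth q"
  shows "grad (\<lambda>x. p x - q x) x = grad p x - grad q x"
proof -
  have "((\<lambda>x. p x - q x) has_derivative (\<lambda>h. grad p x \<bullet> h - grad q x \<bullet> h)) (at x)" for x
    using smooth_C1[OF assms(1)] smooth_C1[OF assms(2)]
    unfolding C1_def grad_def by (intro has_derivative_diff) auto
  from pderiv2_eq[OF this] show ?thesis by (simp add: vec_eq_iff grad_def inner_axis)
qed

context mesh
begin

lemma jump_component:
  "jump \<T> F (pw_Grad v) x $ j = jump \<T> F (pw_grad (pw_cmp j v)) x"
  by (simp add: jump_def pw_Grad_def)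

lemma glue_component:
  "glue \<T> (pw_Hess v) x $ j = glue \<T> (pw_hess (pw_cmp j v)) x"
  "glue \<T> (pw_Grad v) x $ j = glue \<T> (pw_grad (pw_cmp j v)) x"
  by (simp_all add: glue_def pw_Hess_def pw_Grad_def)

lemma jump_continuous:
  assumes v: "v \<in> morley \<T>" and F: "F \<in> faces \<T>"
  shows "continuous_on UNIV (jump \<T> F (pw_grad v))"
proof -
  have c: "continuous_on UNIV (grad (v K))" if "K \<in> \<T>" for K
    by (rule smooth_grad_continuous[OF quadratic_smooth[OF morley_quadratic[OF v that]]])
  show ?thesis
  proof (cases "F \<in> interior_faces \<T>")
    case True
    then have "jump \<T> F (pw_grad v) = (\<lambda>x. grad (v (Tplus \<T> F)) x - grad (v (Tminus \<T> F)) x)"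
      by (simp add: jump_def[abs_def] pw_grad_eq)
    then show ?thesis using continuous_on_diff[OF c[OF Tplus(1)[OF F]] c[OF Tminus(1)[OF True]]] by simp
  next
    case False
    then have "jump \<T> F (pw_grad v) = grad (v (Tplus \<T> F))"
      by (simp add: jump_def[abs_def] pw_grad_eq)
    then show ?thesis using c[OF Tplus(1)[OF F]] by simp
  qed
qed

end

section \<open>Bounds for the gradient jumps and for the interpolation term\<close>

context shape_mesh
begin

abbreviation face_triangles :: "point set \<Rightarrow> point set set"
  where "face_triangles F \<equiv> (if F \<in> interior_faces \<T> then {Tplus \<T> F, Tminus \<T> F} else {Tplus \<T> F})"

text \<open>At an interior face \<phi> drops out of the jump, and so does the common edge mean of
  the two defects; \<open>trace_mean\<close> then bounds each side. At a boundary face \<phi> and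
  the mean of the defect both vanish.\<close>

lemma jump_component_test:
  assumes v: "v \<in> morley0 \<Omega> \<T>" and T: "\<phi> \<in> test_functions \<Omega>" and F: "F \<in> faces \<T>"
  shows "fmean F (\<lambda>x. (jump \<T> F (pw_grad v) x $ i)\<^sup>2)
    \<le> 4 * \<rho>\<^sup>2 * (\<Sum>K\<in>face_triangles F. LINT x|lebesgue_on K. (norm (CR_defect_grad v \<phi> i K x))\<^sup>2)"
proof -
  let ?N = "\<lambda>K. LINT x|lebesgue_on K. (norm (CR_defect_grad v \<phi> i K x))\<^sup>2"
  let ?w = "CR_defect v \<phi> i"
  have vm: "v \<in> morley \<T>" using v by (simp add: morley0_def)
  have sm: "smooth \<phi>" using T by (rule test_functionsD)
  note C = CR_defect_C1[OF vm sm, of _ i]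
  note cw = C1_cont[OF C]
  have cr: "CR ?w (CR_defect_grad v \<phi> i)" by (rule CR_defect_CR[OF v T])
  obtain b c where Fs: "F = closed_segment b c" using face_edge[OF F] by blast
  note P = Tplus[OF F]
  have cj: "continuous_on UNIV (\<lambda>x. (jump \<T> F (pw_grad v) x $ i)\<^sup>2)"
    by (intro continuous_intros jump_continuous[OF vm F])
  have tr: "fmean F (\<lambda>x. (?w K x - fmean F (?w K))\<^sup>2) \<le> 2 * \<rho>\<^sup>2 * ?N K" if "K \<in> \<T>" "F \<in> edges K" for K
    by (rule trace_mean[OF that C[OF that(1)]])
  show ?thesis
  proof (cases "F \<in> interior_faces \<T>")
    case True
    note M = Tminus[OF True]
    define m where "m = fmean F (?w (Tplus \<T> F))"
    have m2: "fmean F (?w (Tminus \<T> F)) = m" using cr True by (simp add: CR_def m_def)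
    have j: "jump \<T> F (pw_grad v) x $ i = (?w (Tplus \<T> F) x - m) - (?w (Tminus \<T> F) x - m)" for x
      using True by (simp add: jump_def pw_grad_def CR_defect_def)
    have c1: "continuous_on UNIV (\<lambda>x. (?w (Tplus \<T> F) x - m)\<^sup>2)" "continuous_on UNIV (\<lambda>x. (?w (Tminus \<T> F) x - m)\<^sup>2)"
      by (intro continuous_intros cw P M)+
    have "fmean F (\<lambda>x. (jump \<T> F (pw_grad v) x $ i)\<^sup>2)
      \<le> fmean F (\<lambda>x. 2 * (?w (Tplus \<T> F) x - m)\<^sup>2 + 2 * (?w (Tminus \<T> F) x - m)\<^sup>2)"
    proof (rule fmean_mono[OF cj _ Fs])
      show "continuous_on UNIV (\<lambda>x. 2 * (?w (Tplus \<T> F) x - m)\<^sup>2 + 2 * (?w (Tminus \<T> F) x - m)\<^sup>2)"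
        by (intro continuous_on_add continuous_on_mult_left c1)
      show "(jump \<T> F (pw_grad v) x $ i)\<^sup>2 \<le> 2 * (?w (Tplus \<T> F) x - m)\<^sup>2 + 2 * (?w (Tminus \<T> F) x - m)\<^sup>2" for x
        unfolding j using norm_diff_sq[of "?w (Tplus \<T> F) x - m" "?w (Tminus \<T> F) x - m"] by simp
    qed
    also have "\<dots> = 2 * fmean F (\<lambda>x. (?w (Tplus \<T> F) x - m)\<^sup>2) + 2 * fmean F (\<lambda>x. (?w (Tminus \<T> F) x - m)\<^sup>2)"
      by (simp add: fmean_add[OF continuous_on_mult_left[OF c1(1)] continuous_on_mult_left[OF c1(2)] Fs] fmean_cmult[OF c1(1) Fs] fmean_cmult[OF c1(2) Fs])
    also have "\<dots> \<le> 2 * (2 * \<rho>\<^sup>2 * ?N (Tplus \<T> F)) + 2 * (2 * \<rho>\<^sup>2 * ?N (Tminus \<T> F))"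
      using tr[OF P] tr[OF M(1,2)] unfolding m2 m_def[symmetric] by (intro add_mono mult_left_mono) auto
    also have "\<dots> = 4 * \<rho>\<^sup>2 * (\<Sum>K\<in>face_triangles F. ?N K)"
      using True M(3) by (simp add: algebra_simps)
    finally show ?thesis .
  next
    case False
    then have Fb: "F \<in> boundary_faces \<T>" using F by (simp add: boundary_faces_def)
    have m0: "fmean F (?w (Tplus \<T> F)) = 0" using cr Fb by (simp add: CR_def)
    have c1: "continuous_on UNIV (\<lambda>x. (?w (Tplus \<T> F) x - 0)\<^sup>2)"
      by (intro continuous_intros cw P)
    have zero: "pderiv2 i \<phi> x = 0" if "x \<in> F" for x
      using that boundary_face_disjoint[OF Fb] test_functions_outside[OF test_functions_pderiv[OF T], of x i] by blast
    have "fmean F (\<lambda>x. (jump \<T> F (pw_grad v) x $ i)\<^sup>2) = fmean F (\<lambda>x. (?w (Tplus \<T> F) x - 0)\<^sup>2)"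
      using False zero by (intro fmean_cong[OF cj c1 Fs]) (auto simp: jump_def pw_grad_def CR_defect_def)
    also have "\<dots> \<le> 2 * \<rho>\<^sup>2 * ?N (Tplus \<T> F)" using tr[OF P] unfolding m0 .
    also have "\<dots> \<le> 4 * \<rho>\<^sup>2 * ?N (Tplus \<T> F)"
      by (intro mult_right_mono Bochner_Integration.integral_nonneg) auto
    finally show ?thesis using False by simp
  qed
qed

lemma jump_test:
  assumes v: "v \<in> morley0 \<Omega> \<T>" and T: "\<phi> \<in> test_functions \<Omega>" and F: "F \<in> faces \<T>"
  shows "fmean F (\<lambda>x. (norm (jump \<T> F (pw_grad v) x))\<^sup>2)
    \<le> 4 * \<rho>\<^sup>2 * (L2norm (face_patch \<T> F) (\<lambda>x. hess \<phi> x - glue \<T> (pw_hess v) x))\<^sup>2"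
proof -
  let ?N = "\<lambda>i K. LINT x|lebesgue_on K. (norm (CR_defect_grad v \<phi> i K x))\<^sup>2"
  have vm: "v \<in> morley \<T>" using v by (simp add: morley0_def)
  have sm: "smooth \<phi>" using T by (rule test_functionsD)
  obtain b c where Fs: "F = closed_segment b c" using face_edge[OF F] by blast
  have cj: "continuous_on UNIV (\<lambda>x. (jump \<T> F (pw_grad v) x $ i)\<^sup>2)" for i
    by (intro continuous_intros jump_continuous[OF vm F])
  have sub: "face_triangles F \<subseteq> \<T>" by (rule face_patch_mesh[OF F])
  have "fmean F (\<lambda>x. (norm (jump \<T> F (pw_grad v) x))\<^sup>2) = (\<Sum>i\<in>UNIV. fmean F (\<lambda>x. (jump \<T> F (pw_grad v) x $ i)\<^sup>2))"
    by (simp add: norm_vec_sq sum_2 fmean_add[OF cj cj Fs])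
  also have "\<dots> \<le> (\<Sum>i\<in>UNIV. 4 * \<rho>\<^sup>2 * (\<Sum>K\<in>face_triangles F. ?N i K))"
    by (intro sum_mono jump_component_test v T F)
  also have "\<dots> = 4 * \<rho>\<^sup>2 * (\<Sum>K\<in>face_triangles F. \<Sum>i\<in>UNIV. ?N i K)"
    unfolding sum_distrib_left[symmetric] by (subst sum.swap) (rule refl)
  also have "(\<Sum>K\<in>face_triangles F. \<Sum>i\<in>UNIV. ?N i K) = (\<Sum>K\<in>face_triangles F. (L2norm K (\<lambda>x. hess \<phi> x - glue \<T> (pw_hess v) x))\<^sup>2)"
    by (rule sum.cong[OF refl], rule CR_defect_grad_integral[OF vm sm]) (use sub in blast)
  also have "\<dots> = (L2norm (face_patch \<T> F) (\<lambda>x. hess \<phi> x - glue \<T> (pw_hess v) x))\<^sup>2"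
    unfolding L2norm_sq patch_subset
    by (rule union_integral[OF sub, symmetric])
       (intro L2_sq_integrable L2_diff test_L2_closure[OF T] glue_pw_hess_L2[OF vm])
  finally show ?thesis .
qed

text \<open>The bound stays local in the limit: the distance of the test functions to
  \<open>u\<close> may be measured on all of \<Omega>, because it tends to zero, while the remaining
  term lives on the face patch.\<close>

lemma jump_bound:
  assumes v: "v \<in> morley0 \<Omega> \<T>" and u: "u \<in> H20 \<Omega>" and F: "F \<in> faces \<T>"
  shows "fmean F (\<lambda>x. (norm (jump \<T> F (pw_grad v) x))\<^sup>2)
    \<le> 8 * \<rho>\<^sup>2 * (L2norm (face_patch \<T> F) (\<lambda>x. whess \<Omega> u x - glue \<T> (pw_hess v) x))\<^sup>2"
proof -
  have vm: "v \<in> morley \<T>" using v by (simp add: morley0_def)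
  note us = H20_sobolev2[OF u]
  obtain \<phi> where T: "\<And>n. \<phi> n \<in> test_functions \<Omega>"
    and l2: "(\<lambda>n. L2norm \<Omega> (\<lambda>x. whess \<Omega> u x - hess (\<phi> n) x)) \<longlonglongrightarrow> 0"
    using H20_approx[OF u] by blast
  let ?P = "face_patch \<T> F"
  have wc: "whess \<Omega> u \<in> L2 (closure \<Omega>)" using whess_L2[OF us] by (simp only: closure_L2)
  note P = closure_lebesgue face_patch_lebesgue[OF F] face_patch_closure[OF F]
  have wP: "whess \<Omega> u \<in> L2 ?P" by (rule L2_subset[OF wc P])
  have gP: "glue \<T> (pw_hess v) \<in> L2 ?P" by (rule L2_subset[OF glue_pw_hess_L2[OF vm] P])
  have hP: "hess (\<phi> n) \<in> L2 ?P" for n by (rule L2_subset[OF test_L2_closure(1)[OF T] P])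
  define E where "E = (L2norm ?P (\<lambda>x. whess \<Omega> u x - glue \<T> (pw_hess v) x))\<^sup>2"
  \<comment> \<open>The summand with factor 0 only brings the bound into the form of
    \<open>square_limit\<close>.\<close>
  have "fmean F (\<lambda>x. (norm (jump \<T> F (pw_grad v) x))\<^sup>2)
    \<le> (4 * \<rho>\<^sup>2) * (2 * (L2norm \<Omega> (\<lambda>x. whess \<Omega> u x - hess (\<phi> n) x))\<^sup>2 + 2 * E) + 0 * (L2norm \<Omega> (\<lambda>x. whess \<Omega> u x - hess (\<phi> n) x))\<^sup>2" for n
  proof -
    have "fmean F (\<lambda>x. (norm (jump \<T> F (pw_grad v) x))\<^sup>2) \<le> 4 * \<rho>\<^sup>2 * (L2norm ?P (\<lambda>x. hess (\<phi> n) x - glue \<T> (pw_hess v) x))\<^sup>2"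
      by (rule jump_test[OF v T F])
    also have "(L2norm ?P (\<lambda>x. hess (\<phi> n) x - glue \<T> (pw_hess v) x))\<^sup>2
      = (L2norm ?P (\<lambda>x. (hess (\<phi> n) x - whess \<Omega> u x) + (whess \<Omega> u x - glue \<T> (pw_hess v) x)))\<^sup>2" by simp
    also have "4 * \<rho>\<^sup>2 * \<dots> \<le> 4 * \<rho>\<^sup>2 * (2 * (L2norm ?P (\<lambda>x. hess (\<phi> n) x - whess \<Omega> u x))\<^sup>2 + 2 * E)"
      unfolding E_def by (intro mult_left_mono L2norm_add_sq L2_diff wP gP hP) auto
    also have "L2norm ?P (\<lambda>x. hess (\<phi> n) x - whess \<Omega> u x) = L2norm ?P (\<lambda>x. whess \<Omega> u x - hess (\<phi> n) x)"
      by (simp add: L2norm_def norm_minus_commute)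
    also have "4 * \<rho>\<^sup>2 * (2 * (L2norm ?P (\<lambda>x. whess \<Omega> u x - hess (\<phi> n) x))\<^sup>2 + 2 * E)
      \<le> 4 * \<rho>\<^sup>2 * (2 * (L2norm \<Omega> (\<lambda>x. whess \<Omega> u x - hess (\<phi> n) x))\<^sup>2 + 2 * E)"
    proof (intro mult_left_mono add_right_mono power_mono)
      show "L2norm ?P (\<lambda>x. whess \<Omega> u x - hess (\<phi> n) x) \<le> L2norm \<Omega> (\<lambda>x. whess \<Omega> u x - hess (\<phi> n) x)"
        unfolding closure_L2(2)[symmetric]
        by (rule L2norm_subset[OF L2_diff[OF wc test_L2_closure(1)[OF T]] P])
    qed auto
    finally show ?thesis by simp
  qed
  from square_limit[OF l2 this] show ?thesis by (simp add: E_def)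
qed

lemma morley0v_cmp: "v \<in> morley0v \<Omega> \<T> \<Longrightarrow> pw_cmp j v \<in> morley0 \<Omega> \<T>"
  and morley0v_cmp': "v \<in> morley0v \<Omega> \<T> \<Longrightarrow> pw_cmp j v \<in> morley \<T>"
  by (auto simp: morley0v_def morley0_def)

lemma H20v_cmp: "u \<in> H20v \<Omega> \<Longrightarrow> cmp j u \<in> H20 \<Omega>"
  by (simp add: H20v_def)

lemma H20_L2_closure:
  assumes "u \<in> H20 \<Omega>"
  shows "whess \<Omega> u \<in> L2 (closure \<Omega>)" "wgrad \<Omega> u \<in> L2 (closure \<Omega>)"
  using whess_L2[OF H20_sobolev2[OF assms]] wgrad_L2[OF H20_sobolev2[OF assms]] by (simp_all only: closure_L2)

lemma Whess_L2: "u \<in> H20v \<Omega> \<Longrightarrow> Whess \<Omega> u \<in> L2 (closure \<Omega>)"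
  and Wgrad_L2: "u \<in> H20v \<Omega> \<Longrightarrow> Wgrad \<Omega> u \<in> L2 (closure \<Omega>)"
  using H20_L2_closure[OF H20v_cmp] by (subst L2_vec, simp add: Whess_def Wgrad_def)+

lemma pw_Hess_L2: "v \<in> morley0v \<Omega> \<T> \<Longrightarrow> glue \<T> (pw_Hess v) \<in> L2 (closure \<Omega>)"
  and pw_Grad_L2: "v \<in> morley0v \<Omega> \<T> \<Longrightarrow> glue \<T> (pw_Grad v) \<in> L2 (closure \<Omega>)"
  using glue_pw_hess_L2[OF morley0v_cmp'] glue_pw_grad_L2[OF morley0v_cmp'] by (subst L2_vec, simp add: glue_component)+

lemma interp_smooth: "K \<in> \<T> \<Longrightarrow> smooth (interp v K)"
  by (intro elementary_smooth affine_poly_elementary interp_affine simp2)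

lemma pw_Grad_interp_L2: "glue \<T> (pw_Grad (interpv v)) \<in> L2 (closure \<Omega>)"
proof -
  have "pw_cmp j (interpv v) K = interp (pw_cmp j v) K" for j K
    by (simp add: pw_cmp_def cmp_def interpv_def)
  then have "continuous_on UNIV (pw_grad (pw_cmp j (interpv v)) K)" if "K \<in> \<T>" for j K
    using smooth_grad_continuous[OF interp_smooth[OF that]] by (simp add: pw_grad_eq)
  then show ?thesis by (subst L2_vec) (simp add: glue_component L2_glue)
qed

lemma hess_err_sq:
  assumes u: "u \<in> H20v \<Omega>" and v: "v \<in> morley0v \<Omega> \<T>" and S: "S \<in> sets lebesgue" "S \<subseteq> closure \<Omega>"
  shows "(hess_err \<Omega> \<T> u v S)\<^sup>2 = (\<Sum>j\<in>UNIV. (L2norm S (\<lambda>x. whess \<Omega> (cmp j u) x - glue \<T> (pw_hess (pw_cmp j v)) x))\<^sup>2)"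
proof -
  have "(\<lambda>x. Whess \<Omega> u x - glue \<T> (pw_Hess v) x) \<in> L2 S"
    by (rule L2_subset[OF L2_diff[OF Whess_L2[OF u] pw_Hess_L2[OF v]] closure_lebesgue S])
  from L2norm_vec_sq[OF this] show ?thesis by (simp add: hess_err_def glue_component Whess_def)
qed

lemma hess_err_mono:
  assumes u: "u \<in> H20v \<Omega>" and v: "v \<in> morley0v \<Omega> \<T>"
    and S: "S \<in> sets lebesgue" "S \<subseteq> S'" "S' \<in> sets lebesgue" "S' \<subseteq> closure \<Omega>"
  shows "hess_err \<Omega> \<T> u v S \<le> hess_err \<Omega> \<T> u v S'"
  unfolding hess_err_def
  by (rule L2norm_subset[OF L2_subset[OF L2_diff[OF Whess_L2[OF u] pw_Hess_L2[OF v]] closure_lebesgue S(3,4)] S(3,1,2)])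

lemma interp_err_mono:
  assumes u: "u \<in> H20v \<Omega>"
    and S: "S \<in> sets lebesgue" "S \<subseteq> S'" "S' \<in> sets lebesgue" "S' \<subseteq> closure \<Omega>"
  shows "interp_err \<Omega> \<T> u v S \<le> interp_err \<Omega> \<T> u v S'"
  unfolding interp_err_def
  by (rule L2norm_subset[OF L2_subset[OF L2_diff[OF Wgrad_L2[OF u] pw_Grad_interp_L2] closure_lebesgue S(3,4)] S(3,1,2)])

text \<open>The weight \<open>inverse (diameter T)\<close> cancels the edge length, so only the mean
  square of the jump is left; 24 is the constant 8 of \<open>jump_bound\<close> for at most three
  edges.\<close>

lemma mu_NC_bound:
  assumes u: "u \<in> H20v \<Omega>" and v: "v \<in> morley0v \<Omega> \<T>" and T: "T \<in> \<T>"
  shows "\<mu>_NC \<T> v T \<le> sqrt (24 * \<rho>\<^sup>2) * hess_err \<Omega> \<T> u v (vertex_patch \<T> T)"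
proof -
  let ?V = "vertex_patch \<T> T"
  let ?e = "hess_err \<Omega> \<T> u v ?V"
  obtain p q r where D: "area2 p q r \<noteq> 0" and Th: "T = convex hull {p,q,r}" using simplex2E[OF simp2[OF T]] by metis
  have hp: "0 < diameter T" by (rule shape_triangle(1)[OF T Th D])
  have each: "inverse (diameter T) * (face_L2norm F (jump \<T> F (pw_Grad v)))\<^sup>2 \<le> 8 * \<rho>\<^sup>2 * ?e\<^sup>2" if F: "F \<in> edges T" for F
  proof -
    have Ff: "F \<in> faces \<T>" using T F by (auto simp: faces_def)
    obtain a b c where D: "area2 a b c \<noteq> 0" and Th: "T = convex hull {a,b,c}" and Fs: "F = closed_segment b c"
      using edgeE[OF simp2[OF T] F] by metis
    let ?J = "\<lambda>j x. (norm (jump \<T> F (pw_grad (pw_cmp j v)) x))\<^sup>2"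
    have cj: "continuous_on UNIV (?J j)" for j
      by (intro continuous_intros jump_continuous morley0v_cmp' v Ff)
    have e: "(\<lambda>x. (norm (jump \<T> F (pw_Grad v) x))\<^sup>2) = (\<lambda>x. ?J 1 x + ?J 2 x)"
      by (rule ext) (simp only: norm_vec_sq[of "jump \<T> F (pw_Grad v) _"] jump_component sum_2)
    have cJ: "continuous_on UNIV (\<lambda>x. ?J 1 x + ?J 2 x)" by (intro continuous_on_add cj)
    have nn: "0 \<le> fmean F (\<lambda>x. ?J 1 x + ?J 2 x)"
    proof -
      have "fmean F (\<lambda>x. 0) \<le> fmean F (\<lambda>x. ?J 1 x + ?J 2 x)" by (rule fmean_mono[OF _ cJ Fs]) auto
      then show ?thesis by (simp add: Fs fmean_eq)
    qed
    have fi: "face_integral F (\<lambda>x. ?J 1 x + ?J 2 x) = dist b c * fmean F (\<lambda>x. ?J 1 x + ?J 2 x)"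
      unfolding Fs face_integral_segment[OF cJ[unfolded Fs]] fmean_eq[OF cJ[unfolded Fs]] ..
    have "(face_L2norm F (jump \<T> F (pw_Grad v)))\<^sup>2 = dist b c * fmean F (\<lambda>x. ?J 1 x + ?J 2 x)"
      unfolding face_L2norm_def e fi using nn by simp
    also have "\<dots> \<le> diameter T * fmean F (\<lambda>x. ?J 1 x + ?J 2 x)"
      unfolding Th using nn by (intro mult_right_mono dist_le_diameter) auto
    also have "fmean F (\<lambda>x. ?J 1 x + ?J 2 x) = fmean F (?J 1) + fmean F (?J 2)"
      by (rule fmean_add[OF cj cj Fs])
    finally have 1: "inverse (diameter T) * (face_L2norm F (jump \<T> F (pw_Grad v)))\<^sup>2 \<le> fmean F (?J 1) + fmean F (?J 2)"
      using hp by (simp add: field_simps)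
    have "fmean F (?J j) \<le> 8 * \<rho>\<^sup>2 * (L2norm ?V (\<lambda>x. whess \<Omega> (cmp j u) x - glue \<T> (pw_hess (pw_cmp j v)) x))\<^sup>2" for j
    proof -
      have "fmean F (?J j) \<le> 8 * \<rho>\<^sup>2 * (L2norm (face_patch \<T> F) (\<lambda>x. whess \<Omega> (cmp j u) x - glue \<T> (pw_hess (pw_cmp j v)) x))\<^sup>2"
        by (rule jump_bound[OF morley0v_cmp[OF v] H20v_cmp[OF u] Ff])
      also have "\<dots> \<le> 8 * \<rho>\<^sup>2 * (L2norm ?V (\<lambda>x. whess \<Omega> (cmp j u) x - glue \<T> (pw_hess (pw_cmp j v)) x))\<^sup>2"
      proof (intro mult_left_mono power_mono)
        have "(\<lambda>x. whess \<Omega> (cmp j u) x - glue \<T> (pw_hess (pw_cmp j v)) x) \<in> L2 (closure \<Omega>)"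
          by (intro L2_diff H20_L2_closure H20v_cmp u glue_pw_hess_L2 morley0v_cmp' v)
        then have "(\<lambda>x. whess \<Omega> (cmp j u) x - glue \<T> (pw_hess (pw_cmp j v)) x) \<in> L2 ?V"
          by (rule L2_subset[OF _ closure_lebesgue vertex_patch_lebesgue vertex_patch_closure])
        then show "L2norm (face_patch \<T> F) (\<lambda>x. whess \<Omega> (cmp j u) x - glue \<T> (pw_hess (pw_cmp j v)) x)
          \<le> L2norm ?V (\<lambda>x. whess \<Omega> (cmp j u) x - glue \<T> (pw_hess (pw_cmp j v)) x)"
          by (rule L2norm_subset[OF _ vertex_patch_lebesgue face_patch_lebesgue[OF Ff] face_patch_vertex_patch[OF T F]])
      qed auto
      finally show ?thesis .
    qed
    from add_mono[OF this[of 1] this[of 2]] have "fmean F (?J 1) + fmean F (?J 2) \<le> 8 * \<rho>\<^sup>2 * ?e\<^sup>2"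
      unfolding hess_err_sq[OF u v vertex_patch_lebesgue vertex_patch_closure] by (simp add: sum_2 distrib_left)
    with 1 show ?thesis by linarith
  qed
  have "(\<mu>_NC \<T> v T)\<^sup>2 = (\<Sum>F\<in>edges T. inverse (diameter T) * (face_L2norm F (jump \<T> F (pw_Grad v)))\<^sup>2)"
    unfolding \<mu>_NC_def using hp by (intro real_sqrt_pow2 sum_nonneg) auto
  also have "\<dots> \<le> real (card (edges T)) * (8 * \<rho>\<^sup>2 * ?e\<^sup>2)" by (rule sum_bounded_above[OF each])
  also have "\<dots> \<le> 3 * (8 * \<rho>\<^sup>2 * ?e\<^sup>2)"
    using card_edges[OF simp2[OF T]] by (intro mult_right_mono) auto
  also have "\<dots> = (sqrt (24 * \<rho>\<^sup>2) * ?e)\<^sup>2" by (simp add: power_mult_distrib)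
  finally show ?thesis by (rule power2_le_imp_le) (simp add: hess_err_def)
qed

lemma mu_I_bound:
  assumes u: "u \<in> H20v \<Omega>" and v: "v \<in> morley0v \<Omega> \<T>"
  shows "(\<Sum>K\<in>\<T>. (\<mu>_I \<T> v K)\<^sup>2)
    \<le> 8 * (R\<^sup>2 + 6 * R * h0 * \<rho>\<^sup>2) * (hess_err \<Omega> \<T> u v \<Omega>)\<^sup>2 + 2 * (interp_err \<Omega> \<T> u v \<Omega>)\<^sup>2"
proof -
  let ?d = "glue \<T> (pw_Grad (\<lambda>K x. v K x - interpv v K x))"
  let ?D = "\<lambda>x. glue \<T> (pw_Grad v) x - glue \<T> (pw_Grad (interpv v)) x"
  have pw: "pw_Grad (\<lambda>K x. v K x - interpv v K x) K x = pw_Grad v K x - pw_Grad (interpv v) K x" if K: "K \<in> \<T>" for K x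
  proof -
    have "pw_cmp j (\<lambda>K x. v K x - interpv v K x) K = (\<lambda>x. pw_cmp j v K x - interp (pw_cmp j v) K x)"
      "pw_cmp j (interpv v) K = interp (pw_cmp j v) K" for j
      by (simp_all add: pw_cmp_def cmp_def interpv_def fun_eq_iff)
    then show ?thesis
      using grad_diff[OF quadratic_smooth[OF morley_quadratic[OF morley0v_cmp'[OF v] K]] interp_smooth[OF K]]
      by (subst vec_eq_iff) (simp add: pw_Grad_def pw_grad_eq)
  qed
  have DL: "?D \<in> L2 \<Omega>" using L2_diff[OF pw_Grad_L2[OF v] pw_Grad_interp_L2] by (simp only: closure_L2)
  have eqK: "L2norm K ?d = L2norm K ?D" if K: "K \<in> \<T>" for K
  proof -
    \<comment> \<open>All glued functions pick the same triangle at \<open>x\<close>, so the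
      equality is pointwise, edges included.\<close>
    have "?d x = ?D x" if "x \<in> K" for x
    proof -
      have "(SOME K. K \<in> \<T> \<and> x \<in> K) \<in> \<T>" using someI[of "\<lambda>K. K \<in> \<T> \<and> x \<in> K" K] K that by simp
      then show ?thesis unfolding glue_def by (rule pw)
    qed
    then show ?thesis unfolding L2norm_def
      by (intro arg_cong[where f = sqrt] Bochner_Integration.integral_cong refl) auto
  qed
  have "(\<Sum>K\<in>\<T>. (\<mu>_I \<T> v K)\<^sup>2) = (\<Sum>K\<in>\<T>. (L2norm K ?D)\<^sup>2)"
    by (rule sum.cong[OF refl]) (simp add: \<mu>_I_def eqK)
  also have "\<dots> = (L2norm \<Omega> ?D)\<^sup>2" by (rule L2norm_Omega_sq[OF DL, symmetric])
  also have "\<dots> = (L2norm \<Omega> (\<lambda>x. (glue \<T> (pw_Grad v) x - Wgrad \<Omega> u x) + (Wgrad \<Omega> u x - glue \<T> (pw_Grad (interpv v)) x)))\<^sup>2"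
    by simp
  also have "\<dots> \<le> 2 * (L2norm \<Omega> (\<lambda>x. glue \<T> (pw_Grad v) x - Wgrad \<Omega> u x))\<^sup>2 + 2 * (interp_err \<Omega> \<T> u v \<Omega>)\<^sup>2"
    unfolding interp_err_def closure_L2(2)[symmetric]
    by (intro L2norm_add_sq L2_diff pw_Grad_L2 v Wgrad_L2 u pw_Grad_interp_L2)
  also have "L2norm \<Omega> (\<lambda>x. glue \<T> (pw_Grad v) x - Wgrad \<Omega> u x) = L2norm \<Omega> (\<lambda>x. Wgrad \<Omega> u x - glue \<T> (pw_Grad v) x)"
    by (simp add: L2norm_def norm_minus_commute)
  also have "(L2norm \<Omega> (\<lambda>x. Wgrad \<Omega> u x - glue \<T> (pw_Grad v) x))\<^sup>2 \<le> 4 * (R\<^sup>2 + 6 * R * h0 * \<rho>\<^sup>2) * (hess_err \<Omega> \<T> u v \<Omega>)\<^sup>2"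
  proof -
    have L: "(\<lambda>x. Wgrad \<Omega> u x - glue \<T> (pw_Grad v) x) \<in> L2 \<Omega>"
      using L2_diff[OF Wgrad_L2[OF u] pw_Grad_L2[OF v]] by (simp only: closure_L2)
    have "(L2norm \<Omega> (\<lambda>x. Wgrad \<Omega> u x - glue \<T> (pw_Grad v) x))\<^sup>2
      = (\<Sum>j\<in>UNIV. (L2norm \<Omega> (\<lambda>x. wgrad \<Omega> (cmp j u) x - glue \<T> (pw_grad (pw_cmp j v)) x))\<^sup>2)"
      using L2norm_vec_sq[OF L] by (simp add: glue_component Wgrad_def)
    also have "\<dots> \<le> (\<Sum>j\<in>UNIV. 4 * (R\<^sup>2 + 6 * R * h0 * \<rho>\<^sup>2) * (L2norm \<Omega> (\<lambda>x. whess \<Omega> (cmp j u) x - glue \<T> (pw_hess (pw_cmp j v)) x))\<^sup>2)"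
      by (intro sum_mono Morley_Friedrichs morley0v_cmp v H20v_cmp u)
    also have "\<dots> = 4 * (R\<^sup>2 + 6 * R * h0 * \<rho>\<^sup>2) * (hess_err \<Omega> \<T> u v \<Omega>)\<^sup>2"
      by (simp add: hess_err_sq[OF u v Omega_lebesgue closure_subset] sum_distrib_left)
    finally show ?thesis .
  qed
  finally have "(\<Sum>K\<in>\<T>. (\<mu>_I \<T> v K)\<^sup>2) \<le> 2 * (4 * (R\<^sup>2 + 6 * R * h0 * \<rho>\<^sup>2) * (hess_err \<Omega> \<T> u v \<Omega>)\<^sup>2) + 2 * (interp_err \<Omega> \<T> u v \<Omega>)\<^sup>2"
    by simp
  also have "2 * (4 * (R\<^sup>2 + 6 * R * h0 * \<rho>\<^sup>2) * (hess_err \<Omega> \<T> u v \<Omega>)\<^sup>2) = 8 * (R\<^sup>2 + 6 * R * h0 * \<rho>\<^sup>2) * (hess_err \<Omega> \<T> u v \<Omega>)\<^sup>2"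
    by (simp only: mult.assoc[symmetric])
  finally show ?thesis .
qed

end

section \<open>Bump functions\<close>

text \<open>\<open>flat 0\<close> applied to one minus the squared distance in units of
  \<open>r\<close>, written in coordinates with sums and products only so that it falls under
  \<open>elementary\<close>.\<close>

definition bump :: "point \<Rightarrow> real \<Rightarrow> point \<Rightarrow> real"
  where "bump m r x = flat 0 (1 + (- inverse (r * r)) *
    ((x$1 + (- m$1)) * (x$1 + (- m$1)) + (x$2 + (- m$2)) * (x$2 + (- m$2))))"

lemma bump_elementary: "elementary (bump m r)"
  unfolding bump_def by (intro elementary.intros)

lemma bump_smooth: "smooth (bump m r)"
  by (rule elementary_smooth[OF bump_elementary])

lemma bump_alt: "bump m r x = flat 0 (1 - (dist x m / r)\<^sup>2)"
proof -
  have e: "(dist x m)\<^sup>2 = (x$1 + (- m$1)) * (x$1 + (- m$1)) + (x$2 + (- m$2)) * (x$2 + (- m$2))"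
    by (simp add: dist_norm power2_norm_eq_inner inner_2)
  have "(dist x m / r)\<^sup>2 = inverse (r * r) * (dist x m)\<^sup>2"
    by (simp add: power_divide power2_eq_square divide_inverse mult.commute)
  then show ?thesis unfolding bump_def e[symmetric] by simp
qed

lemma bump_bounds: "0 \<le> bump m r x" "bump m r x \<le> 1"
  unfolding bump_def by (rule flat_0_bounds)+

lemma bump_support:
  assumes "r > 0" "bump m r x \<noteq> 0"
  shows "dist x m < r"
proof -
  have "(dist x m / r)\<^sup>2 < 1" using assms(2) by (auto simp: bump_alt flat_def split: if_splits)
  then have "dist x m / r < 1" by (rule power2_less_imp_less[of _ 1, simplified])
  then show ?thesis using assms(1) by simp
qed

text \<open>In this range the argument of \<open>flat 0\<close> is at least 1/2, and exp(-1/u) is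
  increasing.\<close>

lemma bump_lower:
  assumes "r > 0" "(dist x m)\<^sup>2 \<le> r\<^sup>2 / 2"
  shows "exp (-2) \<le> bump m r x"
proof -
  have h: "(dist x m / r)\<^sup>2 \<le> 1/2" using assms by (simp add: power_divide divide_simps)
  define u where "u = 1 - (dist x m / r)\<^sup>2"
  have u: "1/2 \<le> u" using h by (simp add: u_def)
  then have "inverse u \<le> inverse (1/2)" by (intro le_imp_inverse_le) auto
  then have "exp (-2) \<le> exp (- inverse u)" by simp
  then show ?thesis using u by (simp add: bump_alt flat_def u_def[symmetric])
qed

lemma bump_scale: "bump m r x = bump 0 1 (inverse r *\<^sub>R (x - m))"
  by (simp add: bump_alt dist_norm divide_inverse power_mult_distrib power_inverse mult.commute)

lemma pderiv2_scale:
  assumes "smooth f"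
  shows "pderiv2 i (\<lambda>x. k * f (s *\<^sub>R (x - m))) = (\<lambda>x. k * s * pderiv2 i f (s *\<^sub>R (x - m)))"
proof -
  have d: "((\<lambda>x. k * f (s *\<^sub>R (x - m))) has_derivative (\<lambda>h. k * (grad f (s *\<^sub>R (x - m)) \<bullet> (s *\<^sub>R h)))) (at x)" for x
  proof (rule has_derivative_mult_right)
    have "(f has_derivative (\<lambda>h. grad f (s *\<^sub>R (x - m)) \<bullet> h)) (at (s *\<^sub>R (x - m)))"
      using smooth_C1[OF assms] by (simp add: C1_def grad_def)
    moreover have "((\<lambda>x. s *\<^sub>R (x - m)) has_derivative (\<lambda>h. s *\<^sub>R h)) (at x)"
      by (auto intro!: derivative_eq_intros)
    ultimately show "((\<lambda>x. f (s *\<^sub>R (x - m))) has_derivative (\<lambda>h. grad f (s *\<^sub>R (x - m)) \<bullet> s *\<^sub>R h)) (at x)"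
      by (rule has_derivative_compose[rotated])
  qed
  show ?thesis unfolding pderiv2_eq[OF d] by (simp add: inner_axis grad_def mult.assoc)
qed

text \<open>Differentiate the parity relation: both sides are rescaled copies of \<open>f\<close>,
  with scale factors 1 and -1. For \<sigma> = 1 an even function gets odd derivatives.\<close>

lemma pderiv2_even_odd:
  assumes "smooth f" "\<And>x. f (-x) = \<sigma> * f x"
  shows "pderiv2 i f (-x) = - \<sigma> * pderiv2 i f x"
proof -
  have e: "(\<lambda>x. \<sigma> * f (1 *\<^sub>R (x - 0))) = (\<lambda>x. 1 * f ((-1) *\<^sub>R (x - 0)))" using assms(2) by simp
  have "pderiv2 i (\<lambda>x. \<sigma> * f (1 *\<^sub>R (x - 0))) x = pderiv2 i (\<lambda>x. 1 * f ((-1) *\<^sub>R (x - 0))) x"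
    unfolding e ..
  then show ?thesis unfolding pderiv2_scale[OF assms(1)] by simp
qed

lemma bump_derivs:
  "pderiv2 i (bump m r) x = inverse r * pderiv2 i (bump 0 1) (inverse r *\<^sub>R (x - m))"
  "pderiv2 k (pderiv2 i (bump m r)) x = (inverse r)\<^sup>2 * pderiv2 k (pderiv2 i (bump 0 1)) (inverse r *\<^sub>R (x - m))"
proof -
  have 0: "bump m r = (\<lambda>x. 1 * bump 0 1 (inverse r *\<^sub>R (x - m)))"
    by (rule ext) (simp add: bump_scale[of m r])
  have 1: "pderiv2 i (bump m r) = (\<lambda>x. inverse r * pderiv2 i (bump 0 1) (inverse r *\<^sub>R (x - m)))" for i
    unfolding 0 pderiv2_scale[OF bump_smooth] by simp
  show "pderiv2 i (bump m r) x = inverse r * pderiv2 i (bump 0 1) (inverse r *\<^sub>R (x - m))" by (simp add: 1)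
  show "pderiv2 k (pderiv2 i (bump m r)) x = (inverse r)\<^sup>2 * pderiv2 k (pderiv2 i (bump 0 1)) (inverse r *\<^sub>R (x - m))"
    unfolding 1 pderiv2_scale[OF smooth_pderiv[OF bump_smooth]] by (simp add: power2_eq_square)
qed

lemma bump_grad: "grad (bump m r) x = inverse r *\<^sub>R grad (bump 0 1) (inverse r *\<^sub>R (x - m))"
  and bump_hess: "hess (bump m r) x = (inverse r)\<^sup>2 *\<^sub>R hess (bump 0 1) (inverse r *\<^sub>R (x - m))"
  by (simp_all add: vec_eq_iff grad_def hess_def bump_derivs(1)[where m = m and r = r] bump_derivs(2)[where m = m and r = r])

lemma bump_derivs_outside:
  assumes "r > 0" "x \<notin> cball m r"
  shows "grad (bump m r) x = 0" "hess (bump m r) x = 0"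
proof -
  have op: "open (- cball m r)" by auto
  have z: "bump m r y = 0" if "y \<in> - cball m r" for y
    using bump_support[OF assms(1), of m y] that by (auto simp: dist_commute)
  have g: "grad (bump m r) y = 0" if "y \<in> - cball m r" for y
    using C1_zero_outside[OF smooth_C1[OF bump_smooth] op z that] by (simp add: grad_def)
  then show "grad (bump m r) x = 0" using assms by simp
  have p: "pderiv2 i (bump m r) y = 0" if "y \<in> - cball m r" for i y
    using g[OF that] by (simp add: grad_def vec_eq_iff)
  have "hess (bump m r) x $ i = 0" for i
    using C1_zero_outside[OF smooth_pderiv_C1[OF bump_smooth] op p] assms by simp
  then show "hess (bump m r) x = 0" by (simp add: vec_eq_iff[of "hess (bump m r) x"])
qed

text \<open>By scaling everything reduces to the unit bump, whose derivatives are continuous with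
  compact support. Hence a single \<open>B\<close> serves all centres and radii.\<close>

lemma bump_deriv_bounds:
  obtains B where "B > 0" "\<And>m r x. r > 0 \<Longrightarrow> norm (grad (bump m r) x) \<le> B / r"
    "\<And>m r x. r > 0 \<Longrightarrow> norm (hess (bump m r) x) \<le> B / r\<^sup>2"
proof -
  have ex: "\<exists>B. \<forall>x. norm (g x) \<le> B"
    if c: "continuous_on UNIV g" and z: "\<And>x. x \<notin> cball 0 1 \<Longrightarrow> g x = 0" for g :: "point \<Rightarrow> 'a::euclidean_space"
  proof -
    have "bounded (g ` cball 0 1)"
      by (intro compact_imp_bounded compact_continuous_image compact_cball continuous_on_subset[OF c]) auto
    then obtain B where B: "\<And>x. x \<in> cball 0 1 \<Longrightarrow> norm (g x) \<le> B" unfolding bounded_iff by blast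
    have "norm (g x) \<le> \<bar>B\<bar>" for x using B[of x] z[of x] by (cases "x \<in> cball 0 1") auto
    then show ?thesis by blast
  qed
  obtain B1 where B1: "\<And>x. norm (grad (bump 0 1) x) \<le> B1"
    using ex[OF smooth_grad_continuous[OF bump_smooth] bump_derivs_outside(1)[OF zero_less_one]] by blast
  obtain B2 where B2: "\<And>x. norm (hess (bump 0 1) x) \<le> B2"
    using ex[OF smooth_hess_continuous[OF bump_smooth] bump_derivs_outside(2)[OF zero_less_one]] by blast
  define B where "B = \<bar>B1\<bar> + \<bar>B2\<bar> + 1"
  have B: "norm (grad (bump 0 1) x) \<le> B" "norm (hess (bump 0 1) x) \<le> B" for x
    using B1[of x] B2[of x] by (auto simp: B_def)
  show ?thesis
  proof (rule that[of B])
    show "B > 0" by (simp add: B_def)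
    show "norm (grad (bump m r) x) \<le> B / r" if "r > 0" for m r x
      by (subst bump_grad) (use B(1) that in \<open>simp add: divide_inverse mult.commute\<close>)
    show "norm (hess (bump m r) x) \<le> B / r\<^sup>2" if "r > 0" for m r x
      by (subst bump_hess) (use B(2) that in \<open>simp add: divide_inverse mult.commute power_inverse\<close>)
  qed
qed

lemma bump_symmetric:
  "pderiv2 i (bump m r) (m + y) = - pderiv2 i (bump m r) (m - y)"
proof -
  have "bump 0 1 (-x) = 1 * bump 0 1 x" for x by (simp add: bump_alt)
  from pderiv2_even_odd[OF bump_smooth this] show ?thesis
    unfolding bump_derivs(1)[of i m r] by simp
qed

lemma square_content:
  assumes "0 \<le> s"
  shows "measure lebesgue (cbox (m - (\<chi> i. s)) (m + (\<chi> i. s)) :: point set) = (2 * s)\<^sup>2"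
proof -
  have "cbox (m - (\<chi> i. s)) (m + (\<chi> i. s)) \<noteq> {}" using assms by (auto simp: interval_ne_empty_cart)
  from content_cbox_cart[OF this] show ?thesis by (simp add: UNIV_2 power2_eq_square)
qed

text \<open>The disc is enclosed in a square of side \<open>2 * r\<close>, whose measure is
  explicit; its square root is the factor in front of \<open>B\<close>.\<close>

lemma L2norm_disc:
  assumes S: "S \<in> sets lebesgue" and B: "\<And>x. x \<in> S \<Longrightarrow> norm (g x) \<le> B" and r: "0 \<le> r"
    and z: "\<And>x. x \<in> S \<Longrightarrow> g x \<noteq> 0 \<Longrightarrow> dist x m \<le> r" and B0: "0 \<le> B"
  shows "L2norm S g \<le> 2 * r * B"
proof -
  let ?Q = "cbox (m - (\<chi> i. r)) (m + (\<chi> i. r)) :: point set"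
  have inQ: "x \<in> ?Q" if "dist x m \<le> r" for x
    using component_le_norm_cart[of "x - m"] that
    by (auto simp: mem_box_cart dist_norm abs_le_iff) (smt (verit))+
  have "(LINT x|lebesgue_on S. (norm (g x))\<^sup>2) = (LINT x|lebesgue. indicator S x * (norm (g x))\<^sup>2)"
    by (rule restrict_integral(2)[OF S])
  also have "\<dots> \<le> (LINT x|lebesgue. indicator ?Q x * B\<^sup>2)"
  proof (rule integral_mono')
    show "integrable lebesgue (\<lambda>x. indicator ?Q x * B\<^sup>2)"
      by (intro integrable_mult_left integrable_real_indicator) (auto simp: emeasure_lborel_cbox_eq)
    show "indicator S x * (norm (g x))\<^sup>2 \<le> indicator ?Q x * B\<^sup>2" for x
    proof (cases "x \<in> S \<and> g x \<noteq> 0")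
      case True
      then have "x \<in> ?Q" "norm (g x) \<le> B" using z[of x] inQ[of x] B[of x] by auto
      then show ?thesis using True by (simp add: power_mono)
    qed (auto simp: indicator_def)
  qed simp
  also have "\<dots> = measure lebesgue ?Q * B\<^sup>2" by simp
  also have "\<dots> = (2 * r * B)\<^sup>2" unfolding square_content[OF r] by (simp add: power_mult_distrib)
  finally have "(L2norm S g)\<^sup>2 \<le> (2 * r * B)\<^sup>2" by (simp add: L2norm_sq)
  then show ?thesis by (rule power2_le_imp_le) (use r B0 in simp)
qed

text \<open>The square of side \<open>r\<close> around \<open>m\<close> lies in the region of
  \<open>bump_lower\<close>, and its area is the factor next to \<open>exp (-2)\<close>.\<close>

lemma bump_integral_lower:
  assumes S: "S \<in> sets lebesgue" "bounded S" and r: "r > 0" and ball: "cball m r \<subseteq> S"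
  shows "exp (-2) * r\<^sup>2 \<le> (LINT x|lebesgue_on S. bump m r x)"
proof -
  let ?Q = "cbox (m - (\<chi> i. r/2)) (m + (\<chi> i. r/2)) :: point set"
  have Q: "(dist x m)\<^sup>2 \<le> r\<^sup>2 / 2" if "x \<in> ?Q" for x
  proof -
    have "m $ i \<le> x $ i + r / 2 \<and> x $ i \<le> m $ i + r / 2" for i
      using that by (simp add: mem_box_cart algebra_simps)
    from this[of 1] this[of 2] have "\<bar>x$1 - m$1\<bar> \<le> r/2" "\<bar>x$2 - m$2\<bar> \<le> r/2" by linarith+
    then have "(x$1 - m$1)\<^sup>2 \<le> (r/2)\<^sup>2" "(x$2 - m$2)\<^sup>2 \<le> (r/2)\<^sup>2"
      using r by (auto simp: abs_le_square_iff[symmetric])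
    moreover have "(dist x m)\<^sup>2 = (x$1 - m$1)\<^sup>2 + (x$2 - m$2)\<^sup>2"
      by (simp add: dist_norm norm_vec_sq sum_2)
    ultimately show ?thesis by (simp add: power_divide)
  qed
  have QS: "?Q \<subseteq> S"
  proof
    fix x assume "x \<in> ?Q"
    from Q[OF this] have "(dist x m)\<^sup>2 \<le> r\<^sup>2" using zero_le_power2[of r] by linarith
    then have "dist x m \<le> r" by (rule power2_le_imp_le) (use r in simp)
    then show "x \<in> S" using ball by (auto simp: dist_commute)
  qed
  have "exp (-2) * r\<^sup>2 = (LINT x|lebesgue. indicator ?Q x * exp (-2))"
    using r square_content[of "r/2" m] by simp
  also have "\<dots> \<le> (LINT x|lebesgue. indicator S x * bump m r x)"
  proof (rule integral_mono')
    show "integrable lebesgue (\<lambda>x. indicator S x * bump m r x)"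
      using continuous_bounded_integrable[OF smooth_continuous[OF bump_smooth] S(2,1)] S(1) by (simp add: restrict_integral)
    show "indicator ?Q x * exp (-2) \<le> indicator S x * bump m r x" for x
    proof (cases "x \<in> ?Q")
      case True
      then show ?thesis using QS bump_lower[OF r Q[OF True]] by (auto simp: indicator_def)
    next
      case False
      then show ?thesis using bump_bounds by (simp add: indicator_def)
    qed
    show "0 \<le> indicator S x * bump m r x" for x using bump_bounds by simp
  qed
  also have "\<dots> = (LINT x|lebesgue_on S. bump m r x)" by (rule restrict_integral(2)[OF S(1), symmetric])
  finally show ?thesis .
qed

text \<open>Parameters within \<open>s\<close> of 1/2 stay within \<open>r / 2\<close> of the
  midpoint, and they fill an interval of length \<open>2 * s = r / dist b c\<close>.\<close>

lemma bump_segmean_lower: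
  assumes r: "0 < r" "r \<le> dist b c"
  shows "exp (-2) * (r / dist b c) \<le> segmean (bump (midpoint b c) r) b c"
proof -
  let ?m = "midpoint b c" define s where "s = r / (2 * dist b c)"
  have d: "0 < dist b c" using r by linarith
  have s: "0 < s" "s \<le> 1/2" "2 * s = r / dist b c" using r d by (auto simp: s_def field_simps)
  let ?I = "{1/2 - s..1/2 + s}"
  have low: "exp (-2) \<le> bump ?m r (linepath b c t)" if "t \<in> ?I" for t
  proof (rule bump_lower[OF r(1)])
    have "linepath b c t - ?m = (t - 1/2) *\<^sub>R (c - b)"
    proof (subst vec_eq_iff, intro allI)
      fix i
      have "(1 - t) * B + t * C - inverse 2 * (B + C) = (t - 1/2) * (C - B)" for B C :: real
        by (simp add: field_simps)
      from this[of "b $ i" "c $ i"] show "(linepath b c t - ?m) $ i = ((t - 1/2) *\<^sub>R (c - b)) $ i"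
        by (simp only: linepath_def midpoint_def vector_minus_component vector_add_component vector_scaleR_component real_scaleR_def)
    qed
    then have "dist (linepath b c t) ?m = \<bar>t - 1/2\<bar> * dist b c" by (simp add: dist_norm norm_minus_commute)
    also have "\<dots> \<le> s * dist b c" using that by (intro mult_right_mono) (auto simp: abs_le_iff)
    also have "\<dots> = r / 2" using d by (simp add: s_def)
    finally have "(dist (linepath b c t) ?m)\<^sup>2 \<le> (r/2)\<^sup>2" by (intro power_mono) auto
    also have "\<dots> \<le> r\<^sup>2 / 2" by (simp add: power_divide)
    finally show "(dist (linepath b c t) ?m)\<^sup>2 \<le> r\<^sup>2 / 2" .
  qed
  have cont: "continuous_on S (\<lambda>t. bump ?m r (linepath b c t))" for S
    by (rule continuous_linepath_comp[OF smooth_continuous[OF bump_smooth]])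
  have "exp (-2) * (r / dist b c) = integral ?I (\<lambda>t. exp (-2))" using s by simp
  also have "\<dots> \<le> integral ?I (\<lambda>t. bump ?m r (linepath b c t))"
    by (intro integral_le integrable_continuous_interval cont continuous_intros low)
  also have "\<dots> \<le> integral {0..1} (\<lambda>t. bump ?m r (linepath b c t))"
    using s by (intro integral_subset_le integrable_continuous_interval cont) (auto simp: bump_bounds)
  finally show ?thesis by (simp add: segmean_def)
qed

lemma bump_test:
  assumes "r > 0" "cball m r \<subseteq> \<Omega>"
  shows "bump m r \<in> test_functions \<Omega>"
  by (rule test_functionsI[OF bump_smooth closed_cball bounded_cball assms(2)])
     (use bump_support[OF assms(1)] in \<open>force simp: dist_commute\<close>)

section \<open>The cofactor product\<close>

lemma cof_mult: "(cof M *v g) $ 1 = M$2$2 * g$1 - M$1$2 * g$2" "(cof M *v g) $ 2 = - M$2$1 * g$1 + M$1$1 * g$2"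
  by (simp_all add: cof_def matrix_vector_mult_def sum_2)

text \<open>Cauchy-Schwarz row by row; \<open>cof\<close> permutes the entries up to sign and so
  keeps the Frobenius norm.\<close>

lemma cof_mult_norm: "norm (cof M *v g) \<le> norm M * norm g"
proof -
  have cs: "(p * x + q * y)\<^sup>2 \<le> (p\<^sup>2 + q\<^sup>2) * (x\<^sup>2 + y\<^sup>2)" for p q x y :: real
    using zero_le_power2[of "p * y - q * x"] by (simp add: power2_eq_square algebra_simps)
  have "(norm (cof M *v g))\<^sup>2 = (M$2$2 * g$1 + (- M$1$2) * g$2)\<^sup>2 + ((- M$2$1) * g$1 + M$1$1 * g$2)\<^sup>2"
    by (simp add: norm_vec_sq sum_2 cof_mult)
  also have "\<dots> \<le> ((M$2$2)\<^sup>2 + (- M$1$2)\<^sup>2) * ((g$1)\<^sup>2 + (g$2)\<^sup>2) + ((- M$2$1)\<^sup>2 + (M$1$1)\<^sup>2) * ((g$1)\<^sup>2 + (g$2)\<^sup>2)"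
    by (intro add_mono cs)
  also have "\<dots> = (norm M * norm g)\<^sup>2"
    by (simp add: power_mult_distrib norm_vec_sq sum_2 algebra_simps)
  finally show ?thesis by (rule power2_le_imp_le) simp
qed

text \<open>Bilinearity of the product. This is where the Hessian error and the gradient error
  separate.\<close>

lemma cof_mult_diff:
  "cof M *v g - cof N *v h = cof (M - N) *v g + cof N *v (g - h)"
  by (simp add: vec_eq_iff forall_2 cof_mult algebra_simps)

lemma cof_mult_measurable:
  assumes "M \<in> borel_measurable X" "g \<in> borel_measurable X"
  shows "(\<lambda>x. cof (M x) *v g x) \<in> borel_measurable X"
proof -
  have m: "(\<lambda>x. M x $ i) \<in> borel_measurable X" "(\<lambda>x. g x $ i) \<in> borel_measurable X" for i
    using assms by (simp_all add: vec_borel_measurable)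
  then have m2: "(\<lambda>x. M x $ i $ k) \<in> borel_measurable X" for i k
    by (simp add: vec_borel_measurable[of "\<lambda>x. M x $ i" for i])
  show ?thesis
    unfolding vec_borel_measurable[of "\<lambda>x. cof (M x) *v g x"] forall_2 cof_mult
    by (intro conjI borel_measurable_diff borel_measurable_add borel_measurable_times borel_measurable_uminus m m2)
qed

lemma cof_mult_integrable:
  fixes M :: "point \<Rightarrow> real^2^2"
  assumes "M \<in> L2 S" "g \<in> L2 S"
  shows "integrable (lebesgue_on S) (\<lambda>x. norm (cof (M x) *v g x))"
    and "(LINT x|lebesgue_on S. norm (cof (M x) *v g x)) \<le> L2norm S M * L2norm S g"
proof -
  note n = L2_norm[OF assms(1)] L2_norm[OF assms(2)]
  have i: "integrable (lebesgue_on S) (\<lambda>x. norm (M x) * norm (g x))" by (rule L2_mult_integrable[OF n])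
  have m: "(\<lambda>x. norm (cof (M x) *v g x)) \<in> borel_measurable (lebesgue_on S)"
    by (rule measurable_compose[OF cof_mult_measurable[OF L2_measurable[OF assms(1)] L2_measurable[OF assms(2)]] borel_measurable_norm])
  show int: "integrable (lebesgue_on S) (\<lambda>x. norm (cof (M x) *v g x))"
    by (rule Bochner_Integration.integrable_bound[OF i m]) (intro AE_I2, simp add: cof_mult_norm)
  have "(LINT x|lebesgue_on S. norm (cof (M x) *v g x)) \<le> (LINT x|lebesgue_on S. norm (M x) * norm (g x))"
    by (rule integral_mono[OF int i]) (rule cof_mult_norm)
  also have "\<dots> = (LINT x|lebesgue_on S. \<bar>norm (M x) * norm (g x)\<bar>)" by simp
  also have "\<dots> \<le> L2norm S M * L2norm S g" using L2_CS[OF n] by (simp add: L2norm_abs_norm)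
  finally show "(LINT x|lebesgue_on S. norm (cof (M x) *v g x)) \<le> L2norm S M * L2norm S g" .
qed

section \<open>The residual\<close>

lemma L2_inner_bound:
  fixes f g :: "point \<Rightarrow> 'a::euclidean_space"
  assumes "f \<in> L2 S" "g \<in> L2 S"
  shows "\<bar>LINT x|lebesgue_on S. f x \<bullet> g x\<bar> \<le> L2norm S f * L2norm S g"
proof -
  note n = L2_norm[OF assms(1)] L2_norm[OF assms(2)]
  have "\<bar>LINT x|lebesgue_on S. f x \<bullet> g x\<bar> \<le> (LINT x|lebesgue_on S. \<bar>f x \<bullet> g x\<bar>)" by (rule integral_abs_bound)
  also have "\<dots> \<le> (LINT x|lebesgue_on S. \<bar>norm (f x) * norm (g x)\<bar>)"
    by (rule integral_mono) (use L2_inner_integrable[OF assms] L2_mult_integrable[OF n] in \<open>auto simp: Cauchy_Schwarz_ineq2\<close>)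
  also have "\<dots> \<le> L2norm S f * L2norm S g" using L2_CS[OF n] by (simp add: L2norm_abs_norm)
  finally show ?thesis .
qed

text \<open>The pairing of an integrable field with a bounded one: the coupling is a product of two
  L^2 factors, which need not be in L^2 itself.\<close>

lemma inner_bounded_integrable:
  fixes X \<psi> :: "point \<Rightarrow> 'a::euclidean_space"
  assumes X: "integrable (lebesgue_on S) (\<lambda>x. norm (X x))" and m: "X \<in> borel_measurable (lebesgue_on S)"
    "\<psi> \<in> borel_measurable (lebesgue_on S)" and B: "\<And>x. norm (\<psi> x) \<le> B"
  shows "integrable (lebesgue_on S) (\<lambda>x. X x \<bullet> \<psi> x)"
    and "\<bar>LINT x|lebesgue_on S. X x \<bullet> \<psi> x\<bar> \<le> B * (LINT x|lebesgue_on S. norm (X x))"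
proof -
  have i: "integrable (lebesgue_on S) (\<lambda>x. B * norm (X x))" using X by simp
  have b: "\<bar>X x \<bullet> \<psi> x\<bar> \<le> B * norm (X x)" for x
  proof -
    have "\<bar>X x \<bullet> \<psi> x\<bar> \<le> norm (X x) * norm (\<psi> x)" by (rule Cauchy_Schwarz_ineq2)
    also have "\<dots> \<le> norm (X x) * B" by (intro mult_left_mono B) auto
    finally show ?thesis by (simp add: mult.commute)
  qed
  have "0 \<le> B" using B[of undefined] norm_ge_zero order_trans by blast
  then have b': "norm (X x \<bullet> \<psi> x) \<le> norm (B * norm (X x))" for x using b[of x] by simp
  show int: "integrable (lebesgue_on S) (\<lambda>x. X x \<bullet> \<psi> x)"
    by (rule Bochner_Integration.integrable_bound[OF i borel_measurable_inner[OF m]]) (intro AE_I2 b')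
  have "\<bar>LINT x|lebesgue_on S. X x \<bullet> \<psi> x\<bar> \<le> (LINT x|lebesgue_on S. \<bar>X x \<bullet> \<psi> x\<bar>)" by (rule integral_abs_bound)
  also have "\<dots> \<le> (LINT x|lebesgue_on S. B * norm (X x))"
    using int i b by (intro integral_mono) auto
  finally show "\<bar>LINT x|lebesgue_on S. X x \<bullet> \<psi> x\<bar> \<le> B * (LINT x|lebesgue_on S. norm (X x))" by simp
qed

text \<open>The common shape of \<open>A_field\<close> and of its continuous counterpart, so that
  the two can be subtracted term by term.\<close>

definition coupling :: "2 \<Rightarrow> (2 \<Rightarrow> point \<Rightarrow> real^2^2) \<Rightarrow> (2 \<Rightarrow> point \<Rightarrow> real^2) \<Rightarrow> point \<Rightarrow> real^2"
  where "coupling j H G x = (if j = 1 then cof (H 1 x) *v G 2 x + cof (H 2 x) *v G 1 x else cof (H 1 x) *v G 1 x)"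

text \<open>The minus sign that \<open>B_form\<close> carries in front of the term tested with the
  second component.\<close>

definition coupling_sign :: "2 \<Rightarrow> real" where "coupling_sign j = (if j = 1 then 1 else -1)"

lemma coupling_measurable:
  assumes "\<And>i. H i \<in> borel_measurable M" "\<And>i. G i \<in> borel_measurable M"
  shows "coupling j H G \<in> borel_measurable M"
  unfolding coupling_def[abs_def] using assms
  by (cases "j = 1") (simp_all add: borel_measurable_add cof_mult_measurable)

lemma coupling_integrable:
  assumes "\<And>i. H i \<in> L2 S" "\<And>i. G i \<in> L2 S"
  shows "integrable (lebesgue_on S) (\<lambda>x. norm (coupling j H G x))"
proof (rule Bochner_Integration.integrable_bound)
  show "integrable (lebesgue_on S) (\<lambda>x. norm (cof (H 1 x) *v G 2 x) + norm (cof (H 2 x) *v G 1 x) + norm (cof (H 1 x) *v G 1 x))"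
    by (intro Bochner_Integration.integrable_add cof_mult_integrable assms)
  show "(\<lambda>x. norm (coupling j H G x)) \<in> borel_measurable (lebesgue_on S)"
    by (rule measurable_compose[OF coupling_measurable borel_measurable_norm]) (intro L2_measurable assms)+
  have "norm (coupling j H G x) \<le> norm (cof (H 1 x) *v G 2 x) + norm (cof (H 2 x) *v G 1 x) + norm (cof (H 1 x) *v G 1 x)" for x
    unfolding coupling_def using norm_triangle_ineq[of "cof (H 1 x) *v G 2 x" "cof (H 2 x) *v G 1 x"]
    by (simp add: add_increasing2)
  then show "AE x in lebesgue_on S. norm (norm (coupling j H G x))
    \<le> norm (norm (cof (H 1 x) *v G 2 x) + norm (cof (H 2 x) *v G 1 x) + norm (cof (H 1 x) *v G 1 x))"
    by (intro AE_I2) simp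
qed

text \<open>\<open>cof_mult_diff\<close> pairs the Hessian error with \<open>G\<close> and the
  gradient error with \<open>H'\<close>, so exactly these two need the bound \<open>M\<close>. The
  factor 2 counts the products in the first component.\<close>

lemma coupling_diff_bound:
  assumes L: "\<And>i. H i \<in> L2 S" "\<And>i. G i \<in> L2 S" "\<And>i. H' i \<in> L2 S" "\<And>i. G' i \<in> L2 S"
    and e: "\<And>i. L2norm S (\<lambda>x. H i x - H' i x) \<le> e" "\<And>i. L2norm S (\<lambda>x. G i x - G' i x) \<le> \<epsilon>"
    and M: "\<And>i. L2norm S (G i) \<le> M" "\<And>i. L2norm S (H' i) \<le> M"
  shows "(LINT x|lebesgue_on S. norm (coupling j H G x - coupling j H' G' x)) \<le> 2 * M * (e + \<epsilon>)"
proof -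
  have e0: "0 \<le> e" "0 \<le> \<epsilon>" "0 \<le> M" using e[of 1] M[of 1] L2norm_nonneg order_trans by blast+
  let ?t = "\<lambda>i k x. norm (cof (H i x - H' i x) *v G k x) + norm (cof (H' i x) *v (G k x - G' k x))"
  have ti: "integrable (lebesgue_on S) (?t i k)" for i k
    by (intro Bochner_Integration.integrable_add cof_mult_integrable L2_diff L)
  have tb: "(LINT x|lebesgue_on S. ?t i k x) \<le> M * (e + \<epsilon>)" for i k
  proof -
    have "(LINT x|lebesgue_on S. ?t i k x) = (LINT x|lebesgue_on S. norm (cof (H i x - H' i x) *v G k x))
      + (LINT x|lebesgue_on S. norm (cof (H' i x) *v (G k x - G' k x)))"
      by (intro Bochner_Integration.integral_add cof_mult_integrable L2_diff L)
    also have "\<dots> \<le> L2norm S (\<lambda>x. H i x - H' i x) * L2norm S (G k) + L2norm S (H' i) * L2norm S (\<lambda>x. G k x - G' k x)"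
      by (intro add_mono cof_mult_integrable L2_diff L)
    also have "\<dots> \<le> e * M + M * \<epsilon>"
      by (intro add_mono mult_mono e M e0 L2norm_nonneg)
    finally show ?thesis by (simp add: algebra_simps)
  qed
  have t: "norm (cof (H i x) *v G k x - cof (H' i x) *v G' k x) \<le> ?t i k x" for i k x
    unfolding cof_mult_diff by (rule norm_triangle_ineq)
  show ?thesis
  proof (cases "j = 1")
    case True
    have "(LINT x|lebesgue_on S. norm (coupling j H G x - coupling j H' G' x)) \<le> (LINT x|lebesgue_on S. ?t 1 2 x + ?t 2 1 x)"
    proof (rule integral_mono')
      show "integrable (lebesgue_on S) (\<lambda>x. ?t 1 2 x + ?t 2 1 x)" by (rule Bochner_Integration.integrable_add[OF ti ti])
      fix x
      have e: "coupling j H G x - coupling j H' G' x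
        = (cof (H 1 x) *v G 2 x - cof (H' 1 x) *v G' 2 x) + (cof (H 2 x) *v G 1 x - cof (H' 2 x) *v G' 1 x)"
        using True by (simp add: coupling_def)
      show "norm (coupling j H G x - coupling j H' G' x) \<le> ?t 1 2 x + ?t 2 1 x"
        unfolding e using norm_triangle_ineq[of "cof (H 1 x) *v G 2 x - cof (H' 1 x) *v G' 2 x" "cof (H 2 x) *v G 1 x - cof (H' 2 x) *v G' 1 x"]
          t[where i = 1 and k = 2 and x = x] t[where i = 2 and k = 1 and x = x] by linarith
    qed simp
    also have "\<dots> = (LINT x|lebesgue_on S. ?t 1 2 x) + (LINT x|lebesgue_on S. ?t 2 1 x)" by (rule Bochner_Integration.integral_add[OF ti ti])
    also have "\<dots> \<le> M * (e + \<epsilon>) + M * (e + \<epsilon>)" by (intro add_mono tb)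
    finally show ?thesis by simp
  next
    case False
    have "(LINT x|lebesgue_on S. norm (coupling j H G x - coupling j H' G' x)) \<le> (LINT x|lebesgue_on S. ?t 1 1 x)"
    proof (rule integral_mono'[OF ti])
      show "norm (coupling j H G x - coupling j H' G' x) \<le> ?t 1 1 x" for x
        using False t[where i = 1 and k = 1 and x = x] by (simp add: coupling_def)
    qed simp
    also have "\<dots> \<le> M * (e + \<epsilon>)" by (rule tb)
    also have "\<dots> \<le> 2 * M * (e + \<epsilon>)" using e0 by (intro mult_right_mono) auto
    finally show ?thesis .
  qed
qed

section \<open>The weak equation tested with smooth functions\<close>

context bounded_open
begin

lemma a_form_test:
  assumes H: "H \<in> L2 \<Omega>" and T: "\<phi> \<in> test_functions \<Omega>"
  shows "a_form \<Omega> H (whess \<Omega> \<phi>) = (LINT x|lebesgue_on \<Omega>. H x \<bullet> hess \<phi> x)"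
  unfolding a_form_def
proof (rule integral_cong_AE)
  show "AE x in lebesgue_on \<Omega>. H x \<bullet> whess \<Omega> \<phi> x = H x \<bullet> hess \<phi> x"
    using test_derivs(2)[OF T] by eventually_elim simp
qed (intro borel_measurable_inner L2_measurable H whess_L2 test_sobolev2 hess_test_L2 T)+

lemma b_form_test:
  assumes H: "H \<in> L2 \<Omega>" "G \<in> L2 \<Omega>" and T: "\<phi> \<in> test_functions \<Omega>"
  shows "b_form \<Omega> H G (wgrad \<Omega> \<phi>) = 1/2 * (LINT x|lebesgue_on \<Omega>. (cof (H x) *v G x) \<bullet> grad \<phi> x)"
proof -
  have "(LINT x|lebesgue_on \<Omega>. (cof (H x) *v G x) \<bullet> wgrad \<Omega> \<phi> x) = (LINT x|lebesgue_on \<Omega>. (cof (H x) *v G x) \<bullet> grad \<phi> x)"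
  proof (rule integral_cong_AE)
    show "AE x in lebesgue_on \<Omega>. (cof (H x) *v G x) \<bullet> wgrad \<Omega> \<phi> x = (cof (H x) *v G x) \<bullet> grad \<phi> x"
      using test_derivs(1)[OF T] by eventually_elim simp
  qed (intro borel_measurable_inner cof_mult_measurable L2_measurable H wgrad_L2 test_sobolev2 grad_test_L2 T)+
  then show ?thesis by (simp add: b_form_def)
qed

lemma grad_hess_zero: "grad (\<lambda>x. 0) x = 0" "hess (\<lambda>x. 0) x = 0"
  by (simp_all add: grad_def hess_def pderiv2_zero vec_eq_iff)

text \<open>Test with \<phi> in component \<open>j\<close> and zero in the other; the zero function
  is a test function as well, so the classical derivatives may be inserted everywhere.\<close>

lemma weak_equation:
  assumes sol: "vK_solution \<Omega> f \<Psi>" and T: "\<phi> \<in> test_functions \<Omega>" and B: "\<And>x. norm (grad \<phi> x) \<le> B"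
  shows "(LINT x|lebesgue_on \<Omega>. whess \<Omega> (cmp j \<Psi>) x \<bullet> hess \<phi> x)
    + coupling_sign j / 2 * (LINT x|lebesgue_on \<Omega>. coupling j (\<lambda>i. whess \<Omega> (cmp i \<Psi>)) (\<lambda>i. wgrad \<Omega> (cmp i \<Psi>)) x \<bullet> grad \<phi> x)
    = (if j = 1 then LINT x|lebesgue_on \<Omega>. f x * \<phi> x else 0)"
proof -
  have s: "cmp i \<Psi> \<in> sobolev \<Omega> 2" for i using sol H20_sobolev2 by (simp add: vK_solution_def H20v_def)
  note H = whess_L2[OF s] and G = wgrad_L2[OF s]
  define \<Phi> :: "point \<Rightarrow> real^2" where "\<Phi> = (\<lambda>x. \<chi> i. if i = j then \<phi> x else 0)"
  have c: "cmp i \<Phi> = (if i = j then \<phi> else (\<lambda>x. 0))" for i by (auto simp: cmp_def \<Phi>_def)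
  have Ti: "cmp i \<Phi> \<in> test_functions \<Omega>" for i unfolding c using T test_functions_zero by simp
  have "\<Phi> \<in> H20v \<Omega>" unfolding H20v_def using test_H20[OF Ti] by simp
  then have eq: "vK_A \<Omega> \<Psi> \<Phi> + vK_B \<Omega> \<Psi> \<Psi> \<Phi> = load \<Omega> f \<Phi>" using sol by (simp add: vK_solution_def)
  have A: "vK_A \<Omega> \<Psi> \<Phi> = (LINT x|lebesgue_on \<Omega>. whess \<Omega> (cmp 1 \<Psi>) x \<bullet> hess (cmp 1 \<Phi>) x)
     + (LINT x|lebesgue_on \<Omega>. whess \<Omega> (cmp 2 \<Psi>) x \<bullet> hess (cmp 2 \<Phi>) x)"
    by (simp add: vK_A_def A_form_def Whess_def a_form_test[OF H Ti])
  have Bf: "vK_B \<Omega> \<Psi> \<Psi> \<Phi> = 1/2 * (LINT x|lebesgue_on \<Omega>. (cof (whess \<Omega> (cmp 1 \<Psi>) x) *v wgrad \<Omega> (cmp 2 \<Psi>) x) \<bullet> grad (cmp 1 \<Phi>) x)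
     + 1/2 * (LINT x|lebesgue_on \<Omega>. (cof (whess \<Omega> (cmp 2 \<Psi>) x) *v wgrad \<Omega> (cmp 1 \<Psi>) x) \<bullet> grad (cmp 1 \<Phi>) x)
     - 1/2 * (LINT x|lebesgue_on \<Omega>. (cof (whess \<Omega> (cmp 1 \<Psi>) x) *v wgrad \<Omega> (cmp 1 \<Psi>) x) \<bullet> grad (cmp 2 \<Phi>) x)"
    by (simp add: vK_B_def B_form_def Whess_def Wgrad_def b_form_test[OF H G Ti])
  have int: "integrable (lebesgue_on \<Omega>) (\<lambda>x. (cof (whess \<Omega> (cmp i \<Psi>) x) *v wgrad \<Omega> (cmp k \<Psi>) x) \<bullet> grad \<phi> x)" for i k
    by (intro inner_bounded_integrable[OF _ _ _ B] cof_mult_integrable cof_mult_measurable L2_measurable H G grad_test_L2 T)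
  show ?thesis
  proof (cases "j = 1")
    case True
    have c1: "cmp 1 \<Phi> = \<phi>" "cmp 2 \<Phi> = (\<lambda>x. 0)" using c True by auto
    have l: "load \<Omega> f \<Phi> = (LINT x|lebesgue_on \<Omega>. f x * \<phi> x)" using True by (simp add: load_def \<Phi>_def)
    show ?thesis using eq unfolding A Bf l c1 using True int[of 1 2] int[of 2 1]
      by (simp add: grad_hess_zero coupling_def coupling_sign_def inner_add_left add_divide_distrib)
  next
    case False
    then have j2: "j = 2" using exhaust_2[of j] by blast
    have c1: "cmp 2 \<Phi> = \<phi>" "cmp 1 \<Phi> = (\<lambda>x. 0)" using c j2 by auto
    have l: "load \<Omega> f \<Phi> = 0" using j2 by (simp add: load_def \<Phi>_def)
    show ?thesis using eq unfolding A Bf l c1 using j2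
      by (simp add: grad_hess_zero coupling_def coupling_sign_def)
  qed
qed

end

section \<open>The residual localised to a union of triangles\<close>

context shape_mesh
begin

text \<open>A triangle outside \<open>S\<close> contributes nothing: almost all of its points are
  interior, hence in \<Omega> and in no triangle of \<open>S\<close>.\<close>

lemma support_integral:
  fixes h :: "point \<Rightarrow> real"
  assumes h: "integrable (lebesgue_on \<Omega>) h" and S: "S \<subseteq> \<T>" and z: "\<And>x. x \<in> \<Omega> \<Longrightarrow> x \<notin> \<Union>S \<Longrightarrow> h x = 0"
  shows "(LINT x|lebesgue_on \<Omega>. h x) = (LINT x|lebesgue_on (\<Union>S). h x)"
proof -
  have hc: "integrable (lebesgue_on (closure \<Omega>)) h" using h closure_integral by blast
  have "(\<Sum>K\<in>\<T>. LINT x|lebesgue_on K. h x) = (\<Sum>K\<in>S. LINT x|lebesgue_on K. h x)"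
  proof (rule sum.mono_neutral_right[OF fin S], intro ballI)
    fix L assume L: "L \<in> \<T> - S"
    have "AE x in lebesgue_on L. x \<in> interior L" using AE_interior L by blast
    then have "AE x in lebesgue_on L. h x = 0"
    proof eventually_elim
      case (elim x)
      have "x \<notin> K" if "K \<in> S" for K using other_triangle_disjoint[of L K] L S that elim by blast
      then show ?case using z[of x] interior_triangle_subset[of L] L elim by blast
    qed
    then show "(LINT x|lebesgue_on L. h x) = 0" by (rule integral_eq_zero_AE)
  qed
  then show ?thesis using Omega_integral[OF h] union_integral[OF S hc] by simp
qed

abbreviation dhess :: "(real^2) pwfun \<Rightarrow> 2 \<Rightarrow> point \<Rightarrow> real^2^2"
  where "dhess v i \<equiv> glue \<T> (pw_hess (pw_cmp i v))"

abbreviation dgrad :: "(real^2) pwfun \<Rightarrow> 2 \<Rightarrow> point \<Rightarrow> real^2"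
  where "dgrad v i \<equiv> glue \<T> (pw_grad (interp (pw_cmp i v)))"

lemma A_field_coupling: "glue \<T> (A_field j v) = coupling j (dhess v) (dgrad v)"
  by (rule ext) (simp add: glue_def A_field_def coupling_def Let_def)

lemma dgrad_L2: "dgrad v i \<in> L2 (closure \<Omega>)"
  by (rule L2_glue) (simp add: pw_grad_eq smooth_grad_continuous interp_smooth)

lemma component_errors:
  assumes u: "u \<in> H20v \<Omega>" and v: "v \<in> morley0v \<Omega> \<T>" and P: "P \<in> sets lebesgue" "P \<subseteq> closure \<Omega>"
  shows "L2norm P (\<lambda>x. whess \<Omega> (cmp i u) x - dhess v i x) \<le> hess_err \<Omega> \<T> u v P"
    "L2norm P (\<lambda>x. wgrad \<Omega> (cmp i u) x - dgrad v i x) \<le> interp_err \<Omega> \<T> u v P"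
proof -
  have le: "(L2norm P (\<lambda>x. F x $ i))\<^sup>2 \<le> (L2norm P F)\<^sup>2" if "F \<in> L2 P" for F :: "point \<Rightarrow> 'a::euclidean_space ^ 2"
    unfolding L2norm_vec_sq[OF that] by (rule member_le_sum) auto
  have 1: "(\<lambda>x. Whess \<Omega> u x - glue \<T> (pw_Hess v) x) \<in> L2 P"
    by (rule L2_subset[OF L2_diff[OF Whess_L2[OF u] pw_Hess_L2[OF v]] closure_lebesgue P])
  have 2: "(\<lambda>x. Wgrad \<Omega> u x - glue \<T> (pw_Grad (interpv v)) x) \<in> L2 P"
    by (rule L2_subset[OF L2_diff[OF Wgrad_L2[OF u] pw_Grad_interp_L2] closure_lebesgue P])
  have ic: "pw_cmp i (interpv v) = interp (pw_cmp i v)"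
    by (simp add: fun_eq_iff pw_cmp_def cmp_def interpv_def)
  show "L2norm P (\<lambda>x. whess \<Omega> (cmp i u) x - dhess v i x) \<le> hess_err \<Omega> \<T> u v P"
    unfolding hess_err_def using le[OF 1]
    by (intro power2_le_imp_le[OF _ L2norm_nonneg]) (simp add: glue_component Whess_def)
  show "L2norm P (\<lambda>x. wgrad \<Omega> (cmp i u) x - dgrad v i x) \<le> interp_err \<Omega> \<T> u v P"
    unfolding interp_err_def using le[OF 2]
    by (intro power2_le_imp_le[OF _ L2norm_nonneg]) (simp add: glue_component Wgrad_def ic)
qed

text \<open>Subtracting the weak equation leaves only errors. The Hessian part pairs L^2 with L^2
  and the coupling pairs L^1 with the supremum; both norms of the bump are of order
  \<open>B / r\<close>, which yields the common factor.\<close>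

lemma residual_bound:
  assumes sol: "vK_solution \<Omega> f \<Psi>" and f: "f \<in> L2 \<Omega>" and v: "v \<in> morley0v \<Omega> \<T>"
    and S: "S \<subseteq> \<T>" and T: "\<phi> \<in> test_functions \<Omega>"
    and z: "\<And>x. x \<in> \<Omega> \<Longrightarrow> x \<notin> \<Union>S \<Longrightarrow> \<phi> x = 0 \<and> grad \<phi> x = 0 \<and> hess \<phi> x = 0"
    and b1: "\<And>x. norm (grad \<phi> x) \<le> B / r" and b2: "L2norm (\<Union>S) (hess \<phi>) \<le> 2 * B / r"
    and M: "\<And>i. L2norm (\<Union>S) (wgrad \<Omega> (cmp i \<Psi>)) \<le> M" "\<And>i. L2norm (\<Union>S) (dhess v i) \<le> M"
    and Br: "0 \<le> B / r"
  shows "\<bar>(LINT x|lebesgue_on (\<Union>S). dhess v j x \<bullet> hess \<phi> x)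
      + coupling_sign j / 2 * (LINT x|lebesgue_on (\<Union>S). glue \<T> (A_field j v) x \<bullet> grad \<phi> x)
      - (if j = 1 then LINT x|lebesgue_on (\<Union>S). f x * \<phi> x else 0)\<bar>
    \<le> (2 + M) * (B / r) * (hess_err \<Omega> \<T> \<Psi> v (\<Union>S) + interp_err \<Omega> \<T> \<Psi> v (\<Union>S))"
proof -
  let ?P = "\<Union>S"
  have u: "\<Psi> \<in> H20v \<Omega>" using sol by (simp add: vK_solution_def)
  let ?H = "\<lambda>i. whess \<Omega> (cmp i \<Psi>)" and ?G = "\<lambda>i. wgrad \<Omega> (cmp i \<Psi>)"
  let ?e = "hess_err \<Omega> \<T> \<Psi> v ?P" and ?\<epsilon> = "interp_err \<Omega> \<T> \<Psi> v ?P"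
  have P: "?P \<in> sets lebesgue" "?P \<subseteq> closure \<Omega>" using union_lebesgue[OF S] union_subset[OF S] by auto
  note sub = L2_subset[OF _ closure_lebesgue P]
  have HP: "?H i \<in> L2 ?P" and GP: "?G i \<in> L2 ?P" for i
    by (intro sub H20_L2_closure H20v_cmp u)+
  have HP': "dhess v i \<in> L2 ?P" and GP': "dgrad v i \<in> L2 ?P" for i
    by (intro sub glue_pw_hess_L2 dgrad_L2 morley0v_cmp' v)+
  have tP: "hess \<phi> \<in> L2 ?P" "grad \<phi> \<in> L2 ?P" by (intro sub test_L2_closure T)+
  note mP = L2_measurable[OF tP(2)]
  have HO: "?H i \<in> L2 \<Omega>" and GO: "?G i \<in> L2 \<Omega>" for i
    using H20_L2_closure[OF H20v_cmp[OF u]] by (simp_all only: closure_L2)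
  define a where "a = (LINT x|lebesgue_on ?P. ?H j x \<bullet> hess \<phi> x)"
  define a' where "a' = (LINT x|lebesgue_on ?P. dhess v j x \<bullet> hess \<phi> x)"
  define b where "b = (LINT x|lebesgue_on ?P. coupling j ?H ?G x \<bullet> grad \<phi> x)"
  define b' where "b' = (LINT x|lebesgue_on ?P. coupling j (dhess v) (dgrad v) x \<bullet> grad \<phi> x)"
  define F where "F = (if j = 1 then LINT x|lebesgue_on ?P. f x * \<phi> x else 0)"
  \<comment> \<open>The weak equation on \<open>?P\<close> alone, since every integrand vanishes off
    the support of \<phi>.\<close>
  have eq: "a + coupling_sign j / 2 * b = F"
  proof -
    have "(LINT x|lebesgue_on \<Omega>. ?H j x \<bullet> hess \<phi> x) = a"
      unfolding a_def by (rule support_integral[OF L2_inner_integrable[OF HO hess_test_L2[OF T]] S]) (use z in auto)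
    moreover have "(LINT x|lebesgue_on \<Omega>. coupling j ?H ?G x \<bullet> grad \<phi> x) = b"
      unfolding b_def
      by (rule support_integral[OF inner_bounded_integrable(1)[OF coupling_integrable[OF HO GO]
            coupling_measurable[OF L2_measurable[OF HO] L2_measurable[OF GO]] L2_measurable[OF grad_test_L2[OF T]] b1] S])
         (use z in auto)
    moreover have "(LINT x|lebesgue_on \<Omega>. f x * \<phi> x) = (LINT x|lebesgue_on ?P. f x * \<phi> x)"
      by (rule support_integral[OF L2_mult_integrable[OF f test_L2[OF T]] S]) (use z in auto)
    ultimately show ?thesis using weak_equation[OF sol T b1, of j] by (simp add: F_def)
  qed
  have d1: "\<bar>a - a'\<bar> \<le> ?e * (2 * B / r)"
  proof -
    have "a - a' = (LINT x|lebesgue_on ?P. (?H j x - dhess v j x) \<bullet> hess \<phi> x)"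
      unfolding a_def a'_def inner_diff_left
      by (rule Bochner_Integration.integral_diff[symmetric]) (intro L2_inner_integrable HP HP' tP)+
    then have "\<bar>a - a'\<bar> \<le> L2norm ?P (\<lambda>x. ?H j x - dhess v j x) * L2norm ?P (hess \<phi>)"
      using L2_inner_bound[OF L2_diff[OF HP HP'] tP(1)] by simp
    also have "\<dots> \<le> ?e * (2 * B / r)"
      by (intro mult_mono component_errors u v P b2) (auto simp: hess_err_def)
    finally show ?thesis .
  qed
  have d2: "\<bar>b - b'\<bar> \<le> (B / r) * (2 * M * (?e + ?\<epsilon>))"
  proof -
    have i: "integrable (lebesgue_on ?P) (\<lambda>x. coupling j ?H ?G x \<bullet> grad \<phi> x)"
      by (rule inner_bounded_integrable(1)[OF coupling_integrable[OF HP GP]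
            coupling_measurable[OF L2_measurable[OF HP] L2_measurable[OF GP]] mP b1])
    have i': "integrable (lebesgue_on ?P) (\<lambda>x. coupling j (dhess v) (dgrad v) x \<bullet> grad \<phi> x)"
      by (rule inner_bounded_integrable(1)[OF coupling_integrable[OF HP' GP']
            coupling_measurable[OF L2_measurable[OF HP'] L2_measurable[OF GP']] mP b1])
    have m: "(\<lambda>x. coupling j ?H ?G x - coupling j (dhess v) (dgrad v) x) \<in> borel_measurable (lebesgue_on ?P)"
      by (intro borel_measurable_diff coupling_measurable L2_measurable HP GP HP' GP')
    have ci: "integrable (lebesgue_on ?P) (\<lambda>x. norm (coupling j ?H ?G x))"
      "integrable (lebesgue_on ?P) (\<lambda>x. norm (coupling j (dhess v) (dgrad v) x))"
      by (rule coupling_integrable[OF HP GP], rule coupling_integrable[OF HP' GP'])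
    have n: "integrable (lebesgue_on ?P) (\<lambda>x. norm (coupling j ?H ?G x - coupling j (dhess v) (dgrad v) x))"
    proof (rule Bochner_Integration.integrable_bound[OF Bochner_Integration.integrable_add[OF ci]])
      show "(\<lambda>x. norm (coupling j ?H ?G x - coupling j (dhess v) (dgrad v) x)) \<in> borel_measurable (lebesgue_on ?P)"
        by (rule measurable_compose[OF m borel_measurable_norm])
    qed (intro AE_I2, simp add: norm_triangle_ineq4)
    have "b - b' = (LINT x|lebesgue_on ?P. (coupling j ?H ?G x - coupling j (dhess v) (dgrad v) x) \<bullet> grad \<phi> x)"
      unfolding b_def b'_def inner_diff_left by (rule Bochner_Integration.integral_diff[symmetric, OF i i'])
    then have "\<bar>b - b'\<bar> \<le> (B / r) * (LINT x|lebesgue_on ?P. norm (coupling j ?H ?G x - coupling j (dhess v) (dgrad v) x))"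
      using inner_bounded_integrable(2)[OF n m mP b1] by simp
    also have "\<dots> \<le> (B / r) * (2 * M * (?e + ?\<epsilon>))"
      by (intro mult_left_mono Br coupling_diff_bound HP GP HP' GP' component_errors u v P M)
    finally show ?thesis .
  qed
  have \<epsilon>0: "0 \<le> ?\<epsilon>" by (simp add: interp_err_def)
  have "\<bar>a' + coupling_sign j / 2 * b' - F\<bar> = \<bar>(a - a') + coupling_sign j / 2 * (b - b')\<bar>"
  proof -
    have "a' + coupling_sign j / 2 * b' - (a + coupling_sign j / 2 * b) = - ((a - a') + coupling_sign j / 2 * (b - b'))"
      by (simp add: right_diff_distrib)
    then show ?thesis unfolding eq[symmetric] by simp
  qed
  also have "\<dots> \<le> \<bar>a - a'\<bar> + \<bar>coupling_sign j / 2 * (b - b')\<bar>" by (rule abs_triangle_ineq)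
  also have "\<bar>coupling_sign j / 2 * (b - b')\<bar> = \<bar>b - b'\<bar> / 2"
    by (simp add: coupling_sign_def abs_mult)
  also have "\<bar>a - a'\<bar> + \<bar>b - b'\<bar> / 2 \<le> ?e * (2 * B / r) + (B / r) * (2 * M * (?e + ?\<epsilon>)) / 2"
    using d1 d2 by (intro add_mono divide_right_mono) auto
  also have "\<dots> = (B / r) * (2 * ?e + M * (?e + ?\<epsilon>))" by (simp add: algebra_simps)
  also have "\<dots> \<le> (B / r) * (2 * (?e + ?\<epsilon>) + M * (?e + ?\<epsilon>))"
    using \<epsilon>0 by (intro mult_left_mono Br add_right_mono) auto
  also have "\<dots> = (2 + M) * (B / r) * (?e + ?\<epsilon>)" by (simp add: algebra_simps)
  finally show ?thesis unfolding a'_def b'_def F_def A_field_coupling .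
qed

end

section \<open>Efficiency of the residual contributions\<close>

lemma test_pderiv_integral:
  assumes T: "\<phi> \<in> test_functions \<Omega>" and K: "K \<in> sets lebesgue" and z: "\<And>x. x \<notin> K \<Longrightarrow> pderiv2 i \<phi> x = 0"
  shows "(LINT x|lebesgue_on K. pderiv2 i \<phi> x) = 0"
proof -
  note D = test_functionsD[OF T]
  have cg: "continuous_on UNIV (pderiv2 i \<phi>)" by (rule smooth_continuous[OF smooth_pderiv[OF D(1)]])
  obtain R where R: "\<And>x. x \<in> closure {x. \<phi> x \<noteq> 0} \<Longrightarrow> norm x < R"
    using compact_imp_bounded[OF D(2)] by (meson bounded_pos_less)
  have R': "\<phi> x \<noteq> 0 \<Longrightarrow> norm x < R" for x using R[of x] closure_subset[of "{x. \<phi> x \<noteq> 0}"] by blast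
  have "(LINT x|lebesgue_on K. pderiv2 i \<phi> x) = (LINT x|lborel. pderiv2 i \<phi> x)"
    by (rule integral_zero_outside[OF K z borel_measurable_continuous_onI[OF cg]])
  also have "\<dots> = (LINT x|lborel. (\<chi> i. pderiv2 i \<phi> x) $ i)" by simp
  also have "\<dots> = 0" by (rule compact_support_integral_gradient[OF smooth_C1[OF D(1)] R'])
  finally show ?thesis .
qed

lemma orthogonal_to_edges:
  assumes D: "area2 a b c \<noteq> 0" and V: "V \<bullet> (b - a) = 0" "V \<bullet> (c - a) = 0"
  shows "V = 0"
proof -
  have "a + V = a + (area2 a (a + V) c / area2 a b c) *\<^sub>R (b - a) + (area2 a b (a + V) / area2 a b c) *\<^sub>R (c - a)"
    by (rule bary_point[OF D])
  then have "V = (area2 a (a + V) c / area2 a b c) *\<^sub>R (b - a) + (area2 a b (a + V) / area2 a b c) *\<^sub>R (c - a)"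
    by simp
  then obtain t s where Vts: "V = t *\<^sub>R (b - a) + s *\<^sub>R (c - a)" by blast
  have "V \<bullet> V = V \<bullet> (t *\<^sub>R (b - a) + s *\<^sub>R (c - a))" using arg_cong[OF Vts, of "\<lambda>W. V \<bullet> W"] .
  also have "\<dots> = 0" by (simp add: inner_add_right V)
  finally show ?thesis by simp
qed

text \<open>The gradient of \<open>area2 x b c\<close> in \<open>x\<close>: the side turned by a
  right angle, so a normal with the length of the edge.\<close>

definition edge_vector :: "point \<Rightarrow> point \<Rightarrow> point"
  where "edge_vector b c = vector [b$2 - c$2, c$1 - b$1]"

lemma edge_vector_facts:
  "edge_vector b c \<bullet> (b - a) = - area2 a b c" "edge_vector b c \<bullet> (c - a) = - area2 a b c"
  "norm (edge_vector b c) = dist b c" "edge_vector b c \<bullet> (c - b) = 0"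
  "edge_vector b c \<bullet> (y - x) = area2 y b c - area2 x b c"
  by (simp_all add: edge_vector_def inner_2 area2_def norm_eq_sqrt_inner dist_norm algebra_simps)

section \<open>Constant fields on triangles and the volume term\<close>

context shape_mesh
begin

text \<open>Shape regularity compares the diameter with an edge, which is itself no longer than the
  diameter. The bound keeps the bump radius in \<open>jump_residual\<close> below the edge
  length.\<close>

lemma rho_ge_2:
  assumes K: "K \<in> \<T>" and Kh: "K = convex hull {a,b,c}" and D: "area2 a b c \<noteq> 0"
  shows "2 \<le> \<rho>"
proof -
  note s = shape_triangle[OF K Kh D]
  have "dist b c \<le> diameter K" unfolding Kh by (rule dist_le_diameter) auto
  then have "\<rho> * dist b c \<le> \<rho> * diameter K" using s(2) by (intro mult_left_mono) auto
  then have "2 * diameter K \<le> \<rho> * diameter K" using s(3) by linarith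
  then show ?thesis using s(1) by simp
qed

text \<open>The discrete Hessian is constant on \<open>K\<close>, so only the integrals of the
  second derivatives of \<phi> count. They vanish for a bump inside \<open>K\<close> by compact
  support, for a bump on a face by symmetry.\<close>

lemma dhess_integral:
  assumes v: "v \<in> morley0v \<Omega> \<T>" and K: "K \<in> \<T>" and sm: "smooth \<phi>"
    and z: "\<And>i k. (LINT x|lebesgue_on K. pderiv2 k (pderiv2 i \<phi>) x) = 0"
  shows "(LINT x|lebesgue_on K. dhess v j x \<bullet> hess \<phi> x) = 0"
proof -
  obtain d :: "2 \<Rightarrow> real" and H where H: "\<And>x. hess (pw_cmp j v K) x = H"
    using quadratic_derivs[OF morley_quadratic[OF morley0v_cmp'[OF v] K]] by metis
  have c: "continuous_on UNIV (pderiv2 k (pderiv2 i \<phi>))" for i k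
    by (intro smooth_continuous smooth_pderiv sm)
  have int: "integrable (lebesgue_on K) (\<lambda>x. H $ i $ k * pderiv2 k (pderiv2 i \<phi>) x)" for i k
    by (rule continuous_bounded_integrable[OF _ triangle_bounded[OF K] triangle_lebesgue[OF K]]) (intro continuous_intros c)
  have e: "H \<bullet> hess \<phi> x = (\<Sum>i\<in>UNIV. \<Sum>k\<in>UNIV. H $ i $ k * pderiv2 k (pderiv2 i \<phi>) x)" for x
    by (simp add: inner_vec_def hess_def)
  have "(LINT x|lebesgue_on K. dhess v j x \<bullet> hess \<phi> x) = (LINT x|lebesgue_on K. H \<bullet> hess \<phi> x)"
  proof (rule integral_cong_AE)
    show ae: "AE x in lebesgue_on K. dhess v j x \<bullet> hess \<phi> x = H \<bullet> hess \<phi> x"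
      using AE_glue[OF K, of "pw_hess (pw_cmp j v)"] by eventually_elim (simp add: pw_hess_eq H)
    show m: "(\<lambda>x. H \<bullet> hess \<phi> x) \<in> borel_measurable (lebesgue_on K)"
      unfolding e by (intro borel_measurable_sum borel_measurable_integrable int)
    have ae': "AE x in lebesgue_on K. H \<bullet> hess \<phi> x = dhess v j x \<bullet> hess \<phi> x"
      using ae by eventually_elim simp
    show "(\<lambda>x. dhess v j x \<bullet> hess \<phi> x) \<in> borel_measurable (lebesgue_on K)"
      by (rule measurable_cong_AE_on[OF triangle_lebesgue[OF K] m ae'])
  qed
  also have "\<dots> = (\<Sum>i\<in>UNIV. \<Sum>k\<in>UNIV. LINT x|lebesgue_on K. H $ i $ k * pderiv2 k (pderiv2 i \<phi>) x)"
    unfolding e by (simp only: Bochner_Integration.integral_sum[OF Bochner_Integration.integrable_sum[OF int]] Bochner_Integration.integral_sum[OF int])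
  also have "\<dots> = 0" by (simp add: z)
  finally show ?thesis .
qed

text \<open>Here the interpolation in the discrete coupling pays off: the gradient of an affine
  function is constant, like the Hessian of a quadratic one. The branches are global, so the origin
  can stand for any point of \<open>K\<close>.\<close>

lemma A_field_const:
  assumes v: "v \<in> morley0v \<Omega> \<T>" and K: "K \<in> \<T>"
  shows "A_field j v K x = A_field j v K 0"
proof -
  have h: "pw_hess (pw_cmp i v) K x = pw_hess (pw_cmp i v) K 0" for i
  proof -
    obtain d :: "2 \<Rightarrow> real" and H where H: "\<And>x. hess (pw_cmp i v K) x = H"
      using quadratic_derivs[OF morley_quadratic[OF morley0v_cmp'[OF v] K]] by metis
    then show ?thesis by (simp add: pw_hess_eq)
  qed
  have g: "pw_grad (interp (pw_cmp i v)) K x = pw_grad (interp (pw_cmp i v)) K 0" for i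
  proof -
    obtain d g where p: "\<And>x. interp (pw_cmp i v) K x = d + g \<bullet> x"
      using interp_affine[OF simp2[OF K], of "pw_cmp i v"] by (auto simp: affine_poly_def)
    show ?thesis by (simp add: pw_grad_def vec_eq_iff affine_pderiv[OF p])
  qed
  show ?thesis unfolding A_field_def Let_def h g ..
qed

lemma glue_A_field_L2: "v \<in> morley0v \<Omega> \<T> \<Longrightarrow> glue \<T> (A_field j v) \<in> L2 (closure \<Omega>)"
proof (rule L2_glue)
  fix K assume v: "v \<in> morley0v \<Omega> \<T>" and K: "K \<in> \<T>"
  have "A_field j v K = (\<lambda>x. A_field j v K 0)" by (rule ext) (rule A_field_const[OF v K])
  then show "continuous_on UNIV (A_field j v K)" by (metis continuous_on_const)
qed

lemma A_field_integral:
  assumes v: "v \<in> morley0v \<Omega> \<T>" and K: "K \<in> \<T>" and sm: "smooth \<phi>"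
  shows "(LINT x|lebesgue_on K. glue \<T> (A_field j v) x \<bullet> grad \<phi> x)
    = A_field j v K 0 \<bullet> (\<chi> i. LINT x|lebesgue_on K. pderiv2 i \<phi> x)"
proof -
  let ?A = "A_field j v K 0"
  have c: "continuous_on UNIV (pderiv2 i \<phi>)" for i by (intro smooth_continuous smooth_pderiv sm)
  have int: "integrable (lebesgue_on K) (\<lambda>x. ?A $ i * pderiv2 i \<phi> x)" for i
    by (rule continuous_bounded_integrable[OF _ triangle_bounded[OF K] triangle_lebesgue[OF K]]) (intro continuous_intros c)
  have e: "?A \<bullet> grad \<phi> x = (\<Sum>i\<in>UNIV. ?A $ i * pderiv2 i \<phi> x)" for x
    by (simp add: inner_vec_def grad_def)
  have "(LINT x|lebesgue_on K. glue \<T> (A_field j v) x \<bullet> grad \<phi> x) = (LINT x|lebesgue_on K. ?A \<bullet> grad \<phi> x)"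
  proof (rule integral_cong_AE)
    show ae: "AE x in lebesgue_on K. glue \<T> (A_field j v) x \<bullet> grad \<phi> x = ?A \<bullet> grad \<phi> x"
      using AE_glue[OF K, of "A_field j v"]
    proof eventually_elim
      case (elim x)
      then show ?case using A_field_const[OF v K, of j x] by simp
    qed
    show m: "(\<lambda>x. ?A \<bullet> grad \<phi> x) \<in> borel_measurable (lebesgue_on K)"
      unfolding e by (intro borel_measurable_sum borel_measurable_integrable int)
    have ae': "AE x in lebesgue_on K. ?A \<bullet> grad \<phi> x = glue \<T> (A_field j v) x \<bullet> grad \<phi> x"
      using ae by eventually_elim simp
    show "(\<lambda>x. glue \<T> (A_field j v) x \<bullet> grad \<phi> x) \<in> borel_measurable (lebesgue_on K)"
      by (rule measurable_cong_AE_on[OF triangle_lebesgue[OF K] m ae'])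
  qed
  also have "\<dots> = (\<Sum>i\<in>UNIV. LINT x|lebesgue_on K. ?A $ i * pderiv2 i \<phi> x)"
    unfolding e by (simp only: Bochner_Integration.integral_sum[OF int])
  also have "\<dots> = ?A \<bullet> (\<chi> i. LINT x|lebesgue_on K. pderiv2 i \<phi> x)" by (simp add: inner_vec_def)
  finally show ?thesis .
qed

lemma Pi0_piecewise: obtains q where "Pi0 \<T> f = glue \<T> (\<lambda>K x. q K)"
  by (auto simp: Pi0_def)

lemma mesh_function_bound: "x \<in> closure \<Omega> \<Longrightarrow> \<bar>mesh_function \<T> x\<bar> \<le> h0"
proof -
  assume "x \<in> closure \<Omega>"
  then obtain K where "K \<in> \<T> \<and> x \<in> K" using Un by blast
  then have "(SOME K. K \<in> \<T> \<and> x \<in> K) \<in> \<T>" using someI[of "\<lambda>K. K \<in> \<T> \<and> x \<in> K" K] by simp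
  then show ?thesis using h0 diameter_ge_0[OF triangle_bounded] by (simp add: mesh_function_def glue_def)
qed

lemma osc_L2:
  assumes f: "f \<in> L2 \<Omega>"
  shows "(\<lambda>x. (mesh_function \<T> x)\<^sup>2 * (f x - Pi0 \<T> f x)) \<in> L2 (closure \<Omega>)"
proof -
  obtain q where q: "Pi0 \<T> f = glue \<T> (\<lambda>K x. q K)" by (rule Pi0_piecewise)
  have fc: "f \<in> L2 (closure \<Omega>)" using f by (simp only: closure_L2)
  have m: "mesh_function \<T> \<in> borel_measurable (lebesgue_on (closure \<Omega>))"
    unfolding mesh_function_def by (intro L2_measurable L2_glue continuous_on_const)
  have d: "(\<lambda>x. f x - Pi0 \<T> f x) \<in> L2 (closure \<Omega>)"
    unfolding q by (intro L2_diff fc L2_glue continuous_on_const)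
  show ?thesis
  proof (rule L2_dominated)
    show "(\<lambda>x. (mesh_function \<T> x)\<^sup>2 * (f x - Pi0 \<T> f x)) \<in> borel_measurable (lebesgue_on (closure \<Omega>))"
      by (intro borel_measurable_times borel_measurable_power m L2_measurable d)
    show "integrable (lebesgue_on (closure \<Omega>)) (\<lambda>x. (h0\<^sup>2)\<^sup>2 * (norm (f x - Pi0 \<T> f x))\<^sup>2)"
      by (intro integrable_mult_right L2_sq_integrable d)
    fix x assume x: "x \<in> closure \<Omega>"
    have "\<bar>mesh_function \<T> x\<bar>\<^sup>2 \<le> h0\<^sup>2" using mesh_function_bound[OF x] by (rule power_mono) simp
    then have "((mesh_function \<T> x)\<^sup>2)\<^sup>2 \<le> (h0\<^sup>2)\<^sup>2" unfolding power2_abs by (rule power_mono) simp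
    then have "((mesh_function \<T> x)\<^sup>2)\<^sup>2 * (norm (f x - Pi0 \<T> f x))\<^sup>2 \<le> (h0\<^sup>2)\<^sup>2 * (norm (f x - Pi0 \<T> f x))\<^sup>2"
      by (rule mult_right_mono) simp
    moreover have "(norm ((mesh_function \<T> x)\<^sup>2 * (f x - Pi0 \<T> f x)))\<^sup>2 = ((mesh_function \<T> x)\<^sup>2)\<^sup>2 * (norm (f x - Pi0 \<T> f x))\<^sup>2"
      by (simp add: norm_mult power_mult_distrib)
    ultimately show "(norm ((mesh_function \<T> x)\<^sup>2 * (f x - Pi0 \<T> f x)))\<^sup>2 \<le> (h0\<^sup>2)\<^sup>2 * (norm (f x - Pi0 \<T> f x))\<^sup>2"
      by (simp only:)
  qed
qed

lemma osc_mono: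
  assumes f: "f \<in> L2 \<Omega>" and S: "S \<in> sets lebesgue" "S \<subseteq> S'" "S' \<in> sets lebesgue" "S' \<subseteq> closure \<Omega>"
  shows "osc \<T> f S \<le> osc \<T> f S'"
  unfolding osc_def by (rule L2norm_subset[OF L2_subset[OF osc_L2[OF f] closure_lebesgue S(3,4)] S(3,1,2)])

lemma L2norm_cmult: "L2norm S (\<lambda>x. k * g x) = \<bar>k\<bar> * L2norm S g" for g :: "point \<Rightarrow> real"
proof -
  have "(LINT x|lebesgue_on S. (norm (k * g x))\<^sup>2) = k\<^sup>2 * (LINT x|lebesgue_on S. (norm (g x))\<^sup>2)"
    by (simp add: power_mult_distrib)
  then show ?thesis by (simp add: L2norm_def real_sqrt_mult)
qed

text \<open>The constant value of \<open>\<Pi>\<^sub>0 f\<close> on \<open>K\<close> is bounded by testing with an interior bump function,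
  against which the piecewise constant fields integrate to zero.\<close>
lemma eta_f_bound:
  assumes sol: "vK_solution \<Omega> f \<Psi>" and f: "f \<in> L2 \<Omega>" and v: "v \<in> morley0v \<Omega> \<T>" and K: "K \<in> \<T>"
    and M: "\<And>i. L2norm K (wgrad \<Omega> (cmp i \<Psi>)) \<le> M" "\<And>i. L2norm K (dhess v i) \<le> M"
    and B: "B > 0" "\<And>m r x. r > 0 \<Longrightarrow> norm (grad (bump m r) x) \<le> B / r"
    "\<And>m r x. r > 0 \<Longrightarrow> norm (hess (bump m r) x) \<le> B / r\<^sup>2"
  shows "\<eta>_f f K \<le> (2 + 64 * \<rho>^3 * exp 2 + 32 * \<rho>^3 * exp 2 * (2 + M) * B)
    * (hess_err \<Omega> \<T> \<Psi> v K + interp_err \<Omega> \<T> \<Psi> v K + osc \<T> f K)"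
proof -
  let ?e = "hess_err \<Omega> \<T> \<Psi> v K" and ?\<epsilon> = "interp_err \<Omega> \<T> \<Psi> v K" and ?h = "diameter K"
  obtain a b c where D: "area2 a b c \<noteq> 0" and Kh: "K = convex hull {a,b,c}" using simplex2E[OF simp2[OF K]] by metis
  obtain z r where zr: "r > 0" "cball z r \<subseteq> K" "?h \<le> \<rho> * r"
    using shape K by (auto simp: shape_regular_def)
  note st = shape_triangle[OF K Kh D]
  have M0: "0 \<le> M" using M(1)[of 1] L2norm_nonneg order_trans by blast
  \<comment> \<open>Half of the inball radius, so that the closed disc lies in the interior of
    \<open>K\<close> and therefore in \<Omega>.\<close>
  define s where "s = r / 2"
  have s: "s > 0" "?h \<le> 2 * \<rho> * s" using zr by (auto simp: s_def)
  have sh: "s \<le> ?h"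
  proof -
    have "2 * r \<le> dist b c" using inball_edge[OF D _ zr(1)] zr(2) Kh by simp
    also have "dist b c \<le> ?h" unfolding Kh by (rule dist_le_diameter) auto
    finally show ?thesis using zr(1) by (simp add: s_def)
  qed
  define \<phi> where "\<phi> = bump z s"
  have sub1: "cball z s \<subseteq> K" using zr by (auto simp: s_def)
  have "ball z r \<subseteq> interior K" by (rule interior_maximal) (use zr(2) ball_subset_cball in auto)
  moreover have "cball z s \<subseteq> ball z r" using zr(1) by (auto simp: s_def)
  ultimately have sub: "cball z s \<subseteq> \<Omega>" using interior_triangle_subset[OF K] by blast
  have T: "\<phi> \<in> test_functions \<Omega>" unfolding \<phi>_def by (rule bump_test[OF s(1) sub])
  have out: "\<phi> x = 0" "grad \<phi> x = 0" "hess \<phi> x = 0" if "x \<notin> cball z s" for x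
    unfolding \<phi>_def using bump_derivs_outside[OF s(1) that] bump_support[OF s(1), of z x] that by (auto simp: dist_commute)
  have outK: "\<phi> x = 0" "grad \<phi> x = 0" "hess \<phi> x = 0" if "x \<notin> K" for x
    using out[of x] sub1 that by blast+
  have b2: "L2norm K (hess \<phi>) \<le> 2 * B / s"
  proof -
    have "L2norm K (hess \<phi>) \<le> 2 * s * (B / s\<^sup>2)"
    proof (rule L2norm_disc[OF triangle_lebesgue[OF K], where m = z])
      show "norm (hess \<phi> x) \<le> B / s\<^sup>2" for x unfolding \<phi>_def by (rule B(3)[OF s(1)])
      show "dist x z \<le> s" if "hess \<phi> x \<noteq> 0" for x using out(3)[of x] that by (auto simp: dist_commute)
    qed (use s B in auto)
    then show ?thesis using s by (simp add: power2_eq_square)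
  qed
  have Bs: "0 \<le> B / s" using B(1) s(1) by simp
  have p1: "(LINT x|lebesgue_on K. pderiv2 i \<phi> x) = 0" for i
    by (rule test_pderiv_integral[OF T triangle_lebesgue[OF K]]) (use outK(2) in \<open>simp add: grad_def vec_eq_iff\<close>)
  have p2: "(LINT x|lebesgue_on K. pderiv2 k (pderiv2 i \<phi>) x) = 0" for i k
  proof (rule test_pderiv_integral[OF test_functions_pderiv[OF T] triangle_lebesgue[OF K]])
    show "pderiv2 k (pderiv2 i \<phi>) x = 0" if "x \<notin> K" for x
      using outK(3)[OF that] by (simp add: hess_def vec_eq_iff)
  qed
  have res: "\<bar>(LINT x|lebesgue_on (\<Union>{K}). dhess v 1 x \<bullet> hess \<phi> x)
      + coupling_sign 1 / 2 * (LINT x|lebesgue_on (\<Union>{K}). glue \<T> (A_field 1 v) x \<bullet> grad \<phi> x)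
      - (if (1::2) = 1 then LINT x|lebesgue_on (\<Union>{K}). f x * \<phi> x else 0)\<bar>
    \<le> (2 + M) * (B / s) * (hess_err \<Omega> \<T> \<Psi> v (\<Union>{K}) + interp_err \<Omega> \<T> \<Psi> v (\<Union>{K}))"
  proof (rule residual_bound[OF sol f v _ T])
    show "norm (grad \<phi> x) \<le> B / s" for x unfolding \<phi>_def by (rule B(2)[OF s(1)])
  qed (use K outK b2 M Bs in auto)
  have sm: "smooth \<phi>" using T by (rule test_functionsD)
  have "(\<chi> i. LINT x|lebesgue_on K. pderiv2 i \<phi> x) = 0" by (simp add: vec_eq_iff p1)
  then have X: "\<bar>LINT x|lebesgue_on K. f x * \<phi> x\<bar> \<le> (2 + M) * (B / s) * (?e + ?\<epsilon>)"
    using res by (simp add: dhess_integral[OF v K sm p2] A_field_integral[OF v K sm])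
  obtain q where q: "Pi0 \<T> f = glue \<T> (\<lambda>K x. q K)" by (rule Pi0_piecewise)
  define k where "k = q K"
  define F where "F = L2norm K (\<lambda>x. f x - k)"
  have F0: "0 \<le> F" by (simp add: F_def)
  have fK: "f \<in> L2 K"
    using L2_subset[OF _ closure_lebesgue triangle_lebesgue[OF K] triangle_subset[OF K]] f by (simp only: closure_L2)
  have kL: "(\<lambda>x. k) \<in> L2 K"
    by (rule continuous_bounded_L2[OF continuous_on_const triangle_bounded[OF K] triangle_lebesgue[OF K]])
  have fk: "(\<lambda>x. f x - k) \<in> L2 K" by (rule L2_diff[OF fK kL])
  have oscK: "osc \<T> f K = ?h\<^sup>2 * F"
  proof -
    have "osc \<T> f K = L2norm K (\<lambda>x. ?h\<^sup>2 * (f x - k))"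
      unfolding osc_def
    proof (rule L2norm_cong_AE)
      show ae: "AE x in lebesgue_on K. (mesh_function \<T> x)\<^sup>2 * (f x - Pi0 \<T> f x) = ?h\<^sup>2 * (f x - k)"
        using AE_interior[OF K]
        by eventually_elim (simp add: mesh_function_def q glue_interior[OF K] k_def)
      show m: "(\<lambda>x. ?h\<^sup>2 * (f x - k)) \<in> borel_measurable (lebesgue_on K)"
        by (intro borel_measurable_times borel_measurable_const L2_measurable fk)
      have ae': "AE x in lebesgue_on K. ?h\<^sup>2 * (f x - k) = (mesh_function \<T> x)\<^sup>2 * (f x - Pi0 \<T> f x)"
        using ae by eventually_elim simp
      show "(\<lambda>x. (mesh_function \<T> x)\<^sup>2 * (f x - Pi0 \<T> f x)) \<in> borel_measurable (lebesgue_on K)"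
        by (rule measurable_cong_AE_on[OF triangle_lebesgue[OF K] m ae'])
    qed
    then show ?thesis by (simp add: L2norm_cmult F_def)
  qed
  have phiL: "\<phi> \<in> L2 K"
    by (rule continuous_bounded_L2[OF smooth_continuous[OF sm] triangle_bounded[OF K] triangle_lebesgue[OF K]])
  have phin: "L2norm K \<phi> \<le> 2 * s * 1"
  proof (rule L2norm_disc[OF triangle_lebesgue[OF K], where m = z])
    show "norm (\<phi> x) \<le> 1" for x unfolding \<phi>_def using bump_bounds[of z s x] by simp
    show "dist x z \<le> s" if "\<phi> x \<noteq> 0" for x using out(1)[of x] that by (auto simp: dist_commute)
  qed (use s in auto)
  have low: "exp (-2) * s\<^sup>2 \<le> (LINT x|lebesgue_on K. \<phi> x)"
    unfolding \<phi>_def by (rule bump_integral_lower[OF triangle_lebesgue[OF K] triangle_bounded[OF K] s(1) sub1])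
  \<comment> \<open>Replacing \<open>f\<close> by the constant \<open>k\<close> costs
    \<open>F\<close> times the norm of the bump; the mass of the bump is at least
    \<open>exp (-2)\<close> times the square of \<open>s\<close>.\<close>
  have kb: "\<bar>k\<bar> * (exp (-2) * s\<^sup>2) \<le> (2 + M) * (B / s) * (?e + ?\<epsilon>) + F * (2 * s)"
  proof -
    have "(LINT x|lebesgue_on K. f x * \<phi> x) = (LINT x|lebesgue_on K. (f x - k) * \<phi> x + k * \<phi> x)"
      by (simp add: algebra_simps)
    also have "\<dots> = (LINT x|lebesgue_on K. (f x - k) * \<phi> x) + k * (LINT x|lebesgue_on K. \<phi> x)"
      using L2_mult_integrable[OF fk phiL] L2_mult_integrable[OF kL phiL] by (subst Bochner_Integration.integral_add) auto
    finally have e: "k * (LINT x|lebesgue_on K. \<phi> x) = (LINT x|lebesgue_on K. f x * \<phi> x) - (LINT x|lebesgue_on K. (f x - k) * \<phi> x)" by simp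
    have "\<bar>LINT x|lebesgue_on K. (f x - k) * \<phi> x\<bar> \<le> (LINT x|lebesgue_on K. \<bar>(f x - k) * \<phi> x\<bar>)" by (rule integral_abs_bound)
    also have "\<dots> \<le> F * L2norm K \<phi>" unfolding F_def by (rule L2_CS[OF fk phiL])
    also have "\<dots> \<le> F * (2 * s)" using phin F0 by (intro mult_left_mono) auto
    finally have d: "\<bar>LINT x|lebesgue_on K. (f x - k) * \<phi> x\<bar> \<le> F * (2 * s)" .
    have "\<bar>k\<bar> * (exp (-2) * s\<^sup>2) \<le> \<bar>k\<bar> * (LINT x|lebesgue_on K. \<phi> x)" using low by (intro mult_left_mono) auto
    also have "\<dots> = \<bar>k * (LINT x|lebesgue_on K. \<phi> x)\<bar>"
    proof -
      have "0 \<le> exp (-2) * s\<^sup>2" by simp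
      also note low
      finally show ?thesis by (simp only: abs_mult abs_of_nonneg)
    qed
    also have "\<dots> \<le> (2 + M) * (B / s) * (?e + ?\<epsilon>) + F * (2 * s)" unfolding e using X d by linarith
    finally show ?thesis .
  qed
  \<comment> \<open>Multiplication by \<open>exp 2 * s\<close> removes the singular
    \<open>B / s\<close> and leaves the cube of \<open>s\<close>, which matches the scaling of the
    diameter squared times the L^2 norm of a constant.\<close>
  have k3: "\<bar>k\<bar> * s^3 \<le> exp 2 * ((2 + M) * B * (?e + ?\<epsilon>) + 2 * (s\<^sup>2 * F))"
  proof -
    have "\<bar>k\<bar> * s^3 = (exp 2 * s) * (\<bar>k\<bar> * (exp (-2) * s\<^sup>2))"
      by (simp add: exp_minus power2_eq_square power3_eq_cube)
    also have "\<dots> \<le> (exp 2 * s) * ((2 + M) * (B / s) * (?e + ?\<epsilon>) + F * (2 * s))"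
      using kb s(1) by (intro mult_left_mono) auto
    also have "\<dots> = exp 2 * ((2 + M) * B * (?e + ?\<epsilon>) + 2 * (s\<^sup>2 * F))"
      using s(1) by (simp add: field_simps power2_eq_square)
    finally show ?thesis .
  qed
  have h3: "?h^3 \<le> 8 * \<rho>^3 * s^3"
  proof -
    have "?h^3 \<le> (2 * \<rho> * s)^3" using s st(1) by (intro power_mono) auto
    then show ?thesis by (simp add: power_mult_distrib)
  qed
  have e0: "0 \<le> ?e" "0 \<le> ?\<epsilon>" "0 \<le> osc \<T> f K" by (simp_all add: hess_err_def interp_err_def osc_def)
  \<comment> \<open>\<open>K\<close> lies in the disc around \<open>z\<close> whose radius is the
    diameter of \<open>K\<close>.\<close>
  have kn: "L2norm K (\<lambda>x. k) \<le> 2 * ?h * \<bar>k\<bar>"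
  proof (rule L2norm_disc[OF triangle_lebesgue[OF K], where m = z])
    have "z \<in> K" using sub1 s(1) by auto
    then show "dist x z \<le> ?h" if "x \<in> K" for x by (rule diameter_bounded_bound[OF triangle_bounded[OF K] that])
  qed (use st in auto)
  have fn: "L2norm K f \<le> 2 * F + 2 * (2 * ?h * \<bar>k\<bar>)"
  proof (rule power2_le_imp_le)
    have "(L2norm K f)\<^sup>2 = (L2norm K (\<lambda>x. (f x - k) + k))\<^sup>2" by simp
    also have "\<dots> \<le> 2 * F\<^sup>2 + 2 * (L2norm K (\<lambda>x. k))\<^sup>2" unfolding F_def by (rule L2norm_add_sq[OF fk kL])
    also have "\<dots> \<le> 2 * F\<^sup>2 + 2 * (2 * ?h * \<bar>k\<bar>)\<^sup>2" using kn F0 by (intro add_mono mult_left_mono power_mono) auto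
    also have "\<dots> \<le> (2 * F + 2 * (2 * ?h * \<bar>k\<bar>))\<^sup>2"
    proof -
      have "2 * x\<^sup>2 + 2 * y\<^sup>2 \<le> (2 * x + 2 * y)\<^sup>2" if "0 \<le> x" "0 \<le> y" for x y :: real
        using that mult_nonneg_nonneg[OF that] zero_le_power2[of x] zero_le_power2[of y]
        unfolding power2_sum power_mult_distrib by simp
      from this[of F "2 * ?h * \<bar>k\<bar>"] show ?thesis using F0 st(1) by simp
    qed
    finally show "(L2norm K f)\<^sup>2 \<le> (2 * F + 2 * (2 * ?h * \<bar>k\<bar>))\<^sup>2" .
  qed (use F0 st in simp)
  have "\<eta>_f f K = ?h\<^sup>2 * L2norm K f" by (simp add: \<eta>_f_def L2norm_cmult)
  also have "\<dots> \<le> ?h\<^sup>2 * (2 * F + 2 * (2 * ?h * \<bar>k\<bar>))" using fn by (intro mult_left_mono) auto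
  also have "\<dots> = 2 * osc \<T> f K + 4 * (?h^3 * \<bar>k\<bar>)"
    by (simp add: oscK power2_eq_square power3_eq_cube algebra_simps)
  also have "\<dots> \<le> 2 * osc \<T> f K + 4 * (8 * \<rho>^3 * s^3 * \<bar>k\<bar>)"
    using h3 by (intro add_left_mono mult_left_mono mult_right_mono) auto
  also have "\<dots> = 2 * osc \<T> f K + 32 * \<rho>^3 * (\<bar>k\<bar> * s^3)" by simp
  also have "\<dots> \<le> 2 * osc \<T> f K + 32 * \<rho>^3 * (exp 2 * ((2 + M) * B * (?e + ?\<epsilon>) + 2 * (s\<^sup>2 * F)))"
    using k3 st(2) by (intro add_left_mono mult_left_mono) auto
  also have "\<dots> \<le> 2 * osc \<T> f K + 32 * \<rho>^3 * (exp 2 * ((2 + M) * B * (?e + ?\<epsilon>) + 2 * osc \<T> f K))"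
  proof -
    have "s\<^sup>2 * F \<le> osc \<T> f K" unfolding oscK using sh s(1) F0 by (intro mult_right_mono power_mono) auto
    then show ?thesis using st(2) by (intro add_left_mono mult_left_mono) auto
  qed
  also have "\<dots> = (2 + 64 * \<rho>^3 * exp 2) * osc \<T> f K + (32 * \<rho>^3 * exp 2 * (2 + M) * B) * (?e + ?\<epsilon>)"
    by (simp add: algebra_simps)
  also have "\<dots> \<le> (2 + 64 * \<rho>^3 * exp 2 + 32 * \<rho>^3 * exp 2 * (2 + M) * B) * (?e + ?\<epsilon> + osc \<T> f K)"
  proof -
    define p where "p = 2 + 64 * \<rho>^3 * exp 2"
    define t where "t = 32 * \<rho>^3 * exp 2 * (2 + M) * B"
    have pt: "0 \<le> p" "0 \<le> t" using st(2) M0 B(1) by (auto simp: p_def t_def)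
    have "p * osc \<T> f K + t * (?e + ?\<epsilon>) \<le> (p + t) * (?e + ?\<epsilon> + osc \<T> f K)"
      using mult_nonneg_nonneg[OF pt(1) add_nonneg_nonneg[OF e0(1,2)]] mult_nonneg_nonneg[OF pt(2) e0(3)]
      by (simp add: algebra_simps)
    then show ?thesis by (simp only: p_def t_def)
  qed
  finally show ?thesis .
qed

end

text \<open>On each side through \<open>a\<close> one of the two barycentric coordinates that equal
  1/2 at the midpoint is zero. By the Lipschitz bound these sides are farther than \<open>r\<close>
  from the midpoint.\<close>

lemma segment_vanish:
  assumes D: "area2 a b c \<noteq> 0" and r: "r * diameter (convex hull {a,b,c}) < \<bar>area2 a b c\<bar> / 2"
    and z: "\<And>x. x \<notin> cball (midpoint b c) r \<Longrightarrow> v x = 0"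
  shows "segmean v a b = 0" "segmean v a c = 0"
proof -
  let ?m = "midpoint b c" and ?h = "diameter (convex hull {a,b,c})"
  have m: "?m = a + (1/2) *\<^sub>R (b - a) + (1/2) *\<^sub>R (c - a)"
    by (simp add: midpoint_def vec_eq_iff forall_2 field_simps)
  have mb: "area2 a ?m c = area2 a b c / 2" "area2 a b ?m = area2 a b c / 2" unfolding m area2_param by simp_all
  have out: "v x = 0" if "\<bar>area2 a b c\<bar> / 2 \<le> dist x ?m * ?h" for x
  proof (rule z)
    have "r * ?h < dist x ?m * ?h" using r that by linarith
    then have "r < dist x ?m" by (rule mult_right_less_imp_less) (intro diameter_ge_0 compact_imp_bounded compact_triangle)
    then show "x \<notin> cball ?m r" by (simp add: dist_commute)
  qed
  have "v x = 0" if x: "x \<in> closed_segment a b" for x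
  proof (rule out)
    obtain u where u: "x = (1 - u) *\<^sub>R a + u *\<^sub>R b" using x by (auto simp: closed_segment_def)
    have "area2 a b x = 0" unfolding u by (simp add: area2_def algebra_simps)
    then have "\<bar>area2 a b c\<bar> / 2 = \<bar>area2 x a b - area2 ?m a b\<bar>" using mb by (simp add: area2_cyclic(2)[of a b])
    also have "\<dots> \<le> dist x ?m * dist a b" by (rule area2_lipschitz)
    also have "\<dots> \<le> dist x ?m * ?h" by (intro mult_left_mono dist_le_diameter) auto
    finally show "\<bar>area2 a b c\<bar> / 2 \<le> dist x ?m * ?h" .
  qed
  then have "segmean v a b = segmean (\<lambda>x. 0) a b" by (intro segmean_cong) auto
  then show "segmean v a b = 0" by simp
  have "v x = 0" if x: "x \<in> closed_segment a c" for x
  proof (rule out)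
    obtain u where u: "x = (1 - u) *\<^sub>R a + u *\<^sub>R c" using x by (auto simp: closed_segment_def)
    have "area2 a x c = 0" unfolding u by (simp add: area2_def algebra_simps)
    then have "\<bar>area2 a b c\<bar> / 2 = \<bar>area2 x c a - area2 ?m c a\<bar>" using mb by (simp add: area2_cyclic(1)[of a _ c])
    also have "\<dots> \<le> dist x ?m * dist c a" by (rule area2_lipschitz)
    also have "\<dots> \<le> dist x ?m * ?h" by (intro mult_left_mono dist_le_diameter) auto
    finally show "\<bar>area2 a b c\<bar> / 2 \<le> dist x ?m * ?h" .
  qed
  then have "segmean v a c = segmean (\<lambda>x. 0) a c" by (intro segmean_cong) auto
  then show "segmean v a c = 0" by simp
qed

text \<open>Only the side \<open>b\<close>, \<open>c\<close> sees \<open>v\<close>, so Gauss gives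
  the same value in the directions \<open>b - a\<close> and \<open>c - a\<close>. These two inner
  products determine the vector, and a multiple of the edge normal has them.\<close>

lemma gauss_near_edge:
  assumes C: "C1 v G" and D: "area2 a b c \<noteq> 0" and r: "r * diameter (convex hull {a,b,c}) < \<bar>area2 a b c\<bar> / 2"
    and z: "\<And>x. x \<notin> cball (midpoint b c) r \<Longrightarrow> v x = 0"
  shows "(\<chi> i. LINT x|lebesgue_on (convex hull {a,b,c}). G x $ i) = (- sgn (area2 a b c) * segmean v b c) *\<^sub>R edge_vector b c"
proof -
  let ?K = "convex hull {a,b,c}" and ?D = "area2 a b c"
  define V :: point where "V = (\<chi> i. LINT x|lebesgue_on ?K. G x $ i)"
  define W where "W = (- sgn ?D * segmean v b c) *\<^sub>R edge_vector b c"
  have cG: "continuous_on UNIV (\<lambda>x. G x $ i)" for i using C1_cont_grad[OF C] by (intro continuous_intros)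
  have int: "integrable (lebesgue_on ?K) (\<lambda>x. G x $ i * d $ i)" for i d
    by (rule continuous_compact_integrable(1)[OF compact_triangle continuous_on_subset[OF _ subset_UNIV]])
       (intro continuous_intros cG)
  have Vd: "V \<bullet> d = (LINT x|lebesgue_on ?K. G x \<bullet> d)" for d
  proof -
    have "(LINT x|lebesgue_on ?K. G x \<bullet> d) = (\<Sum>i\<in>UNIV. LINT x|lebesgue_on ?K. G x $ i * d $ i)"
      unfolding inner_vec_def inner_real_def by (simp only: Bochner_Integration.integral_sum[OF int])
    then show ?thesis by (simp add: inner_vec_def V_def)
  qed
  have seg: "segmean v a b = 0" "segmean v a c = 0" using segment_vanish[OF D r] z by blast+
  have 1: "V \<bullet> (c - a) = \<bar>?D\<bar> * segmean v b c"
    unfolding Vd triangle_gauss[OF C D] seg by simp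
  have D': "area2 a c b \<noteq> 0" using D abs_area2_perm(1)[of a b c] by auto
  have 2: "V \<bullet> (b - a) = \<bar>?D\<bar> * segmean v b c"
    using triangle_gauss[OF C D'] seg(2) segmean_swap[OF C1_cont[OF C], of b c] abs_area2_perm(1)[of a b c]
    unfolding Vd by (simp add: insert_commute)
  have "sgn ?D * ?D = \<bar>?D\<bar>" by (simp add: abs_sgn mult.commute)
  then have "W \<bullet> (c - a) = \<bar>?D\<bar> * segmean v b c" "W \<bullet> (b - a) = \<bar>?D\<bar> * segmean v b c"
    unfolding W_def inner_scaleR_left edge_vector_facts(1,2) by (simp_all add: algebra_simps)
  with 1 2 have "V - W = 0" by (intro orthogonal_to_edges[OF D]) (simp_all add: inner_diff_left)
  then have "V = W" by simp
  then show ?thesis unfolding V_def W_def .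
qed

text \<open>The derivative is odd about the midpoint, so reversing the segment changes the sign of
  its mean.\<close>

lemma bump_pderiv_segmean: "segmean (pderiv2 i (bump (midpoint b c) r)) b c = 0"
proof -
  let ?m = "midpoint b c"
  let ?v = "pderiv2 i (bump ?m r)"
  have l: "linepath b c t = ?m + (t - 1/2) *\<^sub>R (c - b)" "linepath c b t = ?m - (t - 1/2) *\<^sub>R (c - b)" for t
  proof -
    have "(1 - t) * B + t * C = inverse 2 * (B + C) + (t - 1/2) * (C - B)" "(1 - t) * C + t * B = inverse 2 * (B + C) - (t - 1/2) * (C - B)" for B C :: real
      by (simp_all add: field_simps)
    then show "linepath b c t = ?m + (t - 1/2) *\<^sub>R (c - b)" "linepath c b t = ?m - (t - 1/2) *\<^sub>R (c - b)"
      unfolding linepath_def midpoint_def vec_eq_iff vector_minus_component vector_add_component vector_scaleR_component real_scaleR_def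
      by blast+
  qed
  have "?v (linepath b c t) = - ?v (linepath c b t)" for t
    unfolding l by (rule bump_symmetric)
  then have "segmean ?v b c = - segmean ?v c b" by (simp add: segmean_def)
  then show ?thesis using segmean_swap[OF smooth_continuous[OF smooth_pderiv[OF bump_smooth]], of i ?m r b c] by simp
qed

section \<open>Face normals and the jump term\<close>

context shape_mesh
begin

text \<open>\<open>edge_vector\<close> points towards growing \<open>area2 x b c\<close>, that is
  towards the apex if the area is positive; the sign turns it outwards. Uniqueness holds because a
  vector is determined by its inner products with \<open>c - b\<close> and
  \<open>a - b\<close>.\<close>

lemma face_normal_eq:
  assumes Tp: "Tplus \<T> F = convex hull {a,b,c}" and F: "F = closed_segment b c" and D: "area2 a b c \<noteq> 0"
  shows "face_normal \<T> F = (- sgn (area2 a b c) / dist b c) *\<^sub>R edge_vector b c"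
proof -
  let ?D = "area2 a b c" and ?n = "edge_vector b c"
  let ?\<nu> = "(- sgn ?D / dist b c) *\<^sub>R ?n"
  have bc: "0 < dist b c" using triangle_independent(3)[OF D] by simp
  have seg0: "area2 x b c = 0" if x: "x \<in> F" for x
  proof -
    obtain u where u: "x = (1 - u) *\<^sub>R b + u *\<^sub>R c" using x unfolding F closed_segment_def by blast
    show ?thesis unfolding u by (simp add: area2_def algebra_simps)
  qed
  have n1: "norm ?\<nu> = 1" using bc D by (simp add: edge_vector_facts(3) abs_sgn_eq)
  show ?thesis unfolding face_normal_def
  proof (rule the_equality)
    show "norm ?\<nu> = 1 \<and> (\<forall>x\<in>F. \<forall>y\<in>F. ?\<nu> \<bullet> (y - x) = 0) \<and> (\<forall>x\<in>F. \<forall>y\<in>Tplus \<T> F. ?\<nu> \<bullet> (y - x) \<le> 0)"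
    proof (intro conjI ballI n1)
      fix x y assume "x \<in> F" "y \<in> F"
      then show "?\<nu> \<bullet> (y - x) = 0" by (simp only: inner_scaleR_left edge_vector_facts(5) seg0) simp
    next
      fix x y assume x: "x \<in> F" and y: "y \<in> Tplus \<T> F"
      have "0 \<le> area2 y b c / ?D" using y unfolding Tp mem_triangle[OF D] by blast
      then have "0 \<le> sgn ?D * area2 y b c" using D by (auto simp: sgn_if zero_le_divide_iff)
      then have "0 \<le> sgn ?D * area2 y b c / dist b c" using bc by simp
      then show "?\<nu> \<bullet> (y - x) \<le> 0" by (simp add: edge_vector_facts(5) seg0[OF x])
    qed
  next
    fix \<nu> assume *: "norm \<nu> = 1 \<and> (\<forall>x\<in>F. \<forall>y\<in>F. \<nu> \<bullet> (y - x) = 0) \<and> (\<forall>x\<in>F. \<forall>y\<in>Tplus \<T> F. \<nu> \<bullet> (y - x) \<le> 0)"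
    have bF: "b \<in> F" "c \<in> F" by (auto simp: F)
    have aT: "a \<in> Tplus \<T> F" unfolding Tp by (simp add: hull_inc)
    define t where "t = \<nu> \<bullet> (a - b)"
    have t: "t \<le> 0" unfolding t_def using * bF(1) aT by blast
    have cb: "\<nu> \<bullet> (c - b) = 0" using * bF by blast
    have \<nu>ab: "?\<nu> \<bullet> (a - b) = - \<bar>?D\<bar> / dist b c"
    proof -
      have "edge_vector b c \<bullet> (a - b) = ?D" unfolding edge_vector_facts(5) by (simp add: area2_def)
      then show ?thesis by (simp add: abs_sgn mult.commute)
    qed
    \<comment> \<open>The factor forced by the inner product with \<open>a - b\<close>; unit length
      then makes it one.\<close>
    define l where "l = - t * dist b c / \<bar>?D\<bar>"
    have l0: "0 \<le> l" using t bc by (simp add: l_def divide_nonneg_nonneg mult_nonpos_nonneg)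
    have D': "area2 b c a \<noteq> 0" using D by (simp add: area2_cyclic)
    have "\<nu> - l *\<^sub>R ?\<nu> = 0"
    proof (rule orthogonal_to_edges[OF D'])
      show "(\<nu> - l *\<^sub>R ?\<nu>) \<bullet> (c - b) = 0"
        unfolding inner_diff_left inner_scaleR_left cb edge_vector_facts(4) by simp
      show "(\<nu> - l *\<^sub>R ?\<nu>) \<bullet> (a - b) = 0"
        unfolding inner_diff_left inner_scaleR_left[of l] \<nu>ab t_def[symmetric] using D bc by (simp add: l_def)
    qed
    then have e: "\<nu> = l *\<^sub>R ?\<nu>" by (simp only: right_minus_eq)
    have "norm \<nu> = \<bar>l\<bar> * norm ?\<nu>" using arg_cong[OF e, of norm] by (simp only: norm_scaleR)
    then have "l = 1" using * l0 unfolding n1 by simp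
    then show "\<nu> = ?\<nu>" using e by simp
  qed
qed

text \<open>A bump function centred at the midpoint of \<open>F\<close> is even, so its Hessian integrates to zero over
  either triangle, and its gradient integrates to a multiple of the normal.\<close>
lemma jump_residual:
  assumes sol: "vK_solution \<Omega> f \<Psi>" and f: "f \<in> L2 \<Omega>" and v: "v \<in> morley0v \<Omega> \<T>"
    and F: "F \<in> interior_faces \<T>"
    and M: "\<And>i. L2norm (closure \<Omega>) (wgrad \<Omega> (cmp i \<Psi>)) \<le> M" "\<And>i. L2norm (closure \<Omega>) (dhess v i) \<le> M"
    and B: "B > 0" "\<And>m r x. r > 0 \<Longrightarrow> norm (grad (bump m r) x) \<le> B / r"
    "\<And>m r x. r > 0 \<Longrightarrow> norm (hess (bump m r) x) \<le> B / r\<^sup>2"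
    and Cf: "0 \<le> Cf" "\<And>K. K \<in> \<T> \<Longrightarrow> \<eta>_f f K \<le> Cf * (hess_err \<Omega> \<T> \<Psi> v K + interp_err \<Omega> \<T> \<Psi> v K + osc \<T> f K)"
    and Fs: "F = closed_segment b c"
  shows "(dist b c / \<rho>\<^sup>2)\<^sup>2 * \<bar>jump \<T> F (A_field j v) 0 \<bullet> face_normal \<T> F\<bar>
    \<le> 2 * exp 2 * ((2 + M) * B + 4 * Cf) * (hess_err \<Omega> \<T> \<Psi> v (face_patch \<T> F)
      + interp_err \<Omega> \<T> \<Psi> v (face_patch \<T> F) + osc \<T> f (face_patch \<T> F))"
proof -
  have u: "\<Psi> \<in> H20v \<Omega>" using sol by (simp add: vK_solution_def)
  have Ff: "F \<in> faces \<T>" using F by (simp add: interior_faces_def)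
  let ?Tp = "Tplus \<T> F" and ?Tm = "Tminus \<T> F" and ?P = "face_patch \<T> F"
  note P = Tplus[OF Ff] and Mi = Tminus[OF F]
  let ?S = "{?Tp, ?Tm}"
  have S: "?S \<subseteq> \<T>" using P Mi by auto
  have PS: "?P = \<Union>?S" using F by (simp add: face_patch_def)
  have Pl: "?P \<in> sets lebesgue" and Pc: "?P \<subseteq> closure \<Omega>" using face_patch_lebesgue[OF Ff] face_patch_closure[OF Ff] .
  obtain a where D: "area2 a b c \<noteq> 0" and Tp: "?Tp = convex hull {a,b,c}"
    using edge_apex[OF P(1)] P(2) Fs by metis
  obtain a' where D': "area2 a' b c \<noteq> 0" and Tm: "?Tm = convex hull {a',b,c}"
    using edge_apex[OF Mi(1)] Mi(2) Fs by metis
  have opp: "area2 a b c * area2 a' b c < 0" by (rule opposite_apexes[OF P(1) Mi(1) Mi(3) Tp Tm D D'])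
  have rho: "2 \<le> \<rho>" by (rule rho_ge_2[OF P(1) Tp D])
  have bc: "0 < dist b c" using triangle_independent(3)[OF D] by simp
  \<comment> \<open>A radius that depends on the face alone. By shape regularity even twice this
    radius meets the condition of \<open>midpoint_disc\<close> in both triangles.\<close>
  define r where "r = dist b c / \<rho>\<^sup>2"
  have rho2: "4 \<le> \<rho>\<^sup>2" using power_mono[OF rho, of 2] by simp
  have r: "0 < r" "\<rho>\<^sup>2 * r = dist b c" using bc rho by (auto simp: r_def)
  have rbc: "r \<le> dist b c"
    unfolding r_def using rho2 bc by (simp add: divide_le_eq mult_le_cancel_left1)
  have small: "2 * r * diameter K \<le> \<bar>area2 p b c\<bar> / 2" and small': "r * diameter K < \<bar>area2 p b c\<bar> / 2" and rK: "r \<le> diameter K"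
    if K: "K \<in> \<T>" "K = convex hull {p,b,c}" "area2 p b c \<noteq> 0" for K p
  proof -
    note st = shape_triangle[OF K]
    have d: "dist b c \<le> diameter K" unfolding K(2) by (rule dist_le_diameter) auto
    show "r \<le> diameter K" using d rbc by linarith
    have "\<rho>\<^sup>2 * (4 * r * diameter K) = 4 * dist b c * diameter K" using r(2) by (simp add: algebra_simps)
    also have "\<dots> \<le> 4 * diameter K * diameter K" using d st(1) by (intro mult_right_mono mult_left_mono) auto
    also have "\<dots> \<le> \<rho>\<^sup>2 * \<bar>area2 p b c\<bar>" using st(4) by (simp add: power2_eq_square mult.assoc)
    finally have "4 * r * diameter K \<le> \<bar>area2 p b c\<bar>" by (rule mult_left_le_imp_le) (use rho2 in linarith)
    then show "2 * r * diameter K \<le> \<bar>area2 p b c\<bar> / 2" by simp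
    moreover have "r * diameter K < 2 * r * diameter K" using r(1) st(1) by simp
    ultimately show "r * diameter K < \<bar>area2 p b c\<bar> / 2" by linarith
  qed
  note sp = small[OF P(1) Tp D] small'[OF P(1) Tp D] rK[OF P(1) Tp D]
  note sm = small[OF Mi(1) Tm D'] small'[OF Mi(1) Tm D'] rK[OF Mi(1) Tm D']
  let ?m = "midpoint b c"
  \<comment> \<open>The doubled open ball is what puts the closed ball of radius \<open>r\<close>
    into the interior of the closure, hence into \<Omega>.\<close>
  have ballP: "ball ?m (2 * r) \<subseteq> ?P"
  proof
    fix x assume "x \<in> ball ?m (2 * r)"
    then have dx: "dist x ?m \<le> 2 * r" by (simp add: dist_commute)
    have le: "dist x ?m * diameter K \<le> 2 * r * diameter K" if "K \<in> \<T>" for K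
      using dx diameter_ge_0[OF triangle_bounded[OF that]] by (intro mult_right_mono) auto
    \<comment> \<open>The apexes lie on opposite sides of the face, so at every point one of the two
      coordinates is nonnegative.\<close>
    consider "0 \<le> area2 x b c / area2 a b c" | "0 \<le> area2 x b c / area2 a' b c"
      using opp by (cases "0 \<le> area2 x b c"; cases "0 < area2 a b c") (auto simp: zero_le_divide_iff mult_less_0_iff)
    then have "x \<in> ?Tp \<or> x \<in> ?Tm"
    proof cases
      case 1
      have "x \<in> ?Tp" unfolding Tp by (rule midpoint_disc[OF D _ 1]) (use le[OF P(1)] sp(1) in \<open>simp add: Tp\<close>)
      then show ?thesis by simp
    next
      case 2
      have "x \<in> ?Tm" unfolding Tm by (rule midpoint_disc[OF D' _ 2]) (use le[OF Mi(1)] sm(1) in \<open>simp add: Tm\<close>)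
      then show ?thesis by simp
    qed
    then show "x \<in> ?P" unfolding PS by blast
  qed
  have subP: "cball ?m r \<subseteq> ?P" using ballP r(1) by (auto simp: subset_iff)
  have "ball ?m (2 * r) \<subseteq> interior (closure \<Omega>)" by (rule interior_maximal) (use ballP Pc in auto)
  then have sub: "cball ?m r \<subseteq> \<Omega>" using int_closure r(1) by (auto simp: subset_iff)
  define \<phi> where "\<phi> = bump ?m r"
  have T: "\<phi> \<in> test_functions \<Omega>" unfolding \<phi>_def by (rule bump_test[OF r(1) sub])
  have smo: "smooth \<phi>" using T by (rule test_functionsD)
  have out: "\<phi> x = 0" "grad \<phi> x = 0" "hess \<phi> x = 0" if "x \<notin> cball ?m r" for x
    unfolding \<phi>_def using bump_derivs_outside[OF r(1) that] bump_support[OF r(1), of ?m x] that by (auto simp: dist_commute)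
  have outP: "\<phi> x = 0" "grad \<phi> x = 0" "hess \<phi> x = 0" if "x \<notin> ?P" for x
    using out[of x] subP that by blast+
  let ?e = "hess_err \<Omega> \<T> \<Psi> v ?P" and ?\<epsilon> = "interp_err \<Omega> \<T> \<Psi> v ?P" and ?o = "osc \<T> f ?P"
  have e0: "0 \<le> ?e" "0 \<le> ?\<epsilon>" "0 \<le> ?o" by (simp_all add: hess_err_def interp_err_def osc_def)
  have b2: "L2norm ?P (hess \<phi>) \<le> 2 * B / r"
  proof -
    have "L2norm ?P (hess \<phi>) \<le> 2 * r * (B / r\<^sup>2)"
    proof (rule L2norm_disc[OF Pl, where m = ?m])
      show "norm (hess \<phi> x) \<le> B / r\<^sup>2" for x unfolding \<phi>_def by (rule B(3)[OF r(1)])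
      show "dist x ?m \<le> r" if "hess \<phi> x \<noteq> 0" for x using out(3)[of x] that by (auto simp: dist_commute)
    qed (use r B in auto)
    then show ?thesis using r by (simp add: power2_eq_square)
  qed
  have MP: "L2norm ?P (wgrad \<Omega> (cmp i \<Psi>)) \<le> M" "L2norm ?P (dhess v i) \<le> M" for i
    using M(1)[of i] M(2)[of i]
      L2norm_subset[OF H20_L2_closure(2)[OF H20v_cmp[OF u]] closure_lebesgue Pl Pc, of i]
      L2norm_subset[OF glue_pw_hess_L2[OF morley0v_cmp'[OF v]] closure_lebesgue Pl Pc, of i] by linarith+
  have M0: "0 \<le> M" using M(1)[of 1] L2norm_nonneg order_trans by blast
  have res: "\<bar>(LINT x|lebesgue_on ?P. dhess v j x \<bullet> hess \<phi> x)
      + coupling_sign j / 2 * (LINT x|lebesgue_on ?P. glue \<T> (A_field j v) x \<bullet> grad \<phi> x)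
      - (if j = 1 then LINT x|lebesgue_on ?P. f x * \<phi> x else 0)\<bar>
    \<le> (2 + M) * (B / r) * (?e + ?\<epsilon>)"
    unfolding PS
  proof (rule residual_bound[OF sol f v S T])
    show "norm (grad \<phi> x) \<le> B / r" for x unfolding \<phi>_def by (rule B(2)[OF r(1)])
  qed (use outP[unfolded PS] b2[unfolded PS] MP[unfolded PS] B r in auto)
  define s where "s = segmean \<phi> b c"
  have smp: "exp (-2) * (r / dist b c) \<le> s" unfolding s_def \<phi>_def by (rule bump_segmean_lower[OF r(1) rbc])
  have hz: "(LINT x|lebesgue_on K. dhess v j x \<bullet> hess \<phi> x) = 0"
    and gz: "(LINT x|lebesgue_on K. glue \<T> (A_field j v) x \<bullet> grad \<phi> x) = - (sgn (area2 p b c) * s) * (A_field j v K 0 \<bullet> edge_vector b c)"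
    if K: "K \<in> \<T>" "K = convex hull {p,b,c}" "area2 p b c \<noteq> 0" for K p
  proof -
    have zz: "pderiv2 i \<phi> x = 0" if "x \<notin> cball ?m r" for i x
      using out(2)[OF that] by (simp add: grad_def vec_eq_iff)
    have "(\<chi> k. LINT x|lebesgue_on K. hess \<phi> x $ i $ k) = 0" for i
      using gauss_near_edge[OF smooth_pderiv_C1[OF smo, of i] K(3) small'[OF K, unfolded K(2)] zz]
      unfolding K(2) by (simp add: \<phi>_def bump_pderiv_segmean)
    then have "(LINT x|lebesgue_on K. pderiv2 k (pderiv2 i \<phi>) x) = 0" for i k
      by (simp add: vec_eq_iff hess_def)
    then show "(LINT x|lebesgue_on K. dhess v j x \<bullet> hess \<phi> x) = 0" by (rule dhess_integral[OF v K(1) smo])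
    have "(\<chi> i. LINT x|lebesgue_on K. pderiv2 i \<phi> x) = (- sgn (area2 p b c) * s) *\<^sub>R edge_vector b c"
      using gauss_near_edge[OF smooth_C1[OF smo] K(3) small'[OF K, unfolded K(2)] out(1)]
      unfolding K(2) s_def by simp
    then show "(LINT x|lebesgue_on K. glue \<T> (A_field j v) x \<bullet> grad \<phi> x) = - (sgn (area2 p b c) * s) * (A_field j v K 0 \<bullet> edge_vector b c)"
      unfolding A_field_integral[OF v K(1) smo] by simp
  qed
  define J where "J = jump \<T> F (A_field j v) 0 \<bullet> face_normal \<T> F"
  have a1: "(LINT x|lebesgue_on ?P. dhess v j x \<bullet> hess \<phi> x) = 0"
  proof -
    have "integrable (lebesgue_on (closure \<Omega>)) (\<lambda>x. dhess v j x \<bullet> hess \<phi> x)"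
      by (intro L2_inner_integrable glue_pw_hess_L2 morley0v_cmp' v test_L2_closure T)
    from union_integral[OF S this] show ?thesis
      unfolding PS using Mi(3) hz[OF P(1) Tp D] hz[OF Mi(1) Tm D'] by simp
  qed
  have a2: "(LINT x|lebesgue_on ?P. glue \<T> (A_field j v) x \<bullet> grad \<phi> x) = s * dist b c * J"
  proof -
    have "integrable (lebesgue_on (closure \<Omega>)) (\<lambda>x. glue \<T> (A_field j v) x \<bullet> grad \<phi> x)"
      by (intro L2_inner_integrable glue_A_field_L2 v test_L2_closure T)
    from union_integral[OF S this]
    have "(LINT x|lebesgue_on ?P. glue \<T> (A_field j v) x \<bullet> grad \<phi> x)
      = - (sgn (area2 a b c) * s) * (A_field j v ?Tp 0 \<bullet> edge_vector b c)
        - (sgn (area2 a' b c) * s) * (A_field j v ?Tm 0 \<bullet> edge_vector b c)"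
      unfolding PS using Mi(3) gz[OF P(1) Tp D] gz[OF Mi(1) Tm D'] by simp
    \<comment> \<open>Opposite signs turn the sum over the two triangles into the jump.\<close>
    also have "sgn (area2 a' b c) = - sgn (area2 a b c)" using opp by (auto simp: mult_less_0_iff)
    finally have "(LINT x|lebesgue_on ?P. glue \<T> (A_field j v) x \<bullet> grad \<phi> x)
      = - (sgn (area2 a b c) * s) * ((A_field j v ?Tp 0 - A_field j v ?Tm 0) \<bullet> edge_vector b c)"
      by (simp add: inner_diff_left algebra_simps)
    also have "\<dots> = s * dist b c * J"
      using F bc by (simp add: J_def jump_def face_normal_eq[OF Tp Fs D])
    finally show ?thesis .
  qed
  have fP: "f \<in> L2 ?P" using L2_subset[OF _ closure_lebesgue Pl Pc] f by (simp only: closure_L2)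
  have phiP: "\<phi> \<in> L2 ?P" using L2_subset[OF _ closure_lebesgue Pl Pc] test_L2[OF T] by (simp only: closure_L2)
  have load: "\<bar>if j = 1 then LINT x|lebesgue_on ?P. f x * \<phi> x else 0\<bar> \<le> L2norm ?P f * (2 * r)"
  proof -
    have "\<bar>LINT x|lebesgue_on ?P. f x * \<phi> x\<bar> \<le> (LINT x|lebesgue_on ?P. \<bar>f x * \<phi> x\<bar>)" by (rule integral_abs_bound)
    also have "\<dots> \<le> L2norm ?P f * L2norm ?P \<phi>" by (rule L2_CS[OF fP phiP])
    also have "L2norm ?P \<phi> \<le> 2 * r * 1"
    proof (rule L2norm_disc[OF Pl, where m = ?m])
      show "norm (\<phi> x) \<le> 1" for x unfolding \<phi>_def using bump_bounds[of ?m r x] by simp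
      show "dist x ?m \<le> r" if "\<phi> x \<noteq> 0" for x using out(1)[of x] that by (auto simp: dist_commute)
    qed (use r in auto)
    finally show ?thesis using r by (simp add: mult_left_mono)
  qed
  define X where "X = (2 + M) * (B / r) * (?e + ?\<epsilon>) + L2norm ?P f * (2 * r)"
  have "\<bar>coupling_sign j / 2 * (s * dist b c * J)\<bar> \<le> X"
    using res load unfolding a1 a2 X_def by linarith
  moreover have "\<bar>coupling_sign j / 2 * (s * dist b c * J)\<bar> = s * dist b c * \<bar>J\<bar> / 2"
  proof -
    have "0 \<le> exp (-2) * (r / dist b c)" using r bc by simp
    then have "0 \<le> s" using smp by linarith
    then show ?thesis using bc by (simp add: coupling_sign_def abs_mult)
  qed
  moreover have "exp (-2) * r * \<bar>J\<bar> \<le> s * dist b c * \<bar>J\<bar>"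
  proof (rule mult_right_mono)
    have "exp (-2) * (r / dist b c) * dist b c \<le> s * dist b c" using smp bc by (intro mult_right_mono) auto
    then show "exp (-2) * r \<le> s * dist b c" using bc by simp
  qed simp
  ultimately have k: "exp (-2) * r * \<bar>J\<bar> \<le> 2 * X" by linarith
  \<comment> \<open>Multiplying by \<open>exp 2 * r\<close> removes \<open>B / r\<close> and puts
    the square of \<open>r\<close> in front of the norm of \<open>f\<close>; as \<open>r\<close> is
    at most either diameter, \<open>\<eta>_f\<close> on the two triangles takes over.\<close>
  have "r\<^sup>2 * \<bar>J\<bar> = (exp 2 * r) * (exp (-2) * r * \<bar>J\<bar>)"
    by (simp add: exp_minus power2_eq_square)
  also have "\<dots> \<le> (exp 2 * r) * (2 * X)"
    using r by (intro mult_left_mono k) auto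
  also have "\<dots> = 2 * exp 2 * ((2 + M) * B * (?e + ?\<epsilon>) + 2 * (r\<^sup>2 * L2norm ?P f))"
    unfolding X_def using r by (simp add: field_simps power2_eq_square)
  also have "r\<^sup>2 * L2norm ?P f \<le> 2 * Cf * (?e + ?\<epsilon> + ?o)"
  proof -
    have each: "r\<^sup>2 * L2norm K f \<le> Cf * (?e + ?\<epsilon> + ?o)" if K: "K \<in> ?S" for K
    proof -
      have KT: "K \<in> \<T>" using K S by blast
      have KP: "K \<subseteq> ?P" unfolding PS using K by blast
      have "r \<le> diameter K" using K sp(3) sm(3) by auto
      then have "r\<^sup>2 * L2norm K f \<le> (diameter K)\<^sup>2 * L2norm K f"
        using r(1) by (intro mult_right_mono power_mono) auto
      also have "\<dots> = \<eta>_f f K" by (simp add: \<eta>_f_def L2norm_cmult)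
      also have "\<dots> \<le> Cf * (hess_err \<Omega> \<T> \<Psi> v K + interp_err \<Omega> \<T> \<Psi> v K + osc \<T> f K)" by (rule Cf(2)[OF KT])
      also have "\<dots> \<le> Cf * (?e + ?\<epsilon> + ?o)"
        by (intro mult_left_mono add_mono Cf(1) hess_err_mono[OF u v] interp_err_mono[OF u] osc_mono[OF f] triangle_lebesgue KT KP Pl Pc)
      finally show ?thesis .
    qed
    have "L2norm ?P f \<le> L2norm ?Tp f + L2norm ?Tm f"
    proof (rule power2_le_imp_le)
      have "integrable (lebesgue_on (closure \<Omega>)) (\<lambda>x. (norm (f x))\<^sup>2)"
        using L2_sq_integrable[OF f] closure_integral by blast
      from union_integral[OF S this]
      have "(L2norm ?P f)\<^sup>2 = (L2norm ?Tp f)\<^sup>2 + (L2norm ?Tm f)\<^sup>2"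
        unfolding PS L2norm_sq using Mi(3) by simp
      also have "\<dots> \<le> (L2norm ?Tp f + L2norm ?Tm f)\<^sup>2" by (simp add: power2_sum)
      finally show "(L2norm ?P f)\<^sup>2 \<le> (L2norm ?Tp f + L2norm ?Tm f)\<^sup>2" .
    qed simp
    then have "r\<^sup>2 * L2norm ?P f \<le> r\<^sup>2 * (L2norm ?Tp f + L2norm ?Tm f)" by (intro mult_left_mono) auto
    also have "\<dots> \<le> Cf * (?e + ?\<epsilon> + ?o) + Cf * (?e + ?\<epsilon> + ?o)"
      unfolding distrib_left by (intro add_mono each[unfolded distrib_left]) auto
    finally show ?thesis by simp
  qed
  also have "(2 + M) * B * (?e + ?\<epsilon>) \<le> (2 + M) * B * (?e + ?\<epsilon> + ?o)"
    using M0 B(1) e0 by (intro mult_left_mono) auto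
  finally have "r\<^sup>2 * \<bar>J\<bar> \<le> 2 * exp 2 * ((2 + M) * B * (?e + ?\<epsilon> + ?o) + 2 * (2 * Cf * (?e + ?\<epsilon> + ?o)))" by simp
  also have "\<dots> = 2 * exp 2 * ((2 + M) * B + 4 * Cf) * (?e + ?\<epsilon> + ?o)" by (simp add: distrib_left distrib_right)
  finally show ?thesis by (simp add: r_def J_def)
qed

text \<open>The jump is a constant \<open>J\<close> on a face, so the weighted term is at most the
  square of \<open>(diameter T)\<^sup>2 * \<bar>J\<bar>\<close>. Shape regularity gives
  \<open>2 * diameter T \<le> \<rho> * dist b c\<close>, which trades the squared diameter for
  \<open>\<rho>^6 / 4\<close> times the squared bump radius. There are at most three faces; rounding
  up to 16 cancels the 4 after taking the root.\<close>

lemma eta_bound: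
  assumes sol: "vK_solution \<Omega> f \<Psi>" and f: "f \<in> L2 \<Omega>" and v: "v \<in> morley0v \<Omega> \<T>" and T: "T \<in> \<T>"
    and Cg: "0 \<le> Cg" "\<And>F b c. F \<in> interior_faces \<T> \<Longrightarrow> F = closed_segment b c \<Longrightarrow>
      (dist b c / \<rho>\<^sup>2)\<^sup>2 * \<bar>jump \<T> F (A_field j v) 0 \<bullet> face_normal \<T> F\<bar>
      \<le> Cg * (hess_err \<Omega> \<T> \<Psi> v (face_patch \<T> F) + interp_err \<Omega> \<T> \<Psi> v (face_patch \<T> F) + osc \<T> f (face_patch \<T> F))"
  shows "\<eta> j \<T> v T \<le> \<rho>^6 * Cg * (hess_err \<Omega> \<T> \<Psi> v (edge_patch \<T> T) + interp_err \<Omega> \<T> \<Psi> v (edge_patch \<T> T) + osc \<T> f (edge_patch \<T> T))"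
proof -
  have u: "\<Psi> \<in> H20v \<Omega>" using sol by (simp add: vK_solution_def)
  let ?E = "edge_patch \<T> T"
  let ?Q = "hess_err \<Omega> \<T> \<Psi> v ?E + interp_err \<Omega> \<T> \<Psi> v ?E + osc \<T> f ?E"
  have Q0: "0 \<le> ?Q" by (simp add: hess_err_def interp_err_def osc_def)
  let ?h = "diameter T"
  obtain p q r where D: "area2 p q r \<noteq> 0" and Th: "T = convex hull {p,q,r}" using simplex2E[OF simp2[OF T]] by metis
  have hp: "0 < ?h" and rp: "0 < \<rho>" using shape_triangle[OF T Th D] by auto
  have each: "?h ^ 3 * (face_L2norm F (\<lambda>x. jump \<T> F (A_field j v) x \<bullet> face_normal \<T> F))\<^sup>2 \<le> (\<rho>^6 / 4 * Cg * ?Q)\<^sup>2"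
    if F: "F \<in> edges T \<inter> interior_faces \<T>" for F
  proof -
    have Fi: "F \<in> interior_faces \<T>" and FT: "F \<in> edges T" using F by auto
    have Ff: "F \<in> faces \<T>" using Fi by (simp add: interior_faces_def)
    obtain a b c where D: "area2 a b c \<noteq> 0" and Th: "T = convex hull {a,b,c}" and Fs: "F = closed_segment b c"
      using edgeE[OF simp2[OF T] FT] by metis
    define J where "J = jump \<T> F (A_field j v) 0 \<bullet> face_normal \<T> F"
    have jc: "jump \<T> F (A_field j v) x = jump \<T> F (A_field j v) 0" for x
      unfolding jump_def using A_field_const[OF v Tplus(1)[OF Ff], of j x] A_field_const[OF v Tminus(1)[OF Fi], of j x] by simp
    have e: "(\<lambda>x. (norm (jump \<T> F (A_field j v) x \<bullet> face_normal \<T> F))\<^sup>2) = (\<lambda>x. J\<^sup>2)"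
    proof
      fix x show "(norm (jump \<T> F (A_field j v) x \<bullet> face_normal \<T> F))\<^sup>2 = J\<^sup>2" unfolding J_def jc[of x] by simp
    qed
    have "(face_L2norm F (\<lambda>x. jump \<T> F (A_field j v) x \<bullet> face_normal \<T> F))\<^sup>2 = dist b c * J\<^sup>2"
      unfolding face_L2norm_def e unfolding Fs face_integral_segment[OF continuous_on_const] by simp
    then have "?h ^ 3 * (face_L2norm F (\<lambda>x. jump \<T> F (A_field j v) x \<bullet> face_normal \<T> F))\<^sup>2 = ?h ^ 3 * (dist b c * J\<^sup>2)" by simp
    also have "\<dots> \<le> ?h ^ 3 * (?h * J\<^sup>2)"
      using hp dist_le_diameter[of b a b c c] unfolding Th by (intro mult_left_mono mult_right_mono) auto
    also have "\<dots> = (?h\<^sup>2 * \<bar>J\<bar>)\<^sup>2" by (simp add: power_mult_distrib power2_eq_square power3_eq_cube)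
    also have "\<dots> \<le> (\<rho>^6 / 4 * Cg * ?Q)\<^sup>2"
    proof (rule power_mono)
      have fsub: "face_patch \<T> F \<subseteq> ?E" using FT by (auto simp: edge_patch_def)
      note fl = face_patch_lebesgue[OF Ff] and el = edge_patch_lebesgue[OF T] and ec = edge_patch_closure[OF T]
      have "2 * ?h \<le> \<rho> * dist b c" by (rule shape_triangle(3)[OF T Th D])
      then have "(2 * ?h)\<^sup>2 \<le> (\<rho> * dist b c)\<^sup>2" using hp by (intro power_mono) auto
      also have "\<dots> = \<rho>^6 * (dist b c / \<rho>\<^sup>2)\<^sup>2"
        using rp by (simp add: power_mult_distrib power_divide power_mult[symmetric] power_diff[symmetric] divide_simps flip: power_add)
      finally have "?h\<^sup>2 \<le> \<rho>^6 / 4 * (dist b c / \<rho>\<^sup>2)\<^sup>2" by (simp add: power_mult_distrib)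
      then have "?h\<^sup>2 * \<bar>J\<bar> \<le> \<rho>^6 / 4 * (dist b c / \<rho>\<^sup>2)\<^sup>2 * \<bar>J\<bar>" by (rule mult_right_mono) simp
      also have "\<dots> = \<rho>^6 / 4 * ((dist b c / \<rho>\<^sup>2)\<^sup>2 * \<bar>J\<bar>)" by simp
      also have "\<dots> \<le> \<rho>^6 / 4 * (Cg * (hess_err \<Omega> \<T> \<Psi> v (face_patch \<T> F) + interp_err \<Omega> \<T> \<Psi> v (face_patch \<T> F) + osc \<T> f (face_patch \<T> F)))"
        unfolding J_def by (intro mult_left_mono Cg(2)[OF Fi Fs]) (use rp in auto)
      also have "\<dots> \<le> \<rho>^6 / 4 * (Cg * ?Q)"
        using rp by (intro mult_left_mono add_mono Cg(1) hess_err_mono[OF u v fl fsub el ec] interp_err_mono[OF u fl fsub el ec] osc_mono[OF f fl fsub el ec]) auto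
      finally show "?h\<^sup>2 * \<bar>J\<bar> \<le> \<rho>^6 / 4 * Cg * ?Q" by (simp only: mult.assoc)
    qed simp
    finally show ?thesis .
  qed
  have "(\<eta> j \<T> v T)\<^sup>2 = (\<Sum>F\<in>edges T \<inter> interior_faces \<T>. ?h ^ 3 * (face_L2norm F (\<lambda>x. jump \<T> F (A_field j v) x \<bullet> face_normal \<T> F))\<^sup>2)"
    unfolding \<eta>_def using hp by (intro real_sqrt_pow2 sum_nonneg) auto
  also have "\<dots> \<le> real (card (edges T \<inter> interior_faces \<T>)) * (\<rho>^6 / 4 * Cg * ?Q)\<^sup>2" by (rule sum_bounded_above[OF each])
  also have "\<dots> \<le> 16 * (\<rho>^6 / 4 * Cg * ?Q)\<^sup>2"
  proof (rule mult_right_mono)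
    have "card (edges T \<inter> interior_faces \<T>) \<le> card (edges T)"
      by (rule card_mono[OF edges_finite[OF simp2[OF T]]]) auto
    then show "real (card (edges T \<inter> interior_faces \<T>)) \<le> 16" using card_edges[OF simp2[OF T]] by linarith
  qed simp
  also have "\<dots> = (\<rho>^6 * Cg * ?Q)\<^sup>2" by (simp add: power_mult_distrib power_divide)
  finally show ?thesis
    by (rule power2_le_imp_le) (use rp Cg(1) Q0 in simp)
qed


text \<open>The source of the constant \<open>M\<close>: the discrete Hessian is within \<delta> of
  the exact one, so its norm is bounded uniformly over the meshes.\<close>

lemma solution_bounds:
  assumes u: "u \<in> H20v \<Omega>" and v: "v \<in> morley0v \<Omega> \<T>" and e: "hess_err \<Omega> \<T> u v \<Omega> \<le> \<delta>"
  shows "L2norm (closure \<Omega>) (wgrad \<Omega> (cmp i u)) \<le> L2norm \<Omega> (Wgrad \<Omega> u)"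
    and "L2norm (closure \<Omega>) (dhess v i) \<le> sqrt (2 * (L2norm \<Omega> (Whess \<Omega> u))\<^sup>2 + 2 * \<delta>\<^sup>2)"
proof -
  note uL = H20_L2_closure[OF H20v_cmp[OF u], of i]
  have vL: "dhess v i \<in> L2 (closure \<Omega>)" by (rule glue_pw_hess_L2[OF morley0v_cmp'[OF v]])
  have le: "(L2norm (closure \<Omega>) (\<lambda>x. F x $ i))\<^sup>2 \<le> (L2norm \<Omega> F)\<^sup>2" if "F \<in> L2 (closure \<Omega>)"
    for F :: "point \<Rightarrow> 'a::euclidean_space ^ 2"
    unfolding closure_L2(2)[symmetric, of F] L2norm_vec_sq[OF that] by (rule member_le_sum) auto
  show "L2norm (closure \<Omega>) (wgrad \<Omega> (cmp i u)) \<le> L2norm \<Omega> (Wgrad \<Omega> u)"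
    using le[OF Wgrad_L2[OF u]] by (auto simp: Wgrad_def intro: power2_le_imp_le)
  have w: "(L2norm (closure \<Omega>) (whess \<Omega> (cmp i u)))\<^sup>2 \<le> (L2norm \<Omega> (Whess \<Omega> u))\<^sup>2"
    using le[OF Whess_L2[OF u]] by (simp add: Whess_def)
  have "L2norm (closure \<Omega>) (\<lambda>x. dhess v i x - whess \<Omega> (cmp i u) x) = L2norm (closure \<Omega>) (\<lambda>x. whess \<Omega> (cmp i u) x - dhess v i x)"
    unfolding L2norm_def by (subst norm_minus_commute) simp
  also have "\<dots> \<le> hess_err \<Omega> \<T> u v (closure \<Omega>)" by (rule component_errors(1)[OF u v closure_lebesgue subset_refl])
  also have "\<dots> \<le> \<delta>" using e by (simp add: hess_err_def closure_L2(2))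
  finally have d: "(L2norm (closure \<Omega>) (\<lambda>x. dhess v i x - whess \<Omega> (cmp i u) x))\<^sup>2 \<le> \<delta>\<^sup>2" by (intro power_mono) auto
  have "(L2norm (closure \<Omega>) (dhess v i))\<^sup>2 \<le> 2 * (L2norm (closure \<Omega>) (whess \<Omega> (cmp i u)))\<^sup>2
      + 2 * (L2norm (closure \<Omega>) (\<lambda>x. dhess v i x - whess \<Omega> (cmp i u) x))\<^sup>2"
    using L2norm_add_sq[OF uL(1) L2_diff[OF vL uL(1)]] by simp
  also have "\<dots> \<le> 2 * (L2norm \<Omega> (Whess \<Omega> u))\<^sup>2 + 2 * \<delta>\<^sup>2" using w d by linarith
  finally show "L2norm (closure \<Omega>) (dhess v i) \<le> sqrt (2 * (L2norm \<Omega> (Whess \<Omega> u))\<^sup>2 + 2 * \<delta>\<^sup>2)"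
    by (rule real_le_rsqrt)
qed

end

theorem theorem4p8:
  fixes \<Omega> :: "point set" and f :: "point \<Rightarrow> real" and \<Psi> :: "point \<Rightarrow> real^2"
    and \<alpha> c_reg \<rho> h0 \<delta> c0 :: real
  assumes "polygonal_Lipschitz_domain \<Omega>"
    and "f \<in> L2 \<Omega>"
    and "vK_solution \<Omega> f \<Psi>" and "nonsingular \<Omega> \<Psi>"
    and "1/2 < \<alpha>" and "\<alpha> \<le> 1" and "biharmonic_regularity \<Omega> \<alpha>"
    and "regular_solution \<Omega> f \<alpha> c_reg \<Psi>"
    and "0 < h0" and "0 < \<delta>" and "0 < c0"
  shows "\<exists>C>0. \<forall>\<T> \<Psi>h.
    regular_triangulation \<Omega> \<T> \<longrightarrow> shape_regular \<rho> \<T> \<longrightarrow> mesh_size \<T> \<le> h0 \<longrightarrow>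
    near_discrete_solution \<Omega> f \<Psi> \<alpha> \<delta> c0 \<T> \<Psi>h \<longrightarrow>
      (\<forall>T\<in>\<T>.
         \<mu>_NC \<T> \<Psi>h T \<le> C * (INF \<Phi>\<in>H20v \<Omega>. hess_err \<Omega> \<T> \<Phi> \<Psi>h (vertex_patch \<T> T)) \<and>
         (INF \<Phi>\<in>H20v \<Omega>. hess_err \<Omega> \<T> \<Phi> \<Psi>h (vertex_patch \<T> T))
           \<le> hess_err \<Omega> \<T> \<Psi> \<Psi>h (vertex_patch \<T> T)) \<and>
      (\<Sum>K\<in>\<T>. (\<mu>_I \<T> \<Psi>h K)\<^sup>2)
        \<le> C * ((hess_err \<Omega> \<T> \<Psi> \<Psi>h \<Omega>)\<^sup>2 + (interp_err \<Omega> \<T> \<Psi> \<Psi>h \<Omega>)\<^sup>2) \<and>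
      (\<forall>T\<in>\<T>.
         \<eta>_f f T \<le> C * (hess_err \<Omega> \<T> \<Psi> \<Psi>h T + interp_err \<Omega> \<T> \<Psi> \<Psi>h T + osc \<T> f T)) \<and>
      (\<forall>T\<in>\<T>. \<forall>j.
         \<eta> j \<T> \<Psi>h T \<le> C * (hess_err \<Omega> \<T> \<Psi> \<Psi>h (edge_patch \<T> T) +
           interp_err \<Omega> \<T> \<Psi> \<Psi>h (edge_patch \<T> T) + osc \<T> f (edge_patch \<T> T)))"
proof -
  have ne: "\<Omega> \<noteq> {}" and op: "open \<Omega>" and bd: "bounded \<Omega>" and Lip: "Lipschitz_domain \<Omega>"
    using assms(1) by (auto simp: polygonal_Lipschitz_domain_def)
  note f = assms(2) and sol = assms(3)
  have u: "\<Psi> \<in> H20v \<Omega>" using sol by (simp add: vK_solution_def)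
  obtain R where R: "\<And>x. x \<in> \<Omega> \<Longrightarrow> norm x \<le> R" using bd unfolding bounded_iff by blast
  obtain B where B: "B > 0" "\<And>m r x. r > 0 \<Longrightarrow> norm (grad (bump m r) x) \<le> B / r"
    "\<And>m r x. r > 0 \<Longrightarrow> norm (hess (bump m r) x) \<le> B / r\<^sup>2"
    by (rule bump_deriv_bounds) blast
  define M where "M = L2norm \<Omega> (Wgrad \<Omega> \<Psi>) + sqrt (2 * (L2norm \<Omega> (Whess \<Omega> \<Psi>))\<^sup>2 + 2 * \<delta>\<^sup>2)"
  have M0: "0 \<le> M" unfolding M_def by (intro add_nonneg_nonneg) auto
  define Ci where "Ci = 8 * (R\<^sup>2 + 6 * R * h0 * \<rho>\<^sup>2)"
  define Cf where "Cf = 2 + 64 * \<rho>^3 * exp 2 + 32 * \<rho>^3 * exp 2 * (2 + M) * B"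
  define Cg where "Cg = 2 * exp 2 * ((2 + M) * B + 4 * Cf)"
  \<comment> \<open>The summand 2 is the factor of the interpolation error in
    \<open>mu_I_bound\<close>. Absolute values are taken because the sign of \<rho> is known only
    once a triangle is given.\<close>
  define C where "C = 2 + sqrt (24 * \<rho>\<^sup>2) + \<bar>Ci\<bar> + \<bar>Cf\<bar> + \<bar>\<rho>^6 * Cg\<bar>"
  have C: "sqrt (24 * \<rho>\<^sup>2) \<le> C" "0 < C" "Ci \<le> C" "2 \<le> C" "Cf \<le> C" "\<rho>^6 * Cg \<le> C"
  proof -
    have "0 \<le> sqrt (24 * \<rho>\<^sup>2)" by simp
    then show "sqrt (24 * \<rho>\<^sup>2) \<le> C" "0 < C" "Ci \<le> C" "2 \<le> C" "Cf \<le> C" "\<rho>^6 * Cg \<le> C"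
      unfolding C_def by linarith+
  qed
  show ?thesis
  proof (rule exI[of _ C], intro conjI C(2) allI impI ballI)
    fix \<T> \<Psi>h
    assume reg: "regular_triangulation \<Omega> \<T>" and shape: "shape_regular \<rho> \<T>" and h: "mesh_size \<T> \<le> h0"
      and near: "near_discrete_solution \<Omega> f \<Psi> \<alpha> \<delta> c0 \<T> \<Psi>h"
    interpret mesh \<Omega> \<T>
      by unfold_locales (rule op bd reg Lipschitz_domain_interior_closure[OF Lip])+
    have "diameter K \<le> h0" if "K \<in> \<T>" for K
    proof -
      have "diameter K \<le> mesh_size \<T>" unfolding mesh_size_def by (rule Max_ge) (use that fin in auto)
      then show ?thesis using h by linarith
    qed
    then interpret shape_mesh \<Omega> \<T> \<rho> h0 R
      using shape R ne by unfold_locales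
    have v: "\<Psi>h \<in> morley0v \<Omega> \<T>" and \<delta>: "hess_err \<Omega> \<T> \<Psi> \<Psi>h \<Omega> \<le> \<delta>"
      using near by (auto simp: near_discrete_solution_def discrete_solution_def)
    have nn: "0 \<le> hess_err \<Omega> \<T> \<Phi> \<Psi>h S" "0 \<le> interp_err \<Omega> \<T> \<Phi> \<Psi>h S" "0 \<le> osc \<T> f S" for \<Phi> S
      by (simp_all add: hess_err_def interp_err_def osc_def)
    have Mc: "L2norm (closure \<Omega>) (wgrad \<Omega> (cmp i \<Psi>)) \<le> M" "L2norm (closure \<Omega>) (dhess \<Psi>h i) \<le> M" for i
      using solution_bounds[OF u v \<delta>, of i] L2norm_nonneg[of \<Omega> "Wgrad \<Omega> \<Psi>"] unfolding M_def
      by (simp_all add: add_increasing add_increasing2)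
    have \<rho>: "2 \<le> \<rho>" if K: "K \<in> \<T>" for K
    proof -
      obtain a b c where "area2 a b c \<noteq> 0" "K = convex hull {a,b,c}" using simplex2E[OF simp2[OF K]] by metis
      then show ?thesis using rho_ge_2 K by blast
    qed
    have Cfg: "0 \<le> Cf" "0 \<le> Cg" if "K \<in> \<T>" for K
      unfolding Cg_def Cf_def using \<rho>[OF that] M0 B(1) by auto
    have ef: "\<eta>_f f K \<le> Cf * (hess_err \<Omega> \<T> \<Psi> \<Psi>h K + interp_err \<Omega> \<T> \<Psi> \<Psi>h K + osc \<T> f K)" if K: "K \<in> \<T>" for K
      unfolding Cf_def
    proof (rule eta_f_bound[OF sol f v K _ _ B])
      note sub = closure_lebesgue triangle_lebesgue[OF K] triangle_subset[OF K]
      show "L2norm K (wgrad \<Omega> (cmp i \<Psi>)) \<le> M" for i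
        by (rule order_trans[OF L2norm_subset[OF H20_L2_closure(2)[OF H20v_cmp[OF u]] sub] Mc(1)])
      show "L2norm K (dhess \<Psi>h i) \<le> M" for i
        by (rule order_trans[OF L2norm_subset[OF glue_pw_hess_L2[OF morley0v_cmp'[OF v]] sub] Mc(2)])
    qed
    show "\<mu>_NC \<T> \<Psi>h T \<le> C * (INF \<Phi>\<in>H20v \<Omega>. hess_err \<Omega> \<T> \<Phi> \<Psi>h (vertex_patch \<T> T))" if T: "T \<in> \<T>" for T
    proof -
      \<comment> \<open>Division by \<open>C\<close> turns the bound for each \<Phi> into a lower
        bound for the infimum.\<close>
      have "\<mu>_NC \<T> \<Psi>h T / C \<le> (INF \<Phi>\<in>H20v \<Omega>. hess_err \<Omega> \<T> \<Phi> \<Psi>h (vertex_patch \<T> T))"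
      proof (rule cINF_greatest)
        show "H20v \<Omega> \<noteq> {}" using u by auto
        fix \<Phi> assume "\<Phi> \<in> H20v \<Omega>"
        from mu_NC_bound[OF this v T]
        have "\<mu>_NC \<T> \<Psi>h T \<le> C * hess_err \<Omega> \<T> \<Phi> \<Psi>h (vertex_patch \<T> T)"
          by (rule order_trans) (intro mult_right_mono C nn)
        then show "\<mu>_NC \<T> \<Psi>h T / C \<le> hess_err \<Omega> \<T> \<Phi> \<Psi>h (vertex_patch \<T> T)"
          using C(2) by (simp add: pos_divide_le_eq mult.commute)
      qed
      then show ?thesis using C(2) by (simp add: pos_divide_le_eq mult.commute)
    qed
    show "(INF \<Phi>\<in>H20v \<Omega>. hess_err \<Omega> \<T> \<Phi> \<Psi>h (vertex_patch \<T> T)) \<le> hess_err \<Omega> \<T> \<Psi> \<Psi>h (vertex_patch \<T> T)" for T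
      by (rule cINF_lower[OF _ u]) (use nn(1) in \<open>auto simp: bdd_below_def\<close>)
    show "(\<Sum>K\<in>\<T>. (\<mu>_I \<T> \<Psi>h K)\<^sup>2) \<le> C * ((hess_err \<Omega> \<T> \<Psi> \<Psi>h \<Omega>)\<^sup>2 + (interp_err \<Omega> \<T> \<Psi> \<Psi>h \<Omega>)\<^sup>2)"
      by (rule order_trans[OF mu_I_bound[OF u v]], fold Ci_def, unfold distrib_left)
         (intro add_mono mult_right_mono C zero_le_power2)
    show "\<eta>_f f T \<le> C * (hess_err \<Omega> \<T> \<Psi> \<Psi>h T + interp_err \<Omega> \<T> \<Psi> \<Psi>h T + osc \<T> f T)" if T: "T \<in> \<T>" for T
      by (rule order_trans[OF ef[OF T]]) (intro mult_right_mono C add_nonneg_nonneg nn)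
    show "\<eta> j \<T> \<Psi>h T \<le> C * (hess_err \<Omega> \<T> \<Psi> \<Psi>h (edge_patch \<T> T) +
        interp_err \<Omega> \<T> \<Psi> \<Psi>h (edge_patch \<T> T) + osc \<T> f (edge_patch \<T> T))" if T: "T \<in> \<T>" for T j
    proof (rule order_trans[OF eta_bound[OF sol f v T Cfg(2)[OF T]]])
      show "(dist b c / \<rho>\<^sup>2)\<^sup>2 * \<bar>jump \<T> F (A_field j \<Psi>h) 0 \<bullet> face_normal \<T> F\<bar>
        \<le> Cg * (hess_err \<Omega> \<T> \<Psi> \<Psi>h (face_patch \<T> F) + interp_err \<Omega> \<T> \<Psi> \<Psi>h (face_patch \<T> F) + osc \<T> f (face_patch \<T> F))"
        if "F \<in> interior_faces \<T>" "F = closed_segment b c" for F b c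
        unfolding Cg_def by (rule jump_residual[OF sol f v that(1) Mc B Cfg(1)[OF T] ef that(2)])
      show "\<rho>^6 * Cg * (hess_err \<Omega> \<T> \<Psi> \<Psi>h (edge_patch \<T> T) + interp_err \<Omega> \<T> \<Psi> \<Psi>h (edge_patch \<T> T) + osc \<T> f (edge_patch \<T> T))
        \<le> C * (hess_err \<Omega> \<T> \<Psi> \<Psi>h (edge_patch \<T> T) + interp_err \<Omega> \<T> \<Psi> \<Psi>h (edge_patch \<T> T) + osc \<T> f (edge_patch \<T> T))"
        by (intro mult_right_mono C add_nonneg_nonneg nn)
    qed
  qed
qed

end
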